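(* Let $n\in\mathbb N_0$, $N\in\mathbb N$, $0\le u_1<\dots<u_N$ and $\xi=\sum_{j=1}^N\delta_{u_j}$. The noncolliding Bessel process $\mathrm{BES}^{(n+1/2)}$ started at $\xi$, $\Xi(t,\cdot)=\sum_{j=1}^N\delta_{\widetilde X_j(t)}(\cdot)$, has the following complex-process representation: for all $0<t\le T<\infty$ and every bounded $\mathcal F(t)$-measurable $F$, $$\mathbb E_\xi[F(\Xi(\cdot))]=\mathbf E_{\boldsymbol u}\Big[F\Big(\sum_{j=1}^N\delta_{\Re Z_j(\cdot)}\Big)\det_{1\le j,k\le N}\Big[Q_T^{(n+1/2)}(Z_j(T))\,\widetilde\Phi_\xi^{u_k}(Z_j(T))\Big]\Big],$$ where $Z_j(t)=\widetilde R_j(t)+iW_j(t)$, $1\le j\le N$, and $$Q_t^{(n+1/2)}(z)=\Big(\frac t2\Big)^n\frac{z}{(\Re z)^{2n+1}}\sum_{k=0}^n\frac{(2n-k)!}{(n-k)!\,k!}\Big(\frac{2(\Re z)z}{t}\Big)^k,\qquad\widetilde\Phi_\xi^v(z)=\prod_{r\in\operatorname{supp}\xi\setminus\{v,-v\}}\frac{z^2-r^2}{v^2-r^2}.$$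
   Context: For $\nu>-1$ the Bessel process $\mathrm{BES}^{(\nu)}$ is $\widetilde R(t)=\sqrt{R(t)}$, where $R$ is the squared Bessel process $\mathrm{BESQ}^{(\nu)}$, $dR=2\sqrt R\,dB+2(\nu+1)dt$ on $[0,\infty)$. The noncolliding $\mathrm{BES}^{(\nu)}$ is $\widetilde X_j(t)=\sqrt{X_j(t)}$, where $(X_1,\dots,X_N)$ is the noncolliding $\mathrm{BESQ}^{(\nu)}$, i.e. the solution of $dX_j=2\sqrt{X_j}\,dB_j+2(\nu+1)dt+4X_j\sum_{k\ne j}\frac{dt}{X_j-X_k}$ with independent standard Brownian motions $B_j$; it is started with $\widetilde X_j(0)=u_j$ (expectation $\mathbb E_\xi$), and $\mathcal F(t)=\sigma(\Xi(s):0\le s\le t)$. Here $\nu=n+1/2$. Under $\mathbf E_{\boldsymbol u}$: $\widetilde R_1,\dots,\widetilde R_N$ are independent $\mathrm{BES}^{(n+1/2)}$ processes with $\widetilde R_j(0)=u_j$, and $W_1,\dots,W_N$ are independent one-dimensional standard Brownian motions with $W_j(0)=0$, independent of the $\widetilde R_j$. *)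

theory Defs
  imports "HOL-Probability.Probability" "Jordan_Normal_Form.Determinant"
begin

text \<open>
  Time is the half line \<open>{0..}\<close> of the reals; the values of a process at negative times are
  irrelevant everywhere. Filtrations are indexed by all reals because of the class constraint of
  \<^locale>\<open>filtration\<close>; this costs nothing, as a filtration on \<open>{0..}\<close> can be extended constantly.
  The particles are numbered \<open>0, \<dots>, N - 1\<close>.
\<close>

section \<open>Processes and Brownian motion\<close>

definition filtration_on :: "'a measure \<Rightarrow> (real \<Rightarrow> 'a measure) \<Rightarrow> bool" where
  "filtration_on M \<F> \<longleftrightarrow> filtration (space M) \<F> \<and> (\<forall>s. subalgebra M (\<F> s))"

definition continuous_adapted ::
  "'a measure \<Rightarrow> (real \<Rightarrow> 'a measure) \<Rightarrow> (real \<Rightarrow> 'a \<Rightarrow> real) \<Rightarrow> bool" where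
  "continuous_adapted M \<F> X \<longleftrightarrow>
     (\<forall>t\<ge>0. X t \<in> borel_measurable (\<F> t)) \<and>
     (\<forall>\<omega>\<in>space M. continuous_on {0..} (\<lambda>t. X t \<omega>))"

definition natural_filtration ::
  "'a set \<Rightarrow> 'b measure \<Rightarrow> (real \<Rightarrow> 'a \<Rightarrow> 'b) \<Rightarrow> real \<Rightarrow> 'a measure" where
  "natural_filtration \<Omega> S X t =
     sigma \<Omega> {X s -` A \<inter> \<Omega> | s A. 0 \<le> s \<and> s \<le> t \<and> A \<in> sets S}"

definition brownian_motion_wrt ::
  "'a measure \<Rightarrow> (real \<Rightarrow> 'a measure) \<Rightarrow> (real \<Rightarrow> 'a \<Rightarrow> real) \<Rightarrow> bool" where
  "brownian_motion_wrt M \<F> B \<longleftrightarrow>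
     prob_space M \<and> filtration_on M \<F> \<and> continuous_adapted M \<F> B \<and>
     (AE \<omega> in M. B 0 \<omega> = 0) \<and>
     (\<forall>s t. 0 \<le> s \<and> s < t \<longrightarrow>
        distributed M lborel (\<lambda>\<omega>. B t \<omega> - B s \<omega>) (normal_density 0 (sqrt (t - s))) \<and>
        prob_space.indep_set M (sets (\<F> s))
          (sets (vimage_algebra (space M) (\<lambda>\<omega>. B t \<omega> - B s \<omega>) borel)))"

definition standard_brownian_motion :: "'a measure \<Rightarrow> (real \<Rightarrow> 'a \<Rightarrow> real) \<Rightarrow> bool" where
  "standard_brownian_motion M B \<longleftrightarrow>
     brownian_motion_wrt M (natural_filtration (space M) borel B) B"

text \<open>Independence of whole processes, i.e. of the path-valued random variables they induce.\<close>

definition indep_processes ::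
  "'a measure \<Rightarrow> ('i \<Rightarrow> real \<Rightarrow> 'a \<Rightarrow> real) \<Rightarrow> 'i set \<Rightarrow> bool" where
  "indep_processes M Y I \<longleftrightarrow>
     prob_space.indep_vars M (\<lambda>_. Pi\<^sub>M {0..} (\<lambda>_. borel)) (\<lambda>i \<omega>. \<lambda>s\<in>{0..}. Y i s \<omega>) I"

section \<open>The Ito integral and stochastic differentials\<close>

text \<open>
  A simple integrand on \<open>[0, t]\<close> is \<open>\<Sum>i<m. a i * indicator {p i<..p (i+1)}\<close>, where
  \<open>0 = p 0 \<le> \<dots> \<le> p m = t\<close> and \<open>a i\<close> is bounded and measurable with respect to \<open>\<F> (p i)\<close>.
\<close>

definition simple_integrand ::
  "'a measure \<Rightarrow> (real \<Rightarrow> 'a measure) \<Rightarrow> real \<Rightarrow> nat \<Rightarrow> (nat \<Rightarrow> real) \<Rightarrow> (nat \<Rightarrow> 'a \<Rightarrow> real) \<Rightarrow> bool" where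
  "simple_integrand M \<F> t m p a \<longleftrightarrow>
     p 0 = 0 \<and> p m = t \<and>
     (\<forall>i<m. p i \<le> p (Suc i) \<and> a i \<in> borel_measurable (\<F> (p i)) \<and> bounded (a i ` space M))"

definition simple_process ::
  "nat \<Rightarrow> (nat \<Rightarrow> real) \<Rightarrow> (nat \<Rightarrow> 'a \<Rightarrow> real) \<Rightarrow> real \<Rightarrow> 'a \<Rightarrow> real" where
  "simple_process m p a s \<omega> = (\<Sum>i<m. a i \<omega> * indicator {p i<..p (Suc i)} s)"

definition simple_ito_integral ::
  "(real \<Rightarrow> 'a \<Rightarrow> real) \<Rightarrow> nat \<Rightarrow> (nat \<Rightarrow> real) \<Rightarrow> (nat \<Rightarrow> 'a \<Rightarrow> real) \<Rightarrow> 'a \<Rightarrow> real" where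
  "simple_ito_integral B m p a \<omega> = (\<Sum>i<m. a i \<omega> * (B (p (Suc i)) \<omega> - B (p i) \<omega>))"

text \<open>
  \<open>has_ito_integral M \<F> B H t Y\<close>: the random variable \<open>Y\<close> is a version of the Ito integral of
  \<open>H\<close> against \<open>B\<close> over \<open>[0, t]\<close>, for a measurable adapted \<open>H\<close> that is almost surely square
  integrable on \<open>[0, t]\<close>. It is the limit in probability of the integrals of simple integrands
  that approximate \<open>H\<close> in the sense that the time integral of the squared error tends to 0 in
  probability. (Almost sure square integrability of \<open>H\<close> is forced by the existence of such an
  approximation.)
\<close>

definition has_ito_integral ::
  "'a measure \<Rightarrow> (real \<Rightarrow> 'a measure) \<Rightarrow> (real \<Rightarrow> 'a \<Rightarrow> real) \<Rightarrow> (real \<Rightarrow> 'a \<Rightarrow> real) \<Rightarrow>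
   real \<Rightarrow> ('a \<Rightarrow> real) \<Rightarrow> bool" where
  "has_ito_integral M \<F> B H t Y \<longleftrightarrow>
     (\<lambda>(s, \<omega>). indicator {0..t} s * H s \<omega>) \<in> borel_measurable (borel \<Otimes>\<^sub>M M) \<and>
     (\<forall>s\<in>{0..t}. H s \<in> borel_measurable (\<F> s)) \<and>
     Y \<in> borel_measurable M \<and>
     (\<exists>m p a.
        (\<forall>k. simple_integrand M \<F> t (m k) (p k) (a k)) \<and>
        (\<forall>\<epsilon>>0. (\<lambda>k. measure M {\<omega>\<in>space M. ennreal \<epsilon> \<le>
             (\<integral>\<^sup>+s\<in>{0..t}. ennreal ((simple_process (m k) (p k) (a k) s \<omega> - H s \<omega>)\<^sup>2) \<partial>lborel)})
           \<longlonglongrightarrow> 0) \<and>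
        (\<forall>\<epsilon>>0. (\<lambda>k. measure M {\<omega>\<in>space M. \<epsilon> \<le>
             \<bar>simple_ito_integral B (m k) (p k) (a k) \<omega> - Y \<omega>\<bar>})
           \<longlonglongrightarrow> 0))"

text \<open>The stochastic differential \<open>dX = \<sigma> dB + b dt\<close> on \<open>[0, \<infinity>)\<close>.\<close>

definition has_ito_differential ::
  "'a measure \<Rightarrow> (real \<Rightarrow> 'a measure) \<Rightarrow> (real \<Rightarrow> 'a \<Rightarrow> real) \<Rightarrow> (real \<Rightarrow> 'a \<Rightarrow> real) \<Rightarrow>
   (real \<Rightarrow> 'a \<Rightarrow> real) \<Rightarrow> (real \<Rightarrow> 'a \<Rightarrow> real) \<Rightarrow> bool" where
  "has_ito_differential M \<F> B X \<sigma> b \<longleftrightarrow>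
     continuous_adapted M \<F> X \<and>
     (\<forall>t\<ge>0. (AE \<omega> in M. set_integrable lborel {0..t} (\<lambda>s. b s \<omega>)) \<and>
        has_ito_integral M \<F> B \<sigma> t
          (\<lambda>\<omega>. X t \<omega> - X 0 \<omega> - set_lebesgue_integral lborel {0..t} (\<lambda>s. b s \<omega>)))"

section \<open>Bessel processes\<close>

text \<open>
  Solutions are weak: the filtration and the driving Brownian motions are part of what is asserted
  to exist. Initial values are left free here.
\<close>

definition BESQ :: "'a measure \<Rightarrow> real \<Rightarrow> (real \<Rightarrow> 'a \<Rightarrow> real) \<Rightarrow> bool" where
  "BESQ M \<nu> R \<longleftrightarrow>
     (\<forall>t\<ge>0. \<forall>\<omega>\<in>space M. 0 \<le> R t \<omega>) \<and>
     (\<exists>\<F> B. brownian_motion_wrt M \<F> B \<and>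
        has_ito_differential M \<F> B R
          (\<lambda>t \<omega>. 2 * sqrt (R t \<omega>)) (\<lambda>t \<omega>. 2 * (\<nu> + 1)))"

definition BES :: "'a measure \<Rightarrow> real \<Rightarrow> (real \<Rightarrow> 'a \<Rightarrow> real) \<Rightarrow> bool" where
  "BES M \<nu> Rt \<longleftrightarrow>
     (\<exists>R. BESQ M \<nu> R \<and> (\<forall>t\<ge>0. \<forall>\<omega>\<in>space M. Rt t \<omega> = sqrt (R t \<omega>)))"

definition noncolliding_BESQ ::
  "'a measure \<Rightarrow> real \<Rightarrow> nat \<Rightarrow> (nat \<Rightarrow> real \<Rightarrow> 'a \<Rightarrow> real) \<Rightarrow> bool" where
  "noncolliding_BESQ M \<nu> N X \<longleftrightarrow>
     (\<forall>j<N. \<forall>t\<ge>0. \<forall>\<omega>\<in>space M. 0 \<le> X j t \<omega>) \<and>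
     (AE \<omega> in M. \<forall>t\<ge>0. \<forall>j<N. \<forall>k<N. j \<noteq> k \<longrightarrow> X j t \<omega> \<noteq> X k t \<omega>) \<and>
     (\<exists>\<F> B. (\<forall>j<N. brownian_motion_wrt M \<F> (B j)) \<and> indep_processes M B {..<N} \<and>
        (\<forall>j<N. has_ito_differential M \<F> (B j) (X j)
           (\<lambda>t \<omega>. 2 * sqrt (X j t \<omega>))
           (\<lambda>t \<omega>. 2 * (\<nu> + 1) +
              4 * X j t \<omega> * (\<Sum>k\<in>{..<N} - {j}. 1 / (X j t \<omega> - X k t \<omega>)))))"

definition noncolliding_BES ::
  "'a measure \<Rightarrow> real \<Rightarrow> nat \<Rightarrow> (nat \<Rightarrow> real \<Rightarrow> 'a \<Rightarrow> real) \<Rightarrow> bool" where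
  "noncolliding_BES M \<nu> N Xt \<longleftrightarrow>
     (\<exists>X. noncolliding_BESQ M \<nu> N X \<and>
        (\<forall>j<N. \<forall>t\<ge>0. \<forall>\<omega>\<in>space M. Xt j t \<omega> = sqrt (X j t \<omega>)))"

section \<open>Point configurations and their paths\<close>

text \<open>
  The sum of point masses \<open>\<delta>\<^bsub>x 0\<^esub> + \<dots> + \<delta>\<^bsub>x (N - 1)\<^esub>\<close>, counted with multiplicity, as the
  image of the counting measure on the indices.
\<close>

definition point_config :: "nat \<Rightarrow> (nat \<Rightarrow> real) \<Rightarrow> real measure" where
  "point_config N x = distr (count_space {..<N}) borel x"

lemma emeasure_point_config:
  assumes "A \<in> sets borel"
  shows "emeasure (point_config N x) A = of_nat (card {j. j < N \<and> x j \<in> A})"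
proof -
  have eq: "x -` A \<inter> {..<N} = {j. j < N \<and> x j \<in> A}" by auto
  have "emeasure (point_config N x) A = emeasure (count_space {..<N}) {j. j < N \<and> x j \<in> A}"
    using assms by (simp add: point_config_def emeasure_distr eq)
  also have "\<dots> = of_nat (card {j. j < N \<and> x j \<in> A})"
    by (rule emeasure_count_space_finite) auto
  finally show ?thesis .
qed

definition measure_support :: "'a::topological_space measure \<Rightarrow> 'a set" where
  "measure_support \<mu> = {x. \<forall>U. open U \<and> x \<in> U \<longrightarrow> 0 < emeasure \<mu> U}"

lemma measure_support_point_config: "measure_support (point_config N x) = x ` {..<N}"
proof (intro equalityI subsetI)
  fix y assume y: "y \<in> measure_support (point_config N x)"
  show "y \<in> x ` {..<N}"
  proof (rule ccontr)
    assume "y \<notin> x ` {..<N}"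
    moreover have "open (- (x ` {..<N}))" by (intro open_Compl finite_imp_closed) auto
    ultimately have "0 < emeasure (point_config N x) (- (x ` {..<N}))"
      using y by (auto simp: measure_support_def)
    moreover have "- (x ` {..<N}) \<in> sets borel"
      using \<open>open (- (x ` {..<N}))\<close> by simp
    moreover have none: "{j. j < N \<and> x j \<in> - (x ` {..<N})} = {}" by auto
    ultimately show False
      by (simp only: emeasure_point_config none) simp
  qed
next
  fix y assume "y \<in> x ` {..<N}"
  then show "y \<in> measure_support (point_config N x)"
    by (auto simp: measure_support_def emeasure_point_config card_gt_0_iff)
qed

text \<open>
  The space of integer-valued Radon measures on the line, with the \<open>\<sigma>\<close>-algebra generated by the
  counts of Borel sets (which is the Borel \<open>\<sigma>\<close>-algebra of the vague topology). Being
  integer-valued on bounded Borel sets includes being finite there.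
\<close>

definition configurations :: "real measure set" where
  "configurations =
     {\<mu>. sets \<mu> = sets borel \<and>
        (\<forall>A\<in>sets borel. bounded A \<longrightarrow> emeasure \<mu> A \<in> range of_nat)}"

definition config_space :: "real measure measure" where
  "config_space = sigma configurations
     {(\<lambda>\<mu>. emeasure \<mu> A) -` U \<inter> configurations | A U. A \<in> sets borel \<and> U \<in> sets borel}"

lemma point_config_in_configurations: "point_config N x \<in> configurations"
proof -
  have "sets (point_config N x) = sets borel" by (simp add: point_config_def)
  then show ?thesis by (auto simp: configurations_def emeasure_point_config)
qed

definition config_paths :: "(real \<Rightarrow> real measure) set" where
  "config_paths = {\<Xi>. \<forall>s\<ge>0. \<Xi> s \<in> configurations}"

text \<open>
  The filtration \<open>t \<mapsto> \<sigma>(\<Xi>(s) : 0 \<le> s \<le> t)\<close> of the coordinate process on path space. All paths are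
  admitted; a functional measurable for the trace of this filtration on the continuous paths
  extends measurably and boundedly to all paths.
\<close>

definition config_filtration :: "real \<Rightarrow> (real \<Rightarrow> real measure) measure" where
  "config_filtration = natural_filtration config_paths config_space (\<lambda>s \<Xi>. \<Xi> s)"

section \<open>The complex weight\<close>

definition complex_process ::
  "(nat \<Rightarrow> real \<Rightarrow> 'a \<Rightarrow> real) \<Rightarrow> (nat \<Rightarrow> real \<Rightarrow> 'a \<Rightarrow> real) \<Rightarrow> nat \<Rightarrow> real \<Rightarrow> 'a \<Rightarrow> complex" where
  "complex_process Rt W j t \<omega> = complex_of_real (Rt j t \<omega>) + \<i> * complex_of_real (W j t \<omega>)"

text \<open>\<open>Q_weight n t\<close> is the function with upper index \<open>n + 1/2\<close>.\<close>

definition Q_weight :: "nat \<Rightarrow> real \<Rightarrow> complex \<Rightarrow> complex" where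
  "Q_weight n t z =
     complex_of_real ((t / 2) ^ n) * (z / complex_of_real (Re z ^ (2 * n + 1))) *
     (\<Sum>k=0..n. (fact (2 * n - k) / (fact (n - k) * fact k)) *
        (2 * complex_of_real (Re z) * z / complex_of_real t) ^ k)"

definition Phi_tilde :: "real measure \<Rightarrow> real \<Rightarrow> complex \<Rightarrow> complex" where
  "Phi_tilde \<xi> v z =
     (\<Prod>r\<in>measure_support \<xi> - {v, - v}.
        (z\<^sup>2 - (complex_of_real r)\<^sup>2) / ((complex_of_real v)\<^sup>2 - (complex_of_real r)\<^sup>2))"

end

theory Submission
  imports Defs
begin

text \<open>
 For BESQ the semigroup maps functions \<open>exp (- lam x) p(x)\<close>, \<open>p\<close> a polynomial, to functions of the
 same kind. If \<open>f_j(t, x)\<close> are such solutions of the backward equation, Ito's formula shows that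
 \<open>det [f_j(t, X\<^sub>k(t))] / det [X\<^sub>k(t) ^ j]\<close> is a martingale along the noncolliding system, so that it is
 the Doob transform of independent BESQ processes by the Vandermonde determinant \<open>h\<close>. Iterating over
 finitely many times and closing under bounded limits gives
 \<open>E[F(R\<^sub>1, ..., R\<^sub>N) h(R(T)\<^sup>2)] = h(u\<^sup>2) E[F(\<Xi>)]\<close> for symmetric bounded \<open>F\<close>. The determinant with
 the entries \<open>\<Phi>\<close> equals \<open>h(Z\<^sup>2) / h(u\<^sup>2)\<close>, and the average of \<open>Q(Z) Z ^ (2 l)\<close> over the Gaussian
 imaginary part is, by Hermite expansion, a monic polynomial of degree \<open>l\<close> in \<open>R\<^sup>2\<close>; hence
 averaging the complex weight over \<open>W\<close> leaves \<open>h(R(T)\<^sup>2) / h(u\<^sup>2)\<close>.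
\<close>

hide_fact (open) Henstock_Kurzweil_Integration.integral_add Henstock_Kurzweil_Integration.integral_diff
 Henstock_Kurzweil_Integration.integrable_add Henstock_Kurzweil_Integration.integrable_diff Henstock_Kurzweil_Integration.integral_sum
 Henstock_Kurzweil_Integration.integrable_sum Henstock_Kurzweil_Integration.integral_cong Henstock_Kurzweil_Integration.integrable_bound Henstock_Kurzweil_Integration.integrable_cong

text \<open>The damping \<open>exp (- lam * x)\<close> with \<open>lam > 0\<close> shapes the
  argument. It bounds the quotient, and its derivatives times \<open>2 * sqrt x\<close>, along all
  paths, so that Ito's formula yields a true martingale at once; the limit \<open>lam -> 0\<close>
  comes last, at fixed test times. The quotient by the Vandermonde determinant is an exponential
  times a polynomial, hence smooth across collisions, where the drift is singular. The martingale
  identity holds for every weak solution and determines the required expectations. A single BESQ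
  process is the case \<open>N = 1\<close>, so the moments of the independent processes come from
  the same identity. The given Ito integral is a limit in probability, separately for each end time.
  Its left-point sums along dyadic partitions are recovered by Lenglart's inequality, and Ito's
  formula is then proved path by path. The factor \<open>(Re z) ^ - (2n + 1)\<close> of the weight
  \<open>Q\<close> calls for a negative moment of \<open>R(T)\<close>, also when
  \<open>u 0 = 0\<close>. It exists because the Laplace transform of \<open>R(T)^2\<close> decays
  like \<open>lam powr - (n + 3/2)\<close>, and \<open>(2n + 1) / 2 < n + 3/2\<close>.\<close>

abbreviation tends (infixr "~>" 60) where "X ~> l \<equiv> filterlim X (nhds l) sequentially"
abbreviation evseq (binder "EV " 10) where "evseq P \<equiv> eventually P sequentially"
abbreviation "bmeas \<equiv> borel_measurable"
abbreviation "L2 A f \<equiv> \<integral>\<^sup>+r\<in>A. ennreal ((f r)^2) \<partial>lborel"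
abbreviation "cr \<equiv> complex_of_real"

section \<open>Polynomial functions and gradients\<close>

text \<open>Polynomials are kept as functions on \<open>nat => real\<close>. Continuity, growth,
  gradients and divisibility by \<open>y k - y j\<close> then follow by induction over the four
  formation rules.\<close>

inductive polyfun :: "nat => ((nat => real) => real) => bool" for n where
 polyfun_const: "polyfun n (%y. c)"
| polyfun_var: "i < n ==> polyfun n (%y. y i)"
| polyfun_add: "polyfun n f ==> polyfun n g ==> polyfun n (%y. f y + g y)"
| polyfun_mult: "polyfun n f ==> polyfun n g ==> polyfun n (%y. f y * g y)"

lemma polyfun_minus: "polyfun n f ==> polyfun n (%y. - f y)"
 using polyfun_mult[OF polyfun_const[of n "-1"], of f] by simp

lemma polyfun_diff: "polyfun n f ==> polyfun n g ==> polyfun n (%y. f y - g y)"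
 using polyfun_add[OF _ polyfun_minus, of n f g] by simp

lemma polyfun_power: "polyfun n f ==> polyfun n (%y. f y ^ k)"
 by (induction k) (auto intro: polyfun_const polyfun_mult)

lemma polyfun_sum: "(!!i. i : I ==> polyfun n (f i)) ==> polyfun n (%y. SUM i:I. f i y)"
 by (induction I rule: infinite_finite_induct) (auto intro: polyfun_const polyfun_add)

lemma polyfun_prod: "(!!i. i : I ==> polyfun n (f i)) ==> polyfun n (%y. PROD i:I. f i y)"
 by (induction I rule: infinite_finite_induct) (auto intro: polyfun_const polyfun_mult)

lemmas polyfun_intros = polyfun_const polyfun_var polyfun_add polyfun_mult polyfun_minus
 polyfun_diff polyfun_power polyfun_sum polyfun_prod

lemma polyfun_measurable:
 assumes "polyfun n f" "!!i. i < n ==> (%x. Y x i) : bmeas M"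
 shows "(%x. f (Y x)) : bmeas M"
 using assms by (induction rule: polyfun.induct) auto

lemma polyfun_continuous_on:
 assumes "polyfun n f" "!!i. i < n ==> continuous_on S (%s. Y s i)"
 shows "continuous_on S (%s. f (Y s))"
 using assms by (induction rule: polyfun.induct) (auto intro!: continuous_intros)

lemma polyfun_growth:
 assumes "polyfun n f"
 shows "EX C>=0. EX K. ALL y. (abs (f y)) <= C * (1 + (SUM i<n. (abs (y i)))) ^ K"
 using assms
proof (induction rule: polyfun.induct)
 case (polyfun_const c)
 then show ?case by (intro exI[of _ "abs c"] conjI exI[of _ 0]) auto
next
 case (polyfun_var i)
 have "abs (y i) <= (SUM i<n. (abs (y i)))" for y :: "nat => real"
  using polyfun_var by (intro member_le_sum) auto
 then show ?case by (intro exI[of _ "1::real"] conjI exI[of _ 1]) (auto simp: add_increasing)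
next
 case (polyfun_add f g)
 then obtain C K D L where *: "C >= 0" "D >= 0"
  "!!y. (abs (f y)) <= C * (1 + (SUM i<n. (abs (y i)))) ^ K" "!!y. (abs (g y)) <= D * (1 + (SUM i<n. (abs (y i)))) ^ L"
  by metis
 have "abs (f y + g y) <= (C + D) * (1 + (SUM i<n. (abs (y i)))) ^ (K + L)" for y
 proof -
  let ?z = "1 + (SUM i<n. (abs (y i)))"
  have z: "?z >= 1" by (simp add: sum_nonneg)
  have "C * ?z ^ K <= C * ?z ^ (K + L)" "D * ?z ^ L <= D * ?z ^ (K + L)"
   using z * by (auto intro!: mult_left_mono power_increasing)
  with *(3)[of y] *(4)[of y] show ?thesis by (simp add: algebra_simps)
 qed
 with * show ?case by (intro exI[of _ "C + D"] conjI exI[of _ "K + L"]) auto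
next
 case (polyfun_mult f g)
 then obtain C K D L where *: "C >= 0" "D >= 0"
  "!!y. (abs (f y)) <= C * (1 + (SUM i<n. (abs (y i)))) ^ K" "!!y. (abs (g y)) <= D * (1 + (SUM i<n. (abs (y i)))) ^ L"
  by metis
 have "abs (f y * g y) <= (C * D) * (1 + (SUM i<n. (abs (y i)))) ^ (K + L)" for y
 proof -
  have "abs (f y) * abs (g y) <= (C * (1 + (SUM i<n. (abs (y i)))) ^ K) * (D * (1 + (SUM i<n. (abs (y i)))) ^ L)"
   using * by (intro mult_mono) (auto simp: sum_nonneg)
  then show ?thesis by (simp add: abs_mult power_add algebra_simps)
 qed
 with * show ?case by (intro exI[of _ "C * D"] conjI exI[of _ "K + L"]) auto
qed

text \<open>Derivatives along lines avoid any norm on \<open>nat => real\<close>. The direction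
  \<open>v\<close> is arbitrary while the sum stops at \<open>n\<close>, which forces
  \<open>f\<close> to depend on the first \<open>n\<close> coordinates alone.\<close>

definition has_gradient ::
 "nat => ((nat => real) => real) => (nat => (nat => real) => real) => bool" where
 "has_gradient n f g \<longleftrightarrow> (ALL y v ta. ((%ta. f (%i. y i + ta * v i)) has_real_derivative
   (SUM a<n. v a * g a (%i. y i + ta * v i))) (at ta))"

lemma has_gradient_const: "has_gradient n (%y. c) (%_ _. 0)"
 by (simp add: has_gradient_def)

lemma has_gradient_var: "i < n ==> has_gradient n (%y. y i) (%a _. if a = i then 1 else 0)"
 by (auto simp: has_gradient_def if_distrib cong: if_cong intro!: derivative_eq_intros)

lemma has_gradient_add:
 "has_gradient n f f' ==> has_gradient n g g' ==>
  has_gradient n (%y. f y + g y) (%a y. f' a y + g' a y)"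
 by (auto simp: has_gradient_def distrib_left sum.distrib intro!: DERIV_add)

lemma has_gradient_mult:
 assumes "has_gradient n f f'" "has_gradient n g g'"
 shows "has_gradient n (%y. f y * g y) (%a y. f' a y * g y + g' a y * f y)"
 unfolding has_gradient_def
proof (intro allI)
 fix y v ta
 show "((%ta. f (%i. y i + ta * v i) * g (%i. y i + ta * v i)) has_real_derivative
   (SUM a<n. v a * (f' a (%i. y i + ta * v i) * g (%i. y i + ta * v i) +
    g' a (%i. y i + ta * v i) * f (%i. y i + ta * v i)))) (at ta)"
  using DERIV_mult[OF assms[unfolded has_gradient_def, rule_format, of y v ta]]
  by (simp add: sum_distrib_left sum.distrib algebra_simps)
qed

lemma has_gradient_exp:
 assumes "has_gradient n f f'"
 shows "has_gradient n (%y. exp (f y)) (%a y. exp (f y) * f' a y)"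
 unfolding has_gradient_def
proof (intro allI)
 fix y v ta
 show "((%ta. exp (f (%i. y i + ta * v i))) has_real_derivative
   (SUM a<n. v a * (exp (f (%i. y i + ta * v i)) * f' a (%i. y i + ta * v i)))) (at ta)"
  using DERIV_fun_exp[OF assms[unfolded has_gradient_def, rule_format, of y v ta]]
  by (simp add: sum_distrib_left algebra_simps)
qed

lemma polyfun_gradient:
 assumes "polyfun n f"
 shows "EX g. (ALL a. polyfun n (g a)) & has_gradient n f g"
 using assms
proof (induction rule: polyfun.induct)
 case (polyfun_const c)
 show ?case using has_gradient_const by (auto intro: polyfun_intros)
next
 case (polyfun_var i)
 show ?case using has_gradient_var[OF polyfun_var]
  by (intro exI[of _ "%a _. if a = i then 1 else 0"]) (auto intro: polyfun_intros)
next
 case (polyfun_add f g)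
 then show ?case by (elim exE conjE) (rule exI, rule conjI[OF _ has_gradient_add], auto intro: polyfun_intros)
next
 case (polyfun_mult f g)
 then show ?case
  by (elim exE conjE) (rule exI, rule conjI[OF _ has_gradient_mult],
   auto intro!: polyfun.polyfun_add polyfun.polyfun_mult)
qed

lemma has_gradient_partial:
 assumes "has_gradient n f g" "j < n"
 shows "((%t. f (y(j := t))) has_real_derivative g j (y(j := t))) (at t)"
proof -
 let ?v = "%i. if i = j then 1 else 0 :: real"
 have e: "(%i. (y(j := 0)) i + ta * ?v i) = y(j := ta)" for ta by auto
 have "(SUM a<n. ?v a * g a (y(j := t))) = g j (y(j := t))"
  using assms(2) by (simp add: if_distrib[of "%x. x * _"] cong: if_cong)
 with assms(1)[unfolded has_gradient_def, rule_format, of "y(j := 0)" ?v t]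
 show ?thesis unfolding e by simp
qed

text \<open>Substituting \<open>y k\<close> for \<open>y j\<close> respects sums and products. For a
  product, each substituted factor is written as the original one less a multiple of
  \<open>y k - y j\<close>, and the product is expanded.\<close>

lemma polyfun_division:
 assumes "polyfun n f" "j < n" "k < n"
 shows "EX q. polyfun n q & (ALL y. f y - f (y(j := y k)) = (y k - y j) * q y)"
 using assms(1)
proof (induction rule: polyfun.induct)
 case (polyfun_const c)
 show ?case by (intro exI[of _ "%_. 0"]) (auto intro: polyfun_intros)
next
 case (polyfun_var i)
 show ?case by (intro exI[of _ "%_. if i = j then -1 else 0"]) (auto intro: polyfun_intros)
next
 case (polyfun_add f g)
 then obtain q r where *: "polyfun n q" "polyfun n r" "!!y. f y - f (y(j := y k)) = (y k - y j) * q y"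
  "!!y. g y - g (y(j := y k)) = (y k - y j) * r y" by metis
 have "f y + g y - (f (y(j := y k)) + g (y(j := y k))) = (y k - y j) * (q y + r y)" for y
  using *(3,4)[of y] by (simp add: distrib_left)
 then show ?case
  using polyfun.polyfun_add[OF *(1,2)] by blast
next
 case (polyfun_mult f g)
 then obtain q r where *: "polyfun n q" "polyfun n r" "!!y. f y - f (y(j := y k)) = (y k - y j) * q y"
  "!!y. g y - g (y(j := y k)) = (y k - y j) * r y" by metis
 have 1: "f (y(j := y k)) = f y - (y k - y j) * q y" "g (y(j := y k)) = g y - (y k - y j) * r y" for y
  using *(3,4)[of y] by auto
 have "polyfun n (%y. f y * r y + g y * q y - (y k - y j) * (q y * r y))"
  using * polyfun_mult assms by (intro polyfun_intros) auto
 moreover have "f y * g y - f (y(j := y k)) * g (y(j := y k)) =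
   (y k - y j) * (f y * r y + g y * q y - (y k - y j) * (q y * r y))" for y
  unfolding 1 by (simp add: algebra_simps)
 ultimately show ?case by blast
qed

text \<open>One difference is split off at a time. The quotient \<open>q\<close> found so far must
  still vanish where \<open>y j = y k\<close>, also at points where differences already divided out
  are 0; such points are limits of points where they are not.\<close>

lemma polyfun_divide_differences:
 assumes "polyfun n f" "N <= n"
  and "finite P" "P \<subseteq> {(j, k). j < k & k < N}"
  and "!!y j k. j < k ==> k < N ==> y j = y k ==> f y = 0"
 shows "EX q. polyfun n q & (ALL y. f y = (PROD (j, k):P. y k - y j) * q y)"
 using assms(3,4)
proof (induction P rule: finite_induct)
 case empty
 then show ?case using assms(1) by auto
next
 case (insert p P)
 obtain j k where p: "p = (j, k)" and jk: "j < k" "k < N" using insert.prems by auto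
 from insert obtain q where q: "polyfun n q" "!!y. f y = (PROD (j, k):P. y k - y j) * q y" by auto
 have zero: "q y = 0" if "y j = y k" for y
 proof -
  \<comment> \<open>Moving along \<open>w\<close> keeps \<open>y j = y k\<close>, as
    \<open>w j = w k\<close>, and separates every other pair of indices. All earlier differences are
    therefore nonzero for small \<open>eps ~= 0\<close>, and \<open>q\<close> is 0 there.\<close>
  define w where "w = (%i. if i = k then real j else real i)"
  have "\<forall>\<^sub>F eps in at 0. (y b + eps * w b) - (y a + eps * w a) ~= 0" if ab: "(a, b) : P" for a b
  proof -
   have "(a, b) ~= (j, k)" using ab insert.hyps p by auto
   moreover have "a < b" using ab insert.prems by auto
   ultimately have "w b ~= w a" using jk by (auto simp: w_def split: if_splits)
   then have "(y b + eps * w b) - (y a + eps * w a) ~= 0" if "eps ~= (y a - y b) / (w b - w a)" for eps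
    using that by (auto simp: field_simps)
   moreover have "\<forall>\<^sub>F eps in at (0::real). eps ~= (y a - y b) / (w b - w a)"
    by (rule eventually_neq_at_within)
   ultimately show ?thesis by (auto elim: eventually_mono)
  qed
  then have "\<forall>\<^sub>F eps in at 0. ALL (a, b):P. (y b + eps * w b) - (y a + eps * w a) ~= 0"
   using insert.hyps by (auto intro!: eventually_ball_finite)
  then have "\<forall>\<^sub>F eps in at 0. q (%i. y i + eps * w i) = 0"
  proof eventually_elim
   case (elim eps)
   have "f (%i. y i + eps * w i) = 0"
    using assms(5)[OF jk] that jk by (simp add: w_def)
   then have "(PROD (a, b):P. (y b + eps * w b) - (y a + eps * w a)) * q (%i. y i + eps * w i) = 0"
    using q(2) by metis
   moreover have "(PROD (a, b):P. (y b + eps * w b) - (y a + eps * w a)) ~= 0"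
    using elim insert.hyps by (auto simp: prod_zero_iff)
   ultimately show ?case by simp
  qed
  then have "((%eps. q (%i. y i + eps * w i)) \<longlongrightarrow> 0) (at 0)"
   by (rule tendsto_eventually)
  moreover have "continuous_on UNIV (%eps. q (%i. y i + eps * w i))"
   by (rule polyfun_continuous_on[OF q(1)]) (auto intro!: continuous_intros)
  then have "((%eps. q (%i. y i + eps * w i)) \<longlongrightarrow> q (%i. y i + 0 * w i)) (at 0)"
   unfolding continuous_on_def by blast
  ultimately have "q (%i. y i + 0 * w i) = 0"
   using tendsto_unique[OF at_neq_bot] by blast
  then show "q y = 0" by simp
 qed
 have "j < n" "k < n" using jk assms(2) by auto
 from polyfun_division[OF q(1) this] obtain r where r: "polyfun n r"
  "!!y. q y - q (y(j := y k)) = (y k - y j) * r y" by auto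
 have "q (y(j := y k)) = 0" for y using zero jk by simp
 then have "q y = (y k - y j) * r y" for y using r(2)[of y] by simp
 then have "f y = (PROD (j, k):insert p P. y k - y j) * r y" for y
  unfolding prod.insert[OF insert.hyps] q(2)[of y] by (simp add: p)
 then show ?case using r(1) by blast
qed

section \<open>Alternants and the Vandermonde quotient\<close>

text \<open>The Leibniz expansion of the determinant with entries \<open>f row column\<close>. Its
  summands are products over the rows, on which the product rule and, later, the independence of the
  particles can act.\<close>

definition alternant :: "nat => (nat => nat => 'a::comm_ring_1) => 'a" where
 "alternant N f = (\<Sum>p | p permutes {..<N}. of_int (sign p) * (PROD j<N. f j (p j)))"

lemma det_eq_alternant: "Determinant.det (Matrix.mat N N (%(i, j). f i j)) = alternant N f"
using permutes_in_image by (simp add: lessThan_atLeast0 Determinant.det_def alternant_def)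

lemma alternant_cong:
 assumes "!!i j. i < N ==> j < N ==> f i j = g i j"
 shows "alternant N f = alternant N g"
 unfolding alternant_def
 using permutes_in_image assms by (intro sum.cong refl arg_cong2[where f = "(*)"] prod.cong) fastforce+

lemma alternant_identical_columns:
 assumes "k < N" "l < N" "k ~= l" "!!i. i < N ==> f i k = f i l"
 shows "alternant N f = 0"
 unfolding det_eq_alternant[symmetric] using assms
 by (intro Determinant.det_identical_columns[of _ N k l]) (auto intro!: eq_vecI)

lemma alternant_identical_rows:
 assumes "k < N" "l < N" "k ~= l" "!!i. i < N ==> f k i = f l i"
 shows "alternant N f = 0"
 unfolding det_eq_alternant[symmetric] using assms
 by (intro Determinant.det_identical_rows[of _ N k l]) (auto intro!: eq_vecI)

lemma alternant_scale_rows: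
 "alternant N (%i j. c i * f i j) = (PROD i<N. c i) * alternant N f"
 by (simp add: alternant_def prod.distrib sum_distrib_left algebra_simps)

lemma poly_eq_sum_lessThan:
 fixes p :: "'a::comm_semiring_1 poly"
 assumes "degree p < N"
 shows "poly p x = (SUM m<N. coeff p m * x ^ m)"
proof -
 have "(SUM m<N. coeff p m * x ^ m) = (SUM m<=degree p. coeff p m * x ^ m)"
  using assms by (intro sum.mono_neutral_right) (auto simp: coeff_eq_0)
 then show ?thesis by (simp add: poly_altdef)
qed

text \<open>The matrix of values is the matrix of powers of the nodes times the matrix of
  coefficients.\<close>

lemma alternant_poly:
 fixes x :: "nat => 'a::idom"
 assumes "!!k. k < N ==> degree (p k) < N"
 shows "alternant N (%i k. poly (p k) (x i)) =
     alternant N (%i k. x i ^ k) * alternant N (%m k. coeff (p k) m)"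
proof -
 let ?P = "Matrix.mat N N (%(i, k). poly (p k) (x i))" and ?V = "Matrix.mat N N (%(i, k). x i ^ k)"
  and ?C = "Matrix.mat N N (%(m, k). coeff (p k) m)"
 have "?P = ?V * ?C"
  using assms by (intro eq_matI)
   (auto simp: scalar_prod_def poly_eq_sum_lessThan[of _ N] lessThan_atLeast0 mult.commute intro!: sum.cong)
 then have "Determinant.det ?P = Determinant.det ?V * Determinant.det ?C"
  by (metis det_mult mat_carrier)
 then show ?thesis by (simp add: det_eq_alternant)
qed

text \<open>Here the coefficient matrix is triangular with diagonal 1.\<close>

lemma alternant_monic_poly:
 fixes x :: "nat => 'a::idom"
 assumes "!!k. k < N ==> degree (p k) = k & lead_coeff (p k) = 1"
 shows "alternant N (%i k. poly (p k) (x i)) = alternant N (%i k. x i ^ k)"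
proof -
 let ?C = "Matrix.mat N N (%(m, k). coeff (p k) m)"
 have "upper_triangular ?C"
  using assms by (auto simp: upper_triangular_def intro!: coeff_eq_0)
 then have "Determinant.det ?C = prod_list (diag_mat ?C)"
  by (intro det_upper_triangular[of _ N]) auto
 also have "... = 1"
 proof -
  have "diag_mat ?C = map (%_. 1) [0..<N]"
   unfolding diag_mat_def
  using assms by (fastforce intro: map_cong)
  then show ?thesis by (simp add: map_replicate_const)
 qed
 finally have "alternant N (%m k. coeff (p k) m) = 1" by (simp add: det_eq_alternant)
 then show ?thesis using assms by (subst alternant_poly) auto
qed

definition vdm :: "nat => (nat => 'a::comm_ring_1) => 'a" where
 "vdm N x = (PROD (j, k):{(j, k). j < k & k < N}. x k - x j)"

lemma finite_pairs: "finite {(j, k). j < k & k < (N::nat)}"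
 by (rule finite_subset[of _ "{..<N} \<times> {..<N}"]) auto

lemma vdm_Suc: "vdm (Suc N) x = vdm N x * (PROD j<N. x N - x j)"
proof -
 have e: "{(j, k). j < k & k < Suc N} = {(j, k). j < k & k < N} \<union> (%j. (j, N)) ` {..<N}"
  by (auto simp: less_Suc_eq)
 have i: "inj_on (%j. (j, N)) {..<N}" by (auto simp: inj_on_def)
 show ?thesis
  unfolding vdm_def e
  by (subst prod.union_disjoint) (auto simp: finite_pairs prod.reindex[OF i])
qed

lemma vdm_nonzero:
 fixes x :: "nat => 'a::idom"
 assumes "!!j k. j < k ==> k < N ==> x j ~= x k"
 shows "vdm N x ~= 0"
 using assms by (auto simp: vdm_def prod_zero_iff[OF finite_pairs]) metis

lemma alternant_powers:
 fixes x :: "nat => 'a::idom"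
 shows "alternant N (%i k. x i ^ k) = vdm N x"
proof (induction N)
 case 0
 then show ?case by (simp add: alternant_def vdm_def)
next
 case (Suc N)
 \<comment> \<open>The last column is replaced by a monic polynomial that vanishes at the nodes
   \<open>x 0, ..., x (N - 1)\<close>. Expansion along this column then leaves the single entry in
   row \<open>N\<close>.\<close>
 define p where "p = (%k. if k = N then PROD j<N. [:- x j, 1:] else monom 1 k)"
 have dN: "degree (PROD j<N. [:- x j, 1:]) = N & lead_coeff (PROD j<N. [:- x j, 1:]) = 1"
 proof -
  have "degree (PROD j<N. [:- x j, 1:]) = (SUM j<N. degree [:- x j, 1:])"
   by (rule degree_prod_sum_eq) simp
  moreover have "lead_coeff (PROD j<N. [:- x j, 1:]) = 1"
   unfolding lead_coeff_prod by simp
  ultimately show ?thesis by simp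
 qed
 have "alternant (Suc N) (%i k. x i ^ k) = alternant (Suc N) (%i k. poly (p k) (x i))"
  by (rule alternant_monic_poly[symmetric]) (use dN in \<open>auto simp: p_def degree_monom_eq\<close>)
 also have "... = Determinant.det (Matrix.mat (Suc N) (Suc N) (%(i, k). poly (p k) (x i)))"
  (is "_ = Determinant.det ?A") by (simp add: det_eq_alternant)
 also have "... = (SUM i<Suc N. ?A $$ (i, N) * cofactor ?A i N)"
  by (rule laplace_expansion_column[of _ "Suc N"]) auto
 also have "... = ?A $$ (N, N) * cofactor ?A N N"
  by (subst sum.lessThan_Suc) (auto simp: p_def poly_prod prod_zero_iff intro!: sum.neutral)
 also have "mat_delete ?A N N = Matrix.mat N N (%(i, k). x i ^ k)"
  by (intro eq_matI) (auto simp: mat_delete_def p_def poly_monom)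
 then have "cofactor ?A N N = vdm N x"
  by (simp add: Determinant.cofactor_def det_eq_alternant Suc flip: power_mult)
 also have "?A $$ (N, N) = (PROD j<N. x N - x j)"
  by (simp add: p_def poly_prod)
 finally show ?case by (simp add: vdm_Suc mult.commute)
qed

lemma DERIV_prod_rows:
 fixes f f' :: "'i => real => real"
 assumes "finite I" "!!i. i : I ==> (f i has_real_derivative f' i t) (at t)"
 shows "((%t. PROD i:I. f i t) has_real_derivative
   (SUM j:I. PROD i:I. if i = j then f' i t else f i t)) (at t)"
 using assms
proof (induction I rule: finite_induct)
 case (insert a I)
 have "(PROD i:I. if i = a then f' i t else f i t) = (PROD i:I. f i t)"
  using insert.hyps by (intro prod.cong) auto
 moreover have "(SUM j:I. (if a = j then f' a t else f a t) * (PROD i:I. if i = j then f' i t else f i t))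
   = f a t * (SUM j:I. PROD i:I. if i = j then f' i t else f i t)"
  using insert.hyps by (auto simp: sum_distrib_left intro!: sum.cong)
 moreover have "((%t. f a t * (PROD i:I. f i t)) has_real_derivative
   f' a t * (PROD i:I. f i t) + (SUM j:I. PROD i:I. if i = j then f' i t else f i t) * f a t) (at t)"
  using insert by (intro DERIV_mult) auto
 ultimately show ?case using insert.hyps by (simp add: mult.commute)
qed simp

lemma DERIV_alternant:
 fixes f f' :: "nat => nat => real => real"
 assumes "!!i k. i < N ==> k < N ==> (f i k has_real_derivative f' i k t) (at t)"
 shows "((%t. alternant N (%i k. f i k t)) has_real_derivative
   (SUM j<N. alternant N (%i k. if i = j then f' i k t else f i k t))) (at t)"
proof -
 have "((%t. alternant N (%i k. f i k t)) has_real_derivative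
  (\<Sum>p | p permutes {..<N}. of_int (sign p) *
   (SUM j<N. PROD i<N. if i = j then f' i (p i) t else f i (p i) t))) (at t)"
  unfolding alternant_def
 proof (intro DERIV_sum DERIV_cmult DERIV_prod_rows assms)
  fix p i assume "p : {p. p permutes {..<N}}" "i : {..<N}"
  then show "p i < N" using permutes_in_image[of p "{..<N}" i] by auto
 qed auto
 moreover have "(\<Sum>p | p permutes {..<N}. of_int (sign p) *
   (SUM j<N. PROD i<N. if i = j then f' i (p i) t else f i (p i) t))
  = (SUM j<N. alternant N (%i k. if i = j then f' i k t else f i k t))"
  unfolding alternant_def sum_distrib_left by (rule sum.swap)
 ultimately show ?thesis by simp
qed

lemma DERIV_alternant_row:
 fixes f f' :: "nat => real => real" and g :: "nat => nat => real"
 assumes "!!k. k < N ==> (f k has_real_derivative f' k t) (at t)" "j < N"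
 shows "((%t. alternant N (%i k. if i = j then f k t else g i k)) has_real_derivative
   alternant N (%i k. if i = j then f' k t else g i k)) (at t)"
proof -
 have "((%t. alternant N (%i k. if i = j then f k t else g i k)) has_real_derivative
   (SUM l<N. alternant N (%i k. if i = l then if i = j then f' k t else 0
    else if i = j then f k t else g i k))) (at t)"
  by (rule DERIV_alternant[where f' = "%i k t. if i = j then f' k t else 0"]) (use assms in auto)
 moreover have "alternant N (%i k. if i = l then if i = j then f' k t else 0
    else if i = j then f k t else g i k) =
   (if l = j then alternant N (%i k. if i = j then f' k t else g i k) else 0)" if l: "l < N" for l
 proof (cases "l = j")
  case False
  have "(PROD i<N. if i = l then if i = j then f' (p i) t else 0 else if i = j then f (p i) t else g i (p i)) = 0" for p
   using l False by (auto simp: prod_zero_iff)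
  then show ?thesis using False by (simp add: alternant_def del: prod_zero_iff)
 qed (auto intro!: alternant_cong)
 ultimately show ?thesis using assms(2) by (simp add: sum.delta)
qed

lemma vdm_log_derivative:
 fixes y :: "nat => real"
 assumes "!!i k. i < N ==> k < N ==> i ~= k ==> y i ~= y k" "j < N"
 shows "((%t. vdm N (y(j := t))) has_real_derivative
  vdm N y * (SUM k:{..<N} - {j}. 1 / (y j - y k))) (at (y j))"
proof -
 define P where "P = {(i, k). i < k & k < N}"
 have fin: "finite P" unfolding P_def by (rule finite_pairs)
 \<comment> \<open>The derivative of the factor \<open>p\<close> in the variable \<open>y j\<close>:
   1 if \<open>j\<close> is the larger index of the pair, -1 if it is the smaller one. With these
   signs both kinds of pairs contribute \<open>1 / (y j - y k)\<close>.\<close>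
 define d where "d = (%p::nat \<times> nat. (if snd p = j then 1 else 0) - (if fst p = j then 1 else 0) :: real)"
 define f where "f = (%p t. (y(j := t)) (snd p) - (y(j := t)) (fst p))"
 have f: "((%t. f p t) has_real_derivative d p) (at (y j))" if "p : P" for p
  using that by (auto simp: f_def d_def P_def intro!: derivative_eq_intros)
 have f0: "f p (y j) = y (snd p) - y (fst p)" for p by (simp add: f_def)
 have ne: "f p (y j) ~= 0" if "p : P" for p
  using that assms(1)[of "snd p" "fst p"] by (auto simp: f0 P_def)
 let ?C = "%j. PROD p:P. f p (y j)"
 let ?D = "%j. SUM l:P. PROD p:P. if p = l then d p else f p (y j)"
 let ?E = "%j. SUM l:P. d l / f l (y j)"
 have "((%t. PROD p:P. f p t) has_real_derivative
   (?D j)) (at (y j))"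
  by (rule DERIV_prod_rows[where f' = "%p _. d p"]) (auto intro: fin f)
 also have "(?D j) =
   (SUM l:P. (?C j) * (d l / f l (y j)))"
 proof (intro sum.cong refl)
  fix l assume l: "l : P"
  have "(PROD p:P. if p = l then d p else f p (y j)) = d l * (PROD p:P - {l}. f p (y j))"
   using fin l by (subst prod.remove[of _ l]) (auto intro!: prod.cong)
  moreover have "(?C j) = f l (y j) * (PROD p:P - {l}. f p (y j))"
   using fin l by (rule prod.remove)
  ultimately show "(PROD p:P. if p = l then d p else f p (y j)) = (?C j) * (d l / f l (y j))"
   using ne[OF l] by simp
 qed
 also have "... = (?C j) * (?E j)"
  by (simp add: sum_distrib_left)
 also have "(?E j) = (SUM k:{..<N} - {j}. 1 / (y j - y k))"
 proof -
  let ?A = "(%k. (k, j)) ` {..<j}" and ?B = "(%k. (j, k)) ` {j<..<N}"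
  have "(?E j) = (SUM l:?A \<union> ?B. d l / f l (y j))"
   using assms(2) by (intro sum.mono_neutral_right fin) (auto simp: P_def d_def)
  also have "... = (SUM l:?A. d l / f l (y j)) + (SUM l:?B. d l / f l (y j))"
   by (intro sum.union_disjoint) auto
  also have "... = (SUM k<j. 1 / (y j - y k)) + (SUM k:{j<..<N}. 1 / (y j - y k))"
   by (subst (1 2) sum.reindex) (auto simp: inj_on_def f0 d_def divide_simps intro!: sum.cong arg_cong2[where f = "(+)"])
  also have "... = (SUM k:{..<j} \<union> {j<..<N}. 1 / (y j - y k))"
   by (intro sum.union_disjoint[symmetric]) auto
  also have "{..<j} \<union> {j<..<N} = {..<N} - {j}" using assms(2) by auto
  finally show ?thesis .
 qed
 also have "(?C j) = vdm N y"
  by (simp add: f0 vdm_def P_def case_prod_unfold)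
 also have "(%t. PROD p:P. f p t) = (%t. vdm N (y(j := t)))"
  unfolding f_def vdm_def P_def case_prod_unfold by simp
 finally show ?thesis .
qed

hide_const (open) Module.smult

section \<open>Exponential polynomials and the BESQ generator\<close>

text \<open>The generator of BESQ; the diffusion coefficient \<open>2 * sqrt x\<close> has half
  square \<open>2 * x\<close>. It lowers degrees and is therefore nilpotent on each
  polynomial.\<close>

definition besq_op :: "real => real poly => real poly" where
 "besq_op nu p = smult 2 (pCons 0 (pderiv (pderiv p))) + smult (2 * (nu + 1)) (pderiv p)"

lemma poly_besq_op:
 "poly (besq_op nu p) z = 2 * z * poly (pderiv (pderiv p)) z + 2 * (nu + 1) * poly (pderiv p) z"
 by (simp add: besq_op_def)

lemma besq_op_add: "besq_op nu (p + q) = besq_op nu p + besq_op nu q"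
 by (simp add: besq_op_def pderiv_add smult_add_right)

lemma besq_op_smult: "besq_op nu (smult c p) = smult c (besq_op nu p)"
 by (simp add: besq_op_def pderiv_smult smult_add_right mult.commute)

lemma besq_op_0 [simp]: "besq_op nu 0 = 0"
 by (simp add: besq_op_def)

lemma besq_op_sum: "besq_op nu (SUM i:I. f i) = (SUM i:I. besq_op nu (f i))"
 by (induction I rule: infinite_finite_induct) (auto simp: besq_op_add)

lemma degree_besq_op: "degree (besq_op nu p) <= degree p - 1"
by (auto simp: besq_op_def degree_pderiv pderiv_eq_0_iff intro!: degree_add_le order.trans[OF degree_smult_le])

lemma degree_besq_op_funpow: "degree ((besq_op nu ^^ m) p) <= degree p - m"
proof (induction m)
 case (Suc m)
 then show ?case using degree_besq_op[of nu "(besq_op nu ^^ m) p"] by simp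
qed simp

lemma besq_op_funpow_eq_0: "(besq_op nu ^^ Suc (degree p)) p = 0"
proof -
 have "degree ((besq_op nu ^^ degree p) p) = 0"
  using degree_besq_op_funpow[where m = "degree p" and p = p] by simp
 then have "pderiv ((besq_op nu ^^ degree p) p) = 0" by (simp add: pderiv_eq_0_iff)
 then show ?thesis by (simp add: besq_op_def)
qed

text \<open>The exponential of \<open>ka\<close> times the generator, that is, the BESQ semigroup at
  time \<open>ka\<close> on polynomials; by nilpotency the series stops at the degree of
  \<open>q\<close>.\<close>

definition besq_heat :: "real => real => real poly => real poly" where
 "besq_heat nu ka q = (SUM m<=degree q. smult (ka ^ m / fact m) ((besq_op nu ^^ m) q))"

lemma besq_heat_0 [simp]: "besq_heat nu 0 q = q"
 by (simp add: besq_heat_def power_0_left if_distrib[of "%c. c / _"] if_distrib[of "%c. smult c _"]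
   sum.delta cong: if_cong)

text \<open>The right-hand side is the derivative of \<open>besq_heat nu ka q\<close> in
  \<open>ka\<close>, term by term. Shifting the summation index loses the top term, which is 0 by
  \<open>besq_op_funpow_eq_0\<close>.\<close>

lemma besq_op_heat:
 "besq_op nu (besq_heat nu ka q) =
  (SUM m<=degree q. smult (of_nat m * ka ^ (m - 1) / fact m) ((besq_op nu ^^ m) q))"
proof -
 let ?d = "degree q"
 have "besq_op nu (besq_heat nu ka q) =
   (SUM m<=?d. smult (ka ^ m / fact m) ((besq_op nu ^^ Suc m) q))"
  by (simp add: besq_heat_def besq_op_sum besq_op_smult)
 also have "... = (SUM m<?d. smult (ka ^ m / fact m) ((besq_op nu ^^ Suc m) q))"
  using besq_op_funpow_eq_0[where p = q and nu = nu] by (simp add: lessThan_Suc_atMost[symmetric] del: funpow.simps)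
 also have "... = (SUM m<?d. smult (of_nat (Suc m) * ka ^ (Suc m - 1) / fact (Suc m)) ((besq_op nu ^^ Suc m) q))"
 by simp
 also have "... = (SUM m<=?d. smult (of_nat m * ka ^ (m - 1) / fact m) ((besq_op nu ^^ m) q))"
  unfolding lessThan_Suc_atMost[symmetric] sum.lessThan_Suc_shift by simp
 finally show ?thesis .
qed

lemma pderiv_sum: "pderiv (SUM i:I. f i) = (SUM i:I. pderiv (f i))"
 by (induction I rule: infinite_finite_induct) (auto simp: pderiv_add)

lemma DERIV_besq_heat:
 assumes "(ka has_real_derivative ka') (at ta)" "(z has_real_derivative z') (at ta)"
 shows "((%ta. poly (besq_heat nu (ka ta) q) (z ta)) has_real_derivative
  ka' * poly (besq_op nu (besq_heat nu (ka ta) q)) (z ta) +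
  z' * poly (pderiv (besq_heat nu (ka ta) q)) (z ta)) (at ta)"
proof -
 let ?P = "%m. (besq_op nu ^^ m) q"
 have "((%ta. SUM m<=degree q. ka ta ^ m / fact m * poly (?P m) (z ta)) has_real_derivative
   (SUM m<=degree q. of_nat m * ka ta ^ (m - 1) * ka' / fact m * poly (?P m) (z ta) +
    poly (pderiv (?P m)) (z ta) * z' * (ka ta ^ m / fact m))) (at ta)"
 proof (rule DERIV_sum)
  fix m
  have "((%ta. ka ta ^ m / fact m) has_real_derivative
    of_nat m * ka ta ^ (m - 1) * ka' / fact m) (at ta)"
   by (intro DERIV_cdivide DERIV_cong[OF DERIV_power[OF assms(1)]]) simp
  from DERIV_mult[OF this DERIV_chain2[OF poly_DERIV assms(2)]]
  show "((%ta. ka ta ^ m / fact m * poly (?P m) (z ta)) has_real_derivative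
   of_nat m * ka ta ^ (m - 1) * ka' / fact m * poly (?P m) (z ta) +
    poly (pderiv (?P m)) (z ta) * z' * (ka ta ^ m / fact m)) (at ta)"
   by blast
 qed
 moreover have "poly (pderiv (besq_heat nu (ka ta) q)) (z ta) =
   (SUM m<=degree q. ka ta ^ m / fact m * poly (pderiv (?P m)) (z ta))"
  by (simp add: besq_heat_def pderiv_sum pderiv_smult poly_sum)
 ultimately show ?thesis
  unfolding besq_op_heat
  by (simp add: besq_heat_def poly_sum sum.distrib sum_distrib_left algebra_simps)
qed

lemma polyfun_poly_besq_heat:
 assumes "polyfun n f" "polyfun n h"
 shows "polyfun n (%y. poly (besq_heat nu (f y) q) (h y))"
 unfolding besq_heat_def poly_sum poly_smult
 unfolding poly_altdef divide_inverse using assms by (intro polyfun_intros) auto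

context
 fixes nu lam :: real and q :: "real poly"
begin

text \<open>Conjugating the generator with \<open>exp (- lam * b * x)\<close> produces three extra
  terms: a multiple of \<open>x * d/dx\<close>, a multiple of \<open>x\<close>, and a constant. They
  are absorbed by the dilation \<open>b^2 * x\<close>, by the motion of \<open>b\<close>, and by the
  prefactor \<open>g\<close>.\<close>

definition besq_fun :: "real => real => real => real => real" where
 "besq_fun b ka g x = g * exp (- lam * b * x) * poly (besq_heat nu ka q) (b^2 * x)"

definition besq_fun1 :: "real => real => real => real => real" where
 "besq_fun1 b ka g x = g * exp (- lam * b * x) *
   (b^2 * poly (pderiv (besq_heat nu ka q)) (b^2 * x) - lam * b * poly (besq_heat nu ka q) (b^2 * x))"

definition besq_fun2 :: "real => real => real => real => real" where
 "besq_fun2 b ka g x = g * exp (- lam * b * x) *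
   (b ^ 4 * poly (pderiv (pderiv (besq_heat nu ka q))) (b^2 * x)
   - 2 * lam * b ^ 3 * poly (pderiv (besq_heat nu ka q)) (b^2 * x)
   + lam^2 * b^2 * poly (besq_heat nu ka q) (b^2 * x))"

lemma DERIV_besq_fun:
 "((%x. besq_fun b ka g x) has_real_derivative besq_fun1 b ka g x) (at x)"
 unfolding besq_fun_def besq_fun1_def
 by (rule derivative_eq_intros refl poly_DERIV[THEN DERIV_chain2])+ (simp add: algebra_simps)

lemma DERIV_besq_fun1:
 "((%x. besq_fun1 b ka g x) has_real_derivative besq_fun2 b ka g x) (at x)"
 unfolding besq_fun1_def besq_fun2_def
 by (rule derivative_eq_intros refl poly_DERIV[THEN DERIV_chain2])+
  (simp add: algebra_simps power2_eq_square power3_eq_cube power4_eq_xxxx)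

text \<open>
 With \<open>a = 1 + 2 lam r\<close>, where \<open>r\<close> is the time to go, the parameters are \<open>b = 1 / a\<close>, \<open>\<kappa> = r / a\<close>
 and \<open>g = a powr - (nu + 1)\<close>; they solve the differential equations whose right hand sides give the
 direction of differentiation here.
\<close>

lemma DERIV_besq_fun_time:
 "((%ta. besq_fun (b + ta * (2 * lam * b^2)) (ka + ta * (- b\<^sup>2)) (g + ta * (2 * lam * (nu + 1) * b * g)) x)
  has_real_derivative - (2 * x * besq_fun2 b ka g x + 2 * (nu + 1) * besq_fun1 b ka g x)) (at 0)"
proof -
 have A: "((%ta. poly (besq_heat nu (ka + ta * (- b\<^sup>2)) q) ((b + ta * (2 * lam * b^2))^2 * x))
   has_real_derivative
   - b\<^sup>2 * poly (besq_op nu (besq_heat nu (ka + 0 * (- b\<^sup>2)) q)) ((b + 0 * (2 * lam * b^2))^2 * x) +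
   4 * lam * b ^ 3 * x * poly (pderiv (besq_heat nu (ka + 0 * (- b\<^sup>2)) q)) ((b + 0 * (2 * lam * b^2))^2 * x))
   (at 0)"
  by (rule DERIV_besq_heat)
   (auto intro!: derivative_eq_intros simp: power2_eq_square power3_eq_cube)
 have B: "((%ta. (g + ta * (2 * lam * (nu + 1) * b * g)) * exp (- lam * (b + ta * (2 * lam * b^2)) * x))
   has_real_derivative (2 * lam * (nu + 1) * b * g - 2 * lam^2 * b^2 * x * g) * exp (- lam * b * x)) (at 0)"
  by (rule derivative_eq_intros refl)+ (simp add: algebra_simps power2_eq_square)
 show ?thesis
  unfolding besq_fun_def besq_fun1_def besq_fun2_def
  by (rule DERIV_cong[OF DERIV_mult[OF B A]])
   (simp add: poly_besq_op algebra_simps power2_eq_square power3_eq_cube power4_eq_xxxx)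
qed

end

text \<open>The Vandermonde determinant is harmonic for \<open>N\<close> independent BESQ processes:
  the generator maps \<open>x ^ k\<close> to \<open>2 * k * (k + nu) * x ^ (k - 1)\<close>. Summed
  over rows, its action equals an action on columns, where column \<open>k\<close> becomes a
  multiple of column \<open>k - 1\<close>, so that two columns are proportional; for
  \<open>k = 0\<close> the coefficient is 0.\<close>

lemma vdm_harmonic:
 fixes y :: "nat => real"
 shows "(SUM j<N. alternant N (%i k. if i = j then 2 * of_nat k * (of_nat k + nu) * y i ^ (k - 1) else y i ^ k)) = 0"
proof -
 define c where "c = (%k::nat. 2 * of_nat k * (of_nat k + nu))"
 let ?A = "%p m. PROD i<N. if p i = m then y i ^ (m - 1) else y i ^ p i"
 let ?B = "%p. SUM j<N. PROD i<N. if i = j then c (p i) * y i ^ (p i - 1) else y i ^ p i"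
 let ?C = "%j p. PROD i<N. if i = j then c (p i) * y i ^ (p i - 1) else y i ^ p i"
 let ?D = "%p j. PROD i<N. if p i = p j then y i ^ (p j - 1) else y i ^ p i"
 have "(?B p) =
   (SUM m<N. c m * (?A p m))"
  if p: "p permutes {..<N}" for p
 proof -
  have "(?C j p) =
    c (p j) * (?D p j)" if j: "j < N" for j
  proof -
   have "(?C j p) =
     (PROD i<N. (if i = j then c (p j) else 1) * (if p i = p j then y i ^ (p j - 1) else y i ^ p i))"
    using permutes_inj[OF p] by (intro prod.cong) (auto dest: injD)
   then show ?thesis using j by (simp add: prod.distrib)
  qed
  then have "(?B p) =
    (SUM j<N. c (p j) * (?D p j))"
   by simp
  also have "... = (SUM m<N. c m * (?A p m))"
   using sum.permute[OF p, of "%m. c m * (?A p m)"]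
   by (simp add: o_def)
  finally show ?thesis .
 qed
 then have "(SUM j<N. alternant N (%i k. if i = j then c k * y i ^ (k - 1) else y i ^ k)) =
   (\<Sum>p | p permutes {..<N}. of_int (sign p) *
    (SUM m<N. c m * (?A p m)))"
  unfolding alternant_def by (subst sum.swap) (simp flip: sum_distrib_left)
 \<comment> \<open>The sum over rows has become a sum over columns; \<open>m\<close> is the column
   that is altered.\<close>
 also have "... = (SUM m<N. c m * alternant N (%i k. if k = m then y i ^ (m - 1) else y i ^ k))"
  unfolding alternant_def sum_distrib_left by (subst sum.swap) (simp add: algebra_simps)
 also have "... = 0"
 proof (intro sum.neutral ballI)
  fix m assume "m : {..<N}"
  then show "c m * alternant N (%i k. if k = m then y i ^ (m - 1) else y i ^ k) = 0"
   by (cases m) (auto simp: c_def intro!: alternant_identical_columns[of m _ "m - 1"])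
 qed
 finally show ?thesis unfolding c_def .
qed

context
 fixes nu lam :: real and q :: "nat => real poly" and N :: nat
  and F :: "(nat => real) => real" and F1 :: "nat => (nat => real) => real"
  and F2 :: "nat => nat => (nat => real) => real"
 assumes quot: "!!y. vdm N y * F y =
   alternant N (%j k. besq_fun nu lam (q k) (y N) (y (Suc N)) (y (Suc (Suc N))) (y j))"
  and F1: "has_gradient (N + 3) F F1"
  and F2: "!!a. has_gradient (N + 3) (F1 a) (F2 a)"
begin

text \<open>The Doob transform as an identity. The coordinates \<open>N\<close>,
  \<open>Suc N\<close>, \<open>Suc (Suc N)\<close> hold \<open>b\<close>, \<open>ka\<close>,
  \<open>g\<close>. In the product rule for \<open>h * F\<close>, with \<open>h\<close> the
  Vandermonde determinant, the mixed term \<open>4 * y j * (d_j h) * (d_j F)\<close> is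
  \<open>h\<close> times the repulsive drift; the terms with derivatives of the entries cancel
  against the time derivative, and the generator applied to \<open>h\<close> gives 0.\<close>

lemma noncolliding_generator:
 assumes dist: "!!i k. i < N ==> k < N ==> i ~= k ==> y i ~= y k"
 shows "(SUM j<N. (2 * (nu + 1) + 4 * y j * (SUM k:{..<N} - {j}. 1 / (y j - y k))) * F1 j y)
   + (SUM j<N. 2 * y j * F2 j j y)
   + (2 * lam * (y N)^2 * F1 N y - (y N)^2 * F1 (Suc N) y
    + 2 * lam * (nu + 1) * y N * y (Suc (Suc N)) * F1 (Suc (Suc N)) y) = 0"
proof -
 define b ka g where "b = y N" and "ka = y (Suc N)" and "g = y (Suc (Suc N))"
 define f where "f = (%k. besq_fun nu lam (q k) b ka g)"
 define f1 where "f1 = (%k. besq_fun1 nu lam (q k) b ka g)"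
 define f2 where "f2 = (%k. besq_fun2 nu lam (q k) b ka g)"
 define h where "h = vdm N y"
 define h1 where "h1 = (%j. alternant N (%i k. if i = j then of_nat k * y i ^ (k - 1) else y i ^ k))"
 define h2 where "h2 = (%j. alternant N (%i k. if i = j then of_nat k * (of_nat (k - 1) * y i ^ (k - 1 - 1)) else y i ^ k))"
 define A1 where "A1 = (%j. alternant N (%i k. if i = j then f1 k (y i) else f k (y i)))"
 define A2 where "A2 = (%j. alternant N (%i k. if i = j then f2 k (y i) else f k (y i)))"
 define B where "B = (%j. alternant N (%i k. if i = j then - (2 * y i * f2 k (y i) + 2 * (nu + 1) * f1 k (y i)) else f k (y i)))"
 have df: "(f k has_real_derivative f1 k t) (at t)" "(f1 k has_real_derivative f2 k t) (at t)" for k t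
  unfolding f_def f1_def f2_def by (rule DERIV_besq_fun DERIV_besq_fun1)+
 have h0: "h ~= 0" unfolding h_def using dist by (intro vdm_nonzero) auto
 have alt_lin: "alternant N (%i k. if i = j then c * u k + d * v k else w i k) =
   c * alternant N (%i k. if i = j then u k else w i k) + d * alternant N (%i k. if i = j then v k else w i k)"
  if "j < N" for j c d and u v :: "nat => real" and w
 proof -
  have "(PROD i<N. if i = j then s (p i) else w i (p i)) = s (p j) * (PROD i:{..<N} - {j}. w i (p i))"
   for s :: "nat => real" and p
   using that by (subst prod.remove[of _ j]) (auto intro!: prod.cong)
  note * = this[of "%k. c * u k + d * v k"] this[of u] this[of v]
  show ?thesis unfolding alternant_def * by (simp add: sum_distrib_left algebra_simps flip: sum.distrib)
 qed
 let ?A = "%j y. SUM k:{..<N} - {j}. 1 / (y j - y k)"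
 have first: "h1 j * F y + h * F1 j y = A1 j" "h1 j = h * (?A j y)"
  and second: "h2 j * F y + 2 * h1 j * F1 j y + h * F2 j j y = A2 j" if j: "j < N" for j
 proof -
  \<comment> \<open>Row \<open>j\<close> is moved and all other rows are frozen. Differentiating
    \<open>H * F = A\<close> once and twice at \<open>t = y j\<close> gives \<open>first\<close> and
    \<open>second\<close>.\<close>
  define H where "H = (%t. alternant N (%i k. if i = j then t ^ k else y i ^ k))"
  define H1 where "H1 = (%t. alternant N (%i k. if i = j then of_nat k * t ^ (k - 1) else y i ^ k))"
  define A where "A = (%t. alternant N (%i k. if i = j then f k t else f k (y i)))"
  define A' where "A' = (%t. alternant N (%i k. if i = j then f1 k t else f k (y i)))"
  have H: "vdm N (y(j := t)) = H t" for t
   unfolding H_def alternant_powers[symmetric] by (intro alternant_cong) auto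
  have HF: "H t * F (y(j := t)) = A t" for t
   unfolding H[symmetric] quot A_def f_def b_def ka_def g_def using j
   by (intro alternant_cong) auto
  have dH: "(H has_real_derivative H1 t) (at t)" for t
   unfolding H_def H1_def
   by (rule DERIV_alternant_row[OF _ j]) (auto intro!: derivative_eq_intros)
  have dH1: "(H1 has_real_derivative h2 j) (at (y j))"
  proof -
   have "(H1 has_real_derivative alternant N (%i k. if i = j then of_nat k * (of_nat (k - 1) * y j ^ (k - 1 - 1)) else y i ^ k)) (at (y j))"
    unfolding H1_def
    by (rule DERIV_alternant_row[OF _ j]) (auto intro!: derivative_eq_intros)
   then show ?thesis unfolding h2_def by (rule DERIV_cong) (auto intro!: alternant_cong)
  qed
  have dF: "((%t. F (y(j := t))) has_real_derivative F1 j (y(j := t))) (at t)" for t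
   using has_gradient_partial[OF F1] j by simp
  have dF1: "((%t. F1 j (y(j := t))) has_real_derivative F2 j j (y(j := t))) (at t)" for t
   using has_gradient_partial[OF F2] j by simp
  have dA: "(A has_real_derivative A' t) (at t)" for t
   unfolding A_def A'_def by (rule DERIV_alternant_row[OF _ j]) (rule df)
  have dA': "(A' has_real_derivative A2 j) (at (y j))"
  by (fastforce simp: A'_def A2_def intro: alternant_cong DERIV_alternant_row[OF _ j] df DERIV_cong)
  have one: "H1 t * F (y(j := t)) + F1 j (y(j := t)) * H t = A' t" for t
  using dA DERIV_unique by (fastforce simp: HF intro: DERIV_mult[OF dH dF])
  have two: "h2 j * F (y(j := y j)) + F1 j (y(j := y j)) * H1 (y j) +
    (F2 j j (y(j := y j)) * H (y j) + H1 (y j) * F1 j (y(j := y j))) = A2 j"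
  proof -
   have "((%t. H1 t * F (y(j := t)) + F1 j (y(j := t)) * H t) has_real_derivative
    h2 j * F (y(j := y j)) + F1 j (y(j := y j)) * H1 (y j) +
    (F2 j j (y(j := y j)) * H (y j) + H1 (y j) * F1 j (y(j := y j)))) (at (y j))"
    by (intro DERIV_add DERIV_mult dH1 dF dF1 dH)
   then show ?thesis unfolding one using dA' DERIV_unique by blast
  qed
  have Hy: "H (y j) = h" unfolding h_def H[symmetric] by simp
  have H1y: "H1 (y j) = h1 j" unfolding H1_def h1_def by (auto intro!: alternant_cong)
  have A'y: "A' (y j) = A1 j" unfolding A'_def A1_def by (auto intro!: alternant_cong)
  show "h1 j * F y + h * F1 j y = A1 j"
   using one[of "y j"] unfolding Hy H1y A'y by (simp add: algebra_simps)
  show "h2 j * F y + 2 * h1 j * F1 j y + h * F2 j j y = A2 j"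
   using two unfolding Hy H1y by (simp add: algebra_simps)
  have "((%t. vdm N (y(j := t))) has_real_derivative h * (?A j y)) (at (y j))"
   unfolding h_def using dist j by (intro vdm_log_derivative) auto
  then show "h1 j = h * (?A j y)"
   unfolding H H1y[symmetric] using dH DERIV_unique by blast
 qed
 let ?C = "%j nu y. %i k. if i = j then 2 * of_nat k * (of_nat k + nu) * y i ^ (k - 1) else y i ^ k"
 let ?D = "%y nu. SUM j<N. 2 * y j * h2 j + 2 * (nu + 1) * h1 j"
 have harm: "(?D y nu) = 0"
 proof -
  have "2 * y j * h2 j + 2 * (nu + 1) * h1 j =
   alternant N (?C j nu y)"
   if j: "j < N" for j
  proof -
   have *: "2 * of_nat k * (of_nat k + nu) * y j ^ (k - 1) =
    (2 * y j) * (of_nat k * (of_nat (k - 1) * y j ^ (k - 1 - 1))) + (2 * (nu + 1)) * (of_nat k * y j ^ (k - 1))"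
    for k
    by (cases k; cases "k - 1") (auto simp: algebra_simps)
   have "alternant N (?C j nu y) =
    alternant N (%i k. if i = j then (2 * y j) * (of_nat k * (of_nat (k - 1) * y j ^ (k - 1 - 1))) + (2 * (nu + 1)) * (of_nat k * y j ^ (k - 1)) else y i ^ k)"
    unfolding *[symmetric] by (intro alternant_cong) simp
   also have "... = 2 * y j * h2 j + 2 * (nu + 1) * h1 j"
    unfolding alt_lin[OF j] h2_def h1_def
    by (intro arg_cong2[where f = "(+)"] arg_cong2[where f = "(*)"] refl alternant_cong) auto
   finally show ?thesis ..
  qed
  then have "(?D y nu) = (SUM j<N.
   alternant N (?C j nu y))"
   by simp
  then show ?thesis using vdm_harmonic[of N nu y] by simp
 qed
 have B: "B j = - (2 * y j * A2 j + 2 * (nu + 1) * A1 j)" if j: "j < N" for j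
 proof -
  have "B j = alternant N (%i k. if i = j then (- 2 * y j) * f2 k (y j) + (- 2 * (nu + 1)) * f1 k (y j) else f k (y i))"
   unfolding B_def by (intro alternant_cong) (auto simp: algebra_simps)
  also have "... = (- 2 * y j) * A2 j + (- 2 * (nu + 1)) * A1 j"
   unfolding alt_lin[OF j] A1_def A2_def
   by (intro arg_cong2[where f = "(+)"] arg_cong2[where f = "(*)"] refl alternant_cong) auto
  finally show ?thesis by (simp add: algebra_simps)
 qed
 let ?B = "%lam F1 y nu. 2 * lam * b^2 * F1 N y - b^2 * F1 (Suc N) y + 2 * lam * (nu + 1) * b * g * F1 (Suc (Suc N)) y"
 let ?F = "%y i nu lam q k. 2 * y i * besq_fun2 nu lam (q k) b ka g (y i) + 2 * (nu + 1) * besq_fun1 nu lam (q k) b ka g (y i)"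
 have time: "h * (?B lam F1 y nu) = (SUM j<N. B j)"
 proof -
  \<comment> \<open>The velocity of the parameters. It vanishes in the first \<open>N\<close>
    coordinates, so that the Vandermonde determinant stays equal to \<open>h\<close> along this
    direction.\<close>
  define v where "v = (%a. if a = N then 2 * lam * b^2 else if a = Suc N then - b\<^sup>2
   else if a = Suc (Suc N) then 2 * lam * (nu + 1) * b * g else 0 :: real)"
  have "((%ta. F (%i. y i + ta * v i)) has_real_derivative
    (SUM a<N+3. v a * F1 a (%i. y i + 0 * v i))) (at 0)"
   using F1[unfolded has_gradient_def] by blast
  moreover have "(SUM a<N+3. v a * F1 a (%i. y i + 0 * v i)) =
    2 * lam * b^2 * F1 N y - b^2 * F1 (Suc N) y + 2 * lam * (nu + 1) * b * g * F1 (Suc (Suc N)) y"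
   by (simp add: numeral_3_eq_3 v_def)
  ultimately have "((%ta. F (%i. y i + ta * v i)) has_real_derivative
    2 * lam * b^2 * F1 N y - b^2 * F1 (Suc N) y + 2 * lam * (nu + 1) * b * g * F1 (Suc (Suc N)) y) (at 0)"
   by (simp only:)
  then have "((%ta. h * F (%i. y i + ta * v i)) has_real_derivative
    h * (?B lam F1 y nu)) (at 0)"
   by (rule DERIV_cmult)
  moreover have "h * F (%i. y i + ta * v i) = alternant N (%j k. besq_fun nu lam (q k)
    (b + ta * (2 * lam * b^2)) (ka + ta * (- b\<^sup>2)) (g + ta * (2 * lam * (nu + 1) * b * g)) (y j))" for ta
  proof -
   have "h = vdm N (%i. y i + ta * v i)"
    unfolding h_def vdm_def by (intro prod.cong) (auto simp: v_def)
   then show ?thesis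
    by (simp only: quot) (intro alternant_cong, auto simp: v_def b_def ka_def g_def)
  qed
  moreover have "((%ta. alternant N (%j k. besq_fun nu lam (q k)
    (b + ta * (2 * lam * b^2)) (ka + ta * (- b\<^sup>2)) (g + ta * (2 * lam * (nu + 1) * b * g)) (y j)))
    has_real_derivative (SUM j<N. alternant N (%i k. if i = j
     then - (?F y i nu lam q k)
     else besq_fun nu lam (q k)
    (b + 0 * (2 * lam * b^2)) (ka + 0 * (- b\<^sup>2)) (g + 0 * (2 * lam * (nu + 1) * b * g)) (y i)))) (at 0)"
   by (rule DERIV_alternant) (rule DERIV_besq_fun_time)
  ultimately have "h * (?B lam F1 y nu) =
   (SUM j<N. alternant N (%i k. if i = j
     then - (?F y i nu lam q k)
     else besq_fun nu lam (q k)
    (b + 0 * (2 * lam * b^2)) (ka + 0 * (- b\<^sup>2)) (g + 0 * (2 * lam * (nu + 1) * b * g)) (y i)))"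
   using DERIV_unique by simp
  then show ?thesis unfolding B_def f_def f1_def f2_def by (simp cong: if_cong)
 qed
 let ?E = "(SUM j<N. (2 * (nu + 1) + 4 * y j * (?A j y)) * F1 j y)
   + (SUM j<N. 2 * y j * F2 j j y)
   + (2 * lam * b^2 * F1 N y - b^2 * F1 (Suc N) y
    + 2 * lam * (nu + 1) * b * g * F1 (Suc (Suc N)) y)"
 \<comment> \<open>After multiplication by \<open>h\<close>, index \<open>j\<close> contributes
   \<open>- F y\<close> times the one-variable generator applied to \<open>h\<close>; these
   contributions add up to 0 by \<open>harm\<close>. Dividing by \<open>h\<close> is possible as the
   points are distinct.\<close>
 have "h * ?E = (SUM j<N. h * ((2 * (nu + 1) + 4 * y j * (?A j y)) * F1 j y))
   + (SUM j<N. h * (2 * y j * F2 j j y)) + (SUM j<N. B j)"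
  by (simp only: time[symmetric] distrib_left[of h] sum_distrib_left[of h])
 also have "... = (SUM j<N. h * ((2 * (nu + 1) + 4 * y j * (?A j y)) * F1 j y)
   + h * (2 * y j * F2 j j y) + B j)"
  by (simp add: sum.distrib)
 also have "... = (SUM j<N. - F y * (2 * y j * h2 j + 2 * (nu + 1) * h1 j))"
 proof (intro sum.cong refl)
  fix j assume "j : {..<N}"
  then have j: "j < N" by simp
  show "h * ((2 * (nu + 1) + 4 * y j * (?A j y)) * F1 j y)
   + h * (2 * y j * F2 j j y) + B j = - F y * (2 * y j * h2 j + 2 * (nu + 1) * h1 j)"
  using first(2)[OF j] by (simp add: B[OF j] first(1)[OF j, symmetric] second[OF j, symmetric] algebra_simps)
 qed
 also have "... = - F y * (?D y nu)"
  by (rule sum_distrib_left[symmetric])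
 also have "... = 0" unfolding harm by simp
 finally have hE: "h * ?E = 0" .
 have "b = 0" if "a * b = 0" "a ~= 0" for a b :: real using that by simp
 from this[OF hE h0] show ?thesis unfolding b_def g_def .
qed

end

section \<open>Exponential decay against polynomial growth, and Taylor bounds\<close>

lemma power_le_fact_exp:
 fixes x :: real assumes "0 <= x" shows "x ^ K <= fact K * exp x"
proof -
 have "(SUM k:{K}. x ^ k /\<^sub>R fact k) <= (\<Sum>k. x ^ k /\<^sub>R fact k)"
  using assms by (intro sum_le_suminf summable_exp_generic) auto
 then show ?thesis by (simp add: exp_def field_simps)
qed

lemma power_exp_bounded:
 fixes eta c :: real assumes "eta > 0" "c >= 0"
 shows "EX C. ALL z>=0. (c + z) ^ K * exp (- eta * z) <= C"
proof (intro exI allI impI)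
 fix z :: real assume z: "z >= 0"
 have "(eta * (c + z)) ^ K <= fact K * exp (eta * (c + z))"
  using assms z by (intro power_le_fact_exp) auto
 then have "eta ^ K * (c + z) ^ K * exp (- eta * z) <= fact K * exp (eta * (c + z)) * exp (- eta * z)"
  unfolding power_mult_distrib by (rule mult_right_mono) simp
 also have "... = fact K * exp (eta * c)"
  by (simp add: algebra_simps flip: exp_add)
 finally show "(c + z) ^ K * exp (- eta * z) <= fact K * exp (eta * c) / eta ^ K"
  using assms by (simp add: field_simps)
qed

text \<open>The form in which smoothness enters Ito's formula. Uniformity on boxes suffices because
  a continuous path stays in a box during a compact time interval.\<close>

definition taylor_bounded ::
 "nat => ((nat => real) => real) => (nat => (nat => real) => real) =>
  (nat => nat => (nat => real) => real) => bool" where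
 "taylor_bounded n F F1 F2 \<longleftrightarrow> (ALL B. EX C>=0. ALL y z. (ALL i<n. (abs (y i)) <= B) --> (ALL i<n. (abs (z i)) <= B) -->
   abs (F z - F y - (SUM a<n. (z a - y a) * F1 a y)
    - (SUM a<n. SUM b<n. (z a - y a) * (z b - y b) * F2 a b y) / 2)
   <= C * (SUM a<n. (abs (z a - y a))) ^ 3)"

text \<open>The functions \<open>exp P * S\<close> with a fixed \<open>P\<close> are closed under
  differentiation. Three applications give all the derivatives that a second-order expansion with
  cubic remainder requires.\<close>

lemma exp_polyfun_gradient:
 assumes "polyfun n P" "polyfun n S"
 shows "EX S1. (ALL a. polyfun n (S1 a)) & has_gradient n (%y. exp (P y) * S y) (%a y. exp (P y) * S1 a y)"
proof -
 obtain P1 S1 where *: "!!a. polyfun n (P1 a)" "has_gradient n P P1" "!!a. polyfun n (S1 a)" "has_gradient n S S1"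
  using polyfun_gradient assms by metis
 have "has_gradient n (%y. exp (P y) * S y) (%a y. exp (P y) * P1 a y * S y + S1 a y * exp (P y))"
  by (intro has_gradient_mult has_gradient_exp *)
 also have "(%a y. exp (P y) * P1 a y * S y + S1 a y * exp (P y)) = (%a y. exp (P y) * (P1 a y * S y + S1 a y))"
  by (auto simp: algebra_simps)
 finally show ?thesis
  using * assms by (intro exI conjI) (auto intro!: polyfun_add polyfun_mult)
qed

lemma exp_polyfun_box_bounded:
 assumes "polyfun n P" "polyfun n S"
 shows "EX C>=0. ALL y. (ALL i<n. (abs (y i)) <= B) --> abs (exp (P y) * S y) <= C"
proof -
 let ?A = "%n y. 1 + (SUM i<n. (abs (y i)))"
 obtain C K D L where *: "C >= 0" "D >= 0" "!!y. (abs (P y)) <= C * (?A n y) ^ K"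
   "!!y. (abs (S y)) <= D * (?A n y) ^ L"
  using polyfun_growth[OF assms(1)] polyfun_growth[OF assms(2)] by metis
 have "abs (exp (P y) * S y) <= exp (C * (1 + n * B) ^ K) * (D * (1 + n * B) ^ L)" if y: "ALL i<n. (abs (y i)) <= B" for y
 proof -
  have s: "(SUM i<n. (abs (y i))) <= n * B"
   using y sum_bounded_above[of "{..<n}" "%i. (abs (y i))" B] by simp
  have "P y <= abs (P y)" by simp
  also have "... <= C * (?A n y) ^ K" by (rule *)
  also have "... <= C * (1 + n * B) ^ K"
   using s * by (intro mult_left_mono power_mono) (auto simp: add_nonneg_nonneg sum_nonneg)
  finally have 1: "P y <= C * (1 + n * B) ^ K" .
  have "abs (S y) <= D * (?A n y) ^ L" by (rule *)
  also have "... <= D * (1 + n * B) ^ L"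
   using s * by (intro mult_left_mono power_mono) (auto simp: add_nonneg_nonneg sum_nonneg)
  finally have 2: "abs (S y) <= D * (1 + n * B) ^ L" .
  show ?thesis unfolding abs_mult using 1 2 by (intro mult_mono) auto
 qed
 then have "abs (exp (P y) * S y) <= abs (exp (C * (1 + n * B) ^ K) * (D * (1 + n * B) ^ L))"
  if "ALL i<n. (abs (y i)) <= B" for y using that abs_ge_self order.trans by blast
 then show ?thesis by (intro exI[of _ "abs (exp (C * (1 + n * B) ^ K) * (D * (1 + n * B) ^ L))"]) simp
qed

text \<open>Maclaurin's formula of order 3 on the segment from \<open>y\<close> to \<open>z\<close>,
  which does not leave the box. The constant is the sum of the bounds for all third
  derivatives.\<close>

lemma taylor_boundedI:
 assumes F: "has_gradient n F F1" and F1: "!!a. has_gradient n (F1 a) (F2 a)"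
  and F2: "!!a b. has_gradient n (F2 a b) (F3 a b)"
  and bd: "!!a b c B. EX C>=0. ALL y. (ALL i<n. (abs (y i)) <= B) --> abs (F3 a b c y) <= C"
 shows "taylor_bounded n F F1 F2"
 unfolding taylor_bounded_def
proof
 fix B :: real
 obtain C where C0: "!!a b c. C a b c >= 0" and
  C: "!!a b c y. ALL i<n. (abs (y i)) <= B ==> abs (F3 a b c y) <= C a b c"
  using bd[where B = B] by metis
 define D where "D = (SUM a<n. SUM b<n. SUM c<n. C a b c)"
 have D: "abs (F3 a b c y) <= D" if "a < n" "b < n" "c < n" "ALL i<n. (abs (y i)) <= B" for a b c y
 proof -
  have "abs (F3 a b c y) <= C a b c" using that C by blast
  also have "... <= (SUM c<n. C a b c)" using that C0 by (intro member_le_sum) auto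
  also have "... <= (SUM b<n. SUM c<n. C a b c)"
   using that C0 by (intro member_le_sum[where f = "%b. SUM c<n. C a b c"]) (auto intro: sum_nonneg)
  also have "... <= D" unfolding D_def
   using that C0 by (intro member_le_sum[where f = "%a. SUM b<n. SUM c<n. C a b c"]) (auto intro!: sum_nonneg)
  finally show ?thesis .
 qed
 show "EX C>=0. ALL y z. (ALL i<n. (abs (y i)) <= B) --> (ALL i<n. (abs (z i)) <= B) -->
   abs (F z - F y - (SUM a<n. (z a - y a) * F1 a y)
    - (SUM a<n. SUM b<n. (z a - y a) * (z b - y b) * F2 a b y) / 2)
   <= C * (SUM a<n. (abs (z a - y a))) ^ 3"
 proof (intro exI[of _ D] conjI allI impI)
  show "0 <= D" unfolding D_def using C0 by (intro sum_nonneg) auto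
  fix y z assume yz: "ALL i<n. (abs (y i)) <= B" "ALL i<n. (abs (z i)) <= B"
  define v where "v = (%i. z i - y i)"
  define p where "p = (%ta i. y i + ta * v i)"
  \<comment> \<open>\<open>d m\<close> is the derivative of order \<open>m\<close> of
    \<open>F\<close> along the segment.\<close>
  define d where "d = (%m::nat. %ta. if m = 0 then F (p ta) else if m = 1 then SUM a<n. v a * F1 a (p ta)
   else if m = 2 then SUM a<n. v a * (SUM b<n. v b * F2 a b (p ta))
   else SUM a<n. v a * (SUM b<n. v b * (SUM c<n. v c * F3 a b c (p ta))))"
  have der: "(d m has_real_derivative d (Suc m) ta) (at ta)" if m: "m < 3" for m ta
  proof -
   from m consider "m = 0" | "m = 1" | "m = 2" by linarith
   then show ?thesis
   proof cases
    case 1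
    then show ?thesis using F by (simp add: d_def p_def has_gradient_def)
   next
    case 2
    show ?thesis unfolding 2 d_def
     using F1 by (auto simp: p_def has_gradient_def intro!: DERIV_sum DERIV_cmult)
   next
    case 3
    show ?thesis unfolding 3 d_def
     using F2 by (auto simp: p_def has_gradient_def intro!: DERIV_sum DERIV_cmult)
   qed
  qed
  obtain ta where ta: "0 < ta" "ta < 1" and eq: "F (p 1) = (SUM m<3. d m 0 / fact m * 1 ^ m) + d 3 ta / fact 3 * 1 ^ 3"
   using Maclaurin[of 1 3 d "%ta. F (p ta)"] der by (auto simp: d_def)
  have p0: "p 0 = y" and p1: "F (p 1) = F z" by (auto simp: p_def v_def)
  have "F z - F y - (SUM a<n. v a * F1 a y) - (SUM a<n. SUM b<n. v a * v b * F2 a b y) / 2 = d 3 ta / 6"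
   using eq unfolding p1 by (simp add: d_def p0 numeral_3_eq_3 sum_distrib_left mult.assoc fact_numeral)
  moreover have "abs (d 3 ta) <= D * (SUM a<n. (abs (v a))) ^ 3"
  proof -
   have box: "ALL i<n. (abs (p ta i)) <= B"
   proof (intro allI impI)
    fix i assume i: "i < n"
    have "p ta i = (1 - ta) * y i + ta * z i" by (simp add: p_def v_def algebra_simps)
    then have "abs (p ta i) <= (1 - ta) * abs (y i) + ta * abs (z i)"
     using ta by (auto intro!: abs_triangle_ineq[THEN order.trans] simp: abs_mult)
    also have "... <= (1 - ta) * B + ta * B"
     using yz i ta by (intro add_mono mult_left_mono) auto
    finally show "abs (p ta i) <= B" by (simp add: algebra_simps)
   qed
   have "abs (d 3 ta) <= (SUM a<n. (abs (v a)) * (SUM b<n. (abs (v b)) * (SUM c<n. (abs (v c)) * abs (F3 a b c (p ta)))))"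
    unfolding d_def
    by (auto simp: abs_mult intro!: sum_abs[THEN order.trans] sum_mono mult_left_mono)
   also have "... <= (SUM a<n. (abs (v a)) * (SUM b<n. (abs (v b)) * (SUM c<n. (abs (v c)) * D)))"
    using box D by (intro sum_mono mult_left_mono) auto
   also have "... = D * (SUM a<n. (abs (v a))) ^ 3"
    by (simp add: power3_eq_cube algebra_simps flip: sum_distrib_left sum_distrib_right)
   finally show ?thesis .
  qed
  moreover have "D * (SUM a<n. (abs (v a))) ^ 3 >= 0" using \<open>0 <= D\<close> by (simp add: sum_nonneg)
  ultimately show "abs (F z - F y - (SUM a<n. (z a - y a) * F1 a y)
    - (SUM a<n. SUM b<n. (z a - y a) * (z b - y b) * F2 a b y) / 2)
   <= D * (SUM a<n. (abs (z a - y a))) ^ 3" by (simp add: v_def)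
 qed
qed

text \<open>The exponentials are factors of the rows and leave the determinant as
  \<open>exp (- lam * b * sum)\<close>. What remains is a polynomial in the points and the three
  parameters that vanishes whenever two points coincide, hence is divisible by the Vandermonde
  product.\<close>

lemma besq_quotient:
 "EX S. polyfun (N + 3) S & (ALL y. vdm N y * (exp (- lam * y N * (SUM j<N. y j)) * S y) =
   alternant N (%j k. besq_fun nu lam (q k) (y N) (y (Suc N)) (y (Suc (Suc N))) (y j)))"
proof -
 define A where "A = (%y::nat => real. alternant N (%j k. y (Suc (Suc N)) * poly (besq_heat nu (y (Suc N)) (q k)) ((y N)^2 * y j)))"
 have "polyfun (N + 3) A"
  unfolding A_def alternant_def
  by (intro polyfun_sum polyfun_mult polyfun_prod polyfun_const polyfun_var polyfun_power polyfun_poly_besq_heat) auto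
 moreover have "A y = 0" if "j < k" "k < N" "y j = y k" for y j k
  unfolding A_def using that by (intro alternant_identical_rows[of j N k]) auto
 ultimately obtain S where S: "polyfun (N + 3) S" "!!y. A y = (PROD (j, k):{(j, k). j < k & k < N}. y k - y j) * S y"
  using polyfun_divide_differences[of "N + 3" A N "{(j, k). j < k & k < N}"] finite_pairs[of N] by auto
 have "vdm N y * (exp (- lam * y N * (SUM j<N. y j)) * S y) =
   alternant N (%j k. besq_fun nu lam (q k) (y N) (y (Suc N)) (y (Suc (Suc N))) (y j))" for y
 proof -
  have "alternant N (%j k. besq_fun nu lam (q k) (y N) (y (Suc N)) (y (Suc (Suc N))) (y j)) =
    alternant N (%j k. exp (- lam * y N * y j) * (y (Suc (Suc N)) * poly (besq_heat nu (y (Suc N)) (q k)) ((y N)^2 * y j)))"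
   by (intro alternant_cong) (simp add: besq_fun_def algebra_simps)
  also have "... = (PROD j<N. exp (- lam * y N * y j)) * A y"
   unfolding A_def by (rule alternant_scale_rows)
  also have "(PROD j<N. exp (- lam * y N * y j)) = exp (- lam * y N * (SUM j<N. y j))"
   by (simp add: sum_distrib_left exp_sum)
  finally show ?thesis unfolding S(2) vdm_def by (simp add: algebra_simps)
 qed
 with S(1) show ?thesis by blast
qed

text \<open>The lower bound \<open>b0\<close> for \<open>y N\<close> gives the decay rate
  \<open>lam * b0\<close>, which beats every power of the sum of the points. The extra factor
  \<open>1 + sum\<close> on the left is there to dominate the diffusion coefficient
  \<open>2 * sqrt (y a)\<close>.\<close>

lemma exp_polyfun_bounded:
 assumes "polyfun (N + 3) S" "lam > 0" "b0 > 0" "B >= 0"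
 shows "EX C. ALL y. (ALL j<N. 0 <= y j) --> b0 <= y N --> y N <= B --> abs (y (Suc N)) <= B --> abs (y (Suc (Suc N))) <= B -->
  (1 + (SUM j<N. y j)) * abs (exp (- lam * y N * (SUM j<N. y j)) * S y) <= C"
proof -
 obtain D K where D: "D >= 0" "!!y. (abs (S y)) <= D * (1 + (SUM i<N + 3. abs (y i))) ^ K"
  using polyfun_growth[OF assms(1)] by metis
 obtain C where C: "!!z. z >= 0 ==> (1 + 3 * B + z) ^ Suc K * exp (- (lam * b0) * z) <= C"
  using power_exp_bounded[of "lam * b0" "1 + 3 * B" "Suc K"] assms by auto
 have "(1 + (SUM j<N. y j)) * abs (exp (- lam * y N * (SUM j<N. y j)) * S y) <= D * C"
  if y: "ALL j<N. 0 <= y j" "b0 <= y N" "y N <= B" "abs (y (Suc N)) <= B" "abs (y (Suc (Suc N))) <= B" for y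
 proof -
  define z where "z = (SUM j<N. y j)"
  have z: "z >= 0" unfolding z_def using y by (intro sum_nonneg) auto
  have "(SUM i<N + 3. abs (y i)) = z + abs (y N) + abs (y (Suc N)) + abs (y (Suc (Suc N)))"
   using y by (simp add: numeral_3_eq_3 z_def)
  then have le: "1 + (SUM i<N + 3. abs (y i)) <= 1 + 3 * B + z" using y assms by auto
  have S: "abs (S y) <= D * (1 + 3 * B + z) ^ K"
   using le D by (intro order.trans[OF D(2)] mult_left_mono power_mono) (auto simp: add_nonneg_nonneg sum_nonneg)
  have e: "exp (- lam * y N * z) <= exp (- (lam * b0) * z)"
   using y assms z by (simp add: mult_right_mono)
  have "(1 + z) * (exp (- lam * y N * z) * abs (S y)) <=
    (1 + 3 * B + z) * (exp (- (lam * b0) * z) * (D * (1 + 3 * B + z) ^ K))"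
   using S e z assms by (intro mult_mono) auto
  also have "... = D * ((1 + 3 * B + z) ^ Suc K * exp (- (lam * b0) * z))" by simp
  also have "... <= D * C" using C[OF z] D by (intro mult_left_mono) auto
  finally show ?thesis by (simp add: z_def abs_mult)
 qed
 then show ?thesis by blast
qed

lemma (in prob_space) orthogonal_sum_square:
 fixes xi :: "nat => 'a => real"
 assumes fin: "finite J" and diag: "!!i. i : J ==> integrable M (%w. (xi i w)\<^sup>2)"
  and off: "!!i j. i : J ==> j : J ==> i < j ==> integrable M (%w. xi i w * xi j w) & expectation (%w. xi i w * xi j w) = 0"
 shows "integrable M (%w. (SUM i:J. xi i w)\<^sup>2)"
  and "expectation (%w. (SUM i:J. xi i w)\<^sup>2) = (SUM i:J. expectation (%w. (xi i w)\<^sup>2))"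
proof -
 let ?c = "%i j w. xi i w * xi j w"
 let ?B = "%i. %w. (xi i w)\<^sup>2"
 have c: "integrable M (?c i j) & expectation (?c i j) = (if i = j then expectation (?B i) else 0)"
  if ij: "i : J" "j : J" for i j
 proof (cases i j rule: linorder_cases)
  case less
  then show ?thesis using off[OF ij] by simp
 next
  case equal
  then show ?thesis using diag[OF ij(1)] by (simp add: power2_eq_square)
 next
  case greater
  then show ?thesis using off[OF ij(2,1)] by (simp add: mult.commute)
 qed
 let ?A = "%J. %w. (SUM i:J. xi i w)\<^sup>2"
 have eq: "(?A J) = (%w. SUM i:J. SUM j:J. ?c i j w)"
  by (simp only: power2_eq_square sum_product)
 show "integrable M (?A J)"
  unfolding eq using c by (intro integrable_sum) auto
 have "expectation (?A J) = (SUM i:J. expectation (%w. SUM j:J. ?c i j w))"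
  unfolding eq using c by (intro integral_sum integrable_sum) auto
 also have "... = (SUM i:J. SUM j:J. expectation (?c i j))"
  using c by (intro sum.cong refl integral_sum) auto
 also have "... = (SUM i:J. SUM j:J. if i = j then expectation (?B i) else 0)"
  using c by (intro sum.cong) auto
 also have "... = (SUM i:J. expectation (?B i))"
  using fin by (intro sum.cong refl) (simp only: sum.delta' if_True)
 finally show "expectation (?A J) = (SUM i:J. expectation (?B i))" .
qed

section \<open>Elementary stochastic integrals\<close>

locale brownian = prob_space M for M :: "'a measure" +
 fixes \<F> :: "real => 'a measure" and B :: "real => 'a => real"
 assumes bm: "brownian_motion_wrt M \<F> B"
begin

lemma space_F [simp]: "space (\<F> s) = space M"
 using bm by (auto simp: brownian_motion_wrt_def filtration_on_def subalgebra_def)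

lemma measurable_F_mono: "s <= t ==> f : bmeas (\<F> s) ==> f : bmeas (\<F> t)"
 using bm filtration.sets_F_mono[of "space M" \<F> s t]
 by (intro measurable_from_subalg[of "\<F> t" "\<F> s"])
  (auto simp: brownian_motion_wrt_def filtration_on_def subalgebra_def)

lemma measurable_F_M: "f : bmeas (\<F> s) ==> f : bmeas M"
 using bm unfolding brownian_motion_wrt_def filtration_on_def
 by (auto intro: measurable_from_subalg)

lemma B_measurable_F: "0 <= s ==> s <= t ==> B s : bmeas (\<F> t)"
 using bm unfolding brownian_motion_wrt_def continuous_adapted_def
 by (auto intro: measurable_F_mono)

lemma B_measurable [measurable]: "0 <= s ==> B s : bmeas M"
 by (blast intro: measurable_F_M B_measurable_F)

lemma indep_increment:
 assumes "0 <= s" "s < t" "Y : bmeas (\<F> s)" "f : bmeas borel"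
 shows "indep_var borel Y borel (%w. f (B t w - B s w) :: real)"
proof -
 let ?D = "%w. B t w - B s w"
 have ind: "indep_set (sets (\<F> s)) (sets (vimage_algebra (space M) ?D borel))"
  using bm assms by (simp add: brownian_motion_wrt_def)
 have YM: "Y : bmeas M" using assms(3) by (rule measurable_F_M)
 have D: "?D : bmeas M"
  using assms by (intro borel_measurable_diff B_measurable) auto
 have "{Y -` A \<inter> space M |A. A : sets borel} \<subseteq> sets (\<F> s)"
  using measurable_sets[OF assms(3)] by auto
 moreover have "sigma_algebra (space M) (sets (\<F> s))"
  using sets.sigma_algebra_axioms[of "\<F> s"] by simp
 ultimately have 1: "sigma_sets (space M) {Y -` A \<inter> space M |A. A : sets borel} \<subseteq> sets (\<F> s)"
  by (intro sigma_algebra.sigma_sets_subset)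
 have 2: "sigma_sets (space M) {(%w. f (?D w)) -` A \<inter> space M |A. A : sets borel}
   \<subseteq> sets (vimage_algebra (space M) ?D borel)"
 proof (intro sigma_algebra.sigma_sets_subset)
  show "sigma_algebra (space M) (sets (vimage_algebra (space M) ?D borel))"
   using sets.sigma_algebra_axioms[of "vimage_algebra (space M) ?D borel"] by simp
  show "{(%w. f (?D w)) -` A \<inter> space M |A. A : sets borel} \<subseteq> sets (vimage_algebra (space M) ?D borel)"
  proof safe
   fix A :: "real set" assume A: "A : sets borel"
   then have "f -` A \<inter> space borel : sets borel" using assms(4) by (rule measurable_sets[rotated])
   then have "?D -` (f -` A) \<inter> space M : sets (vimage_algebra (space M) ?D borel)"
    by (intro in_vimage_algebra) simp
   then show "(%w. f (?D w)) -` A \<inter> space M : sets (vimage_algebra (space M) ?D borel)"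
    by (simp add: vimage_def)
  qed
 qed
 have "indep_set (sigma_sets (space M) {Y -` A \<inter> space M |A. A : sets borel})
   (sigma_sets (space M) {(%w. f (?D w)) -` A \<inter> space M |A. A : sets borel})"
  using ind 1 2 unfolding indep_set_def
  by (elim indep_sets_mono_sets) (auto split: bool.splits)
 then show ?thesis
  unfolding indep_var_eq using YM D assms(4) by auto
qed

lemma increment_mult:
 assumes "0 <= s" "s < t" "Y : bmeas (\<F> s)" "f : bmeas borel"
  and "integrable M Y" "integrable M (%w. f (B t w - B s w) :: real)"
 shows "integrable M (%w. Y w * f (B t w - B s w))"
  and "expectation (%w. Y w * f (B t w - B s w)) = expectation Y * expectation (%w. f (B t w - B s w))"
 using indep_var_lebesgue_integral indep_var_integrable indep_increment assms by blast+

lemma increment_moments: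
 assumes "0 <= s" "s <= t"
 shows "integrable M (%w. (B t w - B s w) ^ k)"
  and "expectation (%w. B t w - B s w) = 0"
  and "expectation (%w. (B t w - B s w)\<^sup>2) = t - s"
  and "expectation (%w. (B t w - B s w) ^ 4) = 3 * (t - s)^2"
proof -
 \<comment> \<open>A Brownian motion is required to have normal increments for \<open>s < t\<close>;
   a vanishing increment is treated apart.\<close>
 consider "s = t" | "s < t" using assms by linarith
 then have "integrable M (%w. (B t w - B s w) ^ k) & expectation (%w. B t w - B s w) = 0 &
   expectation (%w. (B t w - B s w)\<^sup>2) = t - s & expectation (%w. (B t w - B s w) ^ 4) = 3 * (t - s)^2"
 proof cases
  case 2
  let ?D = "%w. B t w - B s w" and ?sg = "sqrt (t - s)"
  have D: "distributed M lborel ?D (normal_density 0 ?sg)"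
   using bm assms 2 by (simp add: brownian_motion_wrt_def)
  have sg: "0 < ?sg" using 2 by simp
  have i: "integrable M (%w. ?D w ^ k)" for k
   using distributed_integrable[OF D, of "%x. x ^ k"] integrable_normal_moment[of ?sg 0 k] sg by simp
  have e: "expectation (%w. ?D w ^ k) = (\<integral>x. normal_density 0 ?sg x * x ^ k \<partial>lborel)" for k
   using distributed_integral[OF D, of "%x. x ^ k"] by simp
  have "expectation (%w. ?D w ^ 1) = 0"
   unfolding e using integral_normal_moment_odd[OF sg, of 0 0] by simp
  moreover have "expectation (%w. ?D w ^ 2) = t - s"
   unfolding e using integral_normal_moment_even[OF sg, of 0 1] 2 by (simp add: fact_numeral)
  moreover have "expectation (%w. ?D w ^ 4) = 3 * (t - s)^2"
   unfolding e using integral_normal_moment_even[OF sg, of 0 2] 2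
   by (simp add: fact_numeral power_divide power2_eq_square)
  ultimately show ?thesis using i[of k] by simp
 qed (auto simp: power_0_left)
 then show "integrable M (%w. (B t w - B s w) ^ k)" "expectation (%w. B t w - B s w) = 0"
  "expectation (%w. (B t w - B s w)\<^sup>2) = t - s" "expectation (%w. (B t w - B s w) ^ 4) = 3 * (t - s)^2"
  by auto
qed

lemma increment_mult_power:
 assumes "0 <= s" "s <= t" "Y : bmeas (\<F> s)" "integrable M Y"
 shows "integrable M (%w. Y w * (B t w - B s w) ^ k)"
  and "expectation (%w. Y w * (B t w - B s w)) = 0"
  and "expectation (%w. Y w * (B t w - B s w)^2) = expectation Y * (t - s)"
proof -
 have "integrable M (%w. Y w * (B t w - B s w) ^ k)" and
  e: "expectation (%w. Y w * (B t w - B s w) ^ k) = expectation Y * expectation (%w. (B t w - B s w) ^ k)"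
  for k
 proof (atomize(full), cases "s = t")
  case True
  then show "integrable M (%w. Y w * (B t w - B s w) ^ k) &
   expectation (%w. Y w * (B t w - B s w) ^ k) = expectation Y * expectation (%w. (B t w - B s w) ^ k)"
   using assms by (cases k) (auto simp: prob_space)
 next
  case False
  then show "integrable M (%w. Y w * (B t w - B s w) ^ k) &
   expectation (%w. Y w * (B t w - B s w) ^ k) = expectation Y * expectation (%w. (B t w - B s w) ^ k)"
   using assms increment_mult[of s t Y "%x. x ^ k"] increment_moments(1)[of s t k] by simp
 qed
 then show "integrable M (%w. Y w * (B t w - B s w) ^ k)"
  "expectation (%w. Y w * (B t w - B s w)) = 0"
  "expectation (%w. Y w * (B t w - B s w)^2) = expectation Y * (t - s)"
  using e[of 1] e[of 2] increment_moments[of s t] assms by auto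
qed

end

locale elementary_integrand = brownian +
 fixes m :: nat and g :: "nat => real" and a :: "nat => 'a => real"
 assumes g_nonneg: "0 <= g 0" and g_mono: "!!i. i < m ==> g i <= g (Suc i)"
  and a_meas: "!!i. i < m ==> a i : bmeas (\<F> (g i))"
begin

lemma g_le: "i <= j ==> j <= m ==> g i <= g j"
 by (induction j) (auto simp: le_Suc_eq intro: order.trans[OF _ g_mono])

lemma g_ge_0: "i <= m ==> 0 <= g i"
 using g_le[of 0 i] g_nonneg by simp

definition dB :: "nat => 'a => real" where
 "dB i w = B (g (Suc i)) w - B (g i) w"

definition dg :: "nat => real" where
 "dg i = g (Suc i) - g i"

lemma dg_nonneg: "i < m ==> 0 <= dg i"
 using g_mono by (simp add: dg_def)

lemma dB_measurable_F: "i < m ==> g (Suc i) <= t ==> dB i : bmeas (\<F> t)"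
 unfolding dB_def using g_le[of i "Suc i"] g_ge_0[of i] g_ge_0[of "Suc i"]
 by (intro borel_measurable_diff B_measurable_F) auto

lemma dB_measurable [measurable]: "i < m ==> dB i : bmeas M"
 by (blast intro: measurable_F_M dB_measurable_F)

lemma a_measurable [measurable]: "i < m ==> a i : bmeas M"
 by (blast intro: measurable_F_M a_meas)

lemma dB_mult_power:
 assumes "i < m" "Y : bmeas (\<F> (g i))" "integrable M Y"
 shows "integrable M (%w. Y w * dB i w ^ k)" "expectation (%w. Y w * dB i w) = 0"
  "expectation (%w. Y w * (dB i w)^2) = expectation Y * dg i"
 using increment_mult_power[of "g i" "g (Suc i)" Y] assms g_ge_0[of i] g_mono[of i]
 by (auto simp: dB_def dg_def)

lemma bounded_integral_expectation:
 assumes bd: "!!i w. i < m ==> w : space M ==> abs (a i w) <= K i"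
  and J: "J \<subseteq> {..<m}"
  and G: "G : bmeas (\<F> (g 0))" "!!w. w : space M ==> abs (G w) <= L"
 shows "integrable M (%w. G w * (SUM i:J. a i w * dB i w))"
  and "expectation (%w. G w * (SUM i:J. a i w * dB i w)) = 0"
proof -
 have 1: "integrable M (%w. (G w * a i w) * dB i w ^ 1) & expectation (%w. (G w * a i w) * dB i w) = 0"
  if i: "i < m" for i
 proof -
  have F: "(%w. G w * a i w) : bmeas (\<F> (g i))"
   using G(1) i a_meas[OF i] g_le[of 0 i] by (intro borel_measurable_times) (auto intro: measurable_F_mono)
  have "integrable M (%w. G w * a i w)"
  using G(2) F by (fastforce simp: real_norm_def abs_mult intro: AE_I2 mult_mono bd i G integrable_const_bound measurable_F_M)
  then show ?thesis using dB_mult_power(1)[OF i F, of 1] dB_mult_power(2)[OF i F] by blast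
 qed
 have eq: "(%w. G w * (SUM i:J. a i w * dB i w)) = (%w. SUM i:J. (G w * a i w) * dB i w)"
  by (simp add: sum_distrib_left mult.assoc)
 show "integrable M (%w. G w * (SUM i:J. a i w * dB i w))"
  unfolding eq using 1 J by (intro integrable_sum) auto
 show "expectation (%w. G w * (SUM i:J. a i w * dB i w)) = 0"
  unfolding eq using 1 J by (subst integral_sum) (auto intro!: sum.neutral)
qed

text \<open>For \<open>i < j\<close> the product \<open>a i * dB i * a j\<close> is known at time
  \<open>g j\<close>, and \<open>dB j\<close> is independent of that past with mean 0. Hence the
  summands are orthogonal in L2.\<close>

lemma bounded_integral_isometry:
 assumes bd: "!!i w. i < m ==> w : space M ==> abs (a i w) <= K i"
  and J: "J \<subseteq> {..<m}"
 shows "integrable M (%w. (SUM i:J. a i w * dB i w)\<^sup>2)"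
  and "expectation (%w. (SUM i:J. a i w * dB i w)\<^sup>2) = (SUM i:J. expectation (%w. (a i w)\<^sup>2) * dg i)"
proof -
 have fin: "finite J" using J finite_subset by auto
 let ?c = "%i j w. (a i w * dB i w) * (a j w * dB j w)"
 have diag: "integrable M (?c i i) & expectation (?c i i) = expectation (%w. (a i w)\<^sup>2) * dg i" if i: "i < m" for i
 proof -
  have F: "(%w. (a i w)\<^sup>2) : bmeas (\<F> (g i))" using a_meas[OF i] by measurable
  have "(a i w)^2 <= (K i)^2" if "w : space M" for w
   using power_mono[OF bd[OF i that] abs_ge_zero, of 2] by simp
  then have "integrable M (%w. (a i w)\<^sup>2)"
   using measurable_F_M[OF F]
   by (intro integrable_const_bound[where B = "(K i)^2"]) (auto intro!: AE_I2)
  note * = dB_mult_power(1)[OF i F this, of 2] dB_mult_power(3)[OF i F this]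
  have "?c i i = (%w. (a i w)\<^sup>2 * (dB i w)^2)" by (auto simp: power2_eq_square)
  then show ?thesis using * by simp
 qed
 have off: "integrable M (?c i j) & expectation (?c i j) = 0" if ij: "i < j" "j < m" for i j
 proof -
  have i: "i < m" using ij by simp
  have gi: "g (Suc i) <= g j" "g i <= g j" using g_le[of "Suc i" j] g_le[of i j] ij by auto
  have F: "(%w. a i w * dB i w * a j w) : bmeas (\<F> (g j))"
   by (intro borel_measurable_times measurable_F_mono[OF gi(2) a_meas[OF i]] a_meas[OF ij(2)]
     dB_measurable_F[OF i gi(1)])
  have "integrable M (%w. a i w * a j w * dB i w ^ 1)"
  proof -
   have "integrable M (%w. dB i w ^ 1)" using dB_mult_power(1)[OF i borel_measurable_const integrable_const, of 1 1] by (simp)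
   then have "integrable M (%w. K i * K j * dB i w ^ 1)"
    by (rule integrable_mult_right)
   then show ?thesis
   proof (rule integrable_bound)
    show "AE w in M. norm (a i w * a j w * dB i w ^ 1) <= norm (K i * K j * dB i w ^ 1)"
    proof (intro AE_I2)
     fix w assume w: "w : space M"
     have "abs (a i w) * abs (a j w) <= abs (K i) * abs (K j)"
      using bd[OF i w] bd[OF ij(2) w] by (intro mult_mono) auto
     then show "norm (a i w * a j w * dB i w ^ 1) <= norm (K i * K j * dB i w ^ 1)"
      by (simp add: abs_mult mult_right_mono)
    qed
    show "(%w. a i w * a j w * dB i w ^ 1) : bmeas M"
     using a_measurable[OF i] a_measurable[OF ij(2)] dB_measurable[OF i] by simp
   qed
  qed
  then have "integrable M (%w. a i w * dB i w * a j w)" by (simp add: ac_simps)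
  from dB_mult_power(1)[OF ij(2) F this, of 1] dB_mult_power(2)[OF ij(2) F this]
  show ?thesis by (simp add: ac_simps)
 qed
 have d: "integrable M (%w. (a i w * dB i w)\<^sup>2)" "expectation (%w. (a i w * dB i w)\<^sup>2) = expectation (%w. (a i w)\<^sup>2) * dg i"
  if "i : J" for i using diag[of i] that J by (auto simp: power2_eq_square)
 have off': "integrable M (?c i j) & expectation (?c i j) = 0" if "i : J" "j : J" "i < j" for i j
  using off[of i j] that J by auto
 note o = orthogonal_sum_square[where xi = "%i w. a i w * dB i w", OF fin d(1) off']
 show "integrable M (%w. (SUM i:J. a i w * dB i w)\<^sup>2)" by (rule o(1))
 show "expectation (%w. (SUM i:J. a i w * dB i w)\<^sup>2) = (SUM i:J. expectation (%w. (a i w)\<^sup>2) * dg i)"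
  by (rule trans[OF o(2) sum.cong[OF refl d(2)]])
qed

definition energy :: "nat => 'a => real" where
 "energy k w = (SUM i<k. (a i w)\<^sup>2 * dg i)"

text \<open>The integrand is switched off before its energy exceeds \<open>dl\<close>. As
  \<open>a i\<close> is known at \<open>g i\<close>, so is \<open>energy (Suc i)\<close>, and the
  truncation stays adapted although it looks at the energy up to the end of the cell. Cells of
  length 0 are dropped to obtain the bound \<open>sqrt (dl / dg i)\<close>; their increments of
  \<open>B\<close> are 0.\<close>

definition trunc :: "real => nat => 'a => real" where
 "trunc dl i w = (if energy (Suc i) w <= dl & 0 < dg i then a i w else 0)"

lemma energy_mono: "i <= j ==> j <= m ==> energy i w <= energy j w"
 unfolding energy_def by (intro sum_mono2) (auto simp: dg_nonneg)

lemma energy_measurable [measurable]: "k <= m ==> energy k : bmeas M"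
 unfolding energy_def by (intro borel_measurable_sum borel_measurable_times borel_measurable_power a_measurable) auto

lemma energy_measurable_F:
 assumes "i < m" shows "energy (Suc i) : bmeas (\<F> (g i))"
 unfolding energy_def
proof (intro borel_measurable_sum borel_measurable_times borel_measurable_power borel_measurable_const)
 fix j assume "j : {..<Suc i}"
 then show "a j : bmeas (\<F> (g i))"
  using a_meas[of j] g_le[of j i] assms measurable_F_mono by simp
qed

lemma trunc_energy:
 assumes "0 <= dl" "k <= m"
 shows "(SUM i<k. (trunc dl i w)\<^sup>2 * dg i) <= min dl (energy k w)"
 using assms(2)
proof (induction k)
 case 0
 then show ?case using assms by (simp add: energy_def)
next
 case (Suc k)
 have e: "energy (Suc k) w = energy k w + (a k w)^2 * dg k" by (simp add: energy_def)
 have n: "0 <= (a k w)^2 * dg k" using Suc.prems dg_nonneg[of k] by simp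
 show ?case
  using Suc e n by (auto simp: trunc_def)
qed

lemma trunc_bounded:
 assumes "0 <= dl" "i < m"
 shows "abs (trunc dl i w) <= (if 0 < dg i then sqrt (dl / dg i) else 0)"
proof (cases "energy (Suc i) w <= dl & 0 < dg i")
 case True
 have "(a i w)^2 * dg i <= energy (Suc i) w"
  unfolding energy_def using assms dg_nonneg by (auto intro!: sum_nonneg)
 then have "(a i w)^2 <= dl / dg i" using True by (simp add: field_simps)
 then have "sqrt ((a i w)^2) <= sqrt (dl / dg i)" by (rule real_sqrt_le_mono)
 then show ?thesis using True by (simp add: trunc_def)
qed (use assms in \<open>auto simp: trunc_def\<close>)

lemma trunc_elementary: "elementary_integrand M \<F> B m g (trunc dl)"
proof unfold_locales
 fix i assume i: "i < m"
 have "trunc dl i = (%w. if energy (Suc i) w <= dl & 0 < dg i then a i w else 0)"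
  by (simp add: trunc_def[abs_def])
 also have "... : bmeas (\<F> (g i))"
  using energy_measurable_F[OF i] a_meas[OF i] by measurable
 finally show "trunc dl i : bmeas (\<F> (g i))" .
qed (use g_nonneg g_mono in auto)

lemma trunc_eq:
 assumes "energy m w <= dl" "i < m"
 shows "trunc dl i w * dB i w = a i w * dB i w"
proof (cases "0 < dg i")
 case True
 then show ?thesis using energy_mono[of "Suc i" m w] assms by (simp add: trunc_def)
next
 case False
 then have "g (Suc i) = g i" using g_mono[OF assms(2)] by (simp add: dg_def)
 then show ?thesis by (simp add: dB_def)
qed

text \<open>A single block gives the square of a whole stochastic sum, singleton blocks give the sum
  of the squares of its terms. Both are bounded by the same energy.\<close>

definition block_square :: "'b set => ('b => nat set) => 'a => real" where
 "block_square I J w = (SUM b:I. (SUM i:J b. a i w * dB i w)\<^sup>2)"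

text \<open>An instance of Lenglart's inequality.\<close>

lemma block_square_tail:
 assumes I: "finite I" "!!b. b : I ==> J b \<subseteq> {..<m}" "disjoint_family_on J I"
  and dl: "0 <= dl" and eps: "0 < eps"
 shows "prob {w:space M. eps <= block_square I J w} <= prob {w:space M. dl < energy m w} + dl / eps"
proof -
 interpret t: elementary_integrand M \<F> B m g "trunc dl" by (rule trunc_elementary)

 define V where "V = (%w. SUM b:I. (SUM i:J b. trunc dl i w * dB i w)\<^sup>2)"
 note bd = trunc_bounded[OF dl]
 let ?A = "%dl i. %w. (trunc dl i w)\<^sup>2"
 have sq: "integrable M (?A dl i)" if i: "i < m" for i
 using power_mono[OF bd[OF i] abs_ge_zero, where n = 2] t.a_measurable[OF i] by (fastforce intro: AE_I2 integrable_const_bound)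
 have int: "integrable M (%w. (SUM i:J b. trunc dl i w * dB i w)\<^sup>2)" if "b : I" for b
  using t.bounded_integral_isometry(1)[OF bd, of "J b"] I(2)[OF that] by simp
 \<comment> \<open>The isometry is applied in each block. The blocks are disjoint, so that the total
   is at most the expected energy of the truncated integrand, which is at most
   \<open>dl\<close>.\<close>
 have "expectation V = (SUM b:I. expectation (%w. (SUM i:J b. trunc dl i w * dB i w)\<^sup>2))"
  unfolding V_def using int by (intro integral_sum) auto
 also have "... = (SUM b:I. SUM i:J b. expectation (?A dl i) * dg i)"
  using t.bounded_integral_isometry(2)[OF bd] I(2) by (intro sum.cong) auto
 also have "... = (SUM i:(\<Union>b\<in>I. J b). expectation (?A dl i) * dg i)"
  using I finite_subset[OF I(2)] by (intro sum.UNION_disjoint[symmetric]) (auto simp: disjoint_family_on_def)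
 also have "... <= (SUM i<m. expectation (?A dl i) * dg i)"
  using I(2) dg_nonneg by (intro sum_mono2) auto
 also have "... = expectation (%w. SUM i<m. (trunc dl i w)\<^sup>2 * dg i)"
  using sq by (subst integral_sum) auto
 also have "... <= expectation (%w. dl)"
  using sq trunc_energy[OF dl, of m]
  by (intro integral_mono integrable_sum) auto
 finally have E: "expectation V <= dl" by (simp add: prob_space)
 have V: "integrable M V" unfolding V_def using int by (rule integrable_sum)
 have V0: "0 <= V w" for w by (simp add: V_def sum_nonneg)
 have "prob {w:space M. eps <= V w} <= expectation V / eps"
  using V V0 eps by (intro integral_Markov_inequality_measure[where A = "{}"]) auto
 also have "... <= dl / eps" using E eps by (simp add: divide_right_mono)
 finally have mk: "prob {w:space M. eps <= V w} <= dl / eps" .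
 \<comment> \<open>As long as the total energy is at most \<open>dl\<close>, the truncation changes
   nothing; the exceptional event is the first term of the bound.\<close>
 have eqV: "block_square I J w = V w" if "energy m w <= dl" for w
  unfolding block_square_def V_def using I(2) trunc_eq[OF that] by (intro sum.cong refl arg_cong[where f = "%x. x\<^sup>2"]) force
 have sets: "{w:space M. dl < energy m w} : sets M" "{w:space M. eps <= V w} : sets M"
  using energy_measurable[of m] V by measurable
 have "{w:space M. eps <= block_square I J w} \<subseteq> {w:space M. dl < energy m w} \<union> {w:space M. eps <= V w}"
  using eqV not_le by fastforce
 then have "prob {w:space M. eps <= block_square I J w} <= prob ({w:space M. dl < energy m w} \<union> {w:space M. eps <= V w})"
  using sets by (intro finite_measure_mono) auto
 also have "... <= prob {w:space M. dl < energy m w} + prob {w:space M. eps <= V w}"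
  using sets by (rule measure_Un_le)
 finally show ?thesis using mk by linarith
qed

end

text \<open>Convergence to 0 in probability, including measurability. Values in
  \<open>ennreal\<close> admit time integrals of squares that may be infinite with positive
  probability.\<close>

definition prob0 :: "'a measure => (nat => 'a => ennreal) => bool" where
 "prob0 M X \<longleftrightarrow> (ALL k. X k : bmeas M) &
   (ALL eps>0. (%k. measure M {w:space M. ennreal eps <= X k w}) ~> 0)"

context prob_space
begin

lemma prob0I:
 assumes "!!k. X k : bmeas M"
  and "!!eps eta. eps > 0 ==> eta > 0 ==> EV k. prob {w:space M. ennreal eps <= X k w} <= eta"
 shows "prob0 M X"
 unfolding prob0_def
proof (intro conjI allI impI assms(1))
 fix eps :: real assume "eps > 0"
 show "(%k. prob {w:space M. ennreal eps <= X k w}) ~> 0"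
 proof (rule tendstoI)
  fix e :: real assume "e > 0"
  with assms(2)[OF \<open>eps > 0\<close>, of "e / 2"]
  show "EV k. dist (prob {w:space M. ennreal eps <= X k w}) 0 < e"
   by (auto elim!: eventually_mono)
 qed
qed

lemma prob0D:
 assumes "prob0 M X" "eps > 0" "eta > 0"
 shows "EV k. prob {w:space M. ennreal eps <= X k w} < eta"
 using assms order_tendstoD(2) unfolding prob0_def by blast

lemma prob0_measurable: "prob0 M X ==> X k : bmeas M"
 by (simp add: prob0_def)

lemma prob0_subset:
 assumes X: "!!k. X k : bmeas M" and YZ: "prob0 M Y" "prob0 M Z"
  and sub: "!!eps. eps > 0 ==> EX dl>0. ALL k. ALL w:space M. ennreal eps <= X k w --> ennreal dl <= Y k w | ennreal dl <= Z k w"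
 shows "prob0 M X"
proof (rule prob0I[OF X])
 fix eps eta :: real assume e: "eps > 0" "eta > 0"
 from sub[OF e(1)] obtain dl where dl: "dl > 0"
  "!!k w. w : space M ==> ennreal eps <= X k w ==> ennreal dl <= Y k w | ennreal dl <= Z k w" by blast
 have "eta / 2 > 0" using e by simp
 from prob0D[OF YZ(1) dl(1) this] prob0D[OF YZ(2) dl(1) this]
 show "EV k. prob {w:space M. ennreal eps <= X k w} <= eta"
 proof eventually_elim
  case (elim k)
  have s: "{w:space M. ennreal dl <= Y k w} : sets M" "{w:space M. ennreal dl <= Z k w} : sets M"
   using prob0_measurable[OF YZ(1), of k] prob0_measurable[OF YZ(2), of k] by measurable
  have "prob {w:space M. ennreal eps <= X k w} <=
    prob ({w:space M. ennreal dl <= Y k w} \<union> {w:space M. ennreal dl <= Z k w})"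
   using s dl(2) by (intro finite_measure_mono) auto
  also have "... <= prob {w:space M. ennreal dl <= Y k w} + prob {w:space M. ennreal dl <= Z k w}"
   using s by (rule measure_Un_le)
  finally show ?case using elim by linarith
 qed
qed

lemma ennreal_half_le:
 fixes y z :: ennreal
 assumes "ennreal eps <= y + z" "eps > 0"
 shows "ennreal (eps / 2) <= y | ennreal (eps / 2) <= z"
proof (rule ccontr)
 assume "\<not> ?thesis"
 then have "y < ennreal (eps / 2)" "z < ennreal (eps / 2)" by auto
 then have "y + z < ennreal (eps / 2) + ennreal (eps / 2)" by (rule add_strict_mono)
 also have "... = ennreal eps" using assms(2) by (simp flip: ennreal_plus)
 finally show False using assms(1) by simp
qed

lemma prob0_add: "prob0 M X ==> prob0 M Y ==> prob0 M (%k w. X k w + Y k w)"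
proof (rule prob0_subset[of _ X Y])
 assume "prob0 M X" "prob0 M Y"
 then show "(%w. X k w + Y k w) : bmeas M" for k
  using prob0_measurable by (intro borel_measurable_add) auto
 fix eps :: real assume "eps > 0"
 then show "EX dl>0. ALL k. ALL w:space M. ennreal eps <= X k w + Y k w --> ennreal dl <= X k w | ennreal dl <= Y k w"
  using ennreal_half_le by (intro exI[of _ "eps / 2"]) auto
qed

lemma prob0_0: "prob0 M (%_ _. 0)"
by (auto simp: measure_empty intro!: prob0I)

lemma prob0_sum: "(!!i. i : I ==> prob0 M (X i)) ==> prob0 M (%k w. SUM i:I. X i k w)"
 by (induction I rule: infinite_finite_induct) (auto intro: prob0_0 prob0_add)

lemma prob0_le:
 assumes "prob0 M Y" "!!k. X k : bmeas M" "!!k w. w : space M ==> X k w <= Y k w"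
 shows "prob0 M X"
 by (rule prob0_subset[OF assms(2,1,1)]) (use assms(3) order.trans in blast)

lemma prob_large_tendsto_0:
 assumes "ta : bmeas M"
 shows "(%n. prob {w:space M. real n < ta w}) ~> 0"
proof -
 have "(%n. prob {w:space M. real n < ta w}) ~> prob (\<Inter>n. {w:space M. real n < ta w})"
  using assms by (intro finite_Lim_measure_decseq) (auto simp: decseq_def)
 moreover have "(\<Inter>n. {w:space M. real n < ta w}) = {}"
  using reals_Archimedean2 not_less_iff_gr_or_eq by fastforce
 ultimately show ?thesis by simp
qed

text \<open>The random factor is below some \<open>n\<close> outside an event of small probability,
  and there it acts as a constant.\<close>

lemma prob0_mult:
 assumes "prob0 M X" and ta: "ta : bmeas M"
 shows "prob0 M (%k w. ennreal (ta w) * X k w)"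
proof (rule prob0I)
 show "(%w. ennreal (ta w) * X k w) : bmeas M" for k
  using ta prob0_measurable[OF assms(1), of k] by measurable
 fix eps eta :: real assume e: "eps > 0" "eta > 0"
 then have "\<forall>\<^sub>F n in sequentially. prob {w:space M. real n < ta w} < eta / 2"
  by (intro order_tendstoD(2)[OF prob_large_tendsto_0[OF ta]]) auto
 then obtain n where n: "prob {w:space M. real n < ta w} < eta / 2"
  by (auto simp: eventually_sequentially)
 define c where "c = real n + 1"
 have c: "c > 0" by (simp add: c_def)
 have "eps / c > 0" "eta / 2 > 0" using e c by auto
 from prob0D[OF assms(1) this]
 show "EV k. prob {w:space M. ennreal eps <= ennreal (ta w) * X k w} <= eta"
 proof eventually_elim
  case (elim k)
  have s: "{w:space M. real n < ta w} : sets M" "{w:space M. ennreal (eps / c) <= X k w} : sets M"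
   using ta prob0_measurable[OF assms(1), of k] by measurable
  have "ennreal (eps / c) <= X k w"
   if "ennreal eps <= ennreal (ta w) * X k w" "ta w <= real n" for w
  proof -
   have "ennreal eps <= ennreal c * X k w"
    using that by (intro order.trans[OF that(1)] mult_right_mono ennreal_leI) (auto simp: c_def)
   then have "ennreal eps / ennreal c <= X k w"
    using c by (intro divide_le_posI_ennreal) (auto simp: mult.commute)
   then show ?thesis using e c by (simp add: divide_ennreal)
  qed
  then have "prob {w:space M. ennreal eps <= ennreal (ta w) * X k w} <=
    prob ({w:space M. real n < ta w} \<union> {w:space M. ennreal (eps / c) <= X k w})"
   using s by (intro finite_measure_mono) (auto simp: not_less[symmetric])
  also have "... <= prob {w:space M. real n < ta w} + prob {w:space M. ennreal (eps / c) <= X k w}"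
   using s by (rule measure_Un_le)
  finally show ?case using elim n by linarith
 qed
qed

lemma prob0_square:
 assumes "prob0 M (%k w. ennreal (abs (X k w)))"
 shows "prob0 M (%k w. ennreal ((X k w)^2))"
proof (rule prob0_subset[OF _ assms assms])
 have "(%w. ennreal (enn2real (ennreal (abs (X k w))) ^ 2)) : bmeas M" for k
  using prob0_measurable[OF assms, of k] by measurable
 then show "(%w. ennreal ((X k w)^2)) : bmeas M" for k by simp
 fix eps :: real assume "eps > 0"
 have "sqrt eps <= abs x" if "eps <= x^2" for x using real_sqrt_le_mono[OF that] by simp
 then show "EX dl>0. ALL k. ALL w:space M. ennreal eps <= ennreal ((X k w)^2) -->
   ennreal dl <= ennreal (abs (X k w)) | ennreal dl <= ennreal (abs (X k w))"
  using \<open>eps > 0\<close> by (intro exI[of _ "sqrt eps"]) (auto simp: ennreal_le_iff)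
qed

lemma AE_prob0:
 assumes X: "!!k. X k : bmeas M" and ae: "AE w in M. (%k. X k w) ~> 0"
 shows "prob0 M X"
 unfolding prob0_def
proof (intro conjI allI impI X)
 fix eps :: real assume e: "eps > 0"
 let ?A = "%k. {w:space M. ennreal eps <= X k w}"
 have s: "?A k : sets M" for k using X[of k] by measurable
 have "(%k. \<integral>w. indicator (?A k) w \<partial>M) ~> (\<integral>w. 0 \<partial>M :: real)"
 proof (rule integral_dominated_convergence[where w = "%_. 1"])
  show "AE w in M. (%k. indicator (?A k) w :: real) ~> 0"
   using ae
  proof eventually_elim
   case (elim w)
   then have "EV k. X k w < ennreal eps"
    using e by (intro order_tendstoD) auto
   then have "EV k. (indicator (?A k) w :: real) = 0"
    by eventually_elim (auto simp: indicator_def)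
   then show ?case by (rule tendsto_eventually)
  qed
 qed (use s in \<open>auto simp: indicator_def\<close>)
 then show "(%k. prob (?A k)) ~> 0" using s by simp
qed

text \<open>Borel-Cantelli: along the subsequence the \<open>n\<close>-th term exceeds
  \<open>(1/2) ^ n\<close> with probability less than \<open>(1/2) ^ n\<close>.\<close>

lemma prob0_AE_subseq:
 assumes "prob0 M X"
 shows "EX r. strict_mono r & (AE w in M. (%k. X (r k) w) ~> 0)"
proof -
 let ?A = "%e k. {w:space M. ennreal e <= X k w}"
 have s: "?A e k : sets M" for e k using prob0_measurable[OF assms, of k] by measurable
 have "EX r. strict_mono r & (ALL n. prob (?A ((1/2) ^ n) (r n)) < (1/2) ^ n)"
 proof -
  have ev: "EX N. ALL k>=N. prob (?A ((1/2) ^ n) k) < (1/2) ^ n" for n :: nat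
   using prob0D[OF assms, of "(1/2) ^ n" "(1/2) ^ n"] by (simp add: eventually_sequentially)
  then obtain N where N: "!!n k. k >= N n ==> prob (?A ((1/2) ^ n) k) < (1/2) ^ n" by metis
  define r where "r = rec_nat (N 0) (%n x. max (Suc x) (N (Suc n)))"
  have "strict_mono r" unfolding strict_mono_Suc_iff by (simp add: r_def less_max_iff_disj)
  moreover have "N n <= r n" for n by (cases n) (auto simp: r_def)
  ultimately show ?thesis using N by blast
 qed
 then obtain r where r: "strict_mono r" "!!n. prob (?A ((1/2) ^ n) (r n)) < (1/2) ^ n" by blast
 have "AE w in M. \<forall>\<^sub>F n in sequentially. w : space M - ?A ((1/2) ^ n) (r n)"
 proof (rule borel_cantelli_AE1)
  have "summable (%n. (1/2::real) ^ n)" by (simp add: summable_geometric)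
  then show "summable (%n. prob (?A ((1/2) ^ n) (r n)))"
   by (rule summable_comparison_test'[where N = 0]) (use r(2) in \<open>simp add: less_imp_le\<close>)
 qed (use s in \<open>auto simp: emeasure_eq_measure\<close>)
 then have "AE w in M. (%k. X (r k) w) ~> 0"
 proof eventually_elim
  case (elim w)
  have "(%n. ennreal ((1/2) ^ n)) ~> ennreal 0"
   by (intro tendsto_ennrealI LIMSEQ_power_zero) auto
  then show ?case
   by (intro tendsto_sandwich[of "%_. 0" "%k. X (r k) w" _ "%n. ennreal ((1/2) ^ n)"])
    (use elim in \<open>auto elim!: eventually_mono\<close>)
 qed
 with r(1) show ?thesis by blast
qed

end

section \<open>Common refinements of partitions\<close>

locale grid =
 fixes G :: "real set" and m :: nat and g :: "nat => real"
 assumes g_strict: "!!i. i < m ==> g i < g (Suc i)" and g_image: "g ` {..m} = G"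
begin

lemma g_less: "i < j ==> j <= m ==> g i < g j"
proof (induction j)
 case (Suc j)
 then show ?case using g_strict[of j] by (cases "i = j") auto
qed simp

lemma g_less_iff: "i <= m ==> j <= m ==> g i < g j \<longleftrightarrow> i < j"
 using g_less[of i j] g_less[of j i] by (cases i j rule: linorder_cases) auto

lemma g_le_iff: "i <= m ==> j <= m ==> g i <= g j \<longleftrightarrow> i <= j"
 using g_less_iff[of j i] by (simp add: not_less[symmetric])

text \<open>No point of \<open>G\<close> lies strictly inside a cell of the enumeration
  \<open>g\<close>. Everything that jumps at points of \<open>G\<close> is therefore constant on the
  half-open cells.\<close>

lemma dichotomy:
 assumes "x : G" "l < m" shows "g (Suc l) <= x \<longleftrightarrow> g l < x"
using assms g_image by (auto simp: g_less_iff g_le_iff Suc_le_eq)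

definition cells :: "real => real => nat set" where
 "cells x y = {l. l < m & x <= g l & g (Suc l) <= y}"

lemma finite_cells [simp]: "finite (cells x y)"
 by (rule finite_subset[of _ "{..<m}"]) (auto simp: cells_def)

lemma telescope:
 fixes f :: "real => real"
 assumes "x : G" "y : G" "x <= y"
 shows "(SUM l:cells x y. f (g (Suc l)) - f (g l)) = f y - f x"
proof -
 obtain i j where ij: "i <= m" "x = g i" "j <= m" "y = g j" using assms g_image by auto
 have "cells x y = {i..<j}"
  using ij by (auto simp: cells_def g_le_iff Suc_le_eq)
 moreover have "i <= j" using assms ij by (simp add: g_le_iff)
 ultimately show ?thesis using ij sum_Suc_diff'[of i j "%l. f (g l)"] by simp
qed

text \<open>A sum over disjoint half-open cells inside \<open>{x..y}\<close> is the integral of a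
  step function that agrees with \<open>u\<close> on them and is 0 elsewhere.\<close>

lemma cells_square_sum_le:
 assumes "!!l s. l : cells x y ==> g l < s ==> s <= g (Suc l) ==> u s = v l"
 shows "ennreal (SUM l:cells x y. (v l)\<^sup>2 * (g (Suc l) - g l)) <= (L2 {x..y} (%s. u s))"
proof -
 let ?A = "%x y v s. SUM l:cells x y. ennreal ((v l)^2) * indicator {g l<..g (Suc l)} s"
 let ?B = "%x y v s. SUM i:cells x y. ennreal ((v i)^2) * indicator {g i<..g (Suc i)} s"
 have "ennreal (SUM l:cells x y. (v l)\<^sup>2 * (g (Suc l) - g l)) =
   (SUM l:cells x y. ennreal ((v l)^2) * emeasure lborel {g l<..g (Suc l)})"
  using g_strict by (subst sum_ennreal[symmetric]) (auto simp: cells_def ennreal_mult less_imp_le intro!: sum.cong)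
 also have "... = (\<integral>\<^sup>+s. (?A x y v s) \<partial>lborel)"
  by (subst nn_integral_sum) (auto simp: nn_integral_cmult_indicator)
 also have "... <= (L2 {x..y} (%s. u s))"
 proof (rule nn_integral_mono)
  fix s
  show "(?A x y v s) <= ennreal ((u s)^2) * indicator {x..y} s"
  proof (cases "EX l:cells x y. s : {g l<..g (Suc l)}")
   case True
   then obtain l where l: "l : cells x y" "g l < s" "s <= g (Suc l)" by auto
   have "indicator {g i<..g (Suc i)} s = (0::ennreal)" if "i : cells x y" "i ~= l" for i
   proof (rule ccontr)
    assume "indicator {g i<..g (Suc i)} s ~= (0::ennreal)"
    then have "g i < g (Suc l)" "g l < g (Suc i)" using l by (auto simp: indicator_def split: if_splits)
    then show False using that l by (auto simp: cells_def g_less_iff)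
   qed
   then have "(?B x y v s) =
     (SUM i:{l}. ennreal ((v i)^2) * indicator {g i<..g (Suc i)} s)"
    using l by (intro sum.mono_neutral_right) auto
   also have "... = ennreal ((u s)^2) * indicator {x..y} s"
    using l assms[OF l] by (auto simp: cells_def indicator_def)
   finally show ?thesis by simp
  next
   case False
   then have "(?B x y v s) = 0"
    by (intro sum.neutral) (auto simp: indicator_def)
   then show ?thesis by simp
  qed
 qed
 finally show ?thesis .
qed

end

lemma grid_exists:
 fixes G :: "real set"
 assumes "finite G" "G ~= {}"
 shows "EX m g. grid G m g"
proof -
 let ?L = "sorted_list_of_set G"
 have len: "length ?L = card G" by simp
 have "card G > 0" using assms by (simp add: card_gt_0_iff)
 then have *: "{..card G - 1} = {..<length ?L}" by auto
 have "grid G (card G - 1) ((!) ?L)"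
 proof
  fix i assume i: "i < card G - 1"
  have "sorted_wrt (<) ?L" using assms by (simp add: strict_sorted_list_of_set)
  then show "?L ! i < ?L ! Suc i" using i by (intro sorted_wrt_nth_less[of "(<)"]) auto
 next
  show "(!) ?L ` {..card G - 1} = G"
   unfolding * using assms set_sorted_list_of_set[OF assms(1)] by (auto simp: set_conv_nth)
 qed
 then show ?thesis by blast
qed

lemma simple_process_measurable [measurable]:
 "(%s. simple_process m p a s w) : bmeas borel"
 unfolding simple_process_def by measurable

context grid
begin

text \<open>Simple processes are built from intervals open on the left and closed on the right, so
  the right end point of a cell represents the whole cell.\<close>

lemma simple_process_cell:
 assumes "p ` {..k} \<subseteq> G" "l < m" "g l < s" "s <= g (Suc l)"
 shows "simple_process k p a s w = simple_process k p a (g (Suc l)) w"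
 unfolding simple_process_def
proof (intro sum.cong refl arg_cong2[where f = "(*)"])
 fix j assume "j : {..<k}"
 then have "p j : G" "p (Suc j) : G" using assms(1) by auto
 with dichotomy[OF _ assms(2)] assms(3,4) show "(indicator {p j<..p (Suc j)} s :: real) = indicator {p j<..p (Suc j)} (g (Suc l))"
  by (auto simp: indicator_def) (meson leD le_less_linear less_le_trans not_le order.trans)+
qed

lemma simple_ito_integral_cells:
 assumes "p ` {..k} \<subseteq> G" "!!j. j < k ==> p j <= p (Suc j)"
 shows "simple_ito_integral B k p a w =
  (SUM l<m. simple_process k p a (g (Suc l)) w * (B (g (Suc l)) w - B (g l) w))"
proof -
 let ?A = "%g l w. B (g (Suc l)) w - B (g l) w"
 have "a j w * (B (p (Suc j)) w - B (p j) w) =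
   (SUM l<m. a j w * indicator {p j<..p (Suc j)} (g (Suc l)) * (?A g l w))" if j: "j < k" for j
 proof -
  have G: "p j : G" "p (Suc j) : G" using assms(1) j by auto
  have "B (p (Suc j)) w - B (p j) w = (SUM l:cells (p j) (p (Suc j)). B (g (Suc l)) w - B (g l) w)"
   using telescope[OF G assms(2)[OF j], of "%s. B s w"] by simp
  also have "... = (SUM l<m. indicator {p j<..p (Suc j)} (g (Suc l)) * (?A g l w))"
  proof (rule sum.mono_neutral_cong_left)
   show "ALL l:{..<m} - cells (p j) (p (Suc j)). indicator {p j<..p (Suc j)} (g (Suc l)) * (?A g l w) = 0"
    using dichotomy[OF G(1)] by (fastforce simp: cells_def indicator_def)
  next
   fix l assume "l : cells (p j) (p (Suc j))"
   then show "B (g (Suc l)) w - B (g l) w = indicator {p j<..p (Suc j)} (g (Suc l)) * (?A g l w)"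
    using dichotomy[OF G(1), of l] g_strict[of l] by (auto simp: cells_def indicator_def)
  qed (auto simp: cells_def)
  finally show ?thesis by (simp only: sum_distrib_left mult.assoc)
 qed
 then have "simple_ito_integral B k p a w =
   (SUM j<k. SUM l<m. a j w * indicator {p j<..p (Suc j)} (g (Suc l)) * (?A g l w))"
  unfolding simple_ito_integral_def by (intro sum.cong) auto
 also have "... = (SUM l<m. SUM j<k. a j w * indicator {p j<..p (Suc j)} (g (Suc l)) * (?A g l w))"
  by (rule sum.swap)
 finally show ?thesis by (simp only: simple_process_def sum_distrib_right)
qed

end

lemma (in brownian) simple_process_measurable_F:
 assumes "simple_integrand M \<F> t k p a" "grid G m g" "p ` {..k} \<subseteq> G" "l < m"
 shows "simple_process k p a (g (Suc l)) : bmeas (\<F> (g l))"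
proof -
 interpret grid G m g by fact
 have "(%w. SUM j<k. a j w * indicator {p j<..p (Suc j)} (g (Suc l))) : bmeas (\<F> (g l))"
 proof (rule borel_measurable_sum)
  fix j assume j: "j : {..<k}"
  then have G: "p j : G" using assms(3) by auto
  show "(%w. a j w * indicator {p j<..p (Suc j)} (g (Suc l))) : bmeas (\<F> (g l))"
  proof (cases "p j < g (Suc l)")
   case True
   then have "p j <= g l" using dichotomy[OF G assms(4)] by auto
   moreover have "a j : bmeas (\<F> (p j))"
    using assms(1) j by (auto simp: simple_integrand_def)
   ultimately have "a j : bmeas (\<F> (g l))" by (rule measurable_F_mono)
   then show ?thesis by simp
  qed (simp add: indicator_def)
 qed
 then show ?thesis by (simp add: simple_process_def[abs_def])
qed

context grid
begin

lemma cells_Un: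
 assumes "y : G" "x <= y" "y <= z"
 shows "cells x z = cells x y \<union> cells y z" "cells x y \<inter> cells y z = {}"
proof -
 have "g (Suc l) <= y | y <= g l" if "l < m" for l
  using dichotomy[OF assms(1) that] by auto
 then show "cells x z = cells x y \<union> cells y z"
  unfolding cells_def using assms(2,3) order.trans by blast
 show "cells x y \<inter> cells y z = {}"
  using g_strict by (force simp: cells_def)
qed

end

lemma mono_upto:
 fixes s :: "nat => real"
 assumes "!!i. i < n ==> s i <= s (Suc i)" "i <= j" "j <= n"
 shows "s i <= s j"
 using assms(2,3) by (induction j) (auto simp: le_Suc_eq intro: order.trans[OF _ assms(1)])

context brownian
begin

lemma simple_process_pair_measurable:
 assumes "simple_integrand M \<F> t k p a"
 shows "(%(w, r). simple_process k p a r w) : bmeas (M \<Otimes>\<^sub>M lborel)"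
proof -
 have "(%x. SUM i<k. a i (fst x) * indicator {p i<..p (Suc i)} (snd x)) : bmeas (M \<Otimes>\<^sub>M lborel)"
 proof (intro borel_measurable_sum borel_measurable_times)
  fix i assume "i : {..<k}"
  then have "a i : bmeas M"
   using assms by (auto simp: simple_integrand_def intro: measurable_F_M)
  then show "(%x. a i (fst x)) : bmeas (M \<Otimes>\<^sub>M lborel)" by measurable
 qed measurable
 then show ?thesis by (simp add: simple_process_def case_prod_unfold)
qed

lemma square_integral_measurable:
 fixes f :: "'a => real => real"
 assumes "(%(w, r). f w r) : bmeas (M \<Otimes>\<^sub>M lborel)"
 shows "(%w. \<integral>\<^sup>+r\<in>{x..y}. ennreal ((f w r)^2) \<partial>lborel) : bmeas M"
 using assms by measurable

text \<open>The integrals up to different end times come with unrelated simple approximations. The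
  difference of the approximations for \<open>s (Suc i)\<close> and \<open>s i\<close>, less the
  left-point term, splits into two parts: \<open>D i\<close> integrates
  \<open>u (Suc i) - h i\<close> over the new interval, and \<open>E i\<close> integrates the
  discrepancy of the two approximations over the old interval \<open>[0, s i]\<close>. Both are
  elementary integrals on a common grid and have Lenglart bounds.\<close>

lemma integral_error_decomposition:
 fixes n :: nat and s :: "nat => real" and k :: "nat => nat"
  and p :: "nat => nat => real" and a :: "nat => nat => 'a => real" and h ta :: "nat => 'a => real"
 defines "u \<equiv> %i. simple_process (k i) (p i) (a i)"
 assumes s: "0 <= s 0" "!!i. i < n ==> s i <= s (Suc i)"
  and simple: "!!i. i <= n ==> simple_integrand M \<F> (s i) (k i) (p i) (a i)"
  and h: "!!i. i < n ==> h i : bmeas (\<F> (s i))"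
  and ta: "!!i. i < n ==> ta i : bmeas (\<F> (s i))"
  and I: "finite I" "!!b. b : I ==> J b \<subseteq> {..<n}" "disjoint_family_on J I"
 shows "EX D E. (ALL i<n. D i : bmeas M & E i : bmeas M &
   (ALL w. simple_ito_integral B (k (Suc i)) (p (Suc i)) (a (Suc i)) w - simple_ito_integral B (k i) (p i) (a i) w
     - h i w * (B (s (Suc i)) w - B (s i) w) = D i w + E i w)) &
  (ALL dl>=0. ALL eps>0. prob {w:space M. eps <= (SUM b:I. (SUM i:J b. ta i w * D i w)\<^sup>2)} <=
    prob {w:space M. ennreal dl < (SUM i<n. ennreal ((ta i w)^2) *
     (L2 {s i..s (Suc i)} (%r. u (Suc i) r w - h i w)))} + dl / eps) &
  (ALL i<n. ALL dl>=0. ALL eps>0. prob {w:space M. eps <= (E i w)^2} <=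
    prob {w:space M. ennreal dl < (L2 {0..s i} (%r. u (Suc i) r w - u i r w))} + dl / eps)"
proof -
 \<comment> \<open>All partition points of all approximations. The times \<open>s i\<close> belong
   to \<open>G\<close> as last points of their partitions.\<close>
 define G where "G = (\<Union>i\<in>{..n}. p i ` {..k i})"
 have p0: "p i 0 = 0" and pk: "p i (k i) = s i" and pm: "!!j. j < k i ==> p i j <= p i (Suc j)" if "i <= n" for i
  using simple[OF that] by (auto simp: simple_integrand_def)
 have pG: "p i ` {..k i} \<subseteq> G" if "i <= n" for i using that by (auto simp: G_def)
 have sG: "s i : G" if "i <= n" for i using pG[OF that] pk[OF that] by auto
 have "0 : G" using p0[of 0] unfolding G_def by force
 have G0: "x >= 0" if xG: "x : G" for x
 proof -
  obtain i j where "i <= n" "j <= k i" "x = p i j" using xG by (auto simp: G_def)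
  then show ?thesis using mono_upto[of "k i" "p i" 0 j] pm[of i] p0[of i] by auto
 qed
 have "finite G" "G ~= {}" using \<open>0 : G\<close> by (auto simp: G_def)
 then obtain m g where "grid G m g" using grid_exists by blast
 then interpret grid G m g .
 have g0: "g l >= 0" if "l <= m" for l using G0 g_image that by blast
 define v where "v = (%i l. simple_process (k i) (p i) (a i) (g (Suc l)))"
 define dB where "dB = (%l w. B (g (Suc l)) w - B (g l) w)"
 have sm: "s i <= s j" if "i <= j" "j <= n" for i j using mono_upto[of n s] s that by blast
 have s0: "0 <= s i" if "i <= n" for i using sm[of 0 i] s that by auto
 have vF: "v i l : bmeas (\<F> (g l))" if "i <= n" "l < m" for i l
  unfolding v_def using simple_process_measurable_F[OF simple[OF that(1)] \<open>grid G m g\<close> pG[OF that(1)] that(2)] .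
 \<comment> \<open>The partition for \<open>s i\<close> ends at \<open>s i\<close>, so the
   approximation vanishes on later cells and its integral can be taken over the cells up to
   \<open>s i\<close>.\<close>
 have v0: "v i l w = 0" if "i <= n" "l < m" "l ~: cells 0 (s i)" for i l w
 proof -
  have "g (Suc l) > s i" using that g0[of l] by (auto simp: cells_def)
  moreover have "p i (Suc j) <= s i" if "j < k i" for j
   using mono_upto[of "k i" "p i" "Suc j" "k i"] pm[of i] pk[of i] that \<open>i <= n\<close> by auto
  ultimately show ?thesis by (auto simp: v_def simple_process_def indicator_def intro!: sum.neutral) force
 qed
 let ?D = "%i w. SUM l:cells 0 (s i). v i l w * dB l w"
 have ito: "simple_ito_integral B (k i) (p i) (a i) w = (?D i w)" if i: "i <= n" for i w
 proof -
  have "simple_ito_integral B (k i) (p i) (a i) w = (SUM l<m. v i l w * dB l w)"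
   unfolding v_def dB_def by (rule simple_ito_integral_cells[OF pG[OF i]]) (rule pm[OF i])
  also have "... = (?D i w)"
   using v0[OF i] by (intro sum.mono_neutral_right) (auto simp: cells_def)
  finally show ?thesis .
 qed
 define C where "C = (%i. cells (s i) (s (Suc i)))"
 have finC: "finite (C i)" for i by (simp add: C_def)
 have Cm: "C i \<subseteq> {..<m}" for i by (auto simp: C_def cells_def)
 have Cdisj: "C i \<inter> C j = {}" if "i < j" "j < n" for i j
 proof -
  have "s (Suc i) <= s j" using sm that by simp
  then show ?thesis using g_strict by (force simp: C_def cells_def)
 qed
 then have Cdisj': "C i \<inter> C j = {}" if "i ~= j" "i < n" "j < n" for i j
  using that by (metis Int_commute linorder_neqE_nat)
 define D where "D = (%i w. SUM l:C i. (v (Suc i) l w - h i w) * dB l w)"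
 define E where "E = (%i w. SUM l:cells 0 (s i). (v (Suc i) l w - v i l w) * dB l w)"
 \<comment> \<open>The errors on the intervals \<open>C i\<close> are joined to one integrand on the
   whole grid, with weights \<open>ta i\<close> known at the start of the interval. A single
   application of the tail bound then treats all intervals together.\<close>
 define c where "c = (%l w. SUM i<n. if l : C i then ta i w * (v (Suc i) l w - h i w) else 0)"
 have c_eq: "c l w = ta i w * (v (Suc i) l w - h i w)" if "i < n" "l : C i" for i l w
 proof -
  have "l ~: C j" if "j < n" "j ~= i" for j
   using Cdisj'[of i j] that \<open>i < n\<close> \<open>l : C i\<close> by auto
  then have "c l w = (SUM j:{i}. if l : C j then ta j w * (v (Suc j) l w - h j w) else 0)"
   unfolding c_def using that by (intro sum.mono_neutral_right) auto
  then show ?thesis using that by simp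
 qed
 have hF: "h i : bmeas (\<F> (g l))" "ta i : bmeas (\<F> (g l))" if "i < n" "l : C i" for i l
  using that h[OF that(1)] ta[OF that(1)] measurable_F_mono[of "s i" "g l"] by (auto simp: C_def cells_def)
 have vM: "v i l : bmeas M" if "i <= n" "l < m" for i l
  using vF[OF that] by (rule measurable_F_M)
 have dBM: "dB l : bmeas M" if "l < m" for l
  unfolding dB_def using g0[of l] g0[of "Suc l"] that by (intro borel_measurable_diff B_measurable) auto
 have hM: "h i : bmeas M" if "i < n" for i using h[OF that] by (rule measurable_F_M)
 have taM: "ta i : bmeas M" if "i < n" for i using ta[OF that] by (rule measurable_F_M)
 have DM: "D i : bmeas M" if "i < n" for i
  unfolding D_def using that Cm[of i]
  by (intro borel_measurable_sum borel_measurable_times borel_measurable_diff vM dBM hM) auto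
 have EM: "E i : bmeas M" if "i < n" for i
  unfolding E_def using that
  by (intro borel_measurable_sum borel_measurable_times borel_measurable_diff vM dBM) (auto simp: cells_def)
 have uM: "(%(w, r). u i r w) : bmeas (M \<Otimes>\<^sub>M lborel)" if "i <= n" for i
  unfolding u_def using simple_process_pair_measurable[OF simple[OF that]] .
 have dec: "simple_ito_integral B (k (Suc i)) (p (Suc i)) (a (Suc i)) w - simple_ito_integral B (k i) (p i) (a i) w
     - h i w * (B (s (Suc i)) w - B (s i) w) = D i w + E i w" if i: "i < n" for i w
 proof -
  have le: "0 <= s i" "s i <= s (Suc i)" using i s0 s by auto
  have si: "s i : G" "s (Suc i) : G" using sG i by auto
  have "h i w * (B (s (Suc i)) w - B (s i) w) = (SUM l:C i. h i w * dB l w)"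
   using telescope[OF si le(2), of "%s. B s w"] unfolding C_def dB_def sum_distrib_left[symmetric] by simp
  moreover have "simple_ito_integral B (k (Suc i)) (p (Suc i)) (a (Suc i)) w =
    (SUM l:cells 0 (s i). v (Suc i) l w * dB l w) + (SUM l:C i. v (Suc i) l w * dB l w)"
   using i cells_Un[OF si(1) le] by (simp add: ito C_def sum.union_disjoint)
  moreover have "simple_ito_integral B (k i) (p i) (a i) w = (?D i w)"
   using i by (simp add: ito)
  ultimately show ?thesis
   unfolding D_def E_def by (simp add: left_diff_distrib sum_subtractf)
 qed
 have ei: "elementary_integrand M \<F> B m g y" if "!!l. l < m ==> y l : bmeas (\<F> (g l))" for y
  using that g0[of 0] g_strict by unfold_locales (auto intro: less_imp_le)
 have cF: "c l : bmeas (\<F> (g l))" if "l < m" for l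
  unfolding c_def
 proof (rule borel_measurable_sum)
  fix i assume "i : {..<n}"
  then show "(%w. if l : C i then ta i w * (v (Suc i) l w - h i w) else 0) : bmeas (\<F> (g l))"
   using hF[of i l] vF[of "Suc i" l] that by (cases "l : C i") auto
 qed
 let ?A = "%i u w. L2 {s i..s (Suc i)} (%r. u (Suc i) r w - h i w)"
 let ?B = "%i w g. SUM l:C i. (v (Suc i) l w - h i w)\<^sup>2 * (g (Suc l) - g l)"
 let ?E = "%J b w. SUM i:J b. ta i w * D i w"
 have bD: "prob {w:space M. eps <= (SUM b:I. (?E J b w)\<^sup>2)} <=
    prob {w:space M. ennreal dl < (SUM i<n. ennreal ((ta i w)^2) *
     (?A i u w))} + dl / eps"
  if de: "dl >= 0" "eps > 0" for dl eps
 proof -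
  interpret e: elementary_integrand M \<F> B m g c by (rule ei[OF cF])
  let ?K = "%b. \<Union>i\<in>J b. C i"
  have finJ: "finite (J b)" if "b : I" for b using I(2)[OF that] finite_subset by auto
  have K: "b : I ==> ?K b \<subseteq> {..<m}" for b using Cm by auto
  have Kd: "disjoint_family_on ?K I"
   unfolding disjoint_family_on_def
  proof (intro ballI impI)
   fix b b' assume b: "b : I" "b' : I" "b ~= b'"
   then have "J b \<inter> J b' = {}" using I(3) by (auto simp: disjoint_family_on_def)
   moreover have "J b \<subseteq> {..<n}" "J b' \<subseteq> {..<n}" using I(2) b by auto
   ultimately have "C i \<inter> C j = {}" if "i : J b" "j : J b'" for i j
    using that by (intro Cdisj') auto
   then show "?K b \<inter> ?K b' = {}" by blast
  qed
  have bs: "e.block_square I ?K w = (SUM b:I. (?E J b w)\<^sup>2)" for w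
   unfolding e.block_square_def
  proof (rule sum.cong[OF refl])
   fix b assume b: "b : I"
   have "(SUM l:?K b. c l w * e.dB l w) = (SUM i:J b. SUM l:C i. c l w * e.dB l w)"
    using finJ[OF b] finC Cdisj' I(2)[OF b] by (intro sum.UNION_disjoint) auto
   also have "... = (?E J b w)"
    unfolding D_def sum_distrib_left using I(2)[OF b] c_eq
    by (intro sum.cong refl) (auto simp: e.dB_def dB_def)
   finally show "(SUM l:?K b. c l w * e.dB l w)^2 = (?E J b w)^2" by simp
  qed
  have en: "ennreal (e.energy m w) <= (SUM i<n. ennreal ((ta i w)^2) *
     (?A i u w))" for w
  proof -
   have "e.energy m w = (SUM l:(\<Union>i\<in>{..<n}. C i). (c l w)^2 * e.dg l)"
    unfolding e.energy_def
   proof (intro sum.mono_neutral_right ballI)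
    fix l assume "l : {..<m} - (\<Union>i\<in>{..<n}. C i)"
    then have "c l w = 0" unfolding c_def by (intro sum.neutral) auto
    then show "(c l w)^2 * e.dg l = 0" by simp
   qed (use Cm in auto)
   also have "... = (SUM i<n. SUM l:C i. (c l w)\<^sup>2 * e.dg l)"
    using finC Cdisj' by (intro sum.UNION_disjoint) auto
   also have "... = (SUM i<n. (ta i w)\<^sup>2 * (?B i w g))"
    unfolding sum_distrib_left using c_eq
    by (intro sum.cong refl) (auto simp: e.dg_def power_mult_distrib)
   finally have eq: "e.energy m w = (SUM i<n. (ta i w)\<^sup>2 * (?B i w g))" .
   have nn: "0 <= (?B i w g)" for i
   proof (intro sum_nonneg mult_nonneg_nonneg zero_le_power2)
    fix l assume "l : C i"
    then have "l < m" using Cm by auto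
    then show "0 <= g (Suc l) - g l" using g_strict[of l] by simp
   qed
   have "ennreal (e.energy m w) =
     (SUM i<n. ennreal ((ta i w)^2 * (?B i w g)))"
    unfolding eq using nn by (intro sum_ennreal[symmetric]) simp
   also have "... =
     (SUM i<n. ennreal ((ta i w)^2) * ennreal (?B i w g))"
    by (intro sum.cong refl ennreal_mult') simp
   also have "... <= (SUM i<n. ennreal ((ta i w)^2) *
     (?A i u w))"
   proof (intro sum_mono mult_left_mono)
    fix i assume i: "i : {..<n}"
    show "ennreal (?B i w g) <=
      (?A i u w)"
     unfolding C_def
    proof (rule cells_square_sum_le)
     fix l r assume l: "l : cells (s i) (s (Suc i))" "g l < r" "r <= g (Suc l)"
     have "l < m" using l by (simp add: cells_def)
     from simple_process_cell[OF pG this l(2,3), of "Suc i"] i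
     show "u (Suc i) r w - h i w = v (Suc i) l w - h i w" by (simp add: u_def v_def)
    qed
   qed simp
   finally show ?thesis .
  qed
  have "prob {w:space M. eps <= e.block_square I ?K w} <= prob {w:space M. dl < e.energy m w} + dl / eps"
   by (rule e.block_square_tail[OF I(1) K Kd de])
  also have "prob {w:space M. dl < e.energy m w} <= prob {w:space M. ennreal dl < (SUM i<n. ennreal ((ta i w)^2) *
     (?A i u w))}"
  proof (rule finite_measure_mono)
   show "{w:space M. dl < e.energy m w} \<subseteq> {w:space M. ennreal dl < (SUM i<n. ennreal ((ta i w)^2) *
     (?A i u w))}"
    using less_le_trans[OF _ en] de(1) by (auto simp: ennreal_less_iff)
   have "(%w. SUM i<n. ennreal ((ta i w)^2) *
     (?A i u w)) : bmeas M"
   proof (rule borel_measurable_sum)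
    fix i assume "i : {..<n}"
    then have i: "i < n" by simp
    have 1: "(%w. ennreal ((ta i w)^2)) : bmeas M" using taM[of i] i by measurable
    have "(%(w, r). u (Suc i) r w - h i w) : bmeas (M \<Otimes>\<^sub>M lborel)"
     using borel_measurable_diff[OF uM[of "Suc i"] measurable_compose[OF measurable_fst hM[OF i]]] i
     by (simp add: case_prod_unfold)
    from borel_measurable_times_ennreal[OF 1 square_integral_measurable[OF this]]
    show "(%w. ennreal ((ta i w)^2) * (?A i u w))
     : bmeas M" .
   qed
   then show "{w:space M. ennreal dl < (SUM i<n. ennreal ((ta i w)^2) *
     (?A i u w))} : events"
    by measurable
  qed
  finally show ?thesis by (simp add: bs)
 qed
 let ?C = "%i u w. L2 {0..s i} (%r. u (Suc i) r w - u i r w)"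
 have bE: "prob {w:space M. eps <= (E i w)^2} <=
    prob {w:space M. ennreal dl < (?C i u w)} + dl / eps"
  if i: "i < n" and de: "dl >= 0" "eps > 0" for i dl eps
 proof -
  define y where "y = (%l w. if l : cells 0 (s i) then v (Suc i) l w - v i l w else 0)"
  have "y l : bmeas (\<F> (g l))" if "l < m" for l
   unfolding y_def using vF[of "Suc i" l] vF[of i l] that i by (cases "l : cells 0 (s i)") auto
  then interpret e: elementary_integrand M \<F> B m g y by (rule ei)
  have bs: "e.block_square {()} (%_. cells 0 (s i)) w = (E i w)^2" for w
   unfolding e.block_square_def E_def by (simp add: y_def e.dB_def dB_def)
  have en: "ennreal (e.energy m w) <= (?C i u w)" for w
  proof -
   have "e.energy m w = (SUM l:cells 0 (s i). (y l w)^2 * e.dg l)"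
    unfolding e.energy_def by (intro sum.mono_neutral_right) (auto simp: cells_def y_def)
   also have "... = (SUM l:cells 0 (s i). (v (Suc i) l w - v i l w)^2 * (g (Suc l) - g l))"
    by (intro sum.cong) (auto simp: y_def e.dg_def)
   also have "ennreal ... <= (?C i u w)"
   proof (rule cells_square_sum_le)
    fix l r assume l: "l : cells 0 (s i)" "g l < r" "r <= g (Suc l)"
    have "l < m" using l by (simp add: cells_def)
    have "u (Suc i) r w = v (Suc i) l w" "u i r w = v i l w"
     unfolding u_def v_def using i by (intro simple_process_cell[OF pG \<open>l < m\<close> l(2,3)]; simp)+
    then show "u (Suc i) r w - u i r w = v (Suc i) l w - v i l w" by simp
   qed
   finally show ?thesis .
  qed
  have "prob {w:space M. eps <= e.block_square {()} (%_. cells 0 (s i)) w} <= prob {w:space M. dl < e.energy m w} + dl / eps"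
   by (rule e.block_square_tail) (use de in \<open>auto simp: cells_def disjoint_family_on_def\<close>)
  also have "prob {w:space M. dl < e.energy m w} <=
    prob {w:space M. ennreal dl < (?C i u w)}"
  proof (rule finite_measure_mono)
   show "{w:space M. dl < e.energy m w} \<subseteq>
     {w:space M. ennreal dl < (?C i u w)}"
    using less_le_trans[OF _ en] de(1) by (auto simp: ennreal_less_iff)
   have "(%w. \<integral>\<^sup>+r\<in>{0..s i}. ennreal ((u (Suc i) r w - u i r w)^2) \<partial>lborel) : bmeas M"
    using borel_measurable_diff[OF uM[of "Suc i"] uM[of i]] i
    by (intro square_integral_measurable) (simp add: case_prod_unfold)
   then show "{w:space M. ennreal dl < (?C i u w)} : events"
    by measurable
  qed
  finally show ?thesis by (simp add: bs)
 qed
 show ?thesis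
  apply (rule exI[of _ D], rule exI[of _ E])
  apply (intro conjI allI impI)
    apply (erule DM)
    apply (erule EM)
   apply (erule dec)
   apply (rule bD; assumption)
  apply (rule bE; assumption)
  done
qed

end

lemma square_add_le: "(x + y)^2 <= 2 * x^2 + 2 * (y::real)^2"
 using sum_squares_bound[of x y] by (simp add: power2_sum)

lemma sum_square_le_card:
 fixes y :: "'i => real"
 assumes "finite J"
 shows "(SUM i:J. y i)^2 <= card J * (SUM i:J. (y i)\<^sup>2)"
 using Cauchy_Schwarz_ineq_sum[of "%_. 1" y J] by simp

lemma square_integral_triangle:
 fixes f g h :: "real => real"
 assumes [measurable]: "f : bmeas borel" "g : bmeas borel"
  and h: "(%r. indicator A r * h r) : bmeas borel" and [measurable]: "A : sets borel"
 shows "(L2 A (%r. f r - g r)) <=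
  2 * (L2 A (%r. f r - h r)) + 2 * (L2 A (%r. h r - g r))"
proof -
 let ?h = "%r. indicator A r * h r"
 note h[measurable]
 have eq: "(L2 A (%r. f r - h r)) = (L2 A (%r. f r - ?h r))"
  "(L2 A (%r. h r - g r)) = (L2 A (%r. ?h r - g r))"
  by (auto intro!: nn_integral_cong simp: indicator_def)
 have "ennreal ((f r - g r)^2) <= 2 * ennreal ((f r - ?h r)^2) + 2 * ennreal ((?h r - g r)^2)" for r
 proof -
  have "(f r - g r)^2 <= 2 * (f r - ?h r)^2 + 2 * (?h r - g r)^2"
   using square_add_le[of "f r - ?h r" "?h r - g r"] by simp
  then have "ennreal ((f r - g r)^2) <= ennreal (2 * (f r - ?h r)^2 + 2 * (?h r - g r)^2)" by (rule ennreal_leI)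
  then show ?thesis by (simp add: ennreal_mult')
 qed
 note le = this
 have "(L2 A (%r. f r - g r)) <=
   (\<integral>\<^sup>+r. 2 * (ennreal ((f r - ?h r)^2) * indicator A r) + 2 * (ennreal ((?h r - g r)^2) * indicator A r) \<partial>lborel)"
 proof (rule nn_integral_mono)
  fix r
  show "ennreal ((f r - g r)^2) * indicator A r <=
   2 * (ennreal ((f r - ?h r)^2) * indicator A r) + 2 * (ennreal ((?h r - g r)^2) * indicator A r)"
   using le[of r] by (cases "r : A") simp_all
 qed
 also have "... = 2 * (L2 A (%r. f r - ?h r)) + 2 * (L2 A (%r. ?h r - g r))"
  by (subst nn_integral_add) (auto simp: nn_integral_cmult)
 finally show ?thesis unfolding eq .
qed

context brownian
begin

text \<open>The level \<open>dl\<close> is chosen with \<open>C * dl / eps = eta / 2\<close>; the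
  remaining probability is eventually below \<open>eta / 2\<close>.\<close>

lemma prob0_Lenglart:
 assumes X: "!!k. X k : bmeas M" and Z: "prob0 M Z"
  and le: "!!k dl eps. dl > 0 ==> eps > 0 ==> prob {w:space M. eps <= X k w} <= prob {w:space M. ennreal dl <= Z k w} + C * dl / eps"
  and C: "C > 0"
 shows "prob0 M (%k w. ennreal (X k w))"
proof (rule prob0I)
 show "(%w. ennreal (X k w)) : bmeas M" for k using X[of k] by measurable
 fix eps eta :: real assume e: "eps > 0" "eta > 0"
 define dl where "dl = eta * eps / (2 * C)"
 have d: "dl > 0" "eta / 2 > 0" using e C by (auto simp: dl_def)
 from prob0D[OF Z this]
 show "EV k. prob {w:space M. ennreal eps <= ennreal (X k w)} <= eta"
 proof eventually_elim
  case (elim k)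
  have "{w:space M. ennreal eps <= ennreal (X k w)} = {w:space M. eps <= X k w}"
   using e by (auto simp: ennreal_le_iff2)
  then have "prob {w:space M. ennreal eps <= ennreal (X k w)} <= eta / 2 + C * dl / eps"
   using le[OF d(1) e(1), of k] elim by simp
  also have "C * dl / eps = eta / 2" using e C by (simp add: dl_def)
  finally show ?case by simp
 qed
qed

lemma has_ito_integral_measurable:
 assumes "has_ito_integral M \<F> B H t Y"
 shows "(%(w, r). indicator {0..t} r * H r w) : bmeas (M \<Otimes>\<^sub>M lborel)"
  and "w : space M ==> (%r. indicator {0..t} r * H r w) : bmeas borel"
  and "Y : bmeas M"
  and "0 <= r ==> r <= t ==> H r : bmeas (\<F> r)"
proof -
 have *: "(%(r, w). indicator {0..t} r * H r w) : bmeas (borel \<Otimes>\<^sub>M M)"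
  using assms unfolding has_ito_integral_def by (elim conjE) assumption
 show "(%r. indicator {0..t} r * H r w) : bmeas borel" if "w : space M"
  using measurable_compose[OF measurable_Pair2'[OF that] *] by simp
 have "(%(w, r). indicator {0..t} r * H r w) : bmeas (M \<Otimes>\<^sub>M borel)"
  using measurable_pair_swap[OF *] by (simp add: case_prod_unfold)
 then show "(%(w, r). indicator {0..t} r * H r w) : bmeas (M \<Otimes>\<^sub>M lborel)"
  unfolding measurable_cong_sets[OF sets_pair_measure_cong[OF refl sets_lborel] refl] .
 show "Y : bmeas M"
  using assms unfolding has_ito_integral_def by (elim conjE) assumption
 have "ALL s:{0..t}. H s : bmeas (\<F> s)"
  using assms unfolding has_ito_integral_def by (elim conjE) assumption
 then show "0 <= r ==> r <= t ==> H r : bmeas (\<F> r)" by simp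
qed

lemma square_integral_measurable':
 fixes H :: "real => 'a => real" and f :: "'a => real => real"
 assumes H: "(%(w, r). indicator {0..t} r * H r w) : bmeas (M \<Otimes>\<^sub>M lborel)"
  and f: "(%(w, r). f w r) : bmeas (M \<Otimes>\<^sub>M lborel)" and "0 <= x" "y <= t"
 shows "(%w. \<integral>\<^sup>+r\<in>{x..y}. ennreal ((f w r - H r w)^2) \<partial>lborel) : bmeas M"
proof -
 have "(%w. \<integral>\<^sup>+r\<in>{x..y}. ennreal ((f w r - indicator {0..t} r * H r w)^2) \<partial>lborel) : bmeas M"
  using borel_measurable_diff[OF f H]
  by (intro square_integral_measurable[where f = "%w r. f w r - indicator {0..t} r * H r w"]) (simp add: case_prod_unfold)
 moreover have "(L2 {x..y} (%r. f w r - indicator {0..t} r * H r w)) =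
   (L2 {x..y} (%r. f w r - H r w))" for w
 proof (rule nn_integral_cong)
  fix r
  show "ennreal ((f w r - indicator {0..t} r * H r w)^2) * indicator {x..y} r = ennreal ((f w r - H r w)^2) * indicator {x..y} r"
  proof (cases "r : {x..y}")
   case True
   then have "r : {0..t}" using assms(3,4) by auto
   then show ?thesis by simp
  qed simp
 qed
 ultimately show ?thesis by simp
qed

text \<open>For a fixed partition the approximations are sent to their limit. The discrepancies on
  old intervals and the distances to the true integrals vanish in probability, and what stays in the
  bound is \<open>Q\<close>, the energy of \<open>H\<close> minus its left-point value.\<close>

lemma ito_error_tail:
 fixes n :: nat and s :: "nat => real" and Y :: "nat => 'a => real" and ta :: "nat => 'a => real" and H :: "real => 'a => real"
 defines "eps \<equiv> %i w. Y (Suc i) w - Y i w - H (s i) w * (B (s (Suc i)) w - B (s i) w)"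
  and "Q \<equiv> %w. SUM i<n. ennreal ((ta i w)^2) * (L2 {s i..s (Suc i)} (%r. H (s i) w - H r w))"
 assumes s: "0 <= s 0" "!!i. i < n ==> s i <= s (Suc i)"
  and ito: "!!i. i <= n ==> has_ito_integral M \<F> B H (s i) (Y i)"
  and ta: "!!i. i < n ==> ta i : bmeas (\<F> (s i))"
  and I: "finite I" "!!b. b : I ==> J b \<subseteq> {..<n}" "disjoint_family_on J I"
  and de: "dl > 0" "e > 0"
 shows "prob {w:space M. e <= (SUM b:I. (SUM i:J b. ta i w * eps i w)\<^sup>2)} <= prob {w:space M. ennreal dl <= Q w} + 16 * dl / e"
  and "Q : bmeas M"
proof -
 define P where "P = (%i k p a. (ALL l. simple_integrand M \<F> (s i) (k l) (p l) (a l)) &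
    (ALL eps>0. (%l. measure M {w:space M. ennreal eps <=
       (L2 {0..s i} (%r. simple_process (k l) (p l) (a l) r w - H r w))})
      ~> 0) &
    (ALL eps>0. (%l. measure M {w:space M. eps <= abs (simple_ito_integral B (k l) (p l) (a l) w - Y i w)}) ~> 0))"
 have "EX k p a. P i k p a" if "i <= n" for i
  using ito[OF that] unfolding has_ito_integral_def P_def by (elim conjE) assumption
 then obtain k p a where P: "!!i. i <= n ==> P i (k i) (p i) (a i)" by metis
 note P = this[unfolded P_def]
 have simple: "!!i l. i <= n ==> simple_integrand M \<F> (s i) (k i l) (p i l) (a i l)"
  using P by blast
 have conv: "!!i eps. i <= n ==> eps > 0 ==> (%l. measure M {w:space M. ennreal eps <=
       (L2 {0..s i} (%r. simple_process (k i l) (p i l) (a i l) r w - H r w))}) ~> 0"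
  using P by blast
 have convI: "!!i eps. i <= n ==> eps > 0 ==> (%l. measure M {w:space M. eps <= abs (simple_ito_integral B (k i l) (p i l) (a i l) w - Y i w)}) ~> 0"
  using P by blast
 define u where "u = (%l i. simple_process (k i l) (p i l) (a i l))"
 define q where "q = (%i l w. \<integral>\<^sup>+r\<in>{0..s i}. ennreal ((u l i r w - H r w)^2) \<partial>lborel)"
 have sm: "s i <= s j" if "i <= j" "j <= n" for i j using mono_upto[of n s] s that by blast
 have s0: "0 <= s i" if "i <= n" for i using sm[of 0 i] s that by auto
 have hF: "H (s i) : bmeas (\<F> (s i))" if "i <= n" for i
  using has_ito_integral_measurable(4)[OF ito[OF that] s0[OF that]] by simp
 have hM: "H (s i) : bmeas M" if "i <= n" for i using hF[OF that] by (rule measurable_F_M)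
 have YM: "Y i : bmeas M" if "i <= n" for i
  using has_ito_integral_measurable(3)[OF ito[OF that]] .
 have taM: "ta i : bmeas M" if "i < n" for i using ta[OF that] by (rule measurable_F_M)
 have BM: "B (s i) : bmeas M" if "i <= n" for i using s0[OF that] by (rule B_measurable)
 have HM: "(%(w, r). indicator {0..s i} r * H r w) : bmeas (M \<Otimes>\<^sub>M lborel)" if "i <= n" for i
  using has_ito_integral_measurable(1)[OF ito[OF that]] .
 have uM: "(%(w, r). u l i r w) : bmeas (M \<Otimes>\<^sub>M lborel)" if "i <= n" for i l
  unfolding u_def using simple_process_pair_measurable[OF simple[OF that]] .
 have q0: "prob0 M (q i)" if i: "i <= n" for i
  unfolding prob0_def
 proof (intro conjI allI impI)
  show "q i l : bmeas M" for l
   unfolding q_def using i s0[OF i] by (intro square_integral_measurable'[OF HM[OF i]] uM) auto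
 qed (use conv[OF i] in \<open>simp add: q_def u_def\<close>)
 have IM: "simple_ito_integral B (k i l) (p i l) (a i l) : bmeas M" if i: "i <= n" for i l
 proof -
  have pp: "p i l 0 = 0" "!!j. j < k i l ==> p i l j <= p i l (Suc j)"
   using simple[OF i, of l] by (auto simp: simple_integrand_def)
  have "0 <= p i l j" if "j <= k i l" for j
   using mono_upto[of "k i l" "p i l" 0 j] pp that by auto
  then have "(%w. SUM j<k i l. a i l j w * (B (p i l (Suc j)) w - B (p i l j) w)) : bmeas M"
   using simple[OF i, of l]
   by (intro borel_measurable_sum borel_measurable_times borel_measurable_diff B_measurable)
    (auto simp: simple_integrand_def intro: measurable_F_M)
  then show ?thesis by (simp add: simple_ito_integral_def[abs_def])
 qed
 define R where "R = (%i l w. simple_ito_integral B (k i l) (p i l) (a i l) w - Y i w)"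
 have R0: "prob0 M (%l w. ennreal (abs (R i l w)))" if i: "i <= n" for i
  unfolding prob0_def
 proof (intro conjI allI impI)
  show "(%w. ennreal (abs (R i l w))) : bmeas M" for l
   unfolding R_def using IM[OF i] YM[OF i] by measurable
 qed (use convI[OF i] in \<open>simp add: R_def\<close>)
 let ?C = "%i l w. L2 {s i..s (Suc i)} (%r. u l (Suc i) r w - H (s i) w)"
 define P2 where "P2 = (%l D E. (ALL i<n. D i : bmeas M & E i : bmeas M &
   (ALL w. simple_ito_integral B (k (Suc i) l) (p (Suc i) l) (a (Suc i) l) w - simple_ito_integral B (k i l) (p i l) (a i l) w
     - H (s i) w * (B (s (Suc i)) w - B (s i) w) = D i w + E i w)) &
  (ALL dl>=0. ALL eps>0. prob {w:space M. eps <= (SUM b:I. (SUM i:J b. ta i w * D i w)\<^sup>2)} <=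
    prob {w:space M. ennreal dl < (SUM i<n. ennreal ((ta i w)^2) *
     (?C i l w))} + dl / eps) &
  (ALL i<n. ALL dl>=0. ALL eps>0. prob {w:space M. eps <= (E i w)^2} <=
    prob {w:space M. ennreal dl < (L2 {0..s i} (%r. u l (Suc i) r w - u l i r w))} + dl / eps))"
 have "EX D E. P2 l D E" for l
  unfolding P2_def u_def
  by (rule integral_error_decomposition[where k = "%i. k i l" and p = "%i. p i l" and a = "%i. a i l" and h = "%i. H (s i)"])
    (use s simple hF ta I in auto)
 then obtain D E where P2: "!!l. P2 l (D l) (E l)" by metis
 note P2 = this[unfolded P2_def]
 have DM: "!!l i. i < n ==> D l i : bmeas M"
  using P2 by blast
 have EM: "!!l i. i < n ==> E l i : bmeas M"
  using P2 by blast
 have dec: "!!l i w. i < n ==> simple_ito_integral B (k (Suc i) l) (p (Suc i) l) (a (Suc i) l) w - simple_ito_integral B (k i l) (p i l) (a i l) w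
     - H (s i) w * (B (s (Suc i)) w - B (s i) w) = D l i w + E l i w"
  using P2 by blast
 let ?D = "%J b w D l. SUM i:J b. ta i w * D l i w"
 have bD: "!!l dl eps. dl >= 0 ==> eps > 0 ==> prob {w:space M. eps <= (SUM b:I. (?D J b w D l)\<^sup>2)} <=
    prob {w:space M. ennreal dl < (SUM i<n. ennreal ((ta i w)^2) *
     (?C i l w))} + dl / eps"
  using P2 by blast
 have bE: "!!l i dl eps. i < n ==> dl >= 0 ==> eps > 0 ==> prob {w:space M. eps <= (E l i w)^2} <=
    prob {w:space M. ennreal dl < (L2 {0..s i} (%r. u l (Suc i) r w - u l i r w))} + dl / eps"
  using P2 by blast
 let ?E = "%i w. L2 {s i..s (Suc i)} (%r. H (s i) w - H r w)"
 have QM: "Q : bmeas M"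
  unfolding Q_def
 proof (rule borel_measurable_sum)
  fix i assume "i : {..<n}"
  then have i: "i < n" by simp
  have 1: "(%w. ennreal ((ta i w)^2)) : bmeas M" using taM[OF i] by measurable
  have 2: "(%w. \<integral>\<^sup>+r\<in>{s i..s (Suc i)}. ennreal ((H (s i) w - H r w)^2) \<partial>lborel) : bmeas M"
   using i s0[of i] measurable_compose[OF measurable_fst hM[of i]]
   by (intro square_integral_measurable'[OF HM[of "Suc i"]]) (auto simp: case_prod_unfold)
  show "(%w. ennreal ((ta i w)^2) * (?E i w)) : bmeas M"
   by (rule borel_measurable_times_ennreal[OF 1 2])
 qed
 then show "Q : bmeas M" .
 have Hsec: "(%r. indicator {x..y} r * H r w) : bmeas borel"
  if "i <= n" "0 <= x" "y <= s i" "w : space M" for i x y w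
 proof -
  have "(%r. indicator {x..y} r * (indicator {0..s i} r * H r w)) : bmeas borel"
   using has_ito_integral_measurable(2)[OF ito[OF that(1)] that(4)] by measurable
  moreover have "indicator {x..y} r * (indicator {0..s i} r * H r w) = indicator {x..y} r * H r w" for r
   using that by (cases "r : {x..y}") auto
  ultimately show ?thesis by simp
 qed
 have um: "(%r. u l i r w) : bmeas borel" for l i w
  unfolding u_def by (rule simple_process_measurable)
 define Z where "Z = (%i l w. \<integral>\<^sup>+r\<in>{0..s i}. ennreal ((u l (Suc i) r w - u l i r w)^2) \<partial>lborel)"
 let ?H = "%l i w. %r. u l (Suc i) r w - H r w"
 have Z0: "prob0 M (Z i)" if i: "i < n" for i
 proof (rule prob0_le)
  show "prob0 M (%l w. ennreal 2 * q (Suc i) l w + ennreal 2 * q i l w)"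
   using i by (intro prob0_add prob0_mult q0 borel_measurable_const) auto
  show "Z i l : bmeas M" for l
   unfolding Z_def
   using borel_measurable_diff[OF uM[of "Suc i" l] uM[of i l]] i
   by (intro square_integral_measurable[where f = "%w r. u l (Suc i) r w - u l i r w"]) (simp add: case_prod_unfold)
  fix l w assume w: "w : space M"
  have "Z i l w <= 2 * (L2 {0..s i} (?H l i w)) +
    2 * (L2 {0..s i} (%r. H r w - u l i r w))"
   unfolding Z_def using i w by (intro square_integral_triangle um Hsec[of i]) auto
  also have "(L2 {0..s i} (%r. H r w - u l i r w)) = q i l w"
   unfolding q_def by (simp only: power2_commute[of "H _ w" "u _ _ _ w"])
  also have "(L2 {0..s i} (?H l i w)) <= q (Suc i) l w"
   unfolding q_def using i s(2)[of i] by (intro nn_integral_mono) (auto simp: indicator_def)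
  finally show "Z i l w <= ennreal 2 * q (Suc i) l w + ennreal 2 * q i l w"
   by (simp add: add_right_mono mult_left_mono)
 qed
 have E0: "prob0 M (%l w. ennreal ((E l i w)^2))" if i: "i < n" for i
 proof (rule prob0_Lenglart[OF _ Z0[OF i], where C = 1])
  show "(%w. (E l i w)\<^sup>2) : bmeas M" for l using EM[OF i] by measurable
  fix l and dl eps :: real assume d: "dl > 0" "eps > 0"
  have "prob {w:space M. eps <= (E l i w)^2} <= prob {w:space M. ennreal dl < Z i l w} + dl / eps"
   unfolding Z_def using bE[OF i] d by simp
  also have "prob {w:space M. ennreal dl < Z i l w} <= prob {w:space M. ennreal dl <= Z i l w}"
  using prob0_measurable[OF Z0[OF i], of l] by (auto intro!: finite_measure_mono)
  finally show "prob {w:space M. eps <= (E l i w)^2} <= prob {w:space M. ennreal dl <= Z i l w} + 1 * dl / eps"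
   by simp
 qed simp
 \<comment> \<open>Everything that vanishes in probability as \<open>l\<close> grows: the
   discrepancy on the old interval and the two distances \<open>R\<close> between approximate and
   true integrals.\<close>
 define x where "x = (%l i w. E l i w - R (Suc i) l w + R i l w)"
 have eps: "eps i w = D l i w + x l i w" if "i < n" for l i w
  using dec[OF that, of l w] by (simp add: eps_def x_def R_def)
 have xM: "x l i : bmeas M" if "i < n" for l i
  unfolding x_def R_def using EM[OF that, of l] IM[of i l] IM[of "Suc i" l] YM[of i] YM[of "Suc i"] that by simp
 have x0: "prob0 M (%l w. ennreal ((x l i w)^2))" if i: "i < n" for i
 proof (rule prob0_le)
  show "prob0 M (%l w. ennreal 4 * ennreal ((E l i w)^2) + ennreal 4 * ennreal ((R (Suc i) l w)^2) + ennreal 4 * ennreal ((R i l w)^2))"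
   using i by (intro prob0_add prob0_mult prob0_square E0 R0 borel_measurable_const) auto
  show "(%w. ennreal ((x l i w)^2)) : bmeas M" for l using xM[OF i, of l] by measurable
  fix l w
  have "(x l i w)^2 <= 4 * (E l i w)^2 + 4 * (R (Suc i) l w)^2 + 4 * (R i l w)^2"
  proof -
   have "(E l i w - R (Suc i) l w)^2 <= 2 * (E l i w)^2 + 2 * (R (Suc i) l w)^2"
    using square_add_le[of "E l i w" "- R (Suc i) l w"] by simp
   moreover have "0 <= (R i l w)^2" by simp
   ultimately show ?thesis
    unfolding x_def using square_add_le[of "E l i w - R (Suc i) l w" "R i l w"] by linarith
  qed
  then have "ennreal ((x l i w)^2) <= ennreal (4 * (E l i w)^2 + 4 * (R (Suc i) l w)^2 + 4 * (R i l w)^2)"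
   by (rule ennreal_leI)
  then show "ennreal ((x l i w)^2) <= ennreal 4 * ennreal ((E l i w)^2) + ennreal 4 * ennreal ((R (Suc i) l w)^2) + ennreal 4 * ennreal ((R i l w)^2)"
   by (simp add: ennreal_mult')
 qed
 define W where "W = (%l w. SUM i<n. (ta i w)\<^sup>2 * (x l i w)^2)"
 have W0: "prob0 M (%l w. ennreal (W l w))"
 proof -
  have "prob0 M (%l w. SUM i<n. ennreal ((ta i w)^2) * ennreal ((x l i w)^2))"
   using taM by (intro prob0_sum prob0_mult x0) auto
  moreover have "ennreal (W l w) = (SUM i<n. ennreal ((ta i w)^2) * ennreal ((x l i w)^2))" for l w
   unfolding W_def by (subst sum_ennreal[symmetric]) (auto simp: ennreal_mult')
  ultimately show ?thesis by simp
 qed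
 define U where "U = (%l w. SUM i<n. ennreal ((ta i w)^2) * q (Suc i) l w)"
 have U0: "prob0 M U"
  unfolding U_def using taM by (intro prob0_sum prob0_mult q0) auto
 let ?I = "%J b w eps. SUM i:J b. ta i w * eps i w"
 define V where "V = (%w. SUM b:I. (?I J b w eps)\<^sup>2)"
 define VD where "VD = (%l w. SUM b:I. (?D J b w D l)\<^sup>2)"
 let ?F = "%J b w l. SUM i:J b. (ta i w)\<^sup>2 * (x l i w)^2"
 have V: "V w <= 2 * VD l w + 2 * (real n * W l w)" for l w
 proof -
  have finJ: "finite (J b)" if "b : I" for b using I(2)[OF that] finite_subset by auto
  have "(?I J b w eps)^2 <= 2 * (?D J b w D l)^2 +
    2 * (real n * (?F J b w l))" if b: "b : I" for b
  proof -
   have "(?I J b w eps) = (?D J b w D l) + (SUM i:J b. ta i w * x l i w)"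
    unfolding sum.distrib[symmetric] distrib_left[symmetric] using I(2)[OF b] eps[of _ w l]
    by (intro sum.cong) auto
   moreover have "(SUM i:J b. ta i w * x l i w)^2 <= real n * (?F J b w l)"
   proof -
    have "card (J b) <= n" using card_mono[OF _ I(2)[OF b]] by simp
    then have "card (J b) * (SUM i:J b. (ta i w * x l i w)\<^sup>2) <= n * (SUM i:J b. (ta i w * x l i w)\<^sup>2)"
     by (intro mult_right_mono) (auto intro: sum_nonneg)
    then show ?thesis using sum_square_le_card[OF finJ[OF b], of "%i. ta i w * x l i w"]
     by (simp add: power_mult_distrib)
   qed
   ultimately show ?thesis
    using square_add_le[of "SUM i:J b. ta i w * D l i w" "SUM i:J b. ta i w * x l i w"] by simp
  qed
  then have "V w <= (SUM b:I. 2 * (?D J b w D l)^2 +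
    2 * (real n * (?F J b w l)))"
   unfolding V_def by (rule sum_mono)
  also have "... = 2 * VD l w + 2 * (real n * (SUM b:I. SUM i:J b. (ta i w)\<^sup>2 * (x l i w)^2))"
   by (simp add: VD_def sum.distrib sum_distrib_left)
  also have "(SUM b:I. SUM i:J b. (ta i w)\<^sup>2 * (x l i w)^2) = (SUM i:(\<Union>b\<in>I. J b). (ta i w)^2 * (x l i w)^2)"
   using I finJ by (intro sum.UNION_disjoint[symmetric]) (auto simp: disjoint_family_on_def)
  also have "... <= W l w"
   unfolding W_def using I(2) by (intro sum_mono2) auto
  finally show ?thesis by (simp add: mult_left_mono)
 qed
 \<comment> \<open>From \<open>V <= 2 * VD + 2 * n * W\<close> and \<open>e <= V\<close> it follows
   that \<open>VD\<close> is at least \<open>e / 4\<close> or \<open>W\<close> is at least this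
   value; \<open>n + 1\<close> also serves the empty partition.\<close>
 let ?G = "%e. e / (4 * (real n + 1))"
 have bound: "prob {w:space M. e <= V w} <=
   prob {w:space M. ennreal (?G e) <= ennreal (W l w)} + prob {w:space M. ennreal dl <= U l w}
   + (prob {w:space M. ennreal dl <= Q w} + 16 * dl / e)" for l
 proof -
  let ?A = "{w:space M. e / 4 <= VD l w}" and ?B = "{w:space M. ennreal (?G e) <= ennreal (W l w)}"
  have A: "?A : sets M"
  proof -
   have "VD l : bmeas M"
    unfolding VD_def
   proof (rule borel_measurable_sum)
    fix b assume b: "b : I"
    have "(%w. SUM i:J b. ta i w * D l i w) : bmeas M"
    proof (rule borel_measurable_sum)
     fix i assume "i : J b"
     then have "i < n" using I(2)[OF b] by auto
     then show "(%w. ta i w * D l i w) : bmeas M"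
      by (intro borel_measurable_times taM DM)
    qed
    then show "(%w. (?D J b w D l)\<^sup>2) : bmeas M"
     by (rule borel_measurable_power)
   qed
   then show ?thesis by measurable
  qed
  have B: "?B : sets M" using prob0_measurable[OF W0, of l] by measurable
  have C: "{w:space M. ennreal dl <= U l w} : sets M" "{w:space M. ennreal dl <= Q w} : sets M"
   using prob0_measurable[OF U0, of l] QM by measurable
  have "prob {w:space M. e <= V w} <= prob (?A \<union> ?B)"
  proof (rule finite_measure_mono)
   show "{w:space M. e <= V w} \<subseteq> ?A \<union> ?B"
   proof safe
    fix w assume w: "w : space M" "e <= V w" "\<not> ennreal (?G e) <= ennreal (W l w)"
    have W: "0 <= W l w" by (simp add: W_def sum_nonneg)
    have "W l w < e / (4 * (real n + 1))" using w(3) W by (simp add: ennreal_le_iff2 not_le)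
    then have "(real n + 1) * W l w < e / 4" by (simp add: field_simps)
    then have "2 * (real n * W l w) <= e / 2" using W by (simp add: algebra_simps)
    then show "e / 4 <= VD l w" using V[of w l] w(2) by simp
   qed
  qed (use A B in auto)
  also have "... <= prob ?A + prob ?B" using A B by (rule measure_Un_le)
  \<comment> \<open>The bound is used at level \<open>4 * dl\<close> and threshold
    \<open>e / 4\<close>, whence the factor 16. The level \<open>4 * dl\<close> is what the
    splitting into \<open>2 * U + 2 * Q\<close> requires.\<close>
  also have "prob ?A <= prob {w:space M. ennreal (4 * dl) < (SUM i<n. ennreal ((ta i w)^2) *
     (?C i l w))} + 16 * dl / e"
   using bD[of "4 * dl" "e / 4" l] de by (simp add: VD_def)
  also have "prob {w:space M. ennreal (4 * dl) < (SUM i<n. ennreal ((ta i w)^2) *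
     (?C i l w))} <=
    prob ({w:space M. ennreal dl <= U l w} \<union> {w:space M. ennreal dl <= Q w})"
  proof (rule finite_measure_mono)
   show "{w:space M. ennreal (4 * dl) < (SUM i<n. ennreal ((ta i w)^2) *
     (?C i l w))} \<subseteq>
    {w:space M. ennreal dl <= U l w} \<union> {w:space M. ennreal dl <= Q w}"
   proof (intro subsetI)
    fix w assume "w : {w:space M. ennreal (4 * dl) < (SUM i<n. ennreal ((ta i w)^2) *
     (?C i l w))}"
    then have w: "w : space M" and "ennreal (4 * dl) < (SUM i<n. ennreal ((ta i w)^2) *
     (?C i l w))" by auto
    note this(2)
    also have "... <= (SUM i<n. ennreal ((ta i w)^2) * (2 * q (Suc i) l w +
      2 * (?E i w)))"
    proof (intro sum_mono mult_left_mono)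
     fix i assume "i : {..<n}"
     then have i: "i < n" by simp
     have "(?C i l w) <=
       2 * (L2 {s i..s (Suc i)} (?H l i w)) +
       2 * (L2 {s i..s (Suc i)} (%r. H r w - H (s i) w))"
      using i w s0[of i] by (intro square_integral_triangle um Hsec[of "Suc i"]) auto
     also have "(L2 {s i..s (Suc i)} (?H l i w)) <= q (Suc i) l w"
      unfolding q_def using s0[of i] i by (intro nn_integral_mono) (auto simp: indicator_def)
     finally show "(?C i l w) <=
       2 * q (Suc i) l w + 2 * (?E i w)"
      by (simp add: add_right_mono mult_left_mono power2_commute[of "H (s i) w"])
    qed simp
    also have "... = 2 * U l w + 2 * Q w"
     unfolding U_def Q_def sum_distrib_left sum.distrib[symmetric]
     by (intro sum.cong refl) (simp only: distrib_left mult.left_commute)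
    finally have lt: "ennreal (4 * dl) < 2 * U l w + 2 * Q w" .
    have "ennreal dl <= U l w | ennreal dl <= Q w"
    proof (rule ccontr)
     assume "\<not> ?thesis"
     then have "2 * U l w + 2 * Q w <= 2 * ennreal dl + 2 * ennreal dl"
      by (intro add_mono mult_left_mono) auto
     also have "... = ennreal (2 * dl + 2 * dl)" using de by (subst ennreal_plus) (auto simp: ennreal_mult')
     also have "2 * dl + 2 * dl = 4 * dl" by simp
     finally show False using lt by simp
    qed
    then show "w : {w:space M. ennreal dl <= U l w} \<union> {w:space M. ennreal dl <= Q w}" using w by simp
   qed
  qed (use C in auto)
  also have "... <= prob {w:space M. ennreal dl <= U l w} + prob {w:space M. ennreal dl <= Q w}"
   using C by (rule measure_Un_le)
  finally show ?thesis by simp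
 qed
 have "(%l. prob {w:space M. ennreal (?G e) <= ennreal (W l w)} + prob {w:space M. ennreal dl <= U l w}
   + (prob {w:space M. ennreal dl <= Q w} + 16 * dl / e)) ~> 0 + 0 + (prob {w:space M. ennreal dl <= Q w} + 16 * dl / e)"
  using W0 U0 de by (intro tendsto_add tendsto_const) (auto simp: prob0_def)
 from LIMSEQ_le_const[OF this] bound
 show "prob {w:space M. e <= (SUM b:I. (?I J b w eps)\<^sup>2)} <= prob {w:space M. ennreal dl <= Q w} + 16 * dl / e"
  by (auto simp: V_def)
qed

end

section \<open>Dyadic approximation of Ito integrals\<close>

definition dyadic :: "real => real => nat => nat => real" where
 "dyadic t0 t1 k i = t0 + (t1 - t0) * real i / 2 ^ k"

lemma dyadic_0 [simp]: "dyadic t0 t1 k 0 = t0"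
 by (simp add: dyadic_def)

lemma dyadic_end [simp]: "dyadic t0 t1 k (2 ^ k) = t1"
 by (simp add: dyadic_def)

lemma dyadic_Suc: "dyadic t0 t1 k (Suc i) = dyadic t0 t1 k i + (t1 - t0) / 2 ^ k"
 by (simp add: dyadic_def field_simps)

lemma dyadic_bounds:
 assumes "t0 <= t1" "i <= 2 ^ k"
 shows "t0 <= dyadic t0 t1 k i" "dyadic t0 t1 k i <= t1"
proof -
 have "0 <= real i / 2 ^ k" "real i / 2 ^ k <= 1"
 using assms(2) by auto
 then have "0 <= (t1 - t0) * (real i / 2 ^ k)" "(t1 - t0) * (real i / 2 ^ k) <= (t1 - t0) * 1"
  using assms(1) by (intro mult_nonneg_nonneg mult_left_mono; simp)+
 moreover define x where "x = (t1 - t0) * (real i / 2 ^ k)"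
 ultimately have "0 <= x" "x <= t1 - t0" by simp_all
 moreover have "dyadic t0 t1 k i = t0 + x" by (simp add: dyadic_def x_def)
 ultimately show "t0 <= dyadic t0 t1 k i" "dyadic t0 t1 k i <= t1" by linarith+
qed

lemma mesh_tendsto: "(%k. (t1 - t0) / 2 ^ k :: real) ~> 0"
 by real_asymp

lemma mesh_eventually:
 assumes "eps > (0::real)" shows "EV k. (t1 - t0) / 2 ^ k < eps"
 using order_tendstoD(2)[OF mesh_tendsto assms] .

lemma ennreal_tendsto_0I:
 fixes X :: "nat => ennreal"
 assumes "!!e. e > 0 ==> EV k. X k <= ennreal e"
 shows "X ~> 0"
proof (rule order_tendstoI)
 fix a :: ennreal assume "0 < a"
 from dense[OF this] obtain b where b: "0 < b" "b < a" by blast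
 then obtain e where "b = ennreal e" "0 <= e" by (cases b) auto
 with b have e: "0 < e" "ennreal e < a" by auto
 from assms[OF e(1)] show "EV k. X k < a"
  by eventually_elim (use e(2) in auto)
qed auto

lemma uniform_continuity_on_interval:
 fixes f :: "real => real"
 assumes "continuous_on {a..b} f" "eps > 0"
 obtains d where "d > 0" "!!x y. x : {a..b} ==> y : {a..b} ==> abs (x - y) < d ==> abs (f x - f y) < eps"
proof -
 have "uniformly_continuous_on {a..b} f"
  by (rule compact_uniformly_continuous[OF assms(1) compact_Icc])
 then obtain d where "d > 0" "ALL x:{a..b}. ALL x':{a..b}. dist x' x < d --> dist (f x') (f x) < eps"
  using assms(2) unfolding uniformly_continuous_on_def by blast
 then show ?thesis using that[of d] by (auto simp: dist_real_def)
qed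

lemma continuous_on_interval_bound:
 fixes f :: "real => real"
 assumes "continuous_on {a..b} f"
 obtains K where "K >= 0" "!!x. x : {a..b} ==> abs (f x) <= K"
proof -
 have "bounded (f ` {a..b})"
  by (intro compact_imp_bounded compact_continuous_image assms compact_Icc)
 then obtain K where "ALL x:{a..b}. abs (f x) <= K" by (auto simp: bounded_iff)
 then show ?thesis using that[of "abs K"] by fastforce
qed

context brownian
begin

context
 fixes H ta :: "real => 'a => real" and Y :: "real => 'a => real" and t0 t1 :: real
 assumes t: "0 <= t0" "t0 <= t1"
  and ito: "!!r. 0 <= r ==> has_ito_integral M \<F> B H r (Y r)"
  and Hc: "!!w. w : space M ==> continuous_on {0..} (%r. H r w)"
  and taF: "!!r. 0 <= r ==> ta r : bmeas (\<F> r)"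
  and tac: "!!w. w : space M ==> continuous_on {0..} (%r. ta r w)"
begin

definition ito_error :: "nat => nat => 'a => real" where
 "ito_error k i w = Y (dyadic t0 t1 k (Suc i)) w - Y (dyadic t0 t1 k i) w
   - H (dyadic t0 t1 k i) w * (B (dyadic t0 t1 k (Suc i)) w - B (dyadic t0 t1 k i) w)"

definition ito_energy :: "nat => 'a => ennreal" where
 "ito_energy k w = (SUM i<2 ^ k. ennreal ((ta (dyadic t0 t1 k i) w)^2) *
   (L2 {dyadic t0 t1 k i..dyadic t0 t1 k (Suc i)} (%r. H (dyadic t0 t1 k i) w - H r w)))"

lemma dyadic_nonneg: "i <= 2 ^ k ==> 0 <= dyadic t0 t1 k i"
 using dyadic_bounds(1)[OF t(2)] t(1) by (rule order.trans[rotated])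

lemma dyadic_mono_Suc: "dyadic t0 t1 k i <= dyadic t0 t1 k (Suc i)"
 using t by (simp add: dyadic_Suc)

lemma ito_energy_tendsto:
 assumes w: "w : space M" shows "(%k. ito_energy k w) ~> 0"
proof (rule ennreal_tendsto_0I)
 fix e :: real assume e: "e > 0"
 have sub: "{t0..t1} \<subseteq> {0..}" using t by auto
 obtain K where K: "K >= 0" "!!r. r : {t0..t1} ==> abs (ta r w) <= K"
  by (rule continuous_on_interval_bound[OF continuous_on_subset[OF tac[OF w] sub]]) (rule that; assumption)
 \<comment> \<open>The oscillation of \<open>H\<close> on one dyadic cell that keeps the weighted
   energy \<open>K^2 * (t1 - t0) * c^2\<close> below \<open>e\<close>; adding 1 keeps the
   denominator positive.\<close>
 define c where "c = sqrt (e / (K^2 * (t1 - t0) + 1))"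
 have den: "K^2 * (t1 - t0) + 1 > 0" using t by (simp add: add_nonneg_pos)
 have c: "c > 0" "c^2 = e / (K^2 * (t1 - t0) + 1)" using e den by (auto simp: c_def)
 let ?A = "%t1 t0 k. c^2 * ((t1 - t0) / 2 ^ k)"
 obtain d where d: "d > 0" "!!x y. x : {t0..t1} ==> y : {t0..t1} ==> abs (x - y) < d ==> abs (H x w - H y w) < c"
  by (rule uniform_continuity_on_interval[OF continuous_on_subset[OF Hc[OF w] sub] c(1)]) (rule that; assumption)
 from mesh_eventually[OF d(1), of t1 t0] show "EV k. ito_energy k w <= ennreal e"
 proof eventually_elim
  case (elim k)
  have "ito_energy k w <= (SUM i<(2::nat) ^ k. ennreal (K^2) * ennreal (?A t1 t0 k))"
   unfolding ito_energy_def
  proof (intro sum_mono mult_mono)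
   fix i :: nat assume "i : {..<2 ^ k}"
   then have i: "i < 2 ^ k" by simp
   let ?s = "dyadic t0 t1 k i" and ?s' = "dyadic t0 t1 k (Suc i)"
   have s: "?s : {t0..t1}" "?s' : {t0..t1}" using dyadic_bounds[OF t(2)] i by auto
   show "ennreal ((ta ?s w)^2) <= ennreal (K^2)"
    using power_mono[OF K(2)[OF s(1)] abs_ge_zero, of 2] by (intro ennreal_leI) simp
   have "(L2 {?s..?s'} (%r. H ?s w - H r w)) <= (\<integral>\<^sup>+r\<in>{?s..?s'}. ennreal (c^2) \<partial>lborel)"
   proof (rule nn_integral_mono)
    fix r
    show "ennreal ((H ?s w - H r w)^2) * indicator {?s..?s'} r <= ennreal (c^2) * indicator {?s..?s'} r"
    proof (cases "r : {?s..?s'}")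
     case True
     then have "abs (?s - r) < d" using elim by (auto simp: dyadic_Suc)
     then have "abs (H ?s w - H r w) <= c" using d(2)[of ?s r] s True by auto
     from power_mono[OF this abs_ge_zero, of 2] show ?thesis
      by (intro mult_right_mono ennreal_leI) auto
    qed simp
   qed
   also have "... = ennreal (c^2) * emeasure lborel {?s..?s'}"
    by (simp add: nn_integral_cmult_indicator)
   also have "emeasure lborel {?s..?s'} = ennreal ((t1 - t0) / 2 ^ k)"
    using dyadic_mono_Suc[of k i] by (simp add: dyadic_Suc)
   also have "ennreal (c^2) * ... = ennreal (?A t1 t0 k)"
    using t by (intro ennreal_mult[symmetric]) auto
   finally show "(L2 {?s..?s'} (%r. H ?s w - H r w)) <= ennreal (?A t1 t0 k)" .
  qed auto
  also have "... = (SUM i<(2::nat) ^ k. ennreal (K^2 * (?A t1 t0 k)))"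
   using t by (intro sum.cong refl ennreal_mult[symmetric]) auto
  also have "... = ennreal (SUM i<(2::nat) ^ k. K\<^sup>2 * (?A t1 t0 k))"
   using t by (intro sum_ennreal) auto
  also have "(SUM i<(2::nat) ^ k. K\<^sup>2 * (?A t1 t0 k)) = c^2 * (K^2 * (t1 - t0))"
   by simp
  also have "... <= e"
  proof -
   have "e * (K^2 * (t1 - t0)) <= e * (K^2 * (t1 - t0) + 1)" using e by (intro mult_left_mono) auto
   then show ?thesis unfolding c(2) using den by (simp add: divide_le_eq)
  qed
  finally show ?case by (simp add: ennreal_leI)
 qed
qed

text \<open>By uniform continuity the energy tends to 0 on every path, hence in probability, and the
  tail bound passes this on to the left-point errors. The blocks may change with the level
  \<open>k\<close>.\<close>

lemma ito_error_prob0: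
 assumes I: "!!k. finite (I k)" "!!k b. b : I k ==> J k b \<subseteq> {..<2 ^ k}" "!!k. disjoint_family_on (J k) (I k)"
 shows "prob0 M (%k w. ennreal (SUM b:I k. (SUM i:J k b. ta (dyadic t0 t1 k i) w * ito_error k i w)\<^sup>2))"
proof (rule prob0_Lenglart[where C = 16])
 let ?Y = "%k i. Y (dyadic t0 t1 k i)" and ?ta = "%k i. ta (dyadic t0 t1 k i)"
 have ito': "has_ito_integral M \<F> B H (dyadic t0 t1 k i) (?Y k i)" if "i <= 2 ^ k" for k i
  using ito[OF dyadic_nonneg[OF that]] .
 have ta': "?ta k i : bmeas (\<F> (dyadic t0 t1 k i))" if "i < 2 ^ k" for k i
  using taF[OF dyadic_nonneg] that by simp
 have s0: "0 <= dyadic t0 t1 k 0" for k using t by simp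
 let ?A = "%J k b ta t0 t1 w. SUM i:J k b. ta (dyadic t0 t1 k i) w * ito_error k i w"
 have tail: "prob {w:space M. eps <= (SUM b:I k. (?A J k b ta t0 t1 w)\<^sup>2)} <=
   prob {w:space M. ennreal dl <= ito_energy k w} + 16 * dl / eps & ito_energy k : bmeas M"
  if "dl > 0" "eps > 0" for k dl eps
 proof -
  note * = ito_error_tail[where s = "dyadic t0 t1 k" and n = "2 ^ k" and Y = "?Y k" and H = H and ta = "?ta k"
   and I = "I k" and J = "J k", OF s0 dyadic_mono_Suc ito' ta' I that]
  show ?thesis
   unfolding ito_error_def[abs_def] ito_energy_def[abs_def] using * by (intro conjI)
 qed
 have Q: "ito_energy k : bmeas M" for k
  using tail[of 1 1] by simp
 show "prob0 M ito_energy"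
  by (rule AE_prob0[OF Q]) (use ito_energy_tendsto in auto)
 have YM: "ito_error k i : bmeas M" if "i < 2 ^ k" for k i
 proof -
  have n: "0 <= dyadic t0 t1 k i" "0 <= dyadic t0 t1 k (Suc i)" using dyadic_nonneg that by auto
  have "H (dyadic t0 t1 k i) : bmeas M"
   using has_ito_integral_measurable(4)[OF ito[OF n(1)] n(1) order_refl] by (rule measurable_F_M)
  then show ?thesis
   unfolding ito_error_def[abs_def]
   using has_ito_integral_measurable(3)[OF ito[OF n(1)]] has_ito_integral_measurable(3)[OF ito[OF n(2)]]
    B_measurable[OF n(1)] B_measurable[OF n(2)]
   by (intro borel_measurable_diff borel_measurable_times)
 qed
 show "(%w. SUM b:I k. (?A J k b ta t0 t1 w)\<^sup>2) : bmeas M" for k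
 using I(2) by (auto intro!: borel_measurable_times YM measurable_F_M[OF ta'] borel_measurable_sum borel_measurable_power)
 fix k and dl eps :: real assume de: "dl > 0" "eps > 0"
 show "prob {w:space M. eps <= (SUM b:I k. (?A J k b ta t0 t1 w)\<^sup>2)} <=
   prob {w:space M. ennreal dl <= ito_energy k w} + 16 * dl / eps"
  using tail[OF de] by simp
qed simp

lemma ito_error_sum_prob0:
 "prob0 M (%k w. ennreal ((SUM i<2 ^ k. ta (dyadic t0 t1 k i) w * ito_error k i w)^2))"
proof -
 have "prob0 M (%k w. ennreal (SUM b:{()}. (SUM i<2 ^ k. ta (dyadic t0 t1 k i) w * ito_error k i w)^2))"
  by (rule ito_error_prob0) (auto simp: disjoint_family_on_def)
 then show ?thesis
  by (simp only: sum.insert finite.emptyI empty_iff not_False_eq_True sum.empty add_0_right)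
qed

lemma ito_error_squares_prob0:
 "prob0 M (%k w. ennreal (SUM i<2 ^ k. (ta (dyadic t0 t1 k i) w * ito_error k i w)\<^sup>2))"
proof -
 have "prob0 M (%k w. ennreal (SUM b<2 ^ k. (SUM i:{b}. ta (dyadic t0 t1 k i) w * ito_error k i w)\<^sup>2))"
  by (rule ito_error_prob0) (auto simp: disjoint_family_on_def)
 then show ?thesis
  by (simp only: sum.insert finite.emptyI empty_iff not_False_eq_True sum.empty add_0_right)
qed

end

end

section \<open>Quadratic variation and covariation along dyadic partitions\<close>

context prob_space
begin

text \<open>The sum of the squares has finite expectation, hence is finite almost surely. Geometric
  decay of the second moments thus gives convergence along the full sequence of levels.\<close>

lemma AE_tendsto_0_of_summable_squares:
 fixes X :: "nat => 'a => real"
 assumes int: "!!k. integrable M (%w. (X k w)\<^sup>2)" and le: "!!k. expectation (%w. (X k w)\<^sup>2) <= c / 2 ^ k"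
  and c: "0 <= c"
 shows "AE w in M. (%k. X k w) ~> 0"
proof -
 have meas: "(%w. ennreal ((X k w)^2)) : bmeas M" for k using int[of k] by simp
 let ?A = "\<integral>\<^sup>+w. (\<Sum>k. ennreal ((X k w)^2)) \<partial>M"
 have "?A = (\<Sum>k. \<integral>\<^sup>+w. ennreal ((X k w)^2) \<partial>M)"
  by (rule nn_integral_suminf[OF meas])
 also have "... = (\<Sum>k. ennreal (expectation (%w. (X k w)\<^sup>2)))"
  using int by (intro suminf_cong nn_integral_eq_integral) auto
 also have "... <= (\<Sum>k. ennreal (c / 2 ^ k))"
  using le by (intro suminf_le ennreal_leI) auto
 also have "... = ennreal (\<Sum>k. c / 2 ^ k)"
 proof (rule suminf_ennreal2)
  have "summable (%k. c * (1 / 2) ^ k)" by (intro summable_mult summable_geometric) simp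
  then show "summable (%k. c / 2 ^ k)" by (simp add: power_divide)
 qed (use c in simp)
 finally have "?A ~= \<infinity>"
  using le_less_trans[OF _ ennreal_less_top] by fastforce
 then have "AE w in M. (\<Sum>k. ennreal ((X k w)^2)) ~= \<infinity>"
  using meas by (intro nn_integral_PInf_AE borel_measurable_suminf) auto
 then show ?thesis
 proof eventually_elim
  case (elim w)
  then have "summable (%k. (X k w)\<^sup>2)" by (intro summable_suminf_not_top) auto
  then have "(%k. (X k w)\<^sup>2) ~> 0" by (rule summable_LIMSEQ_zero)
  then have "(%k. sqrt ((X k w)^2)) ~> sqrt 0" by (rule tendsto_real_sqrt)
  then show ?case by (simp add: tendsto_rabs_zero_iff)
 qed
qed

lemma indep_vars_pair:
 assumes "indep_vars M' X I" "i : I" "j : I" "i ~= j"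
  and f: "f : measurable (M' i) N1" and g: "g : measurable (M' j) N2"
 shows "indep_var N1 (%w. f (X i w)) N2 (%w. g (X j w))"
proof -
 have "indep_var (PiM {i} M') (%w. restrict (%i. X i w) {i}) (PiM {j} M') (%w. restrict (%i. X i w) {j})"
  using assms by (intro indep_var_restrict[OF assms(1)]) auto
 moreover have "(%h. f (h i)) : measurable (PiM {i} M') N1"
  using f by (intro measurable_compose[OF measurable_component_singleton]) auto
 moreover have "(%h. g (h j)) : measurable (PiM {j} M') N2"
  using g by (intro measurable_compose[OF measurable_component_singleton]) auto
 ultimately have "indep_var N1 ((%h. f (h i)) \<circ> (%w. restrict (%i. X i w) {i})) N2 ((%h. g (h j)) \<circ> (%w. restrict (%i. X i w) {j}))"
  by (rule indep_var_compose)
 then show ?thesis by (simp add: o_def)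
qed

end

context brownian
begin

lemma increments_orthogonal:
 assumes "0 <= s" "s <= t" "t <= s'" "s' <= t'"
 shows "integrable M (%w. (B t w - B s w) * (B t' w - B s' w))"
  and "expectation (%w. (B t w - B s w) * (B t' w - B s' w)) = 0"
proof -
 have F: "(%w. B t w - B s w) : bmeas (\<F> s')"
  using assms by (intro borel_measurable_diff B_measurable_F) auto
 have "integrable M (%w. B t w - B s w)" using increment_moments(1)[OF assms(1,2), of 1] by simp
 from increment_mult_power(1)[OF _ assms(4) F this, of 1] increment_mult_power(2)[OF _ assms(4) F this] assms
 show "integrable M (%w. (B t w - B s w) * (B t' w - B s' w))"
  "expectation (%w. (B t w - B s w) * (B t' w - B s' w)) = 0" by auto
qed

lemma squared_increments_orthogonal:
 assumes "0 <= s" "s <= t" "t <= s'" "s' <= t'"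
 shows "integrable M (%w. ((B t w - B s w)^2 - (t - s)) * ((B t' w - B s' w)^2 - (t' - s')))"
  and "expectation (%w. ((B t w - B s w)^2 - (t - s)) * ((B t' w - B s' w)^2 - (t' - s'))) = 0"
proof -
 let ?Y = "%w. (B t w - B s w)\<^sup>2 - (t - s)"
 have F: "?Y : bmeas (\<F> s')"
  using assms by (intro borel_measurable_diff borel_measurable_power B_measurable_F borel_measurable_const) auto
 have s': "0 <= s'" using assms by simp
 have iY: "integrable M ?Y"
  by (intro integrable_diff increment_moments(1) assms integrable_const)
 have eY: "expectation ?Y = 0"
  using increment_moments(1)[OF assms(1,2), of 2] increment_moments(3)[OF assms(1,2)]
  by (subst integral_diff) (auto simp: prob_space)
 note m = increment_mult_power(1)[OF s' assms(4) F iY, of 2] increment_mult_power(3)[OF s' assms(4) F iY]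
 have i2: "integrable M (%w. ?Y w * (t' - s'))" using iY by (rule integrable_mult_left)
 have eq: "(%w. ?Y w * ((B t' w - B s' w)^2 - (t' - s'))) = (%w. ?Y w * (B t' w - B s' w)^2 - ?Y w * (t' - s'))"
  by (rule ext) (rule right_diff_distrib)
 show "integrable M (%w. ?Y w * ((B t' w - B s' w)^2 - (t' - s')))"
  unfolding eq by (rule integrable_diff[OF m(1) i2])
 have "expectation (%w. ?Y w * (B t' w - B s' w)^2 - ?Y w * (t' - s')) =
   expectation (%w. ?Y w * (B t' w - B s' w)^2) - expectation (%w. ?Y w * (t' - s'))"
  by (rule integral_diff[OF m(1) i2])
 also have "expectation (%w. ?Y w * (t' - s')) = expectation ?Y * (t' - s')"
  by (rule integral_mult_left_zero)
 finally show "expectation (%w. ?Y w * ((B t' w - B s' w)^2 - (t' - s'))) = 0"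
  unfolding eq m(2) eY by simp
qed

lemma squared_increment_variance:
 assumes "0 <= s" "s <= t"
 shows "integrable M (%w. ((B t w - B s w)^2 - (t - s)) * ((B t w - B s w)^2 - (t - s)))"
  and "expectation (%w. ((B t w - B s w)^2 - (t - s)) * ((B t w - B s w)^2 - (t - s))) <= 2 * (t - s)^2"
proof -
 let ?D = "%w. B t w - B s w"
 note m = increment_moments[OF assms]
 have eq: "(%w. ((?D w)^2 - (t - s)) * ((?D w)^2 - (t - s))) = (%w. (?D w) ^ 4 + (- 2 * (t - s)) * (?D w)^2 + (t - s)^2)"
  by (rule ext) (simp add: power2_eq_square power4_eq_xxxx algebra_simps)
 have i: "integrable M (%w. (?D w) ^ 4)" "integrable M (%w. (- 2 * (t - s)) * (?D w)^2)" "integrable M (%w. (t - s)\<^sup>2)"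
  by (intro integrable_mult_right m integrable_const)+
 show "integrable M (%w. ((?D w)^2 - (t - s)) * ((?D w)^2 - (t - s)))"
  unfolding eq using i by (intro integrable_add)
 have "expectation (%w. (?D w) ^ 4 + (- 2 * (t - s)) * (?D w)^2 + (t - s)^2) =
   expectation (%w. (?D w) ^ 4) + expectation (%w. (- 2 * (t - s)) * (?D w)^2) + expectation (%w. (t - s)\<^sup>2)"
  using i by (simp only: integral_add integrable_add)
 also have "... = 3 * (t - s)^2 + (- 2 * (t - s)) * (t - s) + (t - s)^2"
  unfolding m(4) integral_mult_right_zero m(3) by (simp add: prob_space)
 also have "... = 2 * (t - s)^2" by (simp add: power2_eq_square algebra_simps)
 finally show "expectation (%w. ((?D w)^2 - (t - s)) * ((?D w)^2 - (t - s))) <= 2 * (t - s)^2"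
  unfolding eq by (rule eq_refl)
qed

context
 fixes t0 t1 :: real and J :: "nat => nat set"
 assumes t: "0 <= t0" "t0 <= t1" and J: "!!k. J k \<subseteq> {..<2 ^ k}"
begin

lemma dyadic_ordered:
 assumes "i < j" "j < 2 ^ k"
 shows "0 <= dyadic t0 t1 k i" "dyadic t0 t1 k i <= dyadic t0 t1 k (Suc i)"
  "dyadic t0 t1 k (Suc i) <= dyadic t0 t1 k j" "dyadic t0 t1 k j <= dyadic t0 t1 k (Suc j)"
proof -
 show "0 <= dyadic t0 t1 k i" using t by (simp add: dyadic_def)
 show "dyadic t0 t1 k i <= dyadic t0 t1 k (Suc i)" "dyadic t0 t1 k j <= dyadic t0 t1 k (Suc j)"
  using t by (simp_all add: dyadic_Suc)
 have "(t1 - t0) * real (Suc i) <= (t1 - t0) * real j"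
  using assms t by (intro mult_left_mono) auto
 then show "dyadic t0 t1 k (Suc i) <= dyadic t0 t1 k j"
  unfolding dyadic_def by (simp add: divide_right_mono del: of_nat_Suc)
qed

lemma dyadic_increment: "dyadic t0 t1 k (Suc i) - dyadic t0 t1 k i = (t1 - t0) / 2 ^ k"
 by (simp add: dyadic_Suc)

lemma card_dyadic_bound:
 fixes c :: real assumes "0 <= c"
 shows "card (J k) * (c * ((t1 - t0) / 2 ^ k)^2) <= c * (t1 - t0)^2 / 2 ^ k"
proof -
 have "card (J k) <= 2 ^ k" using card_mono[OF _ J[of k]] by simp
 then have "real (card (J k)) <= real (2 ^ k)" by (rule of_nat_mono)
 then have "card (J k) * (c * ((t1 - t0) / 2 ^ k)^2) <= real (2 ^ k) * (c * ((t1 - t0) / 2 ^ k)^2)"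
  using assms by (intro mult_right_mono) auto
 also have "... = c * (t1 - t0)^2 / 2 ^ k" by (simp add: power2_eq_square field_simps)
 finally show ?thesis .
qed

text \<open>At most \<open>2 ^ k\<close> orthogonal terms with second moments of order
  \<open>4 ^ - k\<close> give a second moment of order \<open>2 ^ - k\<close>, which is
  summable.\<close>

lemma dyadic_sum_AE:
 fixes xi :: "nat => nat => 'a => real"
 assumes diag: "!!k i. i < 2 ^ k ==> integrable M (%w. (xi k i w)\<^sup>2) & expectation (%w. (xi k i w)\<^sup>2) <= c * ((t1 - t0) / 2 ^ k)^2"
  and off: "!!k i j. i < j ==> j < 2 ^ k ==> integrable M (%w. xi k i w * xi k j w) & expectation (%w. xi k i w * xi k j w) = 0"
  and c: "0 <= c"
 shows "AE w in M. (%k. SUM i:J k. xi k i w) ~> 0"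
proof (rule AE_tendsto_0_of_summable_squares)
 fix k
 have fin: "finite (J k)" and sub: "i < 2 ^ k" if "i : J k" for i using J[of k] that finite_subset by auto
 have fin: "finite (J k)" using J[of k] finite_subset by blast
 note o = orthogonal_sum_square[where xi = "xi k", OF fin conjunct1[OF diag[OF sub]] off[OF _ sub]]
 show "integrable M (%w. (SUM i:J k. xi k i w)\<^sup>2)" by (rule o(1))
 have "expectation (%w. (SUM i:J k. xi k i w)\<^sup>2) = (SUM i:J k. expectation (%w. (xi k i w)\<^sup>2))" by (rule o(2))
 also have "... <= card (J k) * (c * ((t1 - t0) / 2 ^ k)^2)" by (rule sum_bounded_above) (use diag sub in blast)
 also have "... <= c * (t1 - t0)^2 / 2 ^ k" by (rule card_dyadic_bound[OF c])
 finally show "expectation (%w. (SUM i:J k. xi k i w)\<^sup>2) <= c * (t1 - t0)^2 / 2 ^ k" .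
qed (use c in simp)

lemma quadratic_variation_AE:
 "AE w in M. (%k. SUM i:J k. (B (dyadic t0 t1 k (Suc i)) w - B (dyadic t0 t1 k i) w)\<^sup>2 - (t1 - t0) / 2 ^ k) ~> 0"
proof -
 define xi where "xi = (%k i w. (B (dyadic t0 t1 k (Suc i)) w - B (dyadic t0 t1 k i) w)\<^sup>2
   - (dyadic t0 t1 k (Suc i) - dyadic t0 t1 k i))"
 have off: "integrable M (%w. xi k i w * xi k j w) & expectation (%w. xi k i w * xi k j w) = 0" if "i < j" "j < 2 ^ k" for k i j
  unfolding xi_def using squared_increments_orthogonal[OF dyadic_ordered[OF that]] by (rule conjI)
 let ?A = "%k i. %w. xi k i w * xi k i w"
 have diag: "integrable M (?A k i)"
  "expectation (?A k i) <= 2 * ((t1 - t0) / 2 ^ k)^2" for k i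
 proof -
  have s: "0 <= dyadic t0 t1 k i" "dyadic t0 t1 k i <= dyadic t0 t1 k (Suc i)"
   using t by (simp_all add: dyadic_Suc, simp add: dyadic_def)
  show "integrable M (?A k i)"
   unfolding xi_def by (rule squared_increment_variance(1)[OF s])
  have "expectation (?A k i) <= 2 * (dyadic t0 t1 k (Suc i) - dyadic t0 t1 k i)^2"
   unfolding xi_def by (rule squared_increment_variance(2)[OF s])
  then show "expectation (?A k i) <= 2 * ((t1 - t0) / 2 ^ k)^2"
   unfolding dyadic_increment .
 qed
 have "AE w in M. (%k. SUM i:J k. xi k i w) ~> 0"
  by (rule dyadic_sum_AE[where c = 2]) (use off diag in \<open>auto simp: power2_eq_square\<close>)
 then show ?thesis unfolding xi_def dyadic_increment .
qed

text \<open>Independence of the two paths factors \<open>E[(d i * d' i) * (d j * d' j)]\<close> into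
  \<open>E[d i * d j] * E[d' i * d' j]\<close>, which is the squared mesh for \<open>i = j\<close>
  and 0 otherwise. The two motions may refer to different filtrations.\<close>

lemma covariation_AE:
 assumes B': "brownian M \<F>' B'"
  and indep: "indep_var (PiM {0..} (%_. borel)) (%w. \<lambda>s\<in>{0..}. B s w) (PiM {0..} (%_. borel)) (%w. \<lambda>s\<in>{0..}. B' s w)"
 shows "AE w in M. (%k. SUM i:J k. (B (dyadic t0 t1 k (Suc i)) w - B (dyadic t0 t1 k i) w) *
   (B' (dyadic t0 t1 k (Suc i)) w - B' (dyadic t0 t1 k i) w)) ~> 0"
proof -
 interpret B': brownian M \<F>' B' by fact
 define d where "d = (%k i w. B (dyadic t0 t1 k (Suc i)) w - B (dyadic t0 t1 k i) w)"
 define d' where "d' = (%k i w. B' (dyadic t0 t1 k (Suc i)) w - B' (dyadic t0 t1 k i) w)"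
 have pos: "0 <= dyadic t0 t1 k i" "dyadic t0 t1 k i <= dyadic t0 t1 k (Suc i)" for k i
  using t by (simp_all add: dyadic_Suc, simp add: dyadic_def)
 have dd: "integrable M (%w. d k i w * d k j w) & expectation (%w. d k i w * d k j w) = (if i = j then (t1 - t0) / 2 ^ k else 0)"
  "integrable M (%w. d' k i w * d' k j w) & expectation (%w. d' k i w * d' k j w) = (if i = j then (t1 - t0) / 2 ^ k else 0)"
  if "i <= j" "j < 2 ^ k" for k i j
  using increments_orthogonal[OF dyadic_ordered[of i j k]] increment_moments(1)[OF pos[of k i], of 2] increment_moments(3)[OF pos[of k i]]
   B'.increments_orthogonal[OF dyadic_ordered[of i j k]] B'.increment_moments(1)[OF pos[of k i], of 2] B'.increment_moments(3)[OF pos[of k i]] that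
  by (cases "i = j"; simp add: d_def d'_def dyadic_increment power2_eq_square)+
 define xi where "xi = (%k i w. d k i w * d' k i w)"
 let ?A = "%k i j. %w. xi k i w * xi k j w"
 have all: "integrable M (?A k i j) &
   expectation (?A k i j) = (if i = j then ((t1 - t0) / 2 ^ k)^2 else 0)" if ij: "i <= j" "j < 2 ^ k" for k i j
 proof -
  let ?f = "%x::real => real. (x (dyadic t0 t1 k (Suc i)) - x (dyadic t0 t1 k i)) * (x (dyadic t0 t1 k (Suc j)) - x (dyadic t0 t1 k j))"
  have f: "?f : bmeas (PiM {0..} (%_. borel))"
   using pos(1) by (intro borel_measurable_times borel_measurable_diff measurable_component_singleton) auto
  have "?f \<circ> (%w. \<lambda>s\<in>{0..}. B s w) = (%w. d k i w * d k j w)"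
   "?f \<circ> (%w. \<lambda>s\<in>{0..}. B' s w) = (%w. d' k i w * d' k j w)"
   using pos(1) by (auto simp: d_def d'_def fun_eq_iff)
  then have ind: "indep_var borel (%w. d k i w * d k j w) borel (%w. d' k i w * d' k j w)"
   using indep_var_compose[OF indep f f] by simp
  have eq: "(?A k i j) = (%w. (d k i w * d k j w) * (d' k i w * d' k j w))"
   by (rule ext) (simp add: xi_def)
  show ?thesis
   unfolding eq using dd[OF ij] indep_var_integrable[OF ind] indep_var_lebesgue_integral[OF ind]
   by (simp add: power2_eq_square)
 qed
 have "AE w in M. (%k. SUM i:J k. xi k i w) ~> 0"
 proof (rule dyadic_sum_AE[where c = 1])
  fix k i j :: nat
  show "integrable M (%w. (xi k i w)\<^sup>2) & expectation (%w. (xi k i w)\<^sup>2) <= 1 * ((t1 - t0) / 2 ^ k)^2" if "i < 2 ^ k"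
   using all[OF order.refl that] by (simp add: power2_eq_square)
  show "integrable M (?A k i j) & expectation (?A k i j) = 0" if "i < j" "j < 2 ^ k"
   using all[of i j k] that by simp
 qed simp
 then show ?thesis unfolding xi_def d_def d'_def .
qed

end

end

section \<open>The Ito formula along dyadic partitions\<close>

text \<open>The indices of level \<open>k\<close> whose dyadic points lie in cell \<open>b\<close>
  of level \<open>c\<close>, with the left end point included. The quotient makes sense for
  \<open>k < c\<close> too, so no relation between the levels has to be carried along.\<close>

definition dyadic_block :: "nat => nat => nat => nat set" where
 "dyadic_block c b k = {i. i < 2 ^ k & (i * 2 ^ c) div 2 ^ k = b}"

lemma dyadic_block_subset: "dyadic_block c b k \<subseteq> {..<2 ^ k}"
 by (auto simp: dyadic_block_def)

lemma dyadic_block_0: "dyadic_block 0 0 k = {..<2 ^ k}"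
 by (auto simp: dyadic_block_def)

lemma sum_dyadic_blocks:
 fixes f :: "nat => real"
 shows "(SUM i<2 ^ k. f i) = (SUM b<2 ^ c. SUM i:dyadic_block c b k. f i)"
proof -
 have "(SUM i<2 ^ k. f i) = (SUM b<2 ^ c. SUM i:{i : {..<2 ^ k}. (i * 2 ^ c) div 2 ^ k = b}. f i)"
  by (rule sum.group[symmetric]) (auto simp: less_mult_imp_div_less mult.commute)
 then show ?thesis by (simp add: dyadic_block_def)
qed

lemma dyadic_block_dist:
 assumes "i : dyadic_block c b k" "t0 <= t1"
 shows "abs (dyadic t0 t1 k i - dyadic t0 t1 c b) <= (t1 - t0) / 2 ^ c"
proof -
 define q where "q = (i * 2 ^ c) mod 2 ^ k"
 have b: "(i * 2 ^ c) div 2 ^ k = b" using assms by (simp add: dyadic_block_def)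
 have "i * 2 ^ c = b * 2 ^ k + q" unfolding q_def b[symmetric] by (rule div_mult_mod_eq[symmetric])
 then have "real (i * 2 ^ c) = real (b * 2 ^ k + q)" by simp
 then have eq: "real i * 2 ^ c = real b * 2 ^ k + real q" by simp
 have "q < 2 ^ k" by (simp add: q_def)
 then have "real q < real (2 ^ k)" by (rule less_imp_of_nat_less)
 then have q: "0 <= real q / 2 ^ k" "real q / 2 ^ k <= 1" by simp_all
 have "real i / 2 ^ k - real b / 2 ^ c = (real q / 2 ^ k) / 2 ^ c"
  using eq by (simp add: field_simps)
 then have "dyadic t0 t1 k i - dyadic t0 t1 c b = (real q / 2 ^ k) * ((t1 - t0) / 2 ^ c)"
  by (simp add: dyadic_def field_simps)
 moreover have "(real q / 2 ^ k) * ((t1 - t0) / 2 ^ c) <= 1 * ((t1 - t0) / 2 ^ c)"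
  using q assms(2) by (intro mult_right_mono) auto
 moreover have "0 <= (real q / 2 ^ k) * ((t1 - t0) / 2 ^ c)"
  using q assms(2) by (intro mult_nonneg_nonneg) auto
 ultimately show ?thesis by simp
qed

lemma LIMSEQ_0I:
 fixes x :: "nat => real"
 assumes "!!eps. eps > 0 ==> EV k. (abs (x k)) <= eps"
 shows "x ~> 0"
proof (rule tendstoI)
 fix e :: real assume "e > 0"
 then have "e / 2 > 0" by simp
 from assms[OF this] show "EV k. dist (x k) 0 < e"
  by eventually_elim (use \<open>e > 0\<close> in auto)
qed

lemma LIMSEQ_0_abs_le:
 fixes x y :: "nat => real"
 assumes "y ~> 0" "EV k. (abs (x k)) <= y k"
 shows "x ~> 0"
 by (rule Lim_null_comparison[OF _ assms(1)]) (use assms(2) in simp)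

text \<open>
 Blockwise vanishing weights of bounded total mass do not see a continuous density: it may be
 frozen on the blocks.
\<close>

lemma weighted_sum_tendsto_0:
 fixes ta :: "real => real" and xi :: "nat => nat => real" and L :: "nat => nat"
 assumes t: "t0 <= t1" and ta: "continuous_on {t0..t1} ta"
  and blocks: "!!c b. (%k. SUM i:dyadic_block c b (L k). xi k i) ~> 0"
  and mass: "EV k. (SUM i<2 ^ L k. (abs (xi k i))) <= V"
 shows "(%k. SUM i<2 ^ L k. ta (dyadic t0 t1 (L k) i) * xi k i) ~> 0"
proof (rule LIMSEQ_0I)
 fix eps :: real assume e: "eps > 0"
 define D where "D = abs V + 1"
 have D: "D > 0" "abs V <= D" by (simp_all add: D_def)
 define eta where "eta = eps / (2 * D)"
 have eta: "eta > 0" "eta * D = eps / 2" using e D by (simp_all add: eta_def)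
 obtain d where d: "d > 0" "!!x y. x : {t0..t1} ==> y : {t0..t1} ==> abs (x - y) < d ==> abs (ta x - ta y) < eta"
  by (rule uniform_continuity_on_interval[OF ta eta(1)]) (rule that; assumption)
 obtain c where c: "(t1 - t0) / 2 ^ c < d"
  using mesh_eventually[OF d(1), of t1 t0] by (auto simp: eventually_sequentially)
 define z where "z = (%k. SUM b<2 ^ c. (abs (ta (dyadic t0 t1 c b))) * abs (SUM i:dyadic_block c b (L k). xi k i))"
 have "z ~> (SUM b<(2::nat) ^ c. (abs (ta (dyadic t0 t1 c b))) * abs 0)"
  unfolding z_def by (intro tendsto_intros blocks)
 then have z: "z ~> 0" by simp
 have "EV k. z k < eps / 2" using e by (intro order_tendstoD(2)[OF z]) simp
 with mass show "EV k. (abs (SUM i<2 ^ L k. ta (dyadic t0 t1 (L k) i) * xi k i)) <= eps"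
 proof eventually_elim
  case (elim k)
  let ?s = "dyadic t0 t1 (L k)" and ?J = "%b. dyadic_block c b (L k)"
  have eq: "(SUM i<2 ^ L k. ta (?s i) * xi k i) =
    (SUM b<2 ^ c. (SUM i:?J b. (ta (?s i) - ta (dyadic t0 t1 c b)) * xi k i) + ta (dyadic t0 t1 c b) * (SUM i:?J b. xi k i))"
  proof -
   have "(SUM i:?J b. ta (?s i) * xi k i) =
    (SUM i:?J b. (ta (?s i) - ta (dyadic t0 t1 c b)) * xi k i) + ta (dyadic t0 t1 c b) * (SUM i:?J b. xi k i)" for b
    by (simp add: left_diff_distrib sum_subtractf sum_distrib_left)
   then show ?thesis using sum_dyadic_blocks[of "%i. ta (?s i) * xi k i" "L k" c] by simp
  qed
  have "abs (SUM i<2 ^ L k. ta (?s i) * xi k i) <= (SUM b<2 ^ c. (SUM i:?J b. eta * abs (xi k i)) + abs (ta (dyadic t0 t1 c b)) * abs (SUM i:?J b. xi k i))"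
   unfolding eq
  proof (rule order.trans[OF sum_abs sum_mono])
   fix b :: nat assume "b : {..<2 ^ c}"
   then have b: "b < 2 ^ c" by simp
   have "abs (SUM i:?J b. (ta (?s i) - ta (dyadic t0 t1 c b)) * xi k i) <= (SUM i:?J b. eta * abs (xi k i))"
   proof (rule order.trans[OF sum_abs sum_mono])
    fix i assume i: "i : ?J b"
    have "abs (?s i - dyadic t0 t1 c b) < d" using dyadic_block_dist[OF i t] c by simp
    moreover have "?s i : {t0..t1}" "dyadic t0 t1 c b : {t0..t1}"
     using dyadic_bounds[OF t] b i dyadic_block_subset[of c b "L k"] by auto
    ultimately have "abs (ta (?s i) - ta (dyadic t0 t1 c b)) <= eta" using d(2) by (simp add: less_imp_le)
    then show "abs ((ta (?s i) - ta (dyadic t0 t1 c b)) * xi k i) <= eta * abs (xi k i)"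
     unfolding abs_mult by (rule mult_right_mono) simp
   qed
   then show "abs ((SUM i:?J b. (ta (?s i) - ta (dyadic t0 t1 c b)) * xi k i) + ta (dyadic t0 t1 c b) * (SUM i:?J b. xi k i))
     <= (SUM i:?J b. eta * abs (xi k i)) + abs (ta (dyadic t0 t1 c b)) * abs (SUM i:?J b. xi k i)"
    by (intro order.trans[OF abs_triangle_ineq] add_mono) (simp_all add: abs_mult)
  qed
  also have "... = eta * (SUM i<2 ^ L k. (abs (xi k i))) + z k"
   using sum_dyadic_blocks[of "%i. (abs (xi k i))" "L k" c]
   by (simp add: z_def sum.distrib sum_distrib_left[symmetric])
  also have "... <= eta * D + eps / 2"
   using elim eta(1) D by (intro add_mono mult_left_mono) auto
  finally show ?case using eta(2) by simp
 qed
qed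

lemma product_sum_tendsto_0:
 fixes x y :: "nat => nat => real" and n :: "nat => nat"
 assumes x: "EV k. (SUM i<n k. (x k i)\<^sup>2) <= V"
  and y: "(%k. SUM i<n k. (y k i)\<^sup>2) ~> 0"
 shows "(%k. SUM i<n k. x k i * y k i) ~> 0"
proof (rule LIMSEQ_0_abs_le)
 have "(%k. sqrt (abs V * (SUM i<n k. (y k i)\<^sup>2))) ~> sqrt (abs V * 0)"
  by (intro tendsto_intros y)
 then show "(%k. sqrt (abs V * (SUM i<n k. (y k i)\<^sup>2))) ~> 0" by simp
 show "EV k. (abs (SUM i<n k. x k i * y k i)) <= sqrt (abs V * (SUM i<n k. (y k i)\<^sup>2))"
  using x
 proof eventually_elim
  case (elim k)
  have "(SUM i<n k. x k i * y k i)^2 <= (SUM i<n k. (x k i)\<^sup>2) * (SUM i<n k. (y k i)\<^sup>2)"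
   by (rule Cauchy_Schwarz_ineq_sum)
  also have "... <= abs V * (SUM i<n k. (y k i)\<^sup>2)"
   using elim by (intro mult_right_mono) (auto intro: sum_nonneg)
  finally show ?case using real_sqrt_le_mono by fastforce
 qed
qed

lemma weighted_product_sum_tendsto_0:
 fixes x y ta :: "nat => nat => real" and n :: "nat => nat"
 assumes x: "EV k. (SUM i<n k. (x k i)\<^sup>2) <= V"
  and y: "(%k. SUM i<n k. (y k i)\<^sup>2) ~> 0"
  and ta: "!!k i. i < n k ==> abs (ta k i) <= K"
 shows "(%k. SUM i<n k. ta k i * (x k i * y k i)) ~> 0"
proof -
 have "EV k. (SUM i<n k. (ta k i * x k i)\<^sup>2) <= K^2 * V"
  using x
 proof eventually_elim
  case (elim k)
  have "(SUM i<n k. (ta k i * x k i)\<^sup>2) <= (SUM i<n k. K\<^sup>2 * (x k i)^2)"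
  proof (rule sum_mono)
   fix i assume "i : {..<n k}"
   then have "\<bar>ta k i\<bar>\<^sup>2 <= K^2" using ta[of i k] by (intro power_mono) auto
   then show "(ta k i * x k i)^2 <= K^2 * (x k i)^2"
    unfolding power_mult_distrib by (intro mult_right_mono) simp_all
  qed
  also have "... <= K^2 * V" unfolding sum_distrib_left[symmetric] using elim by (intro mult_left_mono) simp_all
  finally show ?case .
 qed
 from product_sum_tendsto_0[OF this y] show ?thesis by (simp add: mult.assoc)
qed

lemma square_sum_bounded_add:
 fixes x y :: "nat => nat => real" and n :: "nat => nat"
 assumes "EV k. (SUM i<n k. (x k i)\<^sup>2) <= V"
  and "(%k. SUM i<n k. (y k i)\<^sup>2) ~> 0"
 shows "EV k. (SUM i<n k. (x k i + y k i)\<^sup>2) <= 2 * V + 2"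
proof -
 have "EV k. (SUM i<n k. (y k i)\<^sup>2) < 1"
  by (intro order_tendstoD(2)[OF assms(2)]) simp
 with assms(1) show ?thesis
 proof eventually_elim
  case (elim k)
  have "(SUM i<n k. (x k i + y k i)\<^sup>2) <= (SUM i<n k. 2 * (x k i)^2 + 2 * (y k i)^2)"
   by (intro sum_mono square_add_le)
  also have "... = 2 * (SUM i<n k. (x k i)\<^sup>2) + 2 * (SUM i<n k. (y k i)\<^sup>2)"
   by (simp add: sum.distrib sum_distrib_left)
  finally show ?case using elim by linarith
 qed
qed

lemma square_sum_tendsto_0_add:
 fixes x y :: "nat => nat => real" and n :: "nat => nat"
 assumes "(%k. SUM i<n k. (x k i)\<^sup>2) ~> 0" "(%k. SUM i<n k. (y k i)\<^sup>2) ~> 0"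
 shows "(%k. SUM i<n k. (x k i + y k i)\<^sup>2) ~> 0"
proof (rule LIMSEQ_0_abs_le)
 have "(%k. 2 * (SUM i<n k. (x k i)\<^sup>2) + 2 * (SUM i<n k. (y k i)\<^sup>2)) ~> 2 * 0 + 2 * 0"
  by (intro tendsto_intros assms)
 then show "(%k. 2 * (SUM i<n k. (x k i)\<^sup>2) + 2 * (SUM i<n k. (y k i)\<^sup>2)) ~> 0" by simp
 have "abs (SUM i<n k. (x k i + y k i)\<^sup>2) <= 2 * (SUM i<n k. (x k i)\<^sup>2) + 2 * (SUM i<n k. (y k i)\<^sup>2)" for k
 proof -
  have "abs (SUM i<n k. (x k i + y k i)\<^sup>2) = (SUM i<n k. (x k i + y k i)\<^sup>2)" by (simp add: sum_nonneg)
  also have "... <= (SUM i<n k. 2 * (x k i)^2 + 2 * (y k i)^2)"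
   by (intro sum_mono square_add_le)
  finally show ?thesis by (simp add: sum.distrib sum_distrib_left)
 qed
 then show "EV k. (abs (SUM i<n k. (x k i + y k i)\<^sup>2)) <= 2 * (SUM i<n k. (x k i)\<^sup>2) + 2 * (SUM i<n k. (y k i)\<^sup>2)"
  by (rule always_eventually[OF allI])
qed

lemma mesh_square_sum_tendsto_0:
 fixes b :: "nat => nat => real"
 assumes L: "filterlim L at_top sequentially" and b: "!!k i. i < 2 ^ L k ==> abs (b k i) <= K"
 shows "(%k. SUM i<2 ^ L k. (b k i * ((t1 - t0) / 2 ^ L k))\<^sup>2) ~> 0"
proof (rule LIMSEQ_0_abs_le)
 have "(%k. K\<^sup>2 * (t1 - t0) * ((t1 - t0) / 2 ^ L k)) ~> K^2 * (t1 - t0) * 0"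
  by (intro tendsto_intros filterlim_compose[OF mesh_tendsto L])
 then show "(%k. K\<^sup>2 * (t1 - t0) * ((t1 - t0) / 2 ^ L k)) ~> 0" by simp
 let ?A = "%L k t1 t0. SUM i<2 ^ L k. (b k i * ((t1 - t0) / 2 ^ L k))\<^sup>2"
 have "abs (?A L k t1 t0) <= K^2 * (t1 - t0) * ((t1 - t0) / 2 ^ L k)" for k
 proof -
  have "abs (?A L k t1 t0) = (?A L k t1 t0)"
   by (simp add: sum_nonneg)
  also have "... <= (SUM i<(2::nat) ^ L k. K\<^sup>2 * ((t1 - t0) / 2 ^ L k)^2)"
  proof (rule sum_mono)
   fix i :: nat assume "i : {..<2 ^ L k}"
   then have "\<bar>b k i\<bar>\<^sup>2 <= K^2" using b[of i k] by (intro power_mono) auto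
   then show "(b k i * ((t1 - t0) / 2 ^ L k))^2 <= K^2 * ((t1 - t0) / 2 ^ L k)^2"
    unfolding power_mult_distrib by (intro mult_right_mono) simp_all
  qed
  also have "... = K^2 * (t1 - t0) * ((t1 - t0) / 2 ^ L k)" by (simp add: power2_eq_square)
  finally show ?thesis .
 qed
 then show "EV k. (abs (?A L k t1 t0)) <= K^2 * (t1 - t0) * ((t1 - t0) / 2 ^ L k)"
  by (rule always_eventually[OF allI])
qed

text \<open>A cubic sum is at most the largest step times the quadratic sum; the first factor tends
  to 0 and the second stays bounded.\<close>

lemma cubic_sum_tendsto_0:
 fixes d r :: "nat => nat => real" and n :: "nat => nat"
 assumes sq: "EV k. (SUM i<n k. (d k i)\<^sup>2) <= V"
  and small: "!!eps. eps > 0 ==> EV k. ALL i<n k. d k i <= eps"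
  and d: "!!k i. 0 <= d k i" and C: "C >= 0" and r: "!!k i. i < n k ==> abs (r k i) <= C * d k i ^ 3"
 shows "(%k. SUM i<n k. r k i) ~> 0"
proof (rule LIMSEQ_0I)
 fix eps :: real assume e: "eps > 0"
 define eta where "eta = eps / (C * abs V + 1)"
 have den: "C * abs V + 1 > 0" using C by (simp add: add_nonneg_pos)
 then have eta: "eta > 0" using e by (simp add: eta_def)
 have "(C * abs V + 1) * eta = eps" using den by (simp add: eta_def)
 then have eta2: "C * abs V * eta <= eps" using eta by (simp add: distrib_right)
 from small[OF eta] sq show "EV k. (abs (SUM i<n k. r k i)) <= eps"
 proof eventually_elim
  case (elim k)
  have "abs (SUM i<n k. r k i) <= (SUM i<n k. C * eta * (d k i)^2)"
  proof (rule order.trans[OF sum_abs sum_mono])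
   fix i assume "i : {..<n k}"
   then have i: "i < n k" by simp
   have "abs (r k i) <= C * (d k i * (d k i)^2)" using r[OF i] by (simp add: power3_eq_cube power2_eq_square)
   also have "... <= C * (eta * (d k i)^2)" using elim(1) i C by (intro mult_left_mono mult_right_mono) auto
   finally show "abs (r k i) <= C * eta * (d k i)^2" by simp
  qed
  also have "... = C * eta * (SUM i<n k. (d k i)\<^sup>2)" by (simp add: sum_distrib_left)
  also have "... <= C * eta * abs V" using elim(2) C eta by (intro mult_left_mono) auto
  finally show ?case using eta2 by (simp add: mult.commute mult.left_commute)
 qed
qed

lemma continuous_on_interval_bound_family:
 fixes f :: "nat => real => real"
 assumes "!!a. a < n ==> continuous_on {u..v} (f a)"
 obtains K where "K >= 0" "!!a x. a < n ==> x : {u..v} ==> abs (f a x) <= K"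
proof -
 have "EX K>=0. ALL a<n. ALL x:{u..v}. abs (f a x) <= K"
  using assms
 proof (induction n)
  case 0 then show ?case by auto
 next
  case (Suc n)
  then obtain K where K: "K >= 0" "ALL a<n. ALL x:{u..v}. abs (f a x) <= K" by fastforce
  obtain K' where K': "K' >= 0" "!!x. x : {u..v} ==> abs (f n x) <= K'"
   by (rule continuous_on_interval_bound[OF Suc.prems[OF lessI]]) (rule that; assumption)
  show ?case
  proof (intro exI[of _ "max K K'"] conjI allI impI ballI)
   show "0 <= max K K'" using K by simp
   fix a x assume "a < Suc n" "x : {u..v}"
   then show "abs (f a x) <= max K K'" using K(2) K'(2)[of x] by (cases "a = n") (auto intro: max.coboundedI1 max.coboundedI2)
  qed
 qed
 then show ?thesis using that by blast
qed

text \<open>Ito's formula in Foellmer's manner, for deterministic paths. The noise \<open>xi\<close>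
  has covariation density \<open>q\<close> on every dyadic block, the errors \<open>e\<close> are
  negligible in square sum and against \<open>F1\<close>, and \<open>gen\<close> states that drift
  and second-order terms cancel. Hence the left-point sums of the noise part alone converge to the
  increment of \<open>F\<close>.\<close>

theorem pathwise_ito:
 fixes y sg b :: "nat => real => real" and xi e :: "nat => nat => nat => real" and q :: "nat => nat => real"
 assumes t: "t0 <= t1" and L: "filterlim L at_top sequentially"
  and taylor: "taylor_bounded n F F1 F2"
  and cont: "!!a. a < n ==> continuous_on {t0..t1} (y a)" "!!a. a < n ==> continuous_on {t0..t1} (sg a)"
   "!!a. a < n ==> continuous_on {t0..t1} (b a)"
   "!!a. a < n ==> continuous_on {t0..t1} (%r. F1 a (%j. y j r))"
   "!!a a'. a < n ==> a' < n ==> continuous_on {t0..t1} (%r. F2 a a' (%j. y j r))"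
  and step: "!!a k i. a < n ==> i < 2 ^ L k ==>
   y a (dyadic t0 t1 (L k) (Suc i)) - y a (dyadic t0 t1 (L k) i) =
    sg a (dyadic t0 t1 (L k) i) * xi a k i + b a (dyadic t0 t1 (L k) i) * ((t1 - t0) / 2 ^ L k) + e a k i"
  and cov: "!!a a' c d. a < n ==> a' < n ==>
   (%k. SUM i:dyadic_block c d (L k). xi a k i * xi a' k i - q a a' * ((t1 - t0) / 2 ^ L k)) ~> 0"
  and e2: "!!a. a < n ==> (%k. SUM i<2 ^ L k. (e a k i)\<^sup>2) ~> 0"
  and e1: "!!a. a < n ==> (%k. SUM i<2 ^ L k. F1 a (%j. y j (dyadic t0 t1 (L k) i)) * e a k i) ~> 0"
  and gen: "!!r. r : {t0..t1} ==> (SUM a<n. F1 a (%j. y j r) * b a r)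
    + (SUM a<n. SUM a'<n. q a a' * sg a r * sg a' r * F2 a a' (%j. y j r)) / 2 = 0"
 shows "(%k. SUM i<2 ^ L k. SUM a<n. F1 a (%j. y j (dyadic t0 t1 (L k) i)) * sg a (dyadic t0 t1 (L k) i) * xi a k i)
  ~> F (%j. y j t1) - F (%j. y j t0)"
proof -
 define s where "s = (%k i. dyadic t0 t1 (L k) i)"
 define h where "h = (%k. (t1 - t0) / 2 ^ L k)"
 define Y where "Y = (%k i j. y j (s k i))"
 define De where "De = (%a k i. y a (s k (Suc i)) - y a (s k i))"
 define m where "m = (%a k i. sg a (s k i) * xi a k i)"
 define f where "f = (%a k i. b a (s k i) * h k + e a k i)"
 have s_in: "s k i : {t0..t1}" if "i <= 2 ^ L k" for k i
  using dyadic_bounds[OF t that] by (simp add: s_def)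
 have De: "De a k i = m a k i + f a k i" if "a < n" "i < 2 ^ L k" for a k i
  using step[OF that] by (simp add: De_def s_def m_def f_def h_def)
 have hsum: "(SUM i<(2::nat) ^ L k. h k) = t1 - t0" for k by (simp add: h_def)
 have h0: "h k >= 0" for k using t by (simp add: h_def)
 obtain K where K: "K >= 0" "!!a r. a < n ==> r : {t0..t1} ==> abs (sg a r) <= K"
  by (rule continuous_on_interval_bound_family[where f = sg and n = n, OF cont(2)]) (assumption, (rule that; assumption))
 obtain Kb where Kb: "Kb >= 0" "!!a r. a < n ==> r : {t0..t1} ==> abs (b a r) <= Kb"
  by (rule continuous_on_interval_bound_family[where f = b and n = n, OF cont(3)]) (assumption, (rule that; assumption))
 obtain Ky where Ky: "Ky >= 0" "!!a r. a < n ==> r : {t0..t1} ==> abs (y a r) <= Ky"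
  by (rule continuous_on_interval_bound_family[where f = y and n = n, OF cont(1)]) (assumption, (rule that; assumption))
 have f2: "(%k. SUM i<2 ^ L k. (f a k i)\<^sup>2) ~> 0" if "a < n" for a
  unfolding f_def h_def
 proof (rule square_sum_tendsto_0_add[OF mesh_square_sum_tendsto_0[OF L] e2[OF that]])
  show "i < 2 ^ L k ==> abs (b a (s k i)) <= Kb" for k i using Kb(2)[OF that s_in] by simp
 qed
 let ?G = "%L k a. SUM i<2 ^ L k. (xi a k i)\<^sup>2"
 have xi2: "EV k. (?G L k a) <= abs (q a a) * (t1 - t0) + 1" if "a < n" for a
 proof -
  have "EV k. (SUM i<2 ^ L k. xi a k i * xi a k i - q a a * h k) < 1"
   unfolding h_def by (rule order_tendstoD(2)[OF cov[OF that that, of 0 0, unfolded dyadic_block_0]]) simp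
  then show ?thesis
  proof eventually_elim
   case (elim k)
   have "(?G L k a) < 1 + (SUM i<(2::nat) ^ L k. q a a * h k)"
    using elim by (simp add: sum_subtractf power2_eq_square)
   also have "(SUM i<(2::nat) ^ L k. q a a * h k) = q a a * (t1 - t0)" by (simp only: sum_distrib_left[symmetric] hsum)
   also have "... <= abs (q a a) * (t1 - t0)" using t by (intro mult_right_mono) auto
   finally show ?case by simp
  qed
 qed
 define V where "V = (%a. K\<^sup>2 * (abs (q a a) * (t1 - t0) + 1))"
 have m2: "EV k. (SUM i<2 ^ L k. (m a k i)\<^sup>2) <= V a" if a: "a < n" for a
  using xi2[OF a]
 proof eventually_elim
  case (elim k)
  have "(SUM i<2 ^ L k. (m a k i)\<^sup>2) <= (SUM i<2 ^ L k. K\<^sup>2 * (xi a k i)^2)"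
  proof (rule sum_mono)
   fix i :: nat assume "i : {..<2 ^ L k}"
   then have "\<bar>sg a (s k i)\<bar>\<^sup>2 <= K^2" using K(2)[OF a s_in] by (intro power_mono) auto
   then show "(m a k i)^2 <= K^2 * (xi a k i)^2"
    unfolding m_def power_mult_distrib by (intro mult_right_mono) simp_all
  qed
  also have "... <= V a" unfolding V_def sum_distrib_left[symmetric] using elim by (intro mult_left_mono) simp_all
  finally show ?case .
 qed
 have De2: "EV k. (SUM i<2 ^ L k. (De a k i)\<^sup>2) <= 2 * V a + 2" if a: "a < n" for a
  using square_sum_bounded_add[OF m2[OF a] f2[OF a]]
  by eventually_elim (simp add: De[OF a])

 let ?A = "%a k i a' t1 t0 L. xi a k i * xi a' k i - q a a' * ((t1 - t0) / 2 ^ L k)"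
 let ?C = "%a a' F2. %r. sg a r * sg a' r * F2 a a' (%j. y j r)"
 have quad: "(%k. SUM i<2 ^ L k. F2 a a' (Y k i) * (De a k i * De a' k i) -
   q a a' * sg a (s k i) * sg a' (s k i) * F2 a a' (Y k i) * h k) ~> 0"
  if a: "a < n" "a' < n" for a a'
 proof -
  obtain K2 where K2: "K2 >= 0" "!!r. r : {t0..t1} ==> abs (F2 a a' (%j. y j r)) <= K2"
   by (rule continuous_on_interval_bound[OF cont(5)[OF a]]) (rule that; assumption)
  have ta: "abs (F2 a a' (Y k i)) <= K2" if "i < 2 ^ L k" for k i
   using K2(2)[OF s_in] that by (simp add: Y_def)
  \<comment> \<open>\<open>De a * De a'\<close> equals
    \<open>m a * m a' + m a * f a' + De a' * f a\<close>. The last two products vanish by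
    Cauchy-Schwarz (\<open>A\<close> and \<open>B\<close>); in the first one
    \<open>xi a * xi a'\<close> is compared with its density \<open>q a a'\<close> in
    \<open>C\<close>.\<close>
  have A: "(%k. SUM i<2 ^ L k. F2 a a' (Y k i) * (m a k i * f a' k i)) ~> 0"
   by (rule weighted_product_sum_tendsto_0[OF m2[OF a(1)] f2[OF a(2)] ta])
  have B: "(%k. SUM i<2 ^ L k. F2 a a' (Y k i) * (De a' k i * f a k i)) ~> 0"
   by (rule weighted_product_sum_tendsto_0[OF De2[OF a(2)] f2[OF a(1)] ta])
  have C: "(%k. SUM i<2 ^ L k. (?C a a' F2) (dyadic t0 t1 (L k) i) *
    (?A a k i a' t1 t0 L)) ~> 0"
  proof (rule weighted_sum_tendsto_0[OF t _ cov[OF a]])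
   show "continuous_on {t0..t1} (?C a a' F2)"
    by (intro continuous_intros cont a)
   show "EV k. (SUM i<2 ^ L k. (abs (?A a k i a' t1 t0 L)))
     <= (abs (q a a) * (t1 - t0) + 1) + (abs (q a' a') * (t1 - t0) + 1) + abs (q a a') * (t1 - t0)"
    using xi2[OF a(1)] xi2[OF a(2)]
   proof eventually_elim
    case (elim k)
    have "(SUM i<2 ^ L k. (abs (?A a k i a' t1 t0 L))) <=
     (SUM i<2 ^ L k. (xi a k i)\<^sup>2 + (xi a' k i)^2 + abs (q a a') * h k)"
    proof (rule sum_mono)
     fix i :: nat
     have "0 <= (abs (xi a k i) - abs (xi a' k i))^2" by simp
     then have "2 * (abs (xi a k i) * abs (xi a' k i)) <= (xi a k i)^2 + (xi a' k i)^2" by (simp add: power2_diff)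
     moreover have "0 <= abs (xi a k i) * abs (xi a' k i)" by simp
     ultimately have "abs (xi a k i * xi a' k i) <= (xi a k i)^2 + (xi a' k i)^2" unfolding abs_mult by linarith
     moreover have "abs (q a a' * ((t1 - t0) / 2 ^ L k)) = abs (q a a') * h k"
      using t by (simp add: abs_mult h_def)
     ultimately show "abs (?A a k i a' t1 t0 L) <=
      (xi a k i)^2 + (xi a' k i)^2 + abs (q a a') * h k" by linarith
    qed
    also have "... = (?G L k a) + (SUM i<2 ^ L k. (xi a' k i)\<^sup>2) + abs (q a a') * (t1 - t0)"
     unfolding sum.distrib sum_distrib_left[symmetric] hsum ..
    finally show ?case using elim by linarith
   qed
  qed
  have "(%k. (SUM i<2 ^ L k. F2 a a' (Y k i) * (m a k i * f a' k i)) +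
    (SUM i<2 ^ L k. F2 a a' (Y k i) * (De a' k i * f a k i)) +
    (SUM i<2 ^ L k. (?C a a' F2) (dyadic t0 t1 (L k) i) *
    (?A a k i a' t1 t0 L))) ~> 0 + 0 + 0"
   by (intro tendsto_add A B C)
  moreover have "(SUM i<2 ^ L k. F2 a a' (Y k i) * (m a k i * f a' k i)) +
    (SUM i<2 ^ L k. F2 a a' (Y k i) * (De a' k i * f a k i)) +
    (SUM i<2 ^ L k. (?C a a' F2) (dyadic t0 t1 (L k) i) *
    (?A a k i a' t1 t0 L)) =
    (SUM i<2 ^ L k. F2 a a' (Y k i) * (De a k i * De a' k i) -
   q a a' * sg a (s k i) * sg a' (s k i) * F2 a a' (Y k i) * h k)" for k
   unfolding sum.distrib[symmetric]
  proof (rule sum.cong[OF refl])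
   fix i :: nat assume "i : {..<2 ^ L k}"
   then have i: "i < 2 ^ L k" by simp
   have hk: "(t1 - t0) / 2 ^ L k = h k" by (simp add: h_def)
   have si: "dyadic t0 t1 (L k) i = s k i" by (simp add: s_def)
   show "F2 a a' (Y k i) * (m a k i * f a' k i) + F2 a a' (Y k i) * (De a' k i * f a k i) +
    (?C a a' F2) (dyadic t0 t1 (L k) i) *
    (?A a k i a' t1 t0 L) =
    F2 a a' (Y k i) * (De a k i * De a' k i) - q a a' * sg a (s k i) * sg a' (s k i) * F2 a a' (Y k i) * h k"
    unfolding hk si De[OF a(1) i] De[OF a(2) i] m_def Y_def by (simp add: algebra_simps)
  qed
  ultimately show ?thesis by simp
 qed

 \<comment> \<open>The Taylor remainder of one step. It is bounded by the cube of the step, so that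
   its sum vanishes by uniform continuity of the paths.\<close>
 define rem where "rem = (%k i. F (Y k (Suc i)) - F (Y k i) - (SUM a<n. De a k i * F1 a (Y k i))
   - (SUM a<n. SUM a'<n. De a k i * De a' k i * F2 a a' (Y k i)) / 2)"
 obtain C where C: "C >= 0" "!!z w. (ALL i<n. (abs (z i)) <= Ky) ==> (ALL i<n. (abs (w i)) <= Ky) ==>
   abs (F w - F z - (SUM a<n. (w a - z a) * F1 a z)
    - (SUM a<n. SUM b<n. (w a - z a) * (w b - z b) * F2 a b z) / 2)
   <= C * (SUM a<n. (abs (w a - z a))) ^ 3"
  using taylor[unfolded taylor_bounded_def, rule_format, of Ky] by blast
 let ?B = "%n k i. SUM a<n. (abs (De a k i))"
 have rem0: "(%k. SUM i<2 ^ L k. rem k i) ~> 0"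
 proof (rule cubic_sum_tendsto_0[where d = "%k i. SUM a<n. (abs (De a k i))" and C = C])
  show "EV k. (SUM i<2 ^ L k. (?B n k i)\<^sup>2) <= real n * (SUM a<n. 2 * V a + 2)"
  proof -
   have "EV k. ALL a:{..<n}. (SUM i<2 ^ L k. (De a k i)\<^sup>2) <= 2 * V a + 2"
    by (rule eventually_ball_finite) (use De2 in auto)
   then show ?thesis
   proof eventually_elim
    case (elim k)
    have "(SUM i<2 ^ L k. (?B n k i)\<^sup>2) <= (SUM i<2 ^ L k. real n * (SUM a<n. (De a k i)\<^sup>2))"
    proof (rule sum_mono)
     fix i :: nat
     show "(?B n k i)^2 <= real n * (SUM a<n. (De a k i)\<^sup>2)"
      using Cauchy_Schwarz_ineq_sum[of "%_. 1" "%a. (abs (De a k i))" "{..<n}"] by simp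
    qed
    also have "... = real n * (SUM a<n. SUM i<2 ^ L k. (De a k i)\<^sup>2)"
     unfolding sum_distrib_left[symmetric] by (subst sum.swap) (rule refl)
    also have "... <= real n * (SUM a<n. 2 * V a + 2)"
     using elim by (intro mult_left_mono sum_mono) auto
    finally show ?case .
   qed
  qed
  show "0 <= (?B n k i)" for k i by (simp add: sum_nonneg)
  show "0 <= C" by (rule C(1))
  show "abs (rem k i) <= C * (?B n k i) ^ 3" if "i < 2 ^ L k" for k i
  proof -
   have "ALL j<n. (abs (Y k i j)) <= Ky" "ALL j<n. (abs (Y k (Suc i) j)) <= Ky"
    using Ky(2)[OF _ s_in] that by (auto simp: Y_def)
   from C(2)[OF this] show ?thesis by (simp add: rem_def Y_def De_def)
  qed
  fix eps :: real assume e: "eps > 0"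
  define eta where "eta = eps / (real n + 1)"
  have eta: "eta > 0" using e by (simp add: eta_def)
  have "(real n + 1) * eta = eps" by (simp add: eta_def)
  then have etan: "real n * eta <= eps" using eta by (simp add: distrib_right)
  have "EV k. ALL a:{..<n}. ALL i<2 ^ L k. (abs (De a k i)) <= eta"
  proof (intro eventually_ball_finite ballI)
   fix a assume "a : {..<n}"
   then have a: "a < n" by simp
   obtain d where d: "d > 0" "!!x z. x : {t0..t1} ==> z : {t0..t1} ==> abs (x - z) < d ==> abs (y a x - y a z) < eta"
    by (rule uniform_continuity_on_interval[OF cont(1)[OF a] eta]) (rule that; assumption)
   have "EV k. h k < d"
    unfolding h_def by (rule eventually_compose_filterlim[OF mesh_eventually[OF d(1)] L])
   then show "EV k. ALL i<2 ^ L k. (abs (De a k i)) <= eta"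
   proof eventually_elim
    case (elim k)
    show ?case
    proof (intro allI impI)
     fix i :: nat assume i: "i < 2 ^ L k"
     have "abs (s k (Suc i) - s k i) < d" using elim h0[of k] by (simp add: s_def dyadic_Suc h_def)
     from d(2)[OF s_in s_in this] i show "abs (De a k i) <= eta" by (simp add: De_def less_imp_le)
    qed
   qed
  qed simp
  then show "EV k. ALL i<2 ^ L k. (?B n k i) <= eps"
  proof eventually_elim
   case (elim k)
   show ?case
   proof (intro allI impI)
    fix i :: nat assume i: "i < 2 ^ L k"
    have "(?B n k i) <= (SUM a<n. eta)" using elim i by (intro sum_mono) auto
    then show "(?B n k i) <= eps" using etan by simp
   qed
  qed
 qed
 have tele: "(SUM i<2 ^ L k. F (Y k (Suc i)) - F (Y k i)) = F (%j. y j t1) - F (%j. y j t0)" for k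
  using sum_lessThan_telescope[of "%i. F (Y k i)" "2 ^ L k"] by (simp add: Y_def s_def)
 define E1 where "E1 = (%k. SUM a<n. SUM i<2 ^ L k. F1 a (Y k i) * e a k i)"
 define E2 where "E2 = (%k. (SUM a<n. SUM a'<n. (SUM i<2 ^ L k. F2 a a' (Y k i) * (De a k i * De a' k i) -
   q a a' * sg a (s k i) * sg a' (s k i) * F2 a a' (Y k i) * h k)) / 2)"
 have "E1 ~> (SUM a<n. 0)"
  unfolding E1_def
  by (rule tendsto_sum) (use e1 in \<open>simp add: Y_def s_def\<close>)
 then have E1: "E1 ~> 0" by simp
 have "E2 ~> (SUM a<n. SUM a'<n. 0) / 2"
  unfolding E2_def
  by (intro tendsto_intros quad) simp_all
 then have E2: "E2 ~> 0" by simp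
 let ?D = "%n F1 k i. SUM a<n. F1 a (Y k i) * b a (s k i)"
 let ?E = "%n F1 k i. SUM a<n. F1 a (Y k i) * sg a (s k i) * xi a k i"
 let ?F = "%n k i F2. SUM a<n. SUM a'<n. q a a' * sg a (s k i) * sg a' (s k i) * F2 a a' (Y k i)"
 have "(%k. F (%j. y j t1) - F (%j. y j t0) - E1 k - E2 k - (SUM i<2 ^ L k. rem k i))
   ~> F (%j. y j t1) - F (%j. y j t0) - 0 - 0 - 0"
  by (intro tendsto_diff tendsto_const E1 E2 rem0)
 moreover have "F (%j. y j t1) - F (%j. y j t0) - E1 k - E2 k - (SUM i<2 ^ L k. rem k i) =
   (SUM i<2 ^ L k. SUM a<n. F1 a (Y k i) * sg a (s k i) * xi a k i)" for k
 proof -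
  have E1': "E1 k = (SUM i<2 ^ L k. SUM a<n. F1 a (Y k i) * e a k i)"
   unfolding E1_def by (rule sum.swap)
  have E2': "E2 k = (SUM i<2 ^ L k. (SUM a<n. SUM a'<n. F2 a a' (Y k i) * (De a k i * De a' k i) -
   q a a' * sg a (s k i) * sg a' (s k i) * F2 a a' (Y k i) * h k) / 2)"
   unfolding E2_def sum_divide_distrib[symmetric]
   by (subst sum.swap) (subst (2) sum.swap, rule refl)
  show ?thesis
   unfolding tele[of k, symmetric] E1' E2' sum_subtractf[symmetric]
  proof (rule sum.cong[OF refl])
   fix i :: nat assume "i : {..<2 ^ L k}"
   then have i: "i < 2 ^ L k" by simp
   \<comment> \<open>At each partition point the drift sum is minus half of the covariation sum, and
     their contributions of order \<open>h k\<close> cancel.\<close>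
   have g: "(?D n F1 k i) + (?F n k i F2) / 2 = 0"
    using gen[OF s_in, of i k] i by (simp add: Y_def)
   define G where "G = (?F n k i F2)"
   have 1: "(SUM a<n. SUM a'<n. F2 a a' (Y k i) * (De a k i * De a' k i) -
     q a a' * sg a (s k i) * sg a' (s k i) * F2 a a' (Y k i) * h k) =
     (SUM a<n. SUM a'<n. De a k i * De a' k i * F2 a a' (Y k i)) - G * h k"
    by (simp add: G_def sum_subtractf sum_distrib_left mult.commute)
   have "(SUM a<n. De a k i * F1 a (Y k i)) = (SUM a<n. F1 a (Y k i) * sg a (s k i) * xi a k i +
     F1 a (Y k i) * b a (s k i) * h k + F1 a (Y k i) * e a k i)"
    by (rule sum.cong[OF refl]) (simp add: De[OF _ i] m_def f_def algebra_simps)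
   also have "... = (?E n F1 k i) +
     (?D n F1 k i) * h k + (SUM a<n. F1 a (Y k i) * e a k i)"
    by (simp add: sum.distrib sum_distrib_right)
   finally have 2: "(SUM a<n. De a k i * F1 a (Y k i)) = (?E n F1 k i) +
     (?D n F1 k i) * h k + (SUM a<n. F1 a (Y k i) * e a k i)" .
   have 3: "(?D n F1 k i) = - G / 2" using g by (simp add: G_def)
   show "F (Y k (Suc i)) - F (Y k i) - (SUM a<n. F1 a (Y k i) * e a k i) -
     (SUM a<n. SUM a'<n. F2 a a' (Y k i) * (De a k i * De a' k i) -
      q a a' * sg a (s k i) * sg a' (s k i) * F2 a a' (Y k i) * h k) / 2 - rem k i =
     (?E n F1 k i)"
    unfolding rem_def 1 2 3 by (simp add: field_simps)
  qed
 qed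
 ultimately show ?thesis by (simp add: Y_def s_def)
qed

text \<open>Bounded second moments give uniform integrability, made explicit by
  \<open>X <= min X R + X^2 / R\<close>. The truncated part converges by dominated convergence, and
  the rest is of order \<open>1 / R\<close> uniformly in \<open>k\<close>.\<close>

lemma (in prob_space) expectation_limit_L2_bounded:
 fixes Z :: "nat => 'a => real"
 assumes Z: "!!k. Z k : bmeas M" "!!k. integrable M (%w. (Z k w)\<^sup>2)" "!!k. expectation (%w. (Z k w)\<^sup>2) <= V"
  and lim: "AE w in M. (%k. Z k w) ~> D w"
  and D: "D : bmeas M" "!!w. w : space M ==> abs (D w) <= C"
  and G: "G : bmeas M" "!!w. w : space M ==> abs (G w) <= K"
  and zero: "!!k. integrable M (%w. G w * Z k w)" "!!k. expectation (%w. G w * Z k w) = 0"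
 shows "expectation (%w. G w * D w) = 0"
proof -
 define X where "X = (%k w. (abs (Z k w - D w)))"
 have Xm: "X k : bmeas M" for k using Z(1) D(1) unfolding X_def by measurable
 have "D : bmeas M" by (rule D(1))
 have D2: "integrable M (%w. (D w)\<^sup>2)"
 proof (rule integrable_const_bound[where B = "C^2"])
  show "AE w in M. norm ((D w)^2) <= C^2"
  proof (rule AE_I2)
   fix w assume "w : space M"
   from power_mono[OF D(2)[OF this], of 2] show "norm ((D w)^2) <= C^2" by simp
  qed
 qed (use D(1) in measurable)
 have D2': "expectation (%w. (D w)\<^sup>2) <= C^2"
 proof (rule integral_le_const[OF D2])
  show "AE w in M. (D w)\<^sup>2 <= C^2"
  proof (rule AE_I2)
   fix w assume "w : space M"
   from power_mono[OF D(2)[OF this], of 2] show "(D w)^2 <= C^2" by simp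
  qed
 qed
 have Xle: "(X k w)^2 <= 2 * (Z k w)^2 + 2 * (D w)^2" for k w
  using square_add_le[of "Z k w" "- D w"] by (simp add: X_def)
 have Xi: "integrable M (%w. (X k w)\<^sup>2)" for k
  by (rule integrable_bound[where f = "%w. 2 * (Z k w)^2 + 2 * (D w)^2"])
   (use Z(2) D2 Xm[of k] Xle in auto)
 have XV: "expectation (%w. (X k w)\<^sup>2) <= 2 * V + 2 * C^2" for k
 proof -
  have "expectation (%w. (X k w)\<^sup>2) <= expectation (%w. 2 * (Z k w)^2 + 2 * (D w)^2)"
   using Z(2) D2 Xi Xle by (intro integral_mono) auto
  also have "... = 2 * expectation (%w. (Z k w)\<^sup>2) + 2 * expectation (%w. (D w)\<^sup>2)"
   using Z(2) D2 by simp
  finally show ?thesis using Z(3)[of k] D2' by linarith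
 qed
 define E where "E = abs (expectation (%w. G w * D w))"
 have GD: "integrable M (%w. G w * D w)"
 proof (rule integrable_const_bound[where B = "K * C"])
  show "AE w in M. norm (G w * D w) <= K * C"
   using D(2) G(2) by (intro AE_I2) (auto simp: abs_mult intro!: mult_mono order.trans[OF abs_ge_zero G(2)])
 qed (use D(1) G(1) in measurable)
 let ?A = "%k R V C. expectation (%w. min (X k w) R) + (2 * V + 2 * C^2) / R"
 have key: "E <= abs K * (?A k R V C)" if R: "R > 0" for R k
 proof -
  have mi: "integrable M (%w. min (X k w) R)"
   using R Xm[of k] by (intro integrable_const_bound[where B = R]) (auto simp: X_def)
  have "expectation (%w. G w * D w) = expectation (%w. G w * D w - G w * Z k w)"
   using GD zero by simp
  also have "abs (expectation (%w. G w * D w - G w * Z k w)) <= expectation (%w. (abs (G w * D w - G w * Z k w)))"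
   by (rule integral_abs_bound)
  also have "... <= expectation (%w. (abs K) * (min (X k w) R + (X k w)^2 / R))"
  proof (rule integral_mono)
   show "integrable M (%w. (abs (G w * D w - G w * Z k w)))" using GD zero by simp
   show "integrable M (%w. (abs K) * (min (X k w) R + (X k w)^2 / R))" using mi Xi by simp
   fix w assume w: "w : space M"
   have "X k w <= min (X k w) R + (X k w)^2 / R"
   proof (cases "X k w <= R")
    case False
    then have "X k w * R <= X k w * X k w" using R by (intro mult_left_mono) auto
    then have "X k w <= (X k w)^2 / R" using R by (simp add: field_simps power2_eq_square)
    then show ?thesis using False R by simp
   qed (use R in simp)
   moreover have "abs (G w * D w - G w * Z k w) = abs (G w) * X k w"
    by (simp add: X_def abs_mult[symmetric] abs_minus_commute right_diff_distrib)
   moreover have "abs (G w) <= abs K" using G(2)[OF w] by simp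
   ultimately show "abs (G w * D w - G w * Z k w) <= abs K * (min (X k w) R + (X k w)^2 / R)"
    by (simp add: mult_mono X_def)
  qed
  also have "... = abs K * (expectation (%w. min (X k w) R) + expectation (%w. (X k w)\<^sup>2) / R)"
   using mi Xi by simp
  also have "... <= abs K * (?A k R V C)"
   using XV R by (intro mult_left_mono add_left_mono divide_right_mono) auto
  finally show ?thesis by (simp add: E_def)
 qed
 have lim0: "(%k. expectation (%w. min (X k w) R)) ~> expectation (%w. 0)" if R: "R > 0" for R
 proof (rule integral_dominated_convergence[where w = "%_. R"])
  show "AE w in M. (%k. min (X k w) R) ~> 0"
   using lim
  proof eventually_elim
   case (elim w)
   then have "(%k. X k w) ~> abs (D w - D w)" unfolding X_def by (intro tendsto_intros)
   then have "(%k. min (X k w) R) ~> min (abs (D w - D w)) R" by (intro tendsto_min tendsto_const)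
   then show ?case using R by simp
  qed
 qed (use Xm R in \<open>auto simp: X_def\<close>)
 have bound: "E <= abs K * (0 + (2 * V + 2 * C^2) / R)" if R: "R > 0" for R
 proof (rule LIMSEQ_le_const)
  show "(%k. (abs K) * (?A k R V C)) ~> abs K * (0 + (2 * V + 2 * C^2) / R)"
   using lim0[OF R] by (intro tendsto_intros) simp
  show "EX n. ALL k>=n. E <= abs K * (?A k R V C)"
   using key[OF R] by blast
 qed
 have "E <= 0"
 proof (rule LIMSEQ_le_const)
  show "(%j. (abs K) * (0 + (2 * V + 2 * C^2) / real (Suc j))) ~> 0"
   by real_asymp
  show "EX n. ALL k>=n. E <= abs K * (0 + (2 * V + 2 * C^2) / real (Suc k))"
   using bound[of "real (Suc _)"] by auto
 qed
 then show ?thesis by (simp add: E_def)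
qed

text \<open>Errors of smaller order than the mesh, uniformly in the step. This covers both the
  integrated drift and the deterministic coordinates.\<close>

definition small_steps :: "(nat => nat) => real => (nat => nat => real) => bool" where
 "small_steps L T e \<longleftrightarrow> (ALL eta>0. EV k. ALL i<2 ^ L k. (abs (e k i)) <= eta * (T / 2 ^ L k))"

lemma small_steps_weighted_sum:
 assumes e: "small_steps L T e" and ta: "!!k i. i < 2 ^ L k ==> abs (ta k i) <= K" and T: "0 <= T"
 shows "(%k. SUM i<2 ^ L k. ta k i * e k i) ~> 0"
proof (rule LIMSEQ_0I)
 fix eps :: real assume eps: "eps > 0"
 define eta where "eta = eps / (abs K * T + 1)"
 have den: "abs K * T + 1 > 0" using T by (simp add: add_nonneg_pos)
 have eta: "eta > 0" "abs K * T * eta <= eps"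
 proof -
  show 1: "eta > 0" using eps den by (simp add: eta_def)
  have "(abs K * T + 1) * eta = eps" using den by (simp add: eta_def)
  then show "abs K * T * eta <= eps" using 1 by (simp add: distrib_right)
 qed
 from e[unfolded small_steps_def, rule_format, OF eta(1)]
 show "EV k. (abs (SUM i<2 ^ L k. ta k i * e k i)) <= eps"
 proof eventually_elim
  case (elim k)
  have "abs (SUM i<2 ^ L k. ta k i * e k i) <= (SUM i<(2::nat) ^ L k. (abs K) * (eta * (T / 2 ^ L k)))"
  proof (rule order.trans[OF sum_abs sum_mono])
   fix i :: nat assume "i : {..<2 ^ L k}"
   then have "abs (ta k i) <= abs K" "abs (e k i) <= eta * (T / 2 ^ L k)" using ta[of i k] elim by auto
   then show "abs (ta k i * e k i) <= abs K * (eta * (T / 2 ^ L k))" unfolding abs_mult by (intro mult_mono) auto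
  qed
  also have "... = abs K * T * eta" by simp
  finally show ?case using eta(2) by linarith
 qed
qed

lemma small_steps_square_sum:
 assumes e: "small_steps L T e" and T: "0 <= T"
 shows "(%k. SUM i<2 ^ L k. (e k i)\<^sup>2) ~> 0"
proof -
 have ev: "EV k. ALL i<2 ^ L k. (abs (e k i)) <= 1 * (T / 2 ^ L k)"
  using e[unfolded small_steps_def, rule_format, of 1] by simp
 \<comment> \<open>The error is used as its own weight in \<open>small_steps_weighted_sum\<close>.
   That lemma wants a weight bounded for all \<open>k\<close>, hence the clipping, which has no
   effect for large \<open>k\<close>.\<close>
 have "(%k. SUM i<2 ^ L k. max (-T) (min T (e k i)) * e k i) ~> 0"
  by (rule small_steps_weighted_sum[OF e _ T, of _ T]) (use T in auto)
 moreover have "EV k. (SUM i<2 ^ L k. max (-T) (min T (e k i)) * e k i) = (SUM i<2 ^ L k. (e k i)\<^sup>2)"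
  using ev
 proof eventually_elim
  case (elim k)
  show ?case
  proof (rule sum.cong[OF refl])
   fix i :: nat assume "i : {..<2 ^ L k}"
   then have "abs (e k i) <= T / 2 ^ L k" using elim by auto
   also have "... <= T / 1" using T by (intro divide_left_mono) auto
   finally have "max (-T) (min T (e k i)) = e k i" by auto
   then show "max (-T) (min T (e k i)) * e k i = (e k i)^2" by (simp add: power2_eq_square)
  qed
 qed
 ultimately show ?thesis by (rule Lim_transform_eventually)
qed

lemma small_steps_of_modulus:
 fixes be :: "real => real"
 assumes t: "t0 <= t1" and L: "filterlim L at_top sequentially" and be: "continuous_on {t0..t1} be"
  and e: "!!k i eta. i < 2 ^ L k ==> eta > 0 ==>
   (!!x. dyadic t0 t1 (L k) i <= x ==> x <= dyadic t0 t1 (L k) (Suc i) ==> abs (be x - be (dyadic t0 t1 (L k) i)) <= eta) ==>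
   abs (e k i) <= eta * ((t1 - t0) / 2 ^ L k)"
 shows "small_steps L (t1 - t0) e"
 unfolding small_steps_def
proof (intro allI impI)
 fix eta :: real assume eta: "eta > 0"
 obtain d where d: "d > 0" "!!x z. x : {t0..t1} ==> z : {t0..t1} ==> abs (x - z) < d ==> abs (be x - be z) < eta"
  by (rule uniform_continuity_on_interval[OF be eta]) (rule that; assumption)
 have "EV k. (t1 - t0) / 2 ^ L k < d"
  by (rule eventually_compose_filterlim[OF mesh_eventually[OF d(1)] L])
 then show "EV k. ALL i<2 ^ L k. (abs (e k i)) <= eta * ((t1 - t0) / 2 ^ L k)"
 proof eventually_elim
  case (elim k)
  show ?case
  proof (intro allI impI e[OF _ eta])
   fix i x assume i: "i < (2::nat) ^ L k" and x: "dyadic t0 t1 (L k) i <= x" "x <= dyadic t0 t1 (L k) (Suc i)"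
   have "t0 <= dyadic t0 t1 (L k) i" "dyadic t0 t1 (L k) (Suc i) <= t1"
    using dyadic_bounds[OF t] i by simp_all
   then have "x : {t0..t1}" "dyadic t0 t1 (L k) i : {t0..t1}" using x by auto
   moreover have "abs (x - dyadic t0 t1 (L k) i) < d" using x elim by (simp add: dyadic_Suc)
   ultimately show "abs (be x - be (dyadic t0 t1 (L k) i)) <= eta" using d(2) by (simp add: less_imp_le)
  qed
 qed
qed

lemma small_steps_derivative:
 fixes tu :: "real => real"
 assumes t: "t0 <= t1" and L: "filterlim L at_top sequentially" and be: "continuous_on {t0..t1} be"
  and d: "!!r. r : {t0..t1} ==> (tu has_real_derivative be r) (at r within {t0..t1})"
 shows "small_steps L (t1 - t0) (%k i. tu (dyadic t0 t1 (L k) (Suc i)) - tu (dyadic t0 t1 (L k) i)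
   - be (dyadic t0 t1 (L k) i) * ((t1 - t0) / 2 ^ L k))"
proof (rule small_steps_of_modulus[OF t L be])
 fix k i and eta :: real
 let ?s = "dyadic t0 t1 (L k)"
 assume i: "i < 2 ^ L k" and eta: "eta > 0"
  and mod: "!!x. ?s i <= x ==> x <= ?s (Suc i) ==> abs (be x - be (?s i)) <= eta"
 have le: "?s i <= ?s (Suc i)" using t by (simp add: dyadic_Suc)
 have sub: "{?s i..?s (Suc i)} \<subseteq> {t0..t1}" using dyadic_bounds[OF t, of i "L k"] dyadic_bounds[OF t, of "Suc i" "L k"] i by auto
 have "EX x:{?s i..?s (Suc i)}. tu (?s (Suc i)) - tu (?s i) = (*) (be x) (?s (Suc i) - ?s i)"
 proof (rule mvt_very_simple[OF le])
  fix x assume "?s i <= x" "x <= ?s (Suc i)"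
  then show "(tu has_derivative (*) (be x)) (at x within {?s i..?s (Suc i)})"
   using d[of x] sub unfolding has_field_derivative_def by (auto intro: has_derivative_subset)
 qed
 then obtain x where x: "?s i <= x" "x <= ?s (Suc i)" and eq: "tu (?s (Suc i)) - tu (?s i) = be x * ((t1 - t0) / 2 ^ L k)"
  by (auto simp: dyadic_Suc)
 have "abs (tu (?s (Suc i)) - tu (?s i) - be (?s i) * ((t1 - t0) / 2 ^ L k)) = abs (be x - be (?s i)) * ((t1 - t0) / 2 ^ L k)"
  unfolding eq left_diff_distrib[symmetric] using t by (simp add: abs_mult)
 also have "... <= eta * ((t1 - t0) / 2 ^ L k)" using mod[OF x] t by (intro mult_right_mono) auto
 finally show "abs (tu (?s (Suc i)) - tu (?s i) - be (?s i) * ((t1 - t0) / 2 ^ L k)) <= eta * ((t1 - t0) / 2 ^ L k)" .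
qed

lemma small_steps_integral:
 fixes be :: "real => real"
 assumes t: "0 <= t0" "t0 <= t1" and L: "filterlim L at_top sequentially" and be: "continuous_on {t0..t1} be"
  and int: "set_integrable lborel {0..t1} be"
 shows "small_steps L (t1 - t0) (%k i. set_lebesgue_integral lborel {0..dyadic t0 t1 (L k) (Suc i)} be
   - set_lebesgue_integral lborel {0..dyadic t0 t1 (L k) i} be - be (dyadic t0 t1 (L k) i) * ((t1 - t0) / 2 ^ L k))"
proof (rule small_steps_of_modulus[OF t(2) L be])
 fix k i and eta :: real
 let ?s = "dyadic t0 t1 (L k)"
 assume i: "i < 2 ^ L k" and eta: "eta > 0"
  and mod: "!!x. ?s i <= x ==> x <= ?s (Suc i) ==> abs (be x - be (?s i)) <= eta"
 have le: "?s i <= ?s (Suc i)" using t by (simp add: dyadic_Suc)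
 have s: "t0 <= ?s i" "?s (Suc i) <= t1"
  using dyadic_bounds[OF t(2), of i "L k"] dyadic_bounds[OF t(2), of "Suc i" "L k"] i by auto
 let ?A = "{?s i<..?s (Suc i)}"
 have intA: "set_integrable lborel ?A be" by (rule set_integrable_subset[OF int]) (use s t in auto)
 have int0: "set_integrable lborel {0..?s i} be" by (rule set_integrable_subset[OF int]) (use s t le in auto)
 have un: "{0..?s (Suc i)} = {0..?s i} \<union> ?A" using s t le by auto
 have "set_lebesgue_integral lborel {0..?s (Suc i)} be = set_lebesgue_integral lborel {0..?s i} be + set_lebesgue_integral lborel ?A be"
  unfolding un by (rule set_integral_Un[OF _ int0 intA]) auto
 moreover have intc: "set_integrable lborel ?A (%_. c)" for c :: real
  unfolding set_integrable_def using le by (simp add: integrable_real_indicator)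
 moreover have const: "set_lebesgue_integral lborel ?A (%_. c) = c * ((t1 - t0) / 2 ^ L k)" for c :: real
  using le by (simp add: set_lebesgue_integral_def dyadic_Suc)
 ultimately have eq: "set_lebesgue_integral lborel {0..?s (Suc i)} be - set_lebesgue_integral lborel {0..?s i} be
   - be (?s i) * ((t1 - t0) / 2 ^ L k) = set_lebesgue_integral lborel ?A (%x. be x - be (?s i))"
  using set_integral_diff(2)[OF intA intc[of "be (?s i)"]] by simp
 have "abs (set_lebesgue_integral lborel ?A (%x. be x - be (?s i))) <= set_lebesgue_integral lborel ?A (%x. (abs (be x - be (?s i))))"
  using set_integral_norm_bound[OF set_integral_diff(1)[OF intA intc[of "be (?s i)"]]] by simp
 also have "... <= set_lebesgue_integral lborel ?A (%x. eta)"
  using set_integrable_abs[OF set_integral_diff(1)[OF intA intc[of "be (?s i)"]]] intc mod by (intro set_integral_mono) auto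
 finally show "abs (set_lebesgue_integral lborel {0..?s (Suc i)} be - set_lebesgue_integral lborel {0..?s i} be
   - be (?s i) * ((t1 - t0) / 2 ^ L k)) <= eta * ((t1 - t0) / 2 ^ L k)"
  unfolding eq const .
qed

section \<open>Systems driven by independent Brownian motions\<close>

locale ito_system = prob_space M for M :: "'a measure" +
 fixes \<F> :: "real => 'a measure" and B :: "nat => real => 'a => real" and N :: nat
  and X sg b :: "nat => real => 'a => real"
 assumes N_pos: "0 < N" and brownian: "j < N ==> brownian M \<F> (B j)"
  and indep: "indep_processes M B {..<N}"
  and differential: "j < N ==> has_ito_differential M \<F> (B j) (X j) (sg j) (b j)"
  and diffusion_continuous: "j < N ==> w : space M ==> continuous_on {0..} (%r. sg j r w)"
begin

definition increment :: "nat => real => real => 'a => real" where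
 "increment j s t w = B j t w - B j s w"

definition drift :: "nat => real => 'a => real" where
 "drift j r w = set_lebesgue_integral lborel {0..r} (%s. b j s w)"

text \<open>\<open>X\<close> minus its start and its integrated drift is the given version of the
  stochastic integral, so this is the error of the left-point rule over one step.\<close>

definition euler_error :: "nat => real => real => 'a => real" where
 "euler_error j s t w = (X j t w - X j 0 w - drift j t w) - (X j s w - X j 0 w - drift j s w)
   - sg j s w * increment j s t w"

lemma ito: "j < N ==> 0 <= r ==> has_ito_integral M \<F> (B j) (sg j) r (%w. X j r w - X j 0 w - drift j r w)"
 using differential unfolding has_ito_differential_def drift_def by blast

lemma drift_integrable: "j < N ==> 0 <= r ==> AE w in M. set_integrable lborel {0..r} (%s. b j s w)"
 using differential unfolding has_ito_differential_def by blast

lemma X_adapted: "j < N ==> 0 <= r ==> X j r : bmeas (\<F> r)"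
 using differential unfolding has_ito_differential_def continuous_adapted_def by blast

lemma X_continuous: "j < N ==> w : space M ==> continuous_on {0..} (%r. X j r w)"
 using differential unfolding has_ito_differential_def continuous_adapted_def by blast

lemma diffusion_adapted: "j < N ==> 0 <= r ==> sg j r : bmeas (\<F> r)"
 by (rule brownian.has_ito_integral_measurable(4)[OF brownian ito]) (assumption | rule order.refl)+

lemma adapted_measurable: "f : bmeas (\<F> r) ==> f : bmeas M"
 using brownian.measurable_F_M[OF brownian[OF N_pos]] .

lemma adapted_mono: "s <= t ==> f : bmeas (\<F> s) ==> f : bmeas (\<F> t)"
 using brownian.measurable_F_mono[OF brownian[OF N_pos]] .

lemma euler_error_sum_prob0:
 assumes t: "0 <= t0" "t0 <= t1" and j: "j < N"
  and ta: "!!r. 0 <= r ==> ta r : bmeas (\<F> r)" "!!w. w : space M ==> continuous_on {0..} (%r. ta r w)"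
 shows "prob0 M (%k w. ennreal ((SUM i<2 ^ k. ta (dyadic t0 t1 k i) w *
   euler_error j (dyadic t0 t1 k i) (dyadic t0 t1 k (Suc i)) w)^2))"
proof -
 have eq: "brownian.ito_error (B j) (sg j) (%r w. X j r w - X j 0 w - drift j r w) t0 t1 k i w =
   euler_error j (dyadic t0 t1 k i) (dyadic t0 t1 k (Suc i)) w" for k i w
  unfolding euler_error_def increment_def
  by (rule brownian.ito_error_def[OF brownian[OF j] t ito[OF j] diffusion_continuous[OF j] ta])
 show ?thesis
  using brownian.ito_error_sum_prob0[OF brownian[OF j] t ito[OF j] diffusion_continuous[OF j] ta]
  unfolding eq .
qed

lemma euler_error_squares_prob0:
 assumes t: "0 <= t0" "t0 <= t1" and j: "j < N"
 shows "prob0 M (%k w. ennreal (SUM i<2 ^ k. (euler_error j (dyadic t0 t1 k i) (dyadic t0 t1 k (Suc i)) w)\<^sup>2))"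
proof -
 have c: "(%_. 1 :: real) : bmeas (\<F> r)" "continuous_on {0..} (%_::real. 1 :: real)" for r by simp_all
 have eq: "brownian.ito_error (B j) (sg j) (%r w. X j r w - X j 0 w - drift j r w) t0 t1 k i w =
   euler_error j (dyadic t0 t1 k i) (dyadic t0 t1 k (Suc i)) w" for k i w
  unfolding euler_error_def increment_def
  by (rule brownian.ito_error_def[OF brownian[OF j] t ito[OF j] diffusion_continuous[OF j] c])
 show ?thesis
  using brownian.ito_error_squares_prob0[OF brownian[OF j] t ito[OF j] diffusion_continuous[OF j] c]
  unfolding eq mult_1 .
qed

text \<open>There are countably many blocks and finitely many pairs of motions, so one null set
  serves all of them.\<close>

lemma covariation_blocks:
 assumes t: "0 <= t0" "t0 <= t1"
 shows "AE w in M. ALL j<N. ALL j'<N. ALL c d. (%k. SUM i:dyadic_block c d k.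
   increment j (dyadic t0 t1 k i) (dyadic t0 t1 k (Suc i)) w * increment j' (dyadic t0 t1 k i) (dyadic t0 t1 k (Suc i)) w
   - (if j = j' then 1 else 0) * ((t1 - t0) / 2 ^ k)) ~> 0"
proof -
 have "AE w in M. (%k. SUM i:dyadic_block c d k.
   increment j (dyadic t0 t1 k i) (dyadic t0 t1 k (Suc i)) w * increment j' (dyadic t0 t1 k i) (dyadic t0 t1 k (Suc i)) w
   - (if j = j' then 1 else 0) * ((t1 - t0) / 2 ^ k)) ~> 0" if j: "j < N" "j' < N" for j j' c d
 proof (cases "j = j'")
  case True
  have "AE w in M. (%k. SUM i:dyadic_block c d k. (B j (dyadic t0 t1 k (Suc i)) w - B j (dyadic t0 t1 k i) w)\<^sup>2
    - (t1 - t0) / 2 ^ k) ~> 0"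
   by (rule brownian.quadratic_variation_AE[OF brownian[OF j(1)] t]) (rule dyadic_block_subset)
  then show ?thesis using True by (simp add: increment_def power2_eq_square)
 next
  case False
  have ind: "indep_vars (%_. PiM {0..} (%_. borel)) (%i w. \<lambda>s\<in>{0..}. B i s w) {..<N}"
   using indep by (simp add: indep_processes_def)
  have "indep_var (PiM {0..} (%_. borel)) (%w. \<lambda>s\<in>{0..}. B j s w) (PiM {0..} (%_. borel)) (%w. \<lambda>s\<in>{0..}. B j' s w)"
   using indep_vars_pair[OF ind, of j j' "%x. x" _ "%x. x"] j False by simp
  then have "AE w in M. (%k. SUM i:dyadic_block c d k. (B j (dyadic t0 t1 k (Suc i)) w - B j (dyadic t0 t1 k i) w) *
    (B j' (dyadic t0 t1 k (Suc i)) w - B j' (dyadic t0 t1 k i) w)) ~> 0"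
   by (intro brownian.covariation_AE[OF brownian[OF j(1)] t _ brownian[OF j(2)]] dyadic_block_subset)
  then show ?thesis using False by (simp add: increment_def)
 qed
 note pair = this
 have "AE w in M. ALL j:{..<N}. ALL j':{..<N}. ALL c d. (%k. SUM i:dyadic_block c d k.
   increment j (dyadic t0 t1 k i) (dyadic t0 t1 k (Suc i)) w * increment j' (dyadic t0 t1 k i) (dyadic t0 t1 k (Suc i)) w
   - (if j = j' then 1 else 0) * ((t1 - t0) / 2 ^ k)) ~> 0"
  by (intro AE_finite_allI finite_lessThan AE_all_countable[THEN iffD2] allI pair) simp_all
 then show ?thesis by (simp add: Ball_def)
qed

text \<open>\<open>G\<close> is known at \<open>t0\<close>, before all increments, so it does not
  disturb the vanishing mean. The bound for the second moment is independent of \<open>k\<close>, as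
  the passage to the limit in expectation requires.\<close>

lemma stochastic_sum:
 assumes t: "0 <= t0" "t0 <= t1" and j: "j < N"
  and ta: "!!r. 0 <= r ==> ta r : bmeas (\<F> r)" "!!r w. r : {t0..t1} ==> w : space M ==> abs (ta r w) <= C"
  and G: "G : bmeas (\<F> t0)" "!!w. w : space M ==> abs (G w) <= K"
 defines "Z \<equiv> %k w. SUM i<2 ^ k. ta (dyadic t0 t1 k i) w * increment j (dyadic t0 t1 k i) (dyadic t0 t1 k (Suc i)) w"
 shows "integrable M (%w. G w * Z k w)" "expectation (%w. G w * Z k w) = 0"
  "integrable M (%w. (Z k w)\<^sup>2)" "expectation (%w. (Z k w)\<^sup>2) <= C^2 * (t1 - t0)" "Z k : bmeas M"
proof -
 interpret e: elementary_integrand M \<F> "B j" "2 ^ k" "dyadic t0 t1 k" "%i. ta (dyadic t0 t1 k i)"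
  unfolding elementary_integrand_def elementary_integrand_axioms_def
 proof (intro conjI allI impI brownian j)
  show "0 <= dyadic t0 t1 k 0" using t by simp
  show "dyadic t0 t1 k i <= dyadic t0 t1 k (Suc i)" for i using t by (simp add: dyadic_Suc)
  show "ta (dyadic t0 t1 k i) : bmeas (\<F> (dyadic t0 t1 k i))" if "i < 2 ^ k" for i
  proof (rule ta(1))
   show "0 <= dyadic t0 t1 k i" using dyadic_bounds(1)[OF t(2), of i k] that t(1) by simp
  qed
 qed
 have Z: "Z k = (%w. SUM i<2 ^ k. ta (dyadic t0 t1 k i) w * e.dB i w)"
  by (simp add: Z_def increment_def e.dB_def)
 have bd: "abs (ta (dyadic t0 t1 k i) w) <= C" if "i < 2 ^ k" "w : space M" for i w
  using that dyadic_bounds[OF t(2), of i k] by (intro ta(2)) auto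
 have G': "G : bmeas (\<F> (dyadic t0 t1 k 0))" using G(1) by simp
 show "integrable M (%w. G w * Z k w)" "expectation (%w. G w * Z k w) = 0"
  unfolding Z using e.bounded_integral_expectation[OF bd subset_refl G' G(2)] by simp_all
 show "integrable M (%w. (Z k w)\<^sup>2)"
  unfolding Z using e.bounded_integral_isometry(1)[OF bd subset_refl] by simp
 show "Z k : bmeas M"
  unfolding Z by (intro borel_measurable_sum borel_measurable_times e.a_measurable e.dB_measurable) simp_all
 have "expectation (%w. (Z k w)\<^sup>2) = (SUM i<2 ^ k. expectation (%w. (ta (dyadic t0 t1 k i) w)\<^sup>2) * e.dg i)"
  unfolding Z using e.bounded_integral_isometry(2)[OF bd subset_refl] by simp
 also have "... <= (SUM i<(2::nat) ^ k. C\<^sup>2 * ((t1 - t0) / 2 ^ k))"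
 proof (rule sum_mono)
  fix i :: nat assume i: "i : {..<2 ^ k}"
  have sq: "(ta (dyadic t0 t1 k i) w)^2 <= C^2" if "w : space M" for w
   using power_mono[OF bd[OF _ that, of i], of 2] i by simp
  have "integrable M (%w. (ta (dyadic t0 t1 k i) w)\<^sup>2)"
   using sq i e.a_measurable[of i] by (intro integrable_const_bound[where B = "C^2"] AE_I2) auto
  then have "expectation (%w. (ta (dyadic t0 t1 k i) w)\<^sup>2) <= C^2"
   using sq by (intro integral_le_const AE_I2) auto
  then show "expectation (%w. (ta (dyadic t0 t1 k i) w)\<^sup>2) * e.dg i <= C^2 * ((t1 - t0) / 2 ^ k)"
   using t by (simp add: e.dg_def dyadic_Suc mult_right_mono divide_right_mono)
 qed
 also have "... = C^2 * (t1 - t0)" by simp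
 finally show "expectation (%w. (Z k w)\<^sup>2) <= C^2 * (t1 - t0)" .
qed

definition extended :: "(nat => real => real) => nat => real => 'a => real" where
 "extended tu a r w = (if a < N then X a r w else tu a r)"

text \<open>
 The first \<open>N\<close> coordinates are the diffusion, the remaining ones are deterministic functions of time.
\<close>

theorem ito_martingale:
 fixes tu tu' :: "nat => real => real"
 assumes t: "0 <= t0" "t0 <= t1" and n: "N <= n"
  and poly: "polyfun n P" "polyfun n S" "!!a. polyfun n (S1 a)" "!!a b. polyfun n (S2 a b)"
  and taylor: "taylor_bounded n (%y. exp (P y) * S y) (%a y. exp (P y) * S1 a y) (%a b y. exp (P y) * S2 a b y)"
  and tu: "!!a. N <= a ==> a < n ==> continuous_on {0..} (tu a)"
   "!!a. N <= a ==> a < n ==> continuous_on {t0..t1} (tu' a)"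
   "!!a r. N <= a ==> a < n ==> r : {t0..t1} ==> (tu a has_real_derivative tu' a r) (at r within {t0..t1})"
  and b: "AE w in M. ALL j<N. continuous_on {t0..t1} (%r. b j r w)"
  and gen: "AE w in M. ALL r:{t0..t1}.
   (SUM a<n. (exp (P (%j. extended tu j r w)) * S1 a (%j. extended tu j r w)) * (if a < N then b a r w else tu' a r))
   + (SUM a<N. (sg a r w)\<^sup>2 * (exp (P (%j. extended tu j r w)) * S2 a a (%j. extended tu j r w))) / 2 = 0"
  and bd: "!!r w. r : {t0..t1} ==> w : space M ==>
    abs (exp (P (%j. extended tu j r w)) * S (%j. extended tu j r w)) <= C"
   "!!a r w. a < N ==> r : {t0..t1} ==> w : space M ==>
    abs (exp (P (%j. extended tu j r w)) * S1 a (%j. extended tu j r w) * sg a r w) <= C"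
  and G: "G : bmeas (\<F> t0)" "!!w. w : space M ==> abs (G w) <= K"
 shows "expectation (%w. G w * (exp (P (%j. extended tu j t1 w)) * S (%j. extended tu j t1 w))) =
     expectation (%w. G w * (exp (P (%j. extended tu j t0 w)) * S (%j. extended tu j t0 w)))"
proof -
 define y where "y = (%w r j. extended tu j r w)"
 define f where "f = (%y. exp (P y) * S y)"
 define f1 where "f1 = (%a y. exp (P y) * S1 a y)"
 define f2 where "f2 = (%a b y. exp (P y) * S2 a b y)"
 have tay: "taylor_bounded n f f1 f2" using taylor unfolding f_def f1_def f2_def .
 have bd1: "abs (f (y w r)) <= C" if "r : {t0..t1}" "w : space M" for r w
  using bd(1)[OF that] unfolding f_def y_def .
 have bd2: "abs (f1 a (y w r) * sg a r w) <= C" if "a < N" "r : {t0..t1}" "w : space M" for a r w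
  using bd(2)[OF that] unfolding f1_def y_def .
 have gen': "AE w in M. ALL r:{t0..t1}. (SUM a<n. f1 a (y w r) * (if a < N then b a r w else tu' a r))
   + (SUM a<N. (sg a r w)\<^sup>2 * f2 a a (y w r)) / 2 = 0"
  using gen unfolding f1_def f2_def y_def .
 have yc: "continuous_on {0..} (%r. y w r a)" if "a < n" "w : space M" for a w
  using that X_continuous[of a w] tu(1)[of a] by (cases "a < N") (simp_all add: y_def extended_def)
 have ym: "(%w. y w r a) : bmeas (\<F> r)" if "a < n" "0 <= r" for a r
  using that X_adapted[of a r] by (cases "a < N") (simp_all add: y_def extended_def)
 have f_m: "(%w. f (y w r)) : bmeas (\<F> r)" if "0 <= r" for r
  unfolding f_def
  by (intro borel_measurable_times measurable_compose[OF _ borel_measurable_exp] polyfun_measurable[OF poly(1)]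
   polyfun_measurable[OF poly(2)] ym that)
 have f1_m: "(%w. f1 a (y w r)) : bmeas (\<F> r)" if "0 <= r" for a r
  unfolding f1_def
  by (intro borel_measurable_times measurable_compose[OF _ borel_measurable_exp] polyfun_measurable[OF poly(1)]
   polyfun_measurable[OF poly(3)] ym that)
 have f1_c: "continuous_on {0..} (%r. f1 a (y w r))" if "w : space M" for a w
  unfolding f1_def
  by (intro continuous_intros polyfun_continuous_on[OF poly(1)] polyfun_continuous_on[OF poly(3)] yc that)
 have f2_c: "continuous_on {0..} (%r. f2 a a' (y w r))" if "w : space M" for a a' w
  unfolding f2_def
  by (intro continuous_intros polyfun_continuous_on[OF poly(1)] polyfun_continuous_on[OF poly(4)] yc that)
 have sub: "{t0..t1} \<subseteq> {0..}" using t by auto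

 \<comment> \<open>The errors must vanish both when weighted with the first derivative
   (\<open>X1\<close>) and in square sum (\<open>X2\<close>). All of them are added up, so that one
   subsequence gives almost sure convergence for every coordinate.\<close>
 define X1 where "X1 = (%j k w. ennreal ((SUM i<2 ^ k. f1 j (y w (dyadic t0 t1 k i)) *
   euler_error j (dyadic t0 t1 k i) (dyadic t0 t1 k (Suc i)) w)^2))"
 define X2 where "X2 = (%j k w. ennreal (SUM i<2 ^ k. (euler_error j (dyadic t0 t1 k i) (dyadic t0 t1 k (Suc i)) w)\<^sup>2))"
 have "prob0 M (%k w. SUM j:{..<N}. X1 j k w + X2 j k w)"
 proof (rule prob0_sum)
  fix j assume "j : {..<N}"
  then have j: "j < N" by simp
  have "prob0 M (X1 j)" unfolding X1_def
   by (rule euler_error_sum_prob0[OF t j, where ta = "%r w. f1 j (y w r)"]) (rule f1_m f1_c; assumption)+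
  moreover have "prob0 M (X2 j)" unfolding X2_def by (rule euler_error_squares_prob0[OF t j])
  ultimately show "prob0 M (%k w. X1 j k w + X2 j k w)" by (rule prob0_add)
 qed
 then obtain L where L: "strict_mono L" and
  Lim: "AE w in M. (%k. SUM j:{..<N}. X1 j (L k) w + X2 j (L k) w) ~> 0"
  using prob0_AE_subseq by blast
 have Ltop: "filterlim L at_top sequentially" using L by (rule filterlim_subseq)

 define Z where "Z = (%k w. SUM j<N. SUM i<2 ^ k. f1 j (y w (dyadic t0 t1 k i)) * sg j (dyadic t0 t1 k i) w *
   increment j (dyadic t0 t1 k i) (dyadic t0 t1 k (Suc i)) w)"
 have int_all: "AE w in M. ALL j:{..<N}. set_integrable lborel {0..t1} (%s. b j s w)"
  by (rule AE_finite_allI) (use drift_integrable t in auto)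
 let ?A = "%L k w. SUM j:{..<N}. X1 j (L k) w + X2 j (L k) w"
 let ?B = "%t0 t1 L k i. dyadic t0 t1 (L k) i"
 have conv: "AE w in M. (%k. Z (L k) w) ~> f (y w t1) - f (y w t0)"
  using Lim covariation_blocks[OF t] b gen' int_all AE_space
 proof eventually_elim
  case (elim w)
  note lim = elim(1) and cov = elim(2)[rule_format] and bc = elim(3)[rule_format] and g = elim(4)[rule_format]
   and intb = elim(5) and w = elim(6)
  have lim1: "(%k. X1 j (L k) w) ~> 0" "(%k. X2 j (L k) w) ~> 0" if "j < N" for j
  proof -
   have le: "X1 j (L k) w + X2 j (L k) w <= (?A L k w)" for k
    using that by (intro member_le_sum) auto
   have le1: "X1 j (L k) w <= (?A L k w)" for k
    by (rule order.trans[OF _ le]) simp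
   have le2: "X2 j (L k) w <= (?A L k w)" for k
    by (rule order.trans[OF _ le]) simp
   show "(%k. X1 j (L k) w) ~> 0"
    by (rule tendsto_sandwich[OF _ _ tendsto_const lim]) (simp_all add: le1)
   show "(%k. X2 j (L k) w) ~> 0"
    by (rule tendsto_sandwich[OF _ _ tendsto_const lim]) (simp_all add: le2)
  qed
  define s where "s = (%k i. dyadic t0 t1 (L k) i)"
  define h where "h = (%k. (t1 - t0) / 2 ^ L k)"
  define d1 where "d1 = (%a k i. if a < N then euler_error a (s k i) (s k (Suc i)) w else 0)"
  define d2 where "d2 = (%a k i. if a < N then drift a (s k (Suc i)) w - drift a (s k i) w - b a (s k i) w * h k
    else tu a (s k (Suc i)) - tu a (s k i) - tu' a (s k i) * h k)"
  \<comment> \<open>The deterministic coordinates enter Ito's formula with diffusion, noise and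
    covariation 0; their increments consist of a drift and an error small against the mesh.\<close>
  define sg' where "sg' = (%a r. if a < N then sg a r w else 0)"
  define b' where "b' = (%a r. if a < N then b a r w else tu' a r)"
  define xi where "xi = (%a k i. if a < N then increment a (s k i) (s k (Suc i)) w else 0)"
  define q where "q = (%a a'. if a < N & a = a' then 1 else 0 :: real)"
  have small: "small_steps L (t1 - t0) (d2 a)" if a: "a < n" for a
  proof (cases "a < N")
   case True
   have i: "set_integrable lborel {0..t1} (%s. b a s w)" using intb True by simp
   show ?thesis
    using small_steps_integral[OF t Ltop bc[OF True] i] True unfolding d2_def drift_def s_def h_def by simp
  next
   case False
   then have "N <= a" by simp
   from small_steps_derivative[OF t(2) Ltop tu(2)[OF this a] tu(3)[OF this a]] False
   show ?thesis unfolding d2_def s_def h_def by simp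
  qed
  have f1b: "EX K>=0. ALL r:{t0..t1}. abs (f1 a (y w r)) <= K" for a
  by (metis continuous_on_interval_bound[OF continuous_on_subset[OF f1_c[OF w] sub], of a])
  have E1: "(%k. SUM i<2 ^ L k. f1 a (y w (s k i)) * (d1 a k i + d2 a k i)) ~> 0" if a: "a < n" for a
  proof -
   have "(%k. SUM i<2 ^ L k. f1 a (y w (s k i)) * d1 a k i) ~> 0"
   proof (cases "a < N")
    case True
    have "(%k. sqrt (enn2real (X1 a (L k) w))) ~> sqrt (enn2real 0)"
     using lim1(1)[OF True] by (intro tendsto_intros tendsto_enn2real) auto
    then show ?thesis using True by (simp add: X1_def d1_def s_def tendsto_rabs_zero_iff)
   qed (simp add: d1_def)
   moreover have "(%k. SUM i<2 ^ L k. f1 a (y w (s k i)) * d2 a k i) ~> 0"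
   proof -
    obtain K where K: "ALL r:{t0..t1}. abs (f1 a (y w r)) <= K" using f1b[of a] by blast
    show ?thesis
    proof (rule small_steps_weighted_sum[OF small[OF a], of _ K])
     show "abs (f1 a (y w (s k i))) <= K" if "i < 2 ^ L k" for k i
      using K dyadic_bounds[OF t(2), of i "L k"] that by (simp add: s_def)
     show "0 <= t1 - t0" using t by simp
    qed
   qed
   ultimately have "(%k. (SUM i<2 ^ L k. f1 a (y w (s k i)) * d1 a k i) + (SUM i<2 ^ L k. f1 a (y w (s k i)) * d2 a k i)) ~> 0 + 0"
    by (rule tendsto_add)
   then show ?thesis by (simp add: distrib_left sum.distrib)
  qed
  have E2: "(%k. SUM i<2 ^ L k. (d1 a k i + d2 a k i)\<^sup>2) ~> 0" if a: "a < n" for a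
  proof (rule square_sum_tendsto_0_add)
   show "(%k. SUM i<2 ^ L k. (d1 a k i)\<^sup>2) ~> 0"
   proof (cases "a < N")
    case True
    have "(%k. enn2real (X2 a (L k) w)) ~> enn2real 0"
     using lim1(2)[OF True] by (intro tendsto_enn2real) auto
    then show ?thesis using True by (simp add: X2_def d1_def s_def sum_nonneg)
   qed (simp add: d1_def)
   show "(%k. SUM i<2 ^ L k. (d2 a k i)\<^sup>2) ~> 0"
    by (rule small_steps_square_sum[OF small[OF a]]) (use t in simp)
  qed
  have "(%k. SUM i<2 ^ L k. SUM a<n. f1 a (%j. y w (?B t0 t1 L k i) j) * sg' a (?B t0 t1 L k i) * xi a k i)
    ~> f (%j. y w t1 j) - f (%j. y w t0 j)"
  proof (rule pathwise_ito[OF t(2) Ltop tay, where b = b' and e = "%a k i. d1 a k i + d2 a k i" and q = q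
     and y = "%j r. y w r j"])
   show "continuous_on {t0..t1} (%r. y w r a)" if "a < n" for a
    using continuous_on_subset[OF yc[OF that w] sub] .
   show "continuous_on {t0..t1} (sg' a)" if "a < n" for a
    using continuous_on_subset[OF diffusion_continuous[OF _ w] sub, of a] by (cases "a < N") (simp_all add: sg'_def)
   show "continuous_on {t0..t1} (b' a)" if "a < n" for a
    using bc[of a] tu(2)[of a] that by (cases "a < N") (simp_all add: b'_def)
   show "continuous_on {t0..t1} (%r. f1 a (%j. y w r j))" for a
    using continuous_on_subset[OF f1_c[OF w] sub] .
   show "continuous_on {t0..t1} (%r. f2 a a' (%j. y w r j))" for a a'
    using continuous_on_subset[OF f2_c[OF w] sub] .
   show "y w (dyadic t0 t1 (L k) (Suc i)) a - y w (?B t0 t1 L k i) a =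
    sg' a (?B t0 t1 L k i) * xi a k i + b' a (?B t0 t1 L k i) * ((t1 - t0) / 2 ^ L k) + (d1 a k i + d2 a k i)" for a k i
    by (simp add: y_def extended_def sg'_def xi_def b'_def d1_def d2_def s_def h_def euler_error_def)
   show "(%k. SUM i:dyadic_block c d (L k). xi a k i * xi a' k i - q a a' * ((t1 - t0) / 2 ^ L k)) ~> 0" for a a' c d
   proof (cases "a < N & a' < N")
    case True
    then show ?thesis
     using LIMSEQ_subseq_LIMSEQ[OF cov[of a a' c d] L] by (simp add: xi_def q_def s_def o_def)
   next
    case False
    then have "xi a k i * xi a' k i - q a a' * ((t1 - t0) / 2 ^ L k) = 0" for k i by (auto simp: xi_def q_def)
    then show ?thesis by simp
   qed
   show "(%k. SUM i<2 ^ L k. (d1 a k i + d2 a k i)\<^sup>2) ~> 0" if "a < n" for a by (rule E2[OF that])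
   show "(%k. SUM i<2 ^ L k. f1 a (%j. y w (?B t0 t1 L k i) j) * (d1 a k i + d2 a k i)) ~> 0" if "a < n" for a
    using E1[OF that] unfolding s_def .
   fix r assume r: "r : {t0..t1}"
   have "(SUM a<n. SUM a'<n. q a a' * sg' a r * sg' a' r * f2 a a' (y w r)) = (SUM a<n. if a < N then (sg a r w)^2 * f2 a a (y w r) else 0)"
   proof (rule sum.cong[OF refl])
    fix a assume a: "a : {..<n}"
    have "(SUM a'<n. q a a' * sg' a r * sg' a' r * f2 a a' (y w r)) = (SUM a':{a}. q a a' * sg' a r * sg' a' r * f2 a a' (y w r))"
     using a by (intro sum.mono_neutral_right) (auto simp: q_def)
    then show "(SUM a'<n. q a a' * sg' a r * sg' a' r * f2 a a' (y w r)) = (if a < N then (sg a r w)^2 * f2 a a (y w r) else 0)"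
     by (simp add: q_def sg'_def power2_eq_square)
   qed
   also have "... = (SUM a<N. (sg a r w)\<^sup>2 * f2 a a (y w r))"
    using n by (intro sum.mono_neutral_cong_right) auto
   finally show "(SUM a<n. f1 a (%j. y w r j) * b' a r) + (SUM a<n. SUM a'<n. q a a' * sg' a r * sg' a' r * f2 a a' (%j. y w r j)) / 2 = 0"
    using g[OF r] by (simp add: b'_def)
  qed
  moreover have "(SUM i<2 ^ L k. SUM a<n. f1 a (%j. y w (?B t0 t1 L k i) j) * sg' a (?B t0 t1 L k i) * xi a k i) = Z (L k) w" for k
  proof -
   have "(SUM i<2 ^ L k. SUM a<n. f1 a (%j. y w (?B t0 t1 L k i) j) * sg' a (?B t0 t1 L k i) * xi a k i) =
     (SUM i<2 ^ L k. SUM a<N. f1 a (y w (?B t0 t1 L k i)) * sg a (?B t0 t1 L k i) w *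
      increment a (?B t0 t1 L k i) (dyadic t0 t1 (L k) (Suc i)) w)"
    using n by (intro sum.cong[OF refl] sum.mono_neutral_cong_right) (auto simp: sg'_def xi_def s_def)
   then show ?thesis unfolding Z_def by (subst sum.swap) simp
  qed
  ultimately show ?case by simp
 qed

 define Z0 where "Z0 = (%j k w. SUM i<2 ^ k. (%r w. f1 j (y w r) * sg j r w) (dyadic t0 t1 k i) w *
   increment j (dyadic t0 t1 k i) (dyadic t0 t1 k (Suc i)) w)"
 have Z0: "Z k w = (SUM j<N. Z0 j k w)" for k w by (simp add: Z_def Z0_def)
 have tam: "(%w. f1 j (y w r) * sg j r w) : bmeas (\<F> r)" if "j < N" "0 <= r" for j r
  using f1_m[OF that(2)] diffusion_adapted[OF that] by (rule borel_measurable_times)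
 have sum0: "integrable M (%w. G w * Z0 j k w)" "expectation (%w. G w * Z0 j k w) = 0"
  "integrable M (%w. (Z0 j k w)\<^sup>2)" "expectation (%w. (Z0 j k w)\<^sup>2) <= C^2 * (t1 - t0)" "Z0 j k : bmeas M"
  if j: "j < N" for j k
  using stochastic_sum[OF t j tam[OF j] bd2[OF j] G, of k] unfolding Z0_def by simp_all
 have GM: "G : bmeas M" using G(1) by (rule adapted_measurable)
 have fM: "(%w. f (y w t1)) : bmeas M" "(%w. f (y w t0)) : bmeas M"
  by (rule adapted_measurable[OF f_m]; use t in simp)+
 \<comment> \<open>\<open>Z\<close> is a sum of \<open>N\<close> stochastic sums with second moment
   at most \<open>C^2 * (t1 - t0)\<close>. Cauchy-Schwarz contributes one factor \<open>N\<close> to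
   the constant \<open>V\<close>, the summation the other.\<close>
 have "expectation (%w. G w * (f (y w t1) - f (y w t0))) = 0"
 proof (rule expectation_limit_L2_bounded[where Z = "%k. Z (L k)" and K = K and C = "2 * C" and V = "N * (N * (C^2 * (t1 - t0)))"])
  show "AE w in M. (%k. Z (L k) w) ~> f (y w t1) - f (y w t0)" by (rule conv)
  have Zm: "Z k : bmeas M" for k
   unfolding Z0[abs_def] using sum0(5) by (intro borel_measurable_sum) auto
  then show "Z (L k) : bmeas M" for k .
  have Zsq: "(Z k w)^2 <= N * (SUM j<N. (Z0 j k w)\<^sup>2)" for k w
   unfolding Z0 using Cauchy_Schwarz_ineq_sum[of "%_. 1" "%j. Z0 j k w" "{..<N}"] by simp
  have si: "integrable M (%w. N * (SUM j<N. (Z0 j k w)\<^sup>2))" for k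
   using sum0(3) by (intro integrable_mult_right integrable_sum) auto
  have Zi: "integrable M (%w. (Z k w)\<^sup>2)" for k
   by (rule integrable_bound[OF si[of k]]) (use Zm[of k] Zsq order.trans[OF Zsq abs_ge_self] in auto)
  then show "integrable M (%w. (Z (L k) w)\<^sup>2)" for k .
  have "expectation (%w. (Z k w)\<^sup>2) <= N * (N * (C^2 * (t1 - t0)))" for k
  proof -
   have "expectation (%w. (Z k w)\<^sup>2) <= expectation (%w. N * (SUM j<N. (Z0 j k w)\<^sup>2))"
    by (rule integral_mono[OF Zi si Zsq])
   also have "... = N * (SUM j<N. expectation (%w. (Z0 j k w)\<^sup>2))"
    using sum0(3) by (simp add: integral_sum)
   also have "... <= N * (SUM j<N. C\<^sup>2 * (t1 - t0))"
    using sum0(4) by (intro mult_left_mono sum_mono) auto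
   finally show ?thesis by simp
  qed
  then show "expectation (%w. (Z (L k) w)\<^sup>2) <= N * (N * (C^2 * (t1 - t0)))" for k .
  show "(%w. f (y w t1) - f (y w t0)) : bmeas M" using fM by (rule borel_measurable_diff)
  show "abs (f (y w t1) - f (y w t0)) <= 2 * C" if "w : space M" for w
  proof -
   have "t1 : {t0..t1}" "t0 : {t0..t1}" using t by auto
   from bd1[OF this(1) that] bd1[OF this(2) that] show ?thesis by linarith
  qed
  show "G : bmeas M" by (rule GM)
  show "abs (G w) <= K" if "w : space M" for w by (rule G(2)[OF that])
  have GZ: "(%w. G w * Z k w) = (%w. SUM j<N. G w * Z0 j k w)" for k by (simp add: Z0 sum_distrib_left)
  show "integrable M (%w. G w * Z (L k) w)" for k
   unfolding GZ using sum0(1) by (intro integrable_sum) auto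
  show "expectation (%w. G w * Z (L k) w) = 0" for k
   unfolding GZ using sum0(1,2) by (subst integral_sum) auto
 qed
 moreover have Gi: "integrable M (%w. G w * f (y w r))" if "r : {t0, t1}" for r
 proof (rule integrable_const_bound[where B = "abs K * abs C"])
  show "AE w in M. norm (G w * f (y w r)) <= abs K * abs C"
  proof (rule AE_I2)
   fix w assume w: "w : space M"
   have "r : {t0..t1}" using that t by auto
   from bd1[OF this w] G(2)[OF w] show "norm (G w * f (y w r)) <= abs K * abs C"
    unfolding real_norm_def abs_mult by (intro mult_mono) auto
  qed
  show "(%w. G w * f (y w r)) : bmeas M" using that fM GM by (auto intro!: borel_measurable_times)
 qed
 ultimately have "expectation (%w. G w * f (y w t1)) = expectation (%w. G w * f (y w t0))"
  by (simp add: right_diff_distrib)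
 then show ?thesis unfolding f_def y_def .
qed

end

section \<open>The noncolliding system as a Doob transform\<close>

definition exp_poly :: "real \<times> real poly => real => real" where
 "exp_poly f x = exp (- fst f * x) * poly (snd f) x"

text \<open>The BESQ semigroup after time \<open>r\<close>, on functions \<open>exp_poly (L, p)\<close> with \<open>L \<ge> 0\<close>.\<close>

definition besq_step :: "real => real => real \<times> real poly => real \<times> real poly" where
 "besq_step nu r f = (let a = 1 + 2 * fst f * r in
   (fst f / a, smult (a powr - (nu + 1)) (pcompose (besq_heat nu (r / a) (snd f)) [:0, 1 / a^2:])))"

lemma exp_poly_besq_step:
 assumes "a = 1 + 2 * L * r"
 shows "exp_poly (besq_step nu r (L, p)) x = besq_fun nu L p (1 / a) (r / a) (a powr - (nu + 1)) x"
 unfolding besq_step_def exp_poly_def besq_fun_def Let_def fst_conv snd_conv assms[symmetric]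
 by (simp add: poly_pcompose power_divide)

text \<open>At collisions the value is 0, by division by 0, and differs from the smooth continuation
  of the quotient. The particles avoid collisions almost surely, so the two agree in
  expectations.\<close>

definition vdm_quotient :: "nat => (nat => real => real) => (nat => real) => real" where
 "vdm_quotient N ph x = alternant N (%j k. ph k (x j)) / vdm N x"

lemma vdm_quotient_measurable:
 assumes "!!k. ph k : bmeas borel" "!!j. j < N ==> (%w. x w j) : bmeas M"
 shows "(%w. vdm_quotient N ph (x w)) : bmeas M"
proof -
 have p: "p j < N" if "p permutes {..<N}" "j < N" for p j using permutes_in_image[OF that(1), of j] that(2) by simp
 have "(%w. alternant N (%j k. ph k (x w j))) : bmeas M"
  unfolding alternant_def
  by (intro borel_measurable_sum borel_measurable_times borel_measurable_prod borel_measurable_const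
    measurable_compose[OF assms(2) assms(1)]) auto
 moreover have "(%w. vdm N (x w)) : bmeas M"
  unfolding vdm_def case_prod_unfold
  by (intro borel_measurable_prod borel_measurable_diff assms(2)) auto
 ultimately show ?thesis unfolding vdm_quotient_def by (rule borel_measurable_divide)
qed

lemma exp_poly_measurable [measurable]: "exp_poly f : bmeas borel"
by (auto simp: exp_poly_def[abs_def] intro!: continuous_intros borel_measurable_continuous_onI)

locale noncolliding_system = ito_system M \<F> B N X "%j t w. 2 * sqrt (X j t w)"
  "%j t w. 2 * (nu + 1) + 4 * X j t w * (SUM k:{..<N} - {j}. 1 / (X j t w - X k t w))"
 for M :: "'a measure" and \<F> B N X and nu :: real +
 assumes index: "nu > -1"
  and nonneg: "j < N ==> 0 <= t ==> w : space M ==> 0 <= X j t w"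
  and noncolliding: "AE w in M. ALL t>=0. ALL j<N. ALL k<N. j ~= k --> X j t w ~= X k t w"
begin

lemma X_measurable [measurable]: "j < N ==> 0 <= t ==> X j t : bmeas M"
 by (rule adapted_measurable[OF X_adapted])

text \<open>The process \<open>F (t, X t)\<close> is a martingale on \<open>[t0, t1]\<close>, where
  \<open>F\<close> is the smooth continuation of the quotient and its parameters run from the
  evolved functions at \<open>t0\<close> to the given ones at \<open>t1\<close>. The bounded factor
  \<open>G\<close>, known at \<open>t0\<close>, stands in for a conditional expectation.\<close>

theorem markov_step:
 assumes t: "0 <= t0" "t0 <= t1" and lam: "lam > 0"
  and G: "G : bmeas (\<F> t0)" "!!w. w : space M ==> abs (G w) <= K"
 shows "expectation (%w. G w * vdm_quotient N (%k. exp_poly (lam, q k)) (%j. X j t1 w)) =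
     expectation (%w. G w * vdm_quotient N (%k. exp_poly (besq_step nu (t1 - t0) (lam, q k))) (%j. X j t0 w))"
proof -
 obtain S where S: "polyfun (N + 3) S" and quot: "!!y. vdm N y * (exp (- lam * y N * (SUM j<N. y j)) * S y) =
   alternant N (%j k. besq_fun nu lam (q k) (y N) (y (Suc N)) (y (Suc (Suc N))) (y j))"
  using besq_quotient[of N lam nu q] by blast
 define P where "P = (%y::nat => real. - lam * y N * (SUM j<N. y j))"
 have quot': "vdm N y * (exp (P y) * S y) =
   alternant N (%j k. besq_fun nu lam (q k) (y N) (y (Suc N)) (y (Suc (Suc N))) (y j))" for y
  using quot[of y] by (simp add: P_def)
 have P: "polyfun (N + 3) P" unfolding P_def by (intro polyfun_intros) auto
 obtain S1 where S1: "!!a. polyfun (N + 3) (S1 a)"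
  "has_gradient (N + 3) (%y. exp (P y) * S y) (%a y. exp (P y) * S1 a y)"
  using exp_polyfun_gradient[OF P S] by blast
 have "ALL a. EX T. (ALL b. polyfun (N + 3) (T b)) & has_gradient (N + 3) (%y. exp (P y) * S1 a y) (%b y. exp (P y) * T b y)"
  using exp_polyfun_gradient[OF P S1(1)] by blast
 from choice[OF this] obtain S2 where S2: "!!a b. polyfun (N + 3) (S2 a b)"
  "!!a. has_gradient (N + 3) (%y. exp (P y) * S1 a y) (%b y. exp (P y) * S2 a b y)" by blast
 have "ALL a. ALL b. EX T. (ALL c. polyfun (N + 3) (T c)) & has_gradient (N + 3) (%y. exp (P y) * S2 a b y) (%c y. exp (P y) * T c y)"
  using exp_polyfun_gradient[OF P S2(1)] by blast
 then have "ALL a. EX T. ALL b. (ALL c. polyfun (N + 3) (T b c)) & has_gradient (N + 3) (%y. exp (P y) * S2 a b y) (%c y. exp (P y) * T b c y)"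
  by (intro allI choice) simp
 from choice[OF this] obtain S3 where S3: "!!a b c. polyfun (N + 3) (S3 a b c)"
  "!!a b. has_gradient (N + 3) (%y. exp (P y) * S2 a b y) (%c y. exp (P y) * S3 a b c y)" by blast
 have taylor: "taylor_bounded (N + 3) (%y. exp (P y) * S y) (%a y. exp (P y) * S1 a y) (%a b y. exp (P y) * S2 a b y)"
  by (rule taylor_boundedI[OF S1(2) S2(2) S3(2) exp_polyfun_box_bounded[OF P S3(1)]])

 \<comment> \<open>The time to go. It is cut off at 0 because the deterministic coordinates have to
   be continuous on the whole half line; on \<open>[t0, t1]\<close> the cut-off is inactive.\<close>
 define rh where "rh = (%r. max 0 (t1 - r))"
 define A where "A = (%r. 1 + 2 * lam * rh r)"
 define bb where "bb = (%r. 1 / A r)"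
 define gg where "gg = (%r. A r powr - (nu + 1))"
 define tu where "tu = (%a r. if a = N then bb r else if a = Suc N then rh r / A r else gg r)"
 define tu' where "tu' = (%a r. if a = N then 2 * lam * (bb r)^2 else if a = Suc N then - (bb r)\<^sup>2
   else 2 * lam * (nu + 1) * bb r * gg r)"
 have rh0: "0 <= rh r" for r by (simp add: rh_def)
 have A1: "1 <= A r" for r using lam rh0[of r] by (simp add: A_def)
 have A0: "A r ~= 0" for r using A1[of r] by simp
 have Ap: "0 < A r" for r using A1[of r] by simp
 have rhc: "continuous_on U rh" for U unfolding rh_def by (intro continuous_intros)
 have Ac: "continuous_on U A" for U unfolding A_def by (intro continuous_intros rhc)
 have bbc: "continuous_on U bb" for U unfolding bb_def by (intro continuous_intros Ac) (use A0 in auto)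
 have ggc: "continuous_on U gg" for U unfolding gg_def by (intro continuous_intros Ac) (use A0 in auto)
 have tuc: "continuous_on U (tu a)" for U a
 proof -
  have "continuous_on U (%r. rh r / A r)" by (intro continuous_on_divide rhc Ac) (use A0 in auto)
  then show ?thesis unfolding tu_def using bbc ggc by (cases "a = N"; cases "a = Suc N") simp_all
 qed
 have tu'c: "continuous_on U (tu' a)" for U a
 proof -
  have "continuous_on U (%r. 2 * lam * (bb r)^2)" "continuous_on U (%r. - (bb r)\<^sup>2)"
   "continuous_on U (%r. 2 * lam * (nu + 1) * bb r * gg r)"
   by (intro continuous_intros bbc ggc)+
  then show ?thesis unfolding tu'_def by (cases "a = N"; cases "a = Suc N") simp_all
 qed
 have deriv: "(tu a has_real_derivative tu' a r) (at r within {t0..t1})" if r: "r : {t0..t1}" for a r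
 proof -
  define A' where "A' = (%r. 1 + 2 * lam * (t1 - r))"
  have AA: "A x = A' x" "rh x = t1 - x" if "x : {t0..t1}" for x using that by (auto simp: A_def A'_def rh_def)
  have A'p: "A' r > 0" using AA[OF r] Ap[of r] by simp
  have A'd: "(A' has_real_derivative - 2 * lam) (at r within {t0..t1})"
   unfolding A'_def by (auto intro!: derivative_eq_intros)
  have 1: "((%r. 1 / A' r) has_real_derivative 2 * lam * (1 / A' r)^2) (at r within {t0..t1})"
   using A'p by (auto intro!: derivative_eq_intros A'd simp: power2_eq_square field_simps)
  have 2: "((%r. (t1 - r) / A' r) has_real_derivative - (1 / A' r)\<^sup>2) (at r within {t0..t1})"
   using A'p by (auto intro!: derivative_eq_intros A'd simp: power2_eq_square field_simps) (simp add: A'_def algebra_simps)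
  have 3: "((%r. A' r powr - (nu + 1)) has_real_derivative 2 * lam * (nu + 1) * (1 / A' r) * A' r powr - (nu + 1)) (at r within {t0..t1})"
  proof -
   have "((%r. A' r powr - (nu + 1)) has_real_derivative (- (nu + 1) * A' r powr (- (nu + 1) - 1)) * (- 2 * lam)) (at r within {t0..t1})"
    by (rule DERIV_chain2[OF has_real_derivative_powr[OF A'p] A'd])
   then show ?thesis unfolding powr_diff powr_one[OF less_imp_le[OF A'p]] by (simp add: algebra_simps add_divide_distrib)
  qed
  show ?thesis
  proof (rule has_field_derivative_transform_within[where d = 1])
   show "((%r. if a = N then 1 / A' r else if a = Suc N then (t1 - r) / A' r else A' r powr - (nu + 1))
     has_real_derivative tu' a r) (at r within {t0..t1})"
    unfolding tu'_def bb_def gg_def AA[OF r] using 1 2 3 by simp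
  qed (use r AA in \<open>auto simp: tu_def bb_def gg_def\<close>)
 qed

 define y where "y = (%r w j. extended tu j r w)"
 let ?A = "%r w. %j. extended tu j r w"
 have yf: "y r w = (?A r w)" for r w by (simp add: y_def)
 have yX: "y r w j = X j r w" if "j < N" for r w j using that by (simp add: y_def extended_def)
 have yN: "y r w N = bb r" "y r w (Suc N) = rh r / A r" "y r w (Suc (Suc N)) = gg r" for r w
  by (simp_all add: y_def extended_def tu_def)
 have Xc: "continuous_on {t0..t1} (%r. X j r w)" if "j < N" "w : space M" for j w
  by (rule continuous_on_subset[OF X_continuous[OF that]]) (use t in auto)

 \<comment> \<open>A common bound for the three parameters: \<open>b\<close> and \<open>g\<close>
   are at most 1, as \<open>A >= 1\<close> and \<open>nu + 1 > 0\<close>, and \<open>ka\<close> is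
   at most \<open>t1 - t0\<close>.\<close>
 define R where "R = (SUM a<N. 0::real) + max 1 (t1 - t0)"
 have R: "R >= 0" "1 <= R" "t1 - t0 <= R" by (auto simp: R_def)
 \<comment> \<open>The value of \<open>b\<close> at \<open>t0\<close>, its minimum on the interval;
   it keeps the exponential damping uniform in time.\<close>
 define b0 where "b0 = 1 / (1 + 2 * lam * (t1 - t0))"
 have b0: "b0 > 0" using lam t by (simp add: b0_def add_pos_nonneg)
 have range: "b0 <= bb r" "bb r <= R" "abs (rh r / A r) <= R" "abs (gg r) <= R" if r: "r : {t0..t1}" for r
 proof -
  have "rh r <= t1 - t0" using r t by (auto simp: rh_def)
  then have "A r <= 1 + 2 * lam * (t1 - t0)" using lam by (simp add: A_def)
  then show "b0 <= bb r" unfolding b0_def bb_def using Ap[of r] by (intro divide_left_mono) auto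
  have "bb r <= 1" using A1[of r] by (simp add: bb_def)
  then show "bb r <= R" using R by simp
  have "rh r / A r <= rh r / 1" using A1[of r] rh0[of r] by (intro divide_left_mono) auto
  then show "abs (rh r / A r) <= R" using rh0[of r] Ap[of r] \<open>rh r <= t1 - t0\<close> R by simp
  have "A r powr - (nu + 1) <= 1" using powr_mono[of "- (nu + 1)" 0 "A r"] A1[of r] A0[of r] index by simp
  then show "abs (gg r) <= R" using R by (simp add: gg_def)
 qed
 let ?B = "%r w. 1 + (SUM j<N. X j r w)"
 have bound: "EX C. ALL r:{t0..t1}. ALL w:space M. (?B r w) * abs (exp (P (y r w)) * Sa (y r w)) <= C"
  if Sa: "polyfun (N + 3) Sa" for Sa
 proof -
  obtain C where C: "!!z. (ALL j<N. 0 <= z j) ==> b0 <= z N ==> z N <= R ==> abs (z (Suc N)) <= R ==> abs (z (Suc (Suc N))) <= R ==>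
   (1 + (SUM j<N. z j)) * abs (exp (- lam * z N * (SUM j<N. z j)) * Sa z) <= C"
   using exp_polyfun_bounded[OF Sa lam b0 R(1)] by blast
  show ?thesis
  proof (intro exI[of _ C] ballI)
   fix r w assume r: "r : {t0..t1}" and w: "w : space M"
   have "(1 + (SUM j<N. y r w j)) * abs (exp (- lam * y r w N * (SUM j<N. y r w j)) * Sa (y r w)) <= C"
    by (rule C) (use range[OF r] nonneg[OF _ _ w] r t in \<open>simp_all add: yX yN\<close>)
   then show "(?B r w) * abs (exp (P (y r w)) * Sa (y r w)) <= C"
    by (simp add: P_def yX)
  qed
 qed
 obtain C0 where C0: "ALL r:{t0..t1}. ALL w:space M. (?B r w) * abs (exp (P (y r w)) * S (y r w)) <= C0"
  using bound[OF S] by blast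
 let ?F = "%r w a. exp (P (y r w)) * S1 a (y r w)"
 have "ALL a. EX C. ALL r:{t0..t1}. ALL w:space M. (?B r w) * abs (?F r w a) <= C"
  using bound[OF S1(1)] by (rule allI)
 from choice[OF this] obtain C1 where C1: "!!a. ALL r:{t0..t1}. ALL w:space M. (?B r w) * abs (?F r w a) <= C1 a"
  by blast
 define C where "C = abs C0 + (SUM a<N. (abs (C1 a)))"
 have C: "C0 <= C" "!!a. a < N ==> C1 a <= C"
 proof -
  have "0 <= (SUM a<N. (abs (C1 a)))" by (rule sum_nonneg) simp
  then show "C0 <= C" using abs_ge_self[of C0] unfolding C_def by linarith
  fix a assume "a < N"
  then have "abs (C1 a) <= (SUM a<N. (abs (C1 a)))" by (intro member_le_sum) auto
  then show "C1 a <= C" by (simp add: C_def)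
 qed
 have sumX: "0 <= (SUM j<N. X j r w)" "!!a. a < N ==> X a r w <= (SUM j<N. X j r w)"
  if "r : {t0..t1}" "w : space M" for r w
  using that nonneg t by (auto intro!: sum_nonneg member_le_sum)

 let ?C = "%a nu r w. if a < N then 2 * (nu + 1) + 4 * X a r w * (SUM k:{..<N} - {a}. 1 / (X a r w - X k r w)) else tu' a r"
 let ?E = "%nu j w. %r. 2 * (nu + 1) + 4 * X j r w * (SUM k:{..<N} - {j}. 1 / (X j r w - X k r w))"
 let ?G = "%r w S2. SUM a<N. (2 * sqrt (X a r w))\<^sup>2 * (exp (P (y r w)) * S2 a a (y r w))"
 have main: "expectation (%w. G w * (exp (P (%j. extended tu j t1 w)) * S (%j. extended tu j t1 w))) =
     expectation (%w. G w * (exp (P (%j. extended tu j t0 w)) * S (%j. extended tu j t0 w)))"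
 proof (rule ito_martingale[OF t _ P S S1(1) S2(1) taylor, where tu' = tu' and C = C and K = K])
  show "AE w in M. ALL j<N. continuous_on {t0..t1} (?E nu j w)"
   using noncolliding AE_space
  proof eventually_elim
   case (elim w)
   show ?case
   proof (intro allI impI)
    fix j assume j: "j < N"
    show "continuous_on {t0..t1} (?E nu j w)"
    proof (intro continuous_on_add continuous_on_mult continuous_on_const continuous_on_sum Xc j elim(2))
     fix k assume k: "k : {..<N} - {j}"
     show "continuous_on {t0..t1} (%r. 1 / (X j r w - X k r w))"
     proof (intro continuous_on_divide continuous_on_const continuous_on_diff Xc j elim(2) ballI)
      show "k < N" using k by simp
      fix r assume r: "r : {t0..t1}"
      have "X j r w ~= X k r w" using elim(1) j k r t by auto
      then show "X j r w - X k r w ~= 0" by simp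
     qed
    qed
   qed
  qed
  show "AE w in M. ALL r:{t0..t1}.
   (SUM a<N + 3. (exp (P (?A r w)) * S1 a (?A r w)) *
    (?C a nu r w))
   + (SUM a<N. (2 * sqrt (X a r w))\<^sup>2 * (exp (P (?A r w)) * S2 a a (?A r w))) / 2 = 0"
   using noncolliding AE_space
  proof eventually_elim
   case (elim w)
   show ?case
    unfolding yf[symmetric]
   proof
    fix r assume r: "r : {t0..t1}"
    have dist: "y r w i ~= y r w k" if "i < N" "k < N" "i ~= k" for i k
     using elim(1) that r t by (auto simp: yX)
    note gen = noncolliding_generator[where F = "%y. exp (P y) * S y" and q = q and N = N and nu = nu and lam = lam
     and y = "y r w", OF quot' S1(2) S2(2) dist]
    have 1: "(SUM a<N. exp (P (y r w)) * S1 a (y r w) * (2 * (nu + 1) + 4 * X a r w * (SUM k:{..<N} - {a}. 1 / (X a r w - X k r w)))) =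
     (SUM j<N. (2 * (nu + 1) + 4 * y r w j * (SUM k:{..<N} - {j}. 1 / (y r w j - y r w k))) * (exp (P (y r w)) * S1 j (y r w)))"
     by (rule sum.cong[OF refl]) (simp add: yX)
    have 2: "(?G r w S2) / 2 =
     (SUM j<N. 2 * y r w j * (exp (P (y r w)) * S2 j j (y r w)))"
     unfolding sum_divide_distrib
    proof (rule sum.cong[OF refl])
     fix a assume "a : {..<N}"
     moreover then have "0 <= X a r w" using nonneg[OF _ _ elim(2)] r t by simp
     ultimately show "(2 * sqrt (X a r w))^2 * (exp (P (y r w)) * S2 a a (y r w)) / 2 = 2 * y r w a * (exp (P (y r w)) * S2 a a (y r w))"
      by (simp add: yX power_mult_distrib)
    qed
    have n3: "N + 3 = Suc (Suc (Suc N))" by simp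
    show "(SUM a<N + 3. exp (P (y r w)) * S1 a (y r w) *
     (?C a nu r w))
     + (?G r w S2) / 2 = 0"
     unfolding 2 unfolding n3 sum.lessThan_Suc using gen unfolding 1[symmetric]
     by (simp add: tu'_def yN mult_ac)
   qed
  qed
  show "abs (exp (P (?A r w)) * S (?A r w)) <= C" if "r : {t0..t1}" "w : space M" for r w
  proof -
   have "1 * abs (exp (P (y r w)) * S (y r w)) <= (?B r w) * abs (exp (P (y r w)) * S (y r w))"
    using sumX(1)[OF that] by (intro mult_right_mono) auto
   also have "... <= C" using C0 C(1) that by fastforce
   finally show ?thesis by (simp add: y_def)
  qed
  show "abs (exp (P (?A r w)) * S1 a (?A r w) * (2 * sqrt (X a r w))) <= C"
   if a: "a < N" and rw: "r : {t0..t1}" "w : space M" for a r w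
  proof -
   have X0: "0 <= X a r w" using nonneg[OF a _ rw(2)] rw t by simp
   \<comment> \<open>This gives \<open>2 * sqrt x <= 1 + x\<close>, so that the weight
     \<open>1 + sum\<close> in \<open>bound\<close> dominates the diffusion coefficient.\<close>
   have "0 <= (sqrt (X a r w) - 1)^2" by simp
   then have "2 * sqrt (X a r w) <= 1 + X a r w" using X0 by (simp add: power2_diff)
   also have "... <= 1 + (SUM j<N. X j r w)" using sumX(2)[OF rw a] by simp
   finally have "abs (2 * sqrt (X a r w)) <= 1 + (SUM j<N. X j r w)" using X0 by simp
   then have "abs (2 * sqrt (X a r w)) * abs (?F r w a) <= (?B r w) * abs (?F r w a)"
    by (rule mult_right_mono) simp
   also have "... <= C" using C1[of a] C(2)[OF a] rw by fastforce
   finally show ?thesis by (simp add: y_def abs_mult mult_ac)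
  qed
 qed (use G tuc tu'c deriv in auto)
 \<comment> \<open>The continuation was obtained from \<open>vdm * F = alternant\<close>; dividing
   by the Vandermonde determinant is possible off the null set of collisions.\<close>
 have quot_eq: "AE w in M. exp (P (y r w)) * S (y r w) =
   vdm_quotient N (%k. besq_fun nu lam (q k) (bb r) (rh r / A r) (gg r)) (%j. X j r w)" if r: "0 <= r" for r
  using noncolliding
 proof eventually_elim
  case (elim w)
  have "vdm N (%j. X j r w) ~= 0" using elim r by (intro vdm_nonzero) force
  moreover have "vdm N (y r w) = vdm N (%j. X j r w)"
   unfolding vdm_def by (rule prod.cong) (auto simp: yX)
  moreover have "alternant N (%j k. besq_fun nu lam (q k) (bb r) (rh r / A r) (gg r) (y r w j)) =
    alternant N (%j k. besq_fun nu lam (q k) (bb r) (rh r / A r) (gg r) (X j r w))"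
   by (rule alternant_cong) (simp add: yX)
  ultimately show ?case
   using quot[of "y r w"] unfolding vdm_quotient_def yN P_def by (simp add: field_simps)
 qed
 have Gm: "G : bmeas M" using G(1) by (rule adapted_measurable)
 \<comment> \<open>At \<open>t1\<close> there is no time to go: \<open>b = 1\<close>,
   \<open>ka = 0\<close>, \<open>g = 1\<close>.\<close>
 have end1: "vdm_quotient N (%k. besq_fun nu lam (q k) (bb t1) (rh t1 / A t1) (gg t1)) = vdm_quotient N (%k. exp_poly (lam, q k))"
  by (simp add: fun_eq_iff vdm_quotient_def bb_def A_def rh_def gg_def besq_fun_def exp_poly_def)
 have at0: "rh t0 = t1 - t0" "A t0 = 1 + 2 * lam * (t1 - t0)" using t by (simp_all add: rh_def A_def)
 let ?D = "%nu t1 t0 lam q. %k. exp_poly (besq_step nu (t1 - t0) (lam, q k))"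
 have end0: "vdm_quotient N (%k. besq_fun nu lam (q k) (bb t0) (rh t0 / A t0) (gg t0)) =
   vdm_quotient N (?D nu t1 t0 lam q)"
  by (simp only: fun_eq_iff vdm_quotient_def exp_poly_besq_step[OF at0(2)] bb_def gg_def at0(1)) simp
 have ym: "(%w. exp (P (y r w)) * S (y r w)) : bmeas M" if "0 <= r" for r
 proof -
  have "(%w. y r w i) : bmeas M" if "i < N + 3" for i
   using X_measurable[of i r] \<open>0 <= r\<close> by (cases "i < N") (simp_all add: y_def extended_def)
  then show ?thesis
   by (intro borel_measurable_times measurable_compose[OF _ borel_measurable_exp] polyfun_measurable[OF P]
     polyfun_measurable[OF S])
 qed
 have t1: "0 <= t1" using t by simp
 have "expectation (%w. G w * vdm_quotient N (%k. exp_poly (lam, q k)) (%j. X j t1 w)) =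
   expectation (%w. G w * (exp (P (y t1 w)) * S (y t1 w)))"
 using t1 quot_eq[OF t1] by (auto simp: end1 intro!: borel_measurable_times Gm vdm_quotient_measurable integral_cong_AE borel_measurable_times[OF Gm ym[OF t1]])
 also have "... = expectation (%w. G w * (exp (P (y t0 w)) * S (y t0 w)))"
  using main unfolding y_def .
 also have "... = expectation (%w. G w * vdm_quotient N (?D nu t1 t0 lam q) (%j. X j t0 w))"
 proof (rule integral_cong_AE)
  show "(%w. G w * vdm_quotient N (?D nu t1 t0 lam q) (%j. X j t0 w)) : bmeas M"
   using t by (intro borel_measurable_times Gm vdm_quotient_measurable) simp_all
  show "(%w. G w * (exp (P (y t0 w)) * S (y t0 w))) : bmeas M"
   by (rule borel_measurable_times[OF Gm ym[OF t(1)]])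
  show "AE w in M. G w * (exp (P (y t0 w)) * S (y t0 w)) = G w * vdm_quotient N (?D nu t1 t0 lam q) (%j. X j t0 w)"
   using quot_eq[OF t(1)] unfolding end0 by eventually_elim simp
 qed
 finally show ?thesis .
qed

end

definition exp_poly_mult :: "real \<times> real poly => real \<times> real poly => real \<times> real poly" where
 "exp_poly_mult f g = (fst f + fst g, snd f * snd g)"

lemma exp_poly_mult: "exp_poly (exp_poly_mult f g) x = exp_poly f x * exp_poly g x"
 by (simp add: exp_poly_mult_def exp_poly_def algebra_simps exp_add[symmetric])

lemma exp_poly_bounded:
 assumes "0 < fst f"
 shows "EX K>=0. ALL x>=0. abs (exp_poly f x) <= K"
proof -
 have "EX C. ALL x>=0. x ^ i * exp (- fst f * x) <= C" for i
  using power_exp_bounded[OF assms order.refl, of i] by simp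
 then obtain C where C: "!!i x. x >= 0 ==> x ^ i * exp (- fst f * x) <= C i" by metis
 have "abs (exp_poly f x) <= (SUM i<=degree (snd f). abs (coeff (snd f) i) * C i)" if x: "x >= 0" for x
 proof -
  have "exp_poly f x = (SUM i<=degree (snd f). coeff (snd f) i * (x ^ i * exp (- fst f * x)))"
   unfolding exp_poly_def poly_altdef sum_distrib_left by (simp add: mult_ac)
  then have "abs (exp_poly f x) <= (SUM i<=degree (snd f). abs (coeff (snd f) i * (x ^ i * exp (- fst f * x))))"
   by (simp only: sum_abs)
  also have "... <= (SUM i<=degree (snd f). abs (coeff (snd f) i) * C i)"
   using C[OF x] x by (intro sum_mono) (simp add: abs_mult mult_left_mono)
  finally show ?thesis .
 qed
 from this have "ALL x>=0. abs (exp_poly f x) <= abs (SUM i<=degree (snd f). abs (coeff (snd f) i) * C i)"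
  by (meson abs_ge_self order.trans)
 then show ?thesis by (intro exI conjI) auto
qed

text \<open>Backward evolution from time \<open>c\<close> to time 0: run the semigroup down to the
  latest test time, multiply by the test function there, and repeat. The test times are listed in
  decreasing order.\<close>

fun besq_back :: "real => real => (real \<times> real \<times> real poly) list => real \<times> real poly => real \<times> real poly" where
 "besq_back nu c [] ph = besq_step nu c ph"
| "besq_back nu c ((t, f) # xs) ph = besq_back nu t xs (exp_poly_mult f (besq_step nu (c - t) ph))"

definition path_product :: "(real \<times> real \<times> real poly) list => (real => real) => real" where
 "path_product xs x = prod_list (map (%(t, f). exp_poly f (x t)) xs)"

lemma path_product_simps [simp]:
 "path_product [] x = 1" "path_product ((t, f) # xs) x = exp_poly f (x t) * path_product xs x"
 by (simp_all add: path_product_def)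

lemma path_product_append: "path_product (xs @ ys) x = path_product xs x * path_product ys x"
 by (simp add: path_product_def)

lemma path_product_mset_cong: "mset xs = mset ys ==> path_product xs x = path_product ys x"
 unfolding path_product_def prod_mset_prod_list[symmetric] by simp

text \<open>The latest time comes first, so that removing the head leaves a functional of the
  earlier past. Positive exponents make every test function bounded on the half line.\<close>

definition times_ordered :: "real => (real \<times> real \<times> real poly) list => bool" where
 "times_ordered c xs \<longleftrightarrow> 0 <= c & sorted_wrt (%x y. fst y <= fst x) xs &
   (ALL (t, f):set xs. 0 <= t & t <= c & 0 < fst f)"

lemma times_ordered_Cons:
 "times_ordered c ((t, f) # xs) ==> 0 <= t & t <= c & 0 < fst f & times_ordered t xs"
 unfolding times_ordered_def by (auto simp: case_prod_unfold)

lemma times_ordered_mem: "times_ordered c xs ==> (t, f) : set xs ==> 0 <= t & t <= c & 0 < fst f"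
 unfolding times_ordered_def by blast

lemma times_ordered_sort:
 assumes "0 <= c" "!!t f. (t, f) : set xs ==> 0 <= t & t <= c & 0 < fst f"
 shows "EX ys. mset ys = mset xs & times_ordered c ys"
proof (intro exI conjI)
 let ?ys = "sort_key (%z. - fst z) xs"
 show "mset ?ys = mset xs" by simp
 have "sorted (map (%z. - fst z) ?ys)" by simp
 then have "sorted_wrt (%x y. fst y <= fst x) ?ys" by (simp add: sorted_wrt_map)
 then show "times_ordered c ?ys" using assms unfolding times_ordered_def by auto
qed

lemma path_product_bounded:
 assumes "!!t f. (t, f) : set xs ==> 0 <= t & 0 < fst f"
 shows "EX K>=0. ALL x. (ALL t>=0. 0 <= x t) --> abs (path_product xs x) <= K"
 using assms
proof (induction xs)
 case Nil
 then show ?case by (intro exI[of _ 1]) simp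
next
 case (Cons tf xs)
 obtain t f where tf: "tf = (t, f)" by (cases tf)
 have "0 <= t" "0 < fst f" using Cons.prems[of t f] tf by auto
 obtain K where K: "K >= 0" "ALL x. (ALL t>=0. 0 <= x t) --> abs (path_product xs x) <= K"
 proof -
  have "EX K>=0. ALL x. (ALL t>=0. 0 <= x t) --> abs (path_product xs x) <= K"
   by (rule Cons.IH) (rule Cons.prems, simp)
  then show ?thesis using that by blast
 qed
 obtain L where L: "L >= 0" "ALL x>=0. abs (exp_poly f x) <= L" using exp_poly_bounded[OF \<open>0 < fst f\<close>] by auto
 show ?case
 proof (intro exI[of _ "L * K"] conjI allI impI)
  show "0 <= L * K" using K L by simp
  fix x :: "real => real" assume "ALL t>=0. 0 <= x t"
  then show "abs (path_product (tf # xs) x) <= L * K"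
   using K L \<open>0 <= t\<close> unfolding tf path_product_simps abs_mult by (intro mult_mono) auto
 qed
qed

lemma fst_besq_step_pos: "0 < fst f ==> 0 <= r ==> 0 < fst (besq_step nu r f)"
 by (simp add: besq_step_def Let_def add_pos_nonneg)

lemma vdm_quotient_scale_rows:
 "vdm_quotient N (%k z. c z * ph k z) x = (PROD j<N. c (x j)) * vdm_quotient N ph x"
 by (simp add: vdm_quotient_def alternant_scale_rows)

lemma vdm_quotient_exp_powers:
 assumes "!!j k. j < k ==> k < N ==> x j ~= x k"
 shows "vdm_quotient N (%k. exp_poly (lam, monom 1 k)) x = exp (- lam * (SUM j<N. x j))"
proof -
 have "vdm_quotient N (%k. exp_poly (lam, monom 1 k)) x =
   vdm_quotient N (%k z. exp (- lam * z) * z ^ k) x"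
  by (simp add: vdm_quotient_def exp_poly_def poly_monom)
 also have "... = (PROD j<N. exp (- lam * x j)) * vdm_quotient N (%k z. z ^ k) x"
  by (rule vdm_quotient_scale_rows)
 also have "vdm_quotient N (%k z. z ^ k) x = 1"
  using vdm_nonzero[OF assms] by (simp add: vdm_quotient_def alternant_powers)
 finally show ?thesis by (simp add: exp_sum sum_distrib_left)
qed

lemma vdm_quotient_1: "vdm_quotient 1 ph x = ph 0 (x 0)"
proof -
 have e: "{(j, k). j < k & k < (1::nat)} = {}" by auto
 show ?thesis
  unfolding vdm_quotient_def vdm_def e alternant_def by (simp add: lessThan_Suc)
qed

context noncolliding_system
begin

lemma path_product_adapted:
 assumes "times_ordered c xs"
 shows "(%w. PROD j<N. path_product xs (%t. X j t w)) : bmeas (\<F> c)"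
proof (rule borel_measurable_prod)
 fix j assume "j : {..<N}"
 then have j: "j < N" by simp
 show "(%w. path_product xs (%t. X j t w)) : bmeas (\<F> c)"
  using assms
 proof (induction xs arbitrary: c)
  case (Cons tf xs)
  obtain t f where tf: "tf = (t, f)" by (cases tf)
  have t: "0 <= t" "t <= c" "times_ordered t xs" using times_ordered_Cons[OF Cons.prems[unfolded tf]] by auto
  have "(%w. exp_poly f (X j t w) * path_product xs (%t. X j t w)) : bmeas (\<F> t)"
   by (intro borel_measurable_times measurable_compose[OF X_adapted[OF j t(1)] exp_poly_measurable] Cons.IH t(3))
  then show ?case unfolding tf path_product_simps by (rule adapted_mono[OF t(2)])
 qed simp
qed

lemma path_product_measurable:
 assumes "times_ordered c xs"
 shows "(%w. PROD j<N. path_product xs (%t. X j t w)) : bmeas M"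
 by (rule adapted_measurable[OF path_product_adapted[OF assms]])

lemma prod_path_product_bounded:
 assumes "times_ordered c xs"
 shows "EX K>=0. ALL w:space M. (abs (PROD j<N. path_product xs (%t. X j t w))) <= K"
proof -
 obtain K where K: "K >= 0" "ALL x. (ALL t>=0. 0 <= x t) --> abs (path_product xs x) <= K"
 proof -
  have "EX K>=0. ALL x. (ALL t>=0. 0 <= x t) --> abs (path_product xs x) <= K"
   by (rule path_product_bounded) (use times_ordered_mem[OF assms] in blast)
  then show ?thesis using that by blast
 qed
 have "abs (PROD j<N. path_product xs (%t. X j t w)) <= (PROD j<N. K)" if "w : space M" for w
  unfolding abs_prod using K nonneg that by (intro prod_mono) auto
 then show ?thesis using K by (intro exI[of _ "PROD j<N. K"]) (auto intro!: prod_nonneg)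
qed

text \<open>A test function taken at all particles at one time multiplies row \<open>j\<close> of
  the determinant by its value at particle \<open>j\<close>. It is thus absorbed into the entries,
  and the next step goes down to the preceding test time.\<close>

theorem markov_product:
 assumes "times_ordered c xs" "lam > 0"
 shows "expectation (%w. (PROD j<N. path_product xs (%t. X j t w)) * vdm_quotient N (%k. exp_poly (lam, q k)) (%j. X j c w)) =
   expectation (%w. vdm_quotient N (%k. exp_poly (besq_back nu c xs (lam, q k))) (%j. X j 0 w))"
 using assms
proof (induction xs arbitrary: c lam q)
 case Nil
 then have "0 <= c" by (simp add: times_ordered_def)
 from markov_step[OF order.refl this Nil(2), of "%_. 1" 1 q] show ?case by simp
next
 case (Cons tf xs)
 obtain t f where tf: "tf = (t, f)" by (cases tf)
 note o = Cons.prems(1)[unfolded tf]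
 have t: "0 <= t" "t <= c" "0 < fst f" "times_ordered t xs" using times_ordered_Cons[OF o] by auto
 have o': "times_ordered t ((t, f) # xs)" using o t(1) unfolding times_ordered_def by auto
 obtain K where K: "ALL w:space M. (abs (PROD j<N. path_product ((t, f) # xs) (%t. X j t w))) <= K"
  using prod_path_product_bounded[OF o'] by blast
 \<comment> \<open>The exponent after one step does not depend on the polynomial, so the choice of
   \<open>q 0\<close> is immaterial and all columns keep a common exponent, as
   \<open>markov_step\<close> requires.\<close>
 define lam' where "lam' = fst f + fst (besq_step nu (c - t) (lam, q 0))"
 define q' where "q' = (%k. snd f * snd (besq_step nu (c - t) (lam, q k)))"
 have eq: "exp_poly_mult f (besq_step nu (c - t) (lam, q k)) = (lam', q' k)" for k
  by (simp add: exp_poly_mult_def lam'_def q'_def besq_step_def Let_def)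
 have lam': "lam' > 0"
  using t fst_besq_step_pos[of "(lam, q 0)" "c - t" nu] Cons.prems(2) by (simp add: lam'_def)
 have "expectation (%w. (PROD j<N. path_product (tf # xs) (%t. X j t w)) * vdm_quotient N (%k. exp_poly (lam, q k)) (%j. X j c w)) =
   expectation (%w. (PROD j<N. path_product (tf # xs) (%t. X j t w)) *
    vdm_quotient N (%k. exp_poly (besq_step nu (c - t) (lam, q k))) (%j. X j t w))"
  unfolding tf
  by (rule markov_step[OF t(1,2) Cons.prems(2) path_product_adapted[OF o']]) (use K in blast)
 also have "... = expectation (%w. (PROD j<N. path_product xs (%t. X j t w)) *
    vdm_quotient N (%k. exp_poly (lam', q' k)) (%j. X j t w))"
 proof (rule arg_cong[where f = expectation], rule ext)
  fix w
  have "vdm_quotient N (%k. exp_poly (lam', q' k)) (%j. X j t w) =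
   vdm_quotient N (%k z. exp_poly f z * exp_poly (besq_step nu (c - t) (lam, q k)) z) (%j. X j t w)"
   unfolding eq[symmetric] exp_poly_mult[symmetric] ..
  then show "(PROD j<N. path_product (tf # xs) (%t. X j t w)) *
     vdm_quotient N (%k. exp_poly (besq_step nu (c - t) (lam, q k))) (%j. X j t w) =
    (PROD j<N. path_product xs (%t. X j t w)) * vdm_quotient N (%k. exp_poly (lam', q' k)) (%j. X j t w)"
   unfolding tf path_product_simps prod.distrib vdm_quotient_scale_rows by simp
 qed
 also have "... = expectation (%w. vdm_quotient N (%k. exp_poly (besq_back nu t xs (lam', q' k))) (%j. X j 0 w))"
  by (rule Cons.IH[OF t(4) lam'])
 finally show ?case unfolding tf besq_back.simps eq .
qed

theorem product_expectation:
 assumes "times_ordered c xs" "lam > 0" and x0: "!!j. j < N ==> AE w in M. X j 0 w = x0 j"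
 shows "expectation (%w. (PROD j<N. path_product xs (%t. X j t w)) * vdm_quotient N (%k. exp_poly (lam, q k)) (%j. X j c w)) =
   vdm_quotient N (%k. exp_poly (besq_back nu c xs (lam, q k))) x0"
proof -
 have "AE w in M. ALL j:{..<N}. X j 0 w = x0 j" by (rule AE_finite_allI) (use x0 in auto)
 then have "AE w in M. vdm_quotient N ph (%j. X j 0 w) = vdm_quotient N ph x0" for ph
 proof eventually_elim
  case (elim w)
  then have "alternant N (%j k. ph k (X j 0 w)) = alternant N (%j k. ph k (x0 j))"
   by (intro alternant_cong) auto
  moreover have "vdm N (%j. X j 0 w) = vdm N x0"
   unfolding vdm_def using elim by (intro prod.cong) auto
  ultimately show ?case by (simp add: vdm_quotient_def)
 qed
 then have "expectation (%w. vdm_quotient N (%k. exp_poly (besq_back nu c xs (lam, q k))) (%j. X j 0 w)) =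
   expectation (%w. vdm_quotient N (%k. exp_poly (besq_back nu c xs (lam, q k))) x0)"
  by (intro integral_cong_AE vdm_quotient_measurable) auto
 then show ?thesis using markov_product[OF assms(1,2)] by (simp add: prob_space)
qed

end

lemma noncolliding_BESQ_system:
 assumes "noncolliding_BESQ M nu N X" "1 <= N" "-1 < nu"
 shows "EX \<F> B. noncolliding_system M \<F> B N X nu"
proof -
 from assms(1) obtain \<F> B where nonneg: "ALL j<N. ALL t>=0. ALL w:space M. 0 <= X j t w"
  and nc: "AE w in M. ALL t>=0. ALL j<N. ALL k<N. j ~= k --> X j t w ~= X k t w"
  and bm: "ALL j<N. brownian_motion_wrt M \<F> (B j)" and ind: "indep_processes M B {..<N}"
  and diff: "ALL j<N. has_ito_differential M \<F> (B j) (X j) (%t w. 2 * sqrt (X j t w))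
      (%t w. 2 * (nu + 1) + 4 * X j t w * (SUM k:{..<N} - {j}. 1 / (X j t w - X k t w)))"
  unfolding noncolliding_BESQ_def by (elim conjE exE) (rule that; assumption)
 have "brownian_motion_wrt M \<F> (B 0)" using bm assms(2) by simp
 then have ps: "prob_space M" by (simp add: brownian_motion_wrt_def)
 have br: "brownian M \<F> (B j)" if "j < N" for j
  using bm that ps by (simp add: brownian_def brownian_axioms_def)
 have Xc: "continuous_on {0..} (%r. X j r w)" if "j < N" "w : space M" for j w
  using diff that unfolding has_ito_differential_def continuous_adapted_def by simp
 have "noncolliding_system M \<F> B N X nu"
 using assms(2) diff nonneg by (auto intro!: noncolliding_system.intro ito_system.intro ito_system_axioms.intro noncolliding_system_axioms.intro ps continuous_intros Xc ind assms nc br)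
 then show ?thesis by blast
qed

lemma (in prob_space) indep_processes_single:
 assumes "!!s. 0 <= s ==> Y i s : bmeas M"
 shows "indep_processes M Y {i}"
using assms by (auto simp: indep_sets_def indep_processes_def indep_vars_def2 subset_singleton_iff)

text \<open>For one particle the repulsion is an empty sum and the Vandermonde determinant is 1, so
  that results on the system become the semigroup formula for a single BESQ process.\<close>

lemma BESQ_noncolliding_BESQ:
 assumes "BESQ M nu R"
 shows "noncolliding_BESQ M nu 1 (%_. R)"
proof -
 from assms obtain \<F> B where nonneg: "ALL t>=0. ALL w:space M. 0 <= R t w" and bm: "brownian_motion_wrt M \<F> B"
  and diff: "has_ito_differential M \<F> B R (%t w. 2 * sqrt (R t w)) (%t w. 2 * (nu + 1))"
  unfolding BESQ_def by (elim conjE exE) (rule that; assumption)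
 have ps: "prob_space M" using bm by (simp add: brownian_motion_wrt_def)
 interpret brownian M \<F> B using bm ps by (simp add: brownian_def brownian_axioms_def)
 have ind: "indep_processes M (%_. B) {0::nat}"
  by (rule indep_processes_single) (rule B_measurable)
 have e: "{..<1::nat} = {0}" by auto
 show ?thesis
  unfolding noncolliding_BESQ_def e
  using nonneg bm diff ind by (intro conjI exI[of _ \<F>] exI[of _ "%_. B"]) auto
qed

text \<open>Continuity up to \<open>lam = 0\<close> bounds the damped moments uniformly while the
  damping is removed.\<close>

lemma besq_moment_continuous:
 assumes "0 <= c"
 shows "continuous_on {0..1} (%lam. exp_poly (besq_step nu c (lam, p)) x)"
proof -
 have "continuous_on {0..1} (%lam. besq_fun nu lam p (1 / (1 + 2 * lam * c)) (c / (1 + 2 * lam * c)) ((1 + 2 * lam * c) powr - (nu + 1)) x)"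
 proof -
  have nz: "1 + 2 * lam * c ~= 0" if "lam : {0..1}" for lam
  proof -
   have "0 <= lam * c" using that assms by simp
   then show ?thesis by linarith
  qed
  show ?thesis
   unfolding besq_fun_def besq_heat_def poly_sum poly_smult
   by (intro continuous_intros) (use nz in auto)
 qed
 then show ?thesis by (simp add: exp_poly_besq_step[OF refl])
qed

section \<open>Independent Bessel processes\<close>

locale besq_process = noncolliding_system M \<F> "%_. B" 1 "%_. R" nu
 for M :: "'a measure" and \<F> B R nu + fixes x0 :: real
 assumes start: "AE w in M. R 0 w = x0"
begin

lemma R_measurable [measurable]: "0 <= t ==> R t : bmeas M"
 using X_measurable[of 0 t] by simp

lemma R_nonneg: "0 <= t ==> w : space M ==> 0 <= R t w"
 using nonneg[of 0 t w] by simp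

lemma moment_formula:
 assumes "times_ordered c xs" "lam > 0"
 shows "expectation (%w. path_product xs (%t. R t w) * (exp (- lam * R c w) * R c w ^ k)) =
   exp_poly (besq_back nu c xs (lam, monom 1 k)) x0"
proof -
 have "expectation (%w. (PROD j<(1::nat). path_product xs (%t. R t w)) * vdm_quotient 1 (%_. exp_poly (lam, monom 1 k)) (%j. R c w)) =
   vdm_quotient 1 (%_. exp_poly (besq_back nu c xs (lam, monom 1 k))) (%_. x0)"
  by (rule product_expectation[OF assms]) (rule start)
 then show ?thesis unfolding vdm_quotient_1 by (simp add: exp_poly_def poly_monom)
qed

text \<open>Fatou's lemma along \<open>lam = 1 / (n + 1)\<close>: the damped moments are known
  exactly and stay bounded as \<open>lam\<close> tends to 0.\<close>

lemma moment_integrable: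
 assumes c: "0 <= c"
 shows "integrable M (%w. R c w ^ k)"
proof -
 define g where "g = (%lam. exp_poly (besq_step nu c (lam, monom 1 k)) x0)"
 obtain K where K: "K >= 0" "!!lam. lam : {0..1} ==> abs (g lam) <= K"
  by (rule continuous_on_interval_bound[OF besq_moment_continuous[OF c, of nu "monom 1 k" x0]])
   (rule that; simp add: g_def)
 have eq: "expectation (%w. exp (- lam * R c w) * R c w ^ k) = g lam" if "lam > 0" for lam
  using moment_formula[of c "[]" lam k] that c by (simp add: g_def times_ordered_def)
 have int: "integrable M (%w. exp (- lam * R c w) * R c w ^ k)" if lam: "lam > 0" for lam
 proof -
  obtain C where C: "ALL x>=0. abs (exp_poly (lam, monom 1 k) x) <= C" using exp_poly_bounded[of "(lam, monom 1 k)"] lam by auto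
  show ?thesis
   using R_nonneg[OF c] C R_measurable[OF c]
   by (intro integrable_const_bound[where B = C] AE_I2) (auto simp: exp_poly_def poly_monom)
 qed
 define u where "u = (%n w. ennreal (exp (- (1 / real (Suc n)) * R c w) * R c w ^ k))"
 have u_le: "(\<integral>\<^sup>+w. u n w \<partial>M) <= ennreal K" for n
 proof -
  have "(\<integral>\<^sup>+w. u n w \<partial>M) = ennreal (g (1 / real (Suc n)))"
   unfolding u_def
   by (subst nn_integral_eq_integral[OF int]) (use R_nonneg[OF c] in \<open>auto intro!: AE_I2 simp: eq[symmetric]\<close>)
  also have "... <= ennreal K"
   using K(2)[of "1 / real (Suc n)"] by (intro ennreal_leI) (auto simp: divide_simps)
  finally show ?thesis .
 qed
 have lim: "liminf (%n. u n w) = ennreal (R c w ^ k)" for w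
 proof -
  have "(%n. exp (- (1 / real (Suc n)) * R c w) * R c w ^ k) ~> exp (- 0 * R c w) * R c w ^ k"
   by (intro tendsto_intros LIMSEQ_Suc lim_1_over_n)
  then have "(%n. u n w) ~> ennreal (R c w ^ k)" unfolding u_def by (intro tendsto_ennrealI) simp
  then show ?thesis by (rule lim_imp_Liminf[OF sequentially_bot])
 qed
 have "(\<integral>\<^sup>+w. ennreal (R c w ^ k) \<partial>M) = (\<integral>\<^sup>+w. liminf (%n. u n w) \<partial>M)" by (simp only: lim)
 also have "... <= liminf (%n. \<integral>\<^sup>+w. u n w \<partial>M)"
 proof (rule nn_integral_liminf)
  have [measurable]: "R c : bmeas M" by (rule R_measurable[OF c])
  show "u n : bmeas M" for n unfolding u_def by measurable
 qed
 also have "... <= liminf (%n. ennreal K)" by (rule Liminf_mono) (use u_le in auto)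
 also have "... = ennreal K" by (rule Liminf_const) simp
 finally have "(\<integral>\<^sup>+w. ennreal (R c w ^ k) \<partial>M) < \<infinity>" by (rule le_less_trans) simp
 then show ?thesis
  using R_measurable[OF c] R_nonneg[OF c] by (intro integrableI_nonneg) (auto intro!: AE_I2)
qed

text \<open>The Laplace transform at \<open>lam\<close> equals the right-hand side times
  \<open>exp (- lam * x0 / (1 + 2 * lam * c))\<close>; bounding this factor by 1 makes the estimate
  uniform in the starting point.\<close>

lemma laplace_bound:
 assumes "0 <= c" "lam > 0" "0 <= x0"
 shows "expectation (%w. exp (- lam * R c w)) <= (1 + 2 * lam * c) powr - (nu + 1)"
proof -
 have "expectation (%w. exp (- lam * R c w)) = exp_poly (besq_step nu c (lam, 1)) x0"
  using moment_formula[of c "[]" lam 0] assms by (simp add: times_ordered_def monom_0 one_pCons)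
 also have "... = (1 + 2 * lam * c) powr - (nu + 1) * exp (- lam * (1 / (1 + 2 * lam * c)) * x0)"
  unfolding exp_poly_besq_step[OF refl] by (simp add: besq_fun_def besq_heat_def)
 also have "... <= (1 + 2 * lam * c) powr - (nu + 1) * 1"
  using assms by (intro mult_left_mono) auto
 finally show ?thesis by simp
qed

end

lemma BESQ_process:
 assumes "BESQ M nu R" "-1 < nu" "AE w in M. R 0 w = x0"
 shows "EX \<F> B. besq_process M \<F> B R nu x0"
proof -
 obtain \<F> B where "noncolliding_system M \<F> B 1 (%_. R) nu"
  using noncolliding_BESQ_system[OF BESQ_noncolliding_BESQ[OF assms(1)] order.refl assms(2)] by blast
 note s = this
 \<comment> \<open>Index 0 is the only one below 1; a constant driving family has the form that
   \<open>besq_process\<close> expects.\<close>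
 have "noncolliding_system M \<F> (%_. B 0) 1 (%_. R) nu"
 proof -
  interpret s: noncolliding_system M \<F> B 1 "%_. R" nu by (rule s)
  have "brownian M \<F> (B 0)" by (rule s.brownian) simp
  then have "indep_processes M (%_. B 0) {0::nat}"
   by (intro s.indep_processes_single brownian.B_measurable)
  moreover have "{..<1::nat} = {0}" by auto
  ultimately show ?thesis
   using s.brownian[of 0] s.differential[of 0] s.diffusion_continuous[of 0] s.index s.nonneg s.noncolliding s.prob_space_axioms
   by (intro noncolliding_system.intro ito_system.intro ito_system_axioms.intro noncolliding_system_axioms.intro) simp_all
 qed
 then show ?thesis using assms(3) unfolding besq_process_def besq_process_axioms_def by blast
qed

lemma (in prob_space) indep_processes_functionals:
 assumes "indep_processes M Y I" "!!i. i : I ==> ph i : bmeas (PiM {0..} (%_. borel))"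
 shows "indep_vars (%_. borel) (%i w. ph i (\<lambda>s\<in>{0..}. Y i s w)) I"
 by (rule indep_vars_compose2[OF assms(1)[unfolded indep_processes_def] assms(2)])

lemma path_component_measurable: "0 <= s ==> (%x. x s) : bmeas (PiM {0..} (%_. borel :: real measure))"
 by (rule measurable_component_singleton) simp

lemma path_product_path_measurable:
 assumes "times_ordered c xs"
 shows "(%x. path_product xs (%t. (x t)\<^sup>2)) : bmeas (PiM {0..} (%_. borel))"
 using assms
proof (induction xs arbitrary: c)
 case (Cons tf xs)
 obtain t f where tf: "tf = (t, f)" by (cases tf)
 have t: "0 <= t" "times_ordered t xs" using times_ordered_Cons[OF Cons.prems[unfolded tf]] by auto
 show ?case
  unfolding tf path_product_simps
  by (intro borel_measurable_times measurable_compose[OF _ exp_poly_measurable] borel_measurable_power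
    path_component_measurable t(1) Cons.IH[OF t(2)])
qed simp

lemma path_product_cong:
 assumes "times_ordered c xs" "!!t. 0 <= t ==> x t = y t"
 shows "path_product xs x = path_product xs y"
 using assms(1)
proof (induction xs arbitrary: c)
 case (Cons tf xs)
 obtain t f where tf: "tf = (t, f)" by (cases tf)
 have "0 <= t" "times_ordered t xs" using times_ordered_Cons[OF Cons.prems[unfolded tf]] by auto
 then show ?case using Cons.IH[of t] assms(2)[of t] by (simp add: tf)
qed simp

locale bes_family = prob_space P for P :: "'b measure" +
 fixes nu :: real and N :: nat and Rt :: "nat => real => 'b => real" and u :: "nat => real"
 assumes index: "-1 < nu" and bes: "j < N ==> BES P nu (Rt j)"
  and start: "j < N ==> AE w in P. Rt j 0 w = u j"
  and indep: "indep_processes P Rt {..<N}"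
begin

abbreviation "pp xs j w \<equiv> path_product xs (%t. (Rt j t w)\<^sup>2)"

lemma squared_process:
 assumes j: "j < N"
 shows "EX \<F> B R. besq_process P \<F> B R nu ((u j)^2) &
  (ALL t>=0. ALL w:space P. Rt j t w = sqrt (R t w) & R t w = (Rt j t w)^2)"
proof -
 obtain R where R: "BESQ P nu R" "ALL t>=0. ALL w:space P. Rt j t w = sqrt (R t w)"
  using bes[OF j] unfolding BES_def by blast
 have nonneg: "ALL t>=0. ALL w:space P. 0 <= R t w" using R(1) unfolding BESQ_def by (elim conjE)
 have sq: "ALL t>=0. ALL w:space P. Rt j t w = sqrt (R t w) & R t w = (Rt j t w)^2"
 using R(2) nonneg by simp
 have "AE w in P. R 0 w = (u j)^2"
  using start[OF j] AE_space
 proof eventually_elim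
  case (elim w)
  have "R 0 w = (Rt j 0 w)^2" using sq[rule_format, OF order.refl elim(2)] by (rule conjunct2)
  then show ?case by (simp only: elim(1))
 qed
 from BESQ_process[OF R(1) index this] obtain \<F> B where "besq_process P \<F> B R nu ((u j)^2)" by blast
 then show ?thesis using sq by blast
qed

lemma Rt_nonneg: "j < N ==> 0 <= t ==> w : space P ==> 0 <= Rt j t w"
proof -
 assume a: "j < N" "0 <= t" "w : space P"
 obtain \<F> B R where R: "besq_process P \<F> B R nu ((u j)^2)"
  "ALL t>=0. ALL w:space P. Rt j t w = sqrt (R t w) & R t w = (Rt j t w)^2"
  using squared_process[OF a(1)] by blast
 have "Rt j t w = sqrt (R t w)" using R(2) a(2,3) by blast
 then show "0 <= Rt j t w" using besq_process.R_nonneg[OF R(1) a(2,3)] by simp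
qed

lemma Rt_measurable:
 assumes "j < N" "0 <= t"
 shows "Rt j t : bmeas P"
proof -
 obtain \<F> B R where R: "besq_process P \<F> B R nu ((u j)^2)"
  "ALL t>=0. ALL w:space P. Rt j t w = sqrt (R t w) & R t w = (Rt j t w)^2"
  using squared_process[OF assms(1)] by blast
 have [measurable]: "R t : bmeas P" using besq_process.R_measurable[OF R(1) assms(2)] .
 have "(%w. sqrt (R t w)) : bmeas P" by measurable
 moreover have "Rt j t w = sqrt (R t w)" if "w : space P" for w using R(2) assms(2) that by blast
 ultimately show ?thesis by (simp only: measurable_cong[where g = "%w. sqrt (R t w)" and f = "Rt j t"])
qed

lemma moment_formula:
 assumes "times_ordered c xs" "lam > 0" "j < N"
 shows "expectation (%w. pp xs j w * (exp (- lam * (Rt j c w)^2) * ((Rt j c w)^2) ^ k)) =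
  exp_poly (besq_back nu c xs (lam, monom 1 k)) ((u j)^2)"
proof -
 obtain \<F> B R where R: "besq_process P \<F> B R nu ((u j)^2)"
  "ALL t>=0. ALL w:space P. Rt j t w = sqrt (R t w) & R t w = (Rt j t w)^2"
  using squared_process[OF assms(3)] by blast
 have c: "0 <= c" using assms(1) by (simp add: times_ordered_def)
 have "expectation (%w. pp xs j w * (exp (- lam * (Rt j c w)^2) * ((Rt j c w)^2) ^ k)) =
  expectation (%w. path_product xs (%t. R t w) * (exp (- lam * R c w) * R c w ^ k))"
 proof (rule integral_cong[OF refl])
  fix w assume w: "w : space P"
  have "pp xs j w = path_product xs (%t. R t w)"
  proof (rule path_product_cong[OF assms(1)])
   fix t :: real assume "0 <= t"
   then have "R t w = (Rt j t w)^2" using R(2) w by blast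
   then show "(Rt j t w)^2 = R t w" by (rule sym)
  qed
  moreover have "R c w = (Rt j c w)^2" using R(2) w c by blast
  ultimately show "pp xs j w * (exp (- lam * (Rt j c w)^2) * ((Rt j c w)^2) ^ k) =
   path_product xs (%t. R t w) * (exp (- lam * R c w) * R c w ^ k)" by (simp only:)
 qed
 then show ?thesis using besq_process.moment_formula[OF R(1) assms(1,2)] by (simp only:)
qed

lemma moment_integrable:
 assumes "0 <= c" "j < N"
 shows "integrable P (%w. ((Rt j c w)^2) ^ k)"
proof -
 obtain \<F> B R where R: "besq_process P \<F> B R nu ((u j)^2)"
  "ALL t>=0. ALL w:space P. Rt j t w = sqrt (R t w) & R t w = (Rt j t w)^2"
  using squared_process[OF assms(2)] by blast
 have "integrable P (%w. R c w ^ k)" by (rule besq_process.moment_integrable[OF R(1) assms(1)])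
 moreover have "R c w ^ k = ((Rt j c w)^2) ^ k" if "w : space P" for w
 proof -
  have "R c w = (Rt j c w)^2" using R(2) assms(1) that by blast
  then show ?thesis by (rule arg_cong)
 qed
 ultimately show ?thesis by (subst integrable_cong[OF refl, of P _ "%w. R c w ^ k"]) simp_all
qed

lemma vdm_expand: "vdm N x = (\<Sum>p | p permutes {..<N}. of_int (sign p) * (PROD j<N. x j ^ p j))" for x :: "nat => real"
 unfolding alternant_powers[symmetric] alternant_def ..

lemma product_factorization:
 fixes Y :: "nat => 'b => real"
 assumes ph: "!!j. j < N ==> ph j : bmeas (PiM {0..} (%_. borel))"
  and Y: "!!j w. j < N ==> Y j w = ph j (\<lambda>s\<in>{0..}. Rt j s w)"
  and int: "!!j. j < N ==> integrable P (Y j)"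
 shows "integrable P (%w. PROD j<N. Y j w)" "expectation (%w. PROD j<N. Y j w) = (PROD j<N. expectation (Y j))"
proof -
 have "indep_vars (%_. borel) Y {..<N} = indep_vars (%_. borel) (%j w. ph j (\<lambda>s\<in>{0..}. Rt j s w)) {..<N}"
  by (rule indep_vars_cong) (use Y in \<open>auto simp: fun_eq_iff\<close>)
 then have ind: "indep_vars (%_. borel) Y {..<N}"
  using indep_processes_functionals[OF indep, of ph] ph by simp
 show "integrable P (%w. PROD j<N. Y j w)" "expectation (%w. PROD j<N. Y j w) = (PROD j<N. expectation (Y j))"
  using indep_vars_integrable[OF _ ind] indep_vars_lebesgue_integral[OF _ ind] int by simp_all
qed

lemma vdm_integrable:
 assumes c: "0 <= c"
 shows "integrable P (%w. vdm N (%j. (Rt j c w)\<^sup>2))"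
 unfolding vdm_expand
proof (intro integrable_sum integrable_mult_right)
 fix p assume "p : {p. p permutes {..<N}}"
 show "integrable P (%w. PROD j<N. (Rt j c w)\<^sup>2 ^ p j)"
  by (rule product_factorization(1)[where ph = "%j x. ((x c)^2) ^ p j"])
   (use c moment_integrable[OF c] in \<open>auto intro!: borel_measurable_power path_component_measurable\<close>)
qed

lemma path_product_Rt_measurable:
 assumes o: "times_ordered c xs" and j: "j < N"
 shows "(%w. pp xs j w) : bmeas P"
proof -
 have m: "(%w. \<lambda>s\<in>{0..}. Rt j s w) : measurable P (PiM {0..} (%_. borel))"
  using Rt_measurable[OF j] by (intro measurable_restrict) auto
 have "(%w. path_product xs (%t. ((\<lambda>s\<in>{0..}. Rt j s w) t)\<^sup>2)) : bmeas P"
  by (rule measurable_compose[OF m path_product_path_measurable[OF o]])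
 moreover have "path_product xs (%t. ((\<lambda>s\<in>{0..}. Rt j s w) t)\<^sup>2) = pp xs j w" for w
  by (rule path_product_cong[OF o]) simp
 ultimately show ?thesis by simp
qed

text \<open>In the Leibniz expansion each summand is a product over the independent processes. Its
  factors are given by the one-particle formula, and the factors reassemble to a determinant in the
  starting points.\<close>

lemma alternant_expectation:
 assumes o: "times_ordered c xs" and lam: "lam > 0"
 shows "expectation (%w. (PROD j<N. pp xs j w) *
   (exp (- lam * (SUM j<N. (Rt j c w)\<^sup>2)) * vdm N (%j. (Rt j c w)\<^sup>2))) =
  alternant N (%j k. exp_poly (besq_back nu c xs (lam, monom 1 k)) ((u j)^2))"
proof -
 have c: "0 <= c" using o by (simp add: times_ordered_def)
 define Y where "Y = (%k j w. pp xs j w * (exp (- lam * (Rt j c w)^2) * ((Rt j c w)^2) ^ k))"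
 obtain K where K: "K >= 0" "ALL x. (ALL t>=0. 0 <= x t) --> abs (path_product xs x) <= K"
 proof -
  have "EX K>=0. ALL x. (ALL t>=0. 0 <= x t) --> abs (path_product xs x) <= K"
   by (rule path_product_bounded) (use times_ordered_mem[OF o] in blast)
  then show ?thesis using that by blast
 qed
 have Yi: "integrable P (Y k j)" if j: "j < N" for k j
 proof (rule integrable_bound)
  show "integrable P (%w. K * ((Rt j c w)^2) ^ k)" using moment_integrable[OF c j] by simp
  have "(%w. exp (- lam * (Rt j c w)^2) * ((Rt j c w)^2) ^ k) : bmeas P"
   by (intro borel_measurable_times borel_measurable_power borel_measurable_const Rt_measurable[OF j c]
     measurable_compose[OF _ borel_measurable_exp])
  then show "Y k j : bmeas P"
   unfolding Y_def by (rule borel_measurable_times[OF path_product_Rt_measurable[OF o j]])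
  show "AE w in P. norm (Y k j w) <= norm (K * ((Rt j c w)^2) ^ k)"
  proof (rule AE_I2)
   fix w assume "w : space P"
   have 1: "abs (pp xs j w) <= K" using K(2) by simp
   have "exp (- lam * (Rt j c w)^2) * ((Rt j c w)^2) ^ k <= 1 * ((Rt j c w)^2) ^ k"
    using lam by (intro mult_right_mono) auto
   then have 2: "abs (exp (- lam * (Rt j c w)^2) * ((Rt j c w)^2) ^ k) <= ((Rt j c w)^2) ^ k" by simp
   have "abs (Y k j w) <= K * ((Rt j c w)^2) ^ k"
    unfolding Y_def abs_mult[of "path_product _ _"] using 1 2 K(1) by (intro mult_mono) auto
   then show "norm (Y k j w) <= norm (K * ((Rt j c w)^2) ^ k)" by simp
  qed
 qed
 let ?A = "%p. %w. PROD j<N. Y (p j) j w"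
 have fact: "integrable P (?A p) &
   expectation (?A p) = (PROD j<N. exp_poly (besq_back nu c xs (lam, monom 1 (p j))) ((u j)^2))" for p :: "nat => nat"
 proof -
  define ph where "ph = (%j x. path_product xs (%t. (x t)\<^sup>2) * (exp (- lam * (x c)^2) * ((x c)^2) ^ p j))"
  have xc: "(%x. x c) : bmeas (PiM {0..} (%_. borel :: real measure))" by (rule path_component_measurable[OF c])
  have phm: "ph j : bmeas (PiM {0..} (%_. borel))" for j
  proof -
   have "(%x. exp (- lam * (x c)^2) * ((x c)^2) ^ p j) : bmeas (PiM {0..} (%_. borel))"
    using xc by measurable
   then show ?thesis unfolding ph_def by (rule borel_measurable_times[OF path_product_path_measurable[OF o]])
  qed
  have eq: "Y (p j) j w = ph j (\<lambda>s\<in>{0..}. Rt j s w)" for j w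
  proof -
   have "pp xs j w = path_product xs (%t. ((\<lambda>s\<in>{0..}. Rt j s w) t)\<^sup>2)"
    by (rule path_product_cong[OF o]) simp
   then show ?thesis using c by (simp add: Y_def ph_def)
  qed
  have "integrable P (?A p)"
   "expectation (?A p) = (PROD j<N. expectation (Y (p j) j))"
   by (rule product_factorization[where Y = "%j. Y (p j) j" and ph = ph]; (rule phm eq Yi; assumption?)?)+
  moreover have "(PROD j<N. expectation (Y (p j) j)) = (PROD j<N. exp_poly (besq_back nu c xs (lam, monom 1 (p j))) ((u j)^2))"
   using moment_formula[OF o lam] unfolding Y_def by (intro prod.cong) auto
  ultimately show ?thesis by simp
 qed
 have eq: "(PROD j<N. pp xs j w) * (exp (- lam * (SUM j<N. (Rt j c w)\<^sup>2)) * vdm N (%j. (Rt j c w)\<^sup>2)) =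
   (\<Sum>p | p permutes {..<N}. of_int (sign p) * (PROD j<N. Y (p j) j w))" for w
 by (auto simp: sum_distrib_left Y_def prod.distrib vdm_expand mult.left_commute intro!: sum.cong exp_sum)
 show ?thesis
  unfolding eq alternant_def using fact by (subst integral_sum) auto
qed

text \<open>With damping, the left side is a determinant of evolved functions at the squared
  starting points, and the noncolliding expectation is the same determinant divided by
  \<open>vdm N (u^2)\<close>. Then \<open>lam\<close> tends to 0, dominated on one side by the
  integrable Vandermonde determinant and on the other by a constant.\<close>

theorem weighted_product_expectation:
 assumes nc: "noncolliding_system M \<F> B N X nu" and x0: "!!j. j < N ==> AE w in M. X j 0 w = (u j)^2"
  and dist: "!!j k. j < k ==> k < N ==> (u j)^2 ~= (u k)^2"
  and o: "times_ordered c xs"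
 shows "expectation (%w. (PROD j<N. pp xs j w) * vdm N (%j. (Rt j c w)\<^sup>2)) =
  vdm N (%j. (u j)\<^sup>2) * prob_space.expectation M (%w. PROD j<N. path_product xs (%t. X j t w))"
proof -
 interpret nc: noncolliding_system M \<F> B N X nu by (rule nc)
 have c: "0 <= c" using o by (simp add: times_ordered_def)
 define l where "l = (%n::nat. 1 / real (Suc n))"
 have l: "l n > 0" for n by (simp add: l_def)
 have llim: "l ~> 0" unfolding l_def by (rule LIMSEQ_Suc[OF lim_1_over_n])
 define a where "a = (%w. PROD j<N. pp xs j w)"
 define a' where "a' = (%w. PROD j<N. path_product xs (%t. X j t w))"
 define s where "s = (%w. SUM j<N. (Rt j c w)\<^sup>2)"
 define s' where "s' = (%w. SUM j<N. X j c w)"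
 define v where "v = (%w. vdm N (%j. (Rt j c w)\<^sup>2))"
 have vz: "vdm N (%j. (u j)\<^sup>2) ~= 0" using dist by (rule vdm_nonzero)
 let ?A = "%n w. exp (- l n * s w) * v w"
 let ?B = "%n. %w. a' w * exp (- l n * s' w)"
 let ?C = "%n. %k. exp_poly (l n, monom 1 k)"
 have eq: "expectation (%w. a w * (?A n w)) =
   vdm N (%j. (u j)\<^sup>2) * nc.expectation (?B n)" for n
 proof -
  have m: "a' : bmeas M" unfolding a'_def by (rule nc.path_product_measurable[OF o])
  have m2: "s' : bmeas M" unfolding s'_def using nc.X_measurable c by (intro borel_measurable_sum) auto
  have "nc.expectation (?B n) =
    nc.expectation (%w. a' w * vdm_quotient N (?C n) (%j. X j c w))"
  proof (rule integral_cong_AE)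
   show "(?B n) : bmeas M" using m m2 by measurable
   show "(%w. a' w * vdm_quotient N (?C n) (%j. X j c w)) : bmeas M"
    using c by (intro borel_measurable_times m vdm_quotient_measurable nc.X_measurable) auto
   show "AE w in M. a' w * exp (- l n * s' w) = a' w * vdm_quotient N (?C n) (%j. X j c w)"
    using nc.noncolliding
   proof eventually_elim
    case (elim w)
    have "vdm_quotient N (?C n) (%j. X j c w) = exp (- l n * (SUM j<N. X j c w))"
     by (rule vdm_quotient_exp_powers) (use elim c in auto)
    then show ?case by (simp add: s'_def)
   qed
  qed
  also have "... = vdm_quotient N (%k. exp_poly (besq_back nu c xs (l n, monom 1 k))) (%j. (u j)\<^sup>2)"
   unfolding a'_def by (rule nc.product_expectation[OF o l x0])
  finally show ?thesis
   unfolding a_def s_def v_def alternant_expectation[OF o l] using vz by (simp add: vdm_quotient_def)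
 qed
 obtain K where K: "K >= 0" "ALL x. (ALL t>=0. 0 <= x t) --> abs (path_product xs x) <= K"
 proof -
  have "EX K>=0. ALL x. (ALL t>=0. 0 <= x t) --> abs (path_product xs x) <= K"
   by (rule path_product_bounded) (use times_ordered_mem[OF o] in blast)
  then show ?thesis using that by blast
 qed
 have aK: "abs (a w) <= K ^ N" for w
 proof -
  have "abs (a w) <= (PROD j<N. K)" unfolding a_def abs_prod using K by (intro prod_mono) auto
  then show ?thesis by simp
 qed
 have aK': "abs (a' w) <= K ^ N" if "w : space M" for w
 proof -
  have "abs (a' w) <= (PROD j<N. K)" unfolding a'_def abs_prod using K nc.nonneg that by (intro prod_mono) auto
  then show ?thesis by simp
 qed
 have s0: "0 <= s w" for w unfolding s_def by (intro sum_nonneg) auto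
 have s0': "0 <= s' w" if "w : space M" for w unfolding s'_def using nc.nonneg that c by (intro sum_nonneg) auto
 have am: "a : bmeas P" unfolding a_def using path_product_Rt_measurable[OF o] by (intro borel_measurable_prod) auto
 have sm: "s : bmeas P" unfolding s_def using Rt_measurable c by (intro borel_measurable_sum borel_measurable_power) auto
 have vi: "integrable P v" unfolding v_def by (rule vdm_integrable[OF c])
 have am': "a' : bmeas M" unfolding a'_def by (rule nc.path_product_measurable[OF o])
 have sm': "s' : bmeas M" unfolding s'_def using nc.X_measurable c by (intro borel_measurable_sum) auto
 have lim1: "(%n. expectation (%w. a w * (?A n w))) ~> expectation (%w. a w * v w)"
 proof (rule integral_dominated_convergence[where w = "%w. K ^ N * abs (v w)"])
  show "(%w. a w * v w) : bmeas P" using am vi by measurable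
  show "(%w. a w * (?A n w)) : bmeas P" for n using am sm vi by measurable
  show "integrable P (%w. K ^ N * abs (v w))" using vi by simp
  show "AE w in P. (%n. a w * (?A n w)) ~> a w * v w"
  proof (rule AE_I2)
   fix w
   have "(%n. a w * (?A n w)) ~> a w * (exp (- 0 * s w) * v w)"
    by (intro tendsto_intros llim)
   then show "(%n. a w * (?A n w)) ~> a w * v w" by simp
  qed
  show "AE w in P. norm (a w * (?A n w)) <= K ^ N * abs (v w)" for n
  proof (rule AE_I2)
   fix w
   have "exp (- l n * s w) <= 1" using l[of n] s0[of w] by simp
   then have "exp (- l n * s w) * abs (v w) <= 1 * abs (v w)" by (rule mult_right_mono) simp
   then show "norm (a w * (?A n w)) <= K ^ N * abs (v w)"
    using aK[of w] K(1) unfolding real_norm_def abs_mult by (intro mult_mono) auto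
  qed
 qed
 let ?D = "%w. %n. a' w * exp (- l n * s' w)"
 have lim2: "(%n. nc.expectation (?B n)) ~> nc.expectation a'"
 proof (rule integral_dominated_convergence[where w = "%w. K ^ N"])
  show "a' : bmeas M" by (rule am')
  show "(?B n) : bmeas M" for n using am' sm' by measurable
  show "AE w in M. (?D w) ~> a' w"
  proof (rule AE_I2)
   fix w
   have "(?D w) ~> a' w * exp (- 0 * s' w)"
    by (intro tendsto_intros llim)
   then show "(?D w) ~> a' w" by simp
  qed
  show "AE w in M. norm (a' w * exp (- l n * s' w)) <= K ^ N" for n
  proof (rule AE_I2)
   fix w assume w: "w : space M"
   have "exp (- l n * s' w) <= 1" using l[of n] s0'[OF w] by simp
   then have "abs (a' w) * exp (- l n * s' w) <= K ^ N * 1"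
    using aK'[OF w] K(1) by (intro mult_mono) auto
   then show "norm (a' w * exp (- l n * s' w)) <= K ^ N" by (simp add: abs_mult)
  qed
 qed simp
 have "expectation (%w. a w * v w) = vdm N (%j. (u j)\<^sup>2) * nc.expectation a'"
  by (rule LIMSEQ_unique[OF lim1[unfolded eq] tendsto_mult[OF tendsto_const lim2]])
 then show ?thesis unfolding a_def v_def a'_def .
qed

end

section \<open>Closure under bounded limits\<close>

text \<open>A functional monotone class: the linear span of \<open>G\<close>, closed under bounded
  pointwise limits of sequences. Bounds and limits are required on \<open>Om\<close> only, so values
  outside \<open>Om\<close> are free.\<close>

inductive bounded_closure :: "'p set => ('p => real) set => ('p => real) => bool" for Om G where
 base: "g : G ==> bounded_closure Om G g"
| add: "bounded_closure Om G f ==> bounded_closure Om G g ==> bounded_closure Om G (%p. f p + g p)"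
| scale: "bounded_closure Om G f ==> bounded_closure Om G (%p. c * f p)"
| limit: "(!!n::nat. bounded_closure Om G (f n)) ==> (!!n p. p : Om ==> abs (f n p) <= K) ==>
  (!!p. p : Om ==> (%n. f n p) ~> g p) ==> bounded_closure Om G g"

locale multiplicative_class =
 fixes Om :: "'p set" and G :: "('p => real) set"
 assumes G_bounded: "g : G ==> EX K. ALL p:Om. abs (g p) <= K"
  and G_mult: "g : G ==> h : G ==> (%p. g p * h p) : G"
  and G_one: "(%_. 1) : G"
begin

abbreviation "bc \<equiv> bounded_closure Om G"

lemma bc_bounded: "bc f ==> EX K>=0. ALL p:Om. abs (f p) <= K"
proof (induction rule: bounded_closure.induct)
 case (base g)
 then obtain K where "ALL p:Om. abs (g p) <= K" using G_bounded by blast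
 then have "ALL p:Om. abs (g p) <= abs K" by fastforce
 then show ?case by (intro exI[of _ "abs K"]) simp
next
 case (add f g)
 then obtain K L where KL: "K >= 0" "ALL p:Om. abs (f p) <= K" "L >= 0" "ALL p:Om. abs (g p) <= L" by blast
 have "abs (f p + g p) <= K + L" if "p : Om" for p
 proof -
  have "abs (f p) <= K" "abs (g p) <= L" using KL that by blast+
  then show ?thesis by linarith
 qed
 then show ?case using KL by (intro exI[of _ "K + L"]) simp
next
 case (scale f c)
 then obtain K where "K >= 0" "ALL p:Om. abs (f p) <= K" by blast
 then show ?case by (intro exI[of _ "abs c * K"]) (auto simp: abs_mult intro!: mult_left_mono)
next
 case (limit f K g)
 have "abs (g p) <= abs K" if p: "p : Om" for p
 proof (rule LIMSEQ_le_const2[OF tendsto_rabs[OF limit(3)[OF p]]])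
  show "EX N. ALL n>=N. (abs (f n p)) <= abs K"
  proof (intro exI[of _ 0] allI impI)
   fix n
   show "abs (f n p) <= abs K" using limit(2)[OF p, of n] by simp
  qed
 qed
 then show ?case by (intro exI[of _ "abs K"]) simp
qed

context
 fixes M :: "'a measure" and R :: "'a => 'p" and Z :: "'a => complex"
 assumes R: "!!w. w : space M ==> R w : Om" and Z: "integrable M Z"
begin

lemma norm_weighted_le:
 assumes "w : space M" "!!p. p : Om ==> abs (f p) <= K"
 shows "norm (cr (f (R w)) * Z w) <= abs K * norm (Z w)"
 unfolding norm_mult norm_of_real using assms(2)[OF R[OF assms(1)]] by (intro mult_right_mono) auto

lemma weighted_measurable: "(%w. f (R w)) : bmeas M ==> (%w. cr (f (R w)) * Z w) : bmeas M"
 using Z by (intro borel_measurable_times) auto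

lemma weighted_integrable:
 assumes "(%w. f (R w)) : bmeas M" "!!p. p : Om ==> abs (f p) <= K"
 shows "integrable M (%w. cr (f (R w)) * Z w)"
proof (rule integrable_bound)
 show "integrable M (%w. (abs K) * norm (Z w))" using Z by simp
 show "AE w in M. norm (cr (f (R w)) * Z w) <= norm (abs K * norm (Z w))"
  using norm_weighted_le[OF _ assms(2)] by (intro AE_I2) simp
qed (rule weighted_measurable[OF assms(1)])

lemma weighted_add:
 assumes "bc f" "bc g" "(%w. f (R w)) : bmeas M" "(%w. g (R w)) : bmeas M"
 shows "(\<integral>w. cr (f (R w) + g (R w)) * Z w \<partial>M) = (\<integral>w. cr (f (R w)) * Z w \<partial>M) + (\<integral>w. cr (g (R w)) * Z w \<partial>M)"
proof -
 obtain K L where "ALL p:Om. abs (f p) <= K" "ALL p:Om. abs (g p) <= L" using bc_bounded assms(1,2) by blast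
 then show ?thesis unfolding of_real_add distrib_right
  by (intro integral_add weighted_integrable[OF assms(3)] weighted_integrable[OF assms(4)]) auto
qed

lemma weighted_limit:
 assumes f: "!!n. (%w. f n (R w)) : bmeas M" "!!n p. p : Om ==> abs (f n p) <= K" "!!p. p : Om ==> (%n::nat. f n p) ~> g p"
 shows "(%w. g (R w)) : bmeas M & (%n. \<integral>w. cr (f n (R w)) * Z w \<partial>M) ~> (\<integral>w. cr (g (R w)) * Z w \<partial>M)"
proof (intro conjI)
 show g: "(%w. g (R w)) : bmeas M" by (rule borel_measurable_LIMSEQ_real[OF f(3)[OF R] f(1)])
 show "(%n. \<integral>w. cr (f n (R w)) * Z w \<partial>M) ~> (\<integral>w. cr (g (R w)) * Z w \<partial>M)"
 proof (rule integral_dominated_convergence[where w = "%w. (abs K) * norm (Z w)"])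
  show "AE w in M. (%n. cr (f n (R w)) * Z w) ~> cr (g (R w)) * Z w"
   by (rule AE_I2) (intro tendsto_mult tendsto_of_real f(3) R tendsto_const)
  show "AE w in M. norm (cr (f n (R w)) * Z w) <= abs K * norm (Z w)" for n
   by (rule AE_I2) (rule norm_weighted_le[OF _ f(2)])
 qed (use Z in \<open>simp_all add: weighted_measurable f(1) g\<close>)
qed

end

text \<open>Both sides are linear and continuous under dominated convergence, with integrable
  weights in place of measures, which a complex weight could not be. Measurability is carried
  through the same induction because it is a property of the composed function.\<close>

lemma bc_integral_eq:
 fixes Z :: "'a => complex" and Z' :: "'b => complex"
 assumes R: "!!w. w : space M ==> R w : Om" "integrable M Z" and R': "!!w. w : space M' ==> R' w : Om" "integrable M' Z'"
  and G: "!!g. g : G ==> (%w. g (R w)) : bmeas M & (%w. g (R' w)) : bmeas M' &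
   (\<integral>w. cr (g (R w)) * Z w \<partial>M) = (\<integral>w. cr (g (R' w)) * Z' w \<partial>M')"
 shows "bc f ==> (%w. f (R w)) : bmeas M & (%w. f (R' w)) : bmeas M' &
   (\<integral>w. cr (f (R w)) * Z w \<partial>M) = (\<integral>w. cr (f (R' w)) * Z' w \<partial>M')"
proof (induction rule: bounded_closure.induct)
 case (base g)
 then show ?case by (rule G)
next
 case (add f g)
 then show ?case
  using weighted_add[OF R add.hyps] weighted_add[OF R' add.hyps] by (simp add: borel_measurable_add)
next
 case (scale f c)
 then show ?case unfolding of_real_mult mult.assoc integral_mult_right_zero by (simp add: borel_measurable_times)
next
 case (limit f K g)
 have m: "(%w. f n (R w)) : bmeas M" "(%w. f n (R' w)) : bmeas M'"
  "(\<integral>w. cr (f n (R w)) * Z w \<partial>M) = (\<integral>w. cr (f n (R' w)) * Z' w \<partial>M')" for n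
  using limit.IH by blast+
 show ?case
  using weighted_limit[OF R m(1) limit(2,3)] weighted_limit[OF R' m(2) limit(2,3)] unfolding m(3)
  by (blast intro: LIMSEQ_unique)
qed

lemma bc_cong:
 assumes "bc f" "!!p. p : Om ==> f p = g p"
 shows "bc g"
proof -
 obtain K where K: "ALL p:Om. abs (f p) <= K" using bc_bounded[OF assms(1)] by blast
 show ?thesis
 proof (rule bounded_closure.limit[where f = "%_. f" and K = K and g = g])
  show "abs (f p) <= K" if "p : Om" for p using K that by blast
  show "(%n. f p) ~> g p" if "p : Om" for p using assms(2)[OF that] by simp
 qed (rule assms(1))
qed

text \<open>Two inductions: first with a generator as left factor, then with the right factor fixed
  in the closure.\<close>

lemma bc_mult:
 assumes f: "bc f" and g: "bc g"
 shows "bc (%p. f p * g p)"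
proof -
 have 1: "bc (%p. h p * g p)" if h: "h : G" "bc g" for h g
  using that(2)
 proof (induction rule: bounded_closure.induct)
  case (base g)
  then show ?case using h(1) by (intro bounded_closure.base G_mult)
 next
  case (add f g)
  from bounded_closure.add[OF add.IH] show ?case by (simp add: distrib_left)
 next
  case (scale f c)
  from bounded_closure.scale[OF scale.IH, of c] show ?case by (simp add: mult_ac)
 next
  case (limit f K g)
  obtain L where L: "L >= 0" "ALL p:Om. abs (h p) <= L" using bc_bounded[OF bounded_closure.base[OF h(1)]] by blast
  show ?case
  proof (rule bounded_closure.limit[OF limit.IH])
   show "abs (h p * f n p) <= L * K" if "p : Om" for n p
    unfolding abs_mult using L limit(2)[OF that] that by (intro mult_mono) auto
   show "(%n. h p * f n p) ~> h p * g p" if "p : Om" for p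
    by (rule tendsto_mult[OF tendsto_const limit(3)[OF that]])
  qed
 qed
 show ?thesis
  using f
 proof (induction rule: bounded_closure.induct)
  case (base h)
  then show ?case by (rule 1[OF _ g])
 next
  case (add f h)
  from bounded_closure.add[OF add.IH] show ?case by (simp add: distrib_right)
 next
  case (scale f c)
  from bounded_closure.scale[OF scale.IH, of c] show ?case by (simp add: mult_ac)
 next
  case (limit f K h)
  obtain L where L: "L >= 0" "ALL p:Om. abs (g p) <= L" using bc_bounded[OF g] by blast
  show ?case
  proof (rule bounded_closure.limit[OF limit.IH])
   show "abs (f n p * g p) <= abs K * L" if "p : Om" for n p
    unfolding abs_mult using L limit(2)[OF that, of n] that by (intro mult_mono) auto
   show "(%n. f n p * g p) ~> h p * g p" if "p : Om" for p
    by (rule tendsto_mult[OF limit(3)[OF that] tendsto_const])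
  qed
 qed
qed

lemma bc_const: "bc (%_. c)"
 using bounded_closure.scale[OF bounded_closure.base[OF G_one], where c = c] by simp

lemma bc_diff: "bc f ==> bc g ==> bc (%p. f p - g p)"
 using bounded_closure.add[of Om G f "%p. -1 * g p"] bounded_closure.scale[of Om G g "-1"] by simp

lemma bc_sum: "(!!i. i : I ==> bc (f i)) ==> bc (%p. SUM i:I. f i p)"
 by (induction I rule: infinite_finite_induct) (auto intro: bc_const bounded_closure.add)

lemma bc_prod: "(!!i. i : I ==> bc (f i)) ==> bc (%p. PROD i:I. f i p)"
 by (induction I rule: infinite_finite_induct) (auto intro: bc_const bc_mult)

definition bc_pred :: "('p => bool) => bool" where
 "bc_pred Q \<longleftrightarrow> bc (%p. of_bool (Q p))"

lemma bc_pred_not: "bc_pred Q ==> bc_pred (%p. \<not> Q p)"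
 unfolding bc_pred_def of_bool_not_iff by (rule bc_diff[OF bc_const])

lemma bc_pred_disj: "bc_pred Q ==> bc_pred R ==> bc_pred (%p. Q p | R p)"
proof -
 assume "bc_pred Q" "bc_pred R"
 then have "bc (%p. of_bool (Q p) + of_bool (R p) - of_bool (Q p) * of_bool (R p))"
  unfolding bc_pred_def by (intro bc_diff bounded_closure.add bc_mult)
 moreover have "(%p. of_bool (Q p) + of_bool (R p) - of_bool (Q p) * of_bool (R p)) = (%p. of_bool (Q p | R p) :: real)"
  by (rule ext) (simp add: of_bool_def)
 ultimately show ?thesis unfolding bc_pred_def by simp
qed

lemma bc_pred_ex:
 fixes Q :: "nat => 'p => bool"
 assumes "!!n. bc_pred (Q n)" shows "bc_pred (%p. EX n. Q n p)"
proof -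
 have fin: "bc_pred (%p. EX n<m. Q n p)" for m
 proof (induction m)
  case 0
  show ?case using bc_const[of 0] by (simp add: bc_pred_def)
 next
  case (Suc m)
  have "(%p. EX n<Suc m. Q n p) = (%p. (EX n<m. Q n p) | Q m p)" by (auto simp: less_Suc_eq)
  then show ?case using bc_pred_disj[OF Suc assms] by simp
 qed
 show ?thesis
  unfolding bc_pred_def
 proof (rule bounded_closure.limit[where f = "%m p. of_bool (EX n<m. Q n p)" and K = 1])
  show "bc (%p. of_bool (EX n<m. Q n p))" for m using fin[of m] by (simp add: bc_pred_def)
  show "(%m. of_bool (EX n<m. Q n p) :: real) ~> of_bool (EX n. Q n p)" for p
  proof (cases "EX n. Q n p")
   case True
   then obtain n where n: "Q n p" by blast
   have "\<forall>\<^sub>F m in sequentially. of_bool (EX n<m. Q n p) = (of_bool (EX n. Q n p) :: real)"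
    using eventually_gt_at_top[of n] by eventually_elim (use n in auto)
   then show ?thesis by (rule tendsto_eventually)
  qed simp
 qed simp
qed

lemma bc_pred_sigma_sets:
 assumes "A : sigma_sets S E" "!!a. a : E ==> bc_pred (%p. h p : a)" and h: "!!p. p : Om ==> h p : S"
 shows "bc_pred (%p. h p : A)"
 using assms(1)
proof (induction rule: sigma_sets.induct)
 case (Basic a)
 then show ?case by (rule assms(2))
next
 case Empty
 show ?case using bc_const[of 0] by (simp add: bc_pred_def)
next
 case (Compl a)
 have "bc (%p. of_bool (h p ~: a))" using bc_pred_not[OF Compl.IH] by (simp only: bc_pred_def)
 then show ?case unfolding bc_pred_def by (rule bc_cong) (use h in auto)
next
 case (Union a)
 from bc_pred_ex[of "%n p. h p : a n", OF Union.IH] show ?case by simp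
qed

text \<open>Simple functions of \<open>h p\<close> are combinations of events; they approximate
  \<open>F\<close> pointwise and are dominated by \<open>2 * K\<close>.\<close>

lemma bc_measurable_function:
 fixes F :: "'q => real"
 assumes sets: "!!A. A : sets \<M> ==> bc_pred (%p. h p : A)" and F: "F : bmeas \<M>"
  and h: "!!p. p : Om ==> h p : space \<M>" and bd: "!!x. x : space \<M> ==> abs (F x) <= K"
 shows "bc (%p. F (h p))"
proof -
 let ?A = "%h p s y. h p : s -` {y} \<inter> space \<M>"
 have simple: "bc (%p. s (h p))" if s: "simple_function \<M> s" for s :: "'q => real"
 proof (rule bc_cong)
  show "bc (%p. SUM y:s ` space \<M>. y * of_bool (?A h p s y))"
  proof (rule bc_sum, rule bounded_closure.scale)
   fix y
   have "s -` {y} \<inter> space \<M> : sets \<M>" by (rule simple_functionD(2)[OF s])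
   from sets[OF this] show "bc (%p. of_bool (?A h p s y))" unfolding bc_pred_def .
  qed
  fix p assume "p : Om"
  then have hp: "h p : space \<M>" by (rule h)
  have "(SUM y:s ` space \<M>. y * of_bool (?A h p s y)) = (SUM y:s ` space \<M>. if y = s (h p) then y else 0)"
   using hp by (intro sum.cong) auto
  also have "... = s (h p)" using hp simple_functionD(1)[OF s] by simp
  finally show "(SUM y:s ` space \<M>. y * of_bool (?A h p s y)) = s (h p)" .
 qed
 define Q where "Q = (%s :: nat => 'q => real. (ALL i. simple_function \<M> (s i)) &
  (ALL x:space \<M>. (%i. s i x) ~> F x) & (ALL i. ALL x:space \<M>. dist (s i x) 0 <= 2 * dist (F x) 0))"
 have "EX s. Q s" unfolding Q_def by (rule borel_measurable_implies_sequence_metric[OF F])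
 then obtain s where Q: "Q s" ..
 have s1: "simple_function \<M> (s i)" for i using Q unfolding Q_def by (elim conjE) (erule spec)
 have s2: "(%i. s i x) ~> F x" if "x : space \<M>" for x
  using Q unfolding Q_def by (elim conjE) (erule bspec[OF _ that])
 have s3: "dist (s i x) 0 <= 2 * dist (F x) 0" if "x : space \<M>" for i x
 proof -
  have "ALL i. ALL x:space \<M>. dist (s i x) 0 <= 2 * dist (F x) 0" using Q unfolding Q_def by (elim conjE)
  then show ?thesis using that by blast
 qed
 define fs where "fs = (%i p. s i (h p))"
 define Fh where "Fh = (%p. F (h p))"
 have 1: "bc (fs i)" for i unfolding fs_def by (rule simple[OF s1])
 have 2: "abs (fs i p) <= 2 * K" if p: "p : Om" for i p
 proof -
  have "abs (s i (h p)) <= 2 * abs (F (h p))" using s3[OF h[OF p], of i] by (simp add: dist_real_def)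
  moreover have "abs (F (h p)) <= K" by (rule bd[OF h[OF p]])
  ultimately show ?thesis unfolding fs_def by linarith
 qed
 have 3: "(%i. fs i p) ~> Fh p" if p: "p : Om" for p
  unfolding fs_def Fh_def by (rule s2[OF h[OF p]])
 have "bc Fh"
  by (rule bounded_closure.limit[where f = fs and g = Fh and K = "2 * K"]) (erule 1 2 3 | rule 1)+
 then show ?thesis unfolding Fh_def .
qed

end

section \<open>Approximation by polynomials and by symmetric products\<close>

lemma bernstein_poly:
 fixes f :: "nat => real"
 shows "EX q. ALL x. poly q x = (SUM k<=n. f k * Bernstein n k x)"
proof -
 have "poly (SUM k<=n. smult (f k * real (n choose k)) (monom 1 k * [:1, -1:] ^ (n - k))) x =
   (SUM k<=n. f k * Bernstein n k x)" for x
  unfolding poly_sum by (rule sum.cong[OF refl]) (simp add: Bernstein_def poly_monom)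
 then show ?thesis by blast
qed

lemma poly_approximation:
 fixes ph :: "real => real"
 assumes "continuous_on {0..1} ph"
 shows "EX q. ALL m. ALL x:{0..1}. abs (ph x - poly (q m) x) < 1 / real (Suc m)"
proof -
 have "EX q. ALL x:{0..1}. abs (ph x - poly q x) < 1 / real (Suc m)" for m
 proof -
  have pos: "0 < 1 / real (Suc m)" by simp
  obtain n where n: "!!x. x : {0..1} ==> abs (ph x - (SUM k<=n. ph (k / n) * Bernstein n k x)) < 1 / real (Suc m)"
   using Bernstein_Weierstrass[OF assms pos] by (elim exE) (rule that, blast)
  obtain q where "ALL x. poly q x = (SUM k<=n. ph (k / n) * Bernstein n k x)"
   using bernstein_poly[where f = "%k. ph (k / n)" and n = n] ..
  then show ?thesis using n by (intro exI[of _ q]) simp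
 qed
 then show ?thesis by (rule choice[OF allI])
qed

text \<open>The derivative of the product in the scale \<open>1 / Suc n\<close> at 0. It turns
  symmetric products over the particles into symmetric sums, and so into counts.\<close>

lemma prod_one_plus_limit:
 fixes a :: "nat => real"
 shows "(%n. real (Suc n) * ((PROD j<m. 1 + a j / real (Suc n)) - 1)) ~> (SUM j<m. a j)"
proof (induction m)
 case (Suc m)
 have z: "(%n. a j / real (Suc n)) ~> 0" for j by real_asymp
 have "(%n. PROD j<m. 1 + a j / real (Suc n)) ~> (PROD j<m. 1 + 0)"
  by (intro tendsto_prod tendsto_add tendsto_const z)
 then have P: "(%n. PROD j<m. 1 + a j / real (Suc n)) ~> 1" by simp
 have "(%n. real (Suc n) * ((PROD j<m. 1 + a j / real (Suc n)) - 1) + (PROD j<m. 1 + a j / real (Suc n)) * a m)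
   ~> (SUM j<m. a j) + 1 * a m"
  by (intro tendsto_add tendsto_mult Suc P tendsto_const)
 moreover have "real (Suc n) * ((PROD j<m. 1 + a j / real (Suc n)) - 1) + (PROD j<m. 1 + a j / real (Suc n)) * a m =
   real (Suc n) * ((PROD j<Suc m. 1 + a j / real (Suc n)) - 1)" for n
 by (simp add: field_simps)
 ultimately show ?case by simp
qed simp

text \<open>The same difference quotient, bounded uniformly in the scale \<open>e\<close>, as a
  bounded limit demands.\<close>

lemma prod_one_plus_bound:
 fixes a :: "nat => real"
 assumes "!!j. j < m ==> abs (a j) <= K" "0 <= e" "e <= 1" "0 <= K"
 shows "abs ((PROD j<m. 1 + e * a j) - 1) <= e * ((1 + K) ^ m - 1)"
 using assms(1)
proof (induction m)
 case (Suc m)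
 define p where "p = (PROD j<m. 1 + e * a j)"
 have IH: "abs (p - 1) <= e * ((1 + K) ^ m - 1)" unfolding p_def using Suc.prems by (intro Suc.IH) simp
 have ea: "abs (e * a m) <= e * K" using Suc.prems[of m] assms(2) by (simp add: abs_mult mult_left_mono)
 moreover have "e * K <= K" using assms(3,4) by (simp add: mult_left_le_one_le assms(2))
 ultimately have "abs (1 + e * a m) <= 1 + K" by linarith
 then have "abs ((p - 1) * (1 + e * a m)) <= (e * ((1 + K) ^ m - 1)) * (1 + K)"
  unfolding abs_mult using IH by (intro mult_mono) auto
 moreover have "p * (1 + e * a m) - 1 = (p - 1) * (1 + e * a m) + e * a m" by (simp add: algebra_simps)
 ultimately have "abs (p * (1 + e * a m) - 1) <= (e * ((1 + K) ^ m - 1)) * (1 + K) + e * K" using ea by linarith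
 also have "... = e * ((1 + K) ^ Suc m - 1)" by (simp add: algebra_simps)
 finally show ?case by (simp add: p_def)
qed simp

lemma exp_partial_sums:
 fixes y :: real
 shows "(%n. SUM k<=n. y ^ k / fact k) ~> exp y"
  and "0 <= y ==> (SUM k<=n. y ^ k / fact k) <= exp y"
proof -
 have s: "(%k. y ^ k / fact k) sums exp y"
  using exp_converges[of y] by (simp add: divide_inverse mult.commute)
 then show "(%n. SUM k<=n. y ^ k / fact k) ~> exp y" by (simp add: sums_def_le)
 assume "0 <= y"
 then show "(SUM k<=n. y ^ k / fact k) <= exp y"
  unfolding sums_unique[OF s] by (intro sum_le_suminf sums_summable[OF s]) auto
qed

text \<open>
 A polynomial in \<open>exp (- x)\<close> is a bounded limit of functions \<open>exp (- L * x) * p x\<close>, as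
 \<open>exp (- i * x)\<close> is the limit of \<open>exp (- L * x)\<close> times the partial sums of \<open>exp ((L - i) * x)\<close>.
\<close>

lemma poly_exp_approximation:
 "EX f K. (ALL n. 0 < fst (f n)) & 0 <= K & (ALL n. ALL x>=0. abs (exp_poly (f n) x) <= K) &
   (ALL x>=0. (%n. exp_poly (f n) x) ~> poly q (exp (- x)))"
proof -
 define L where "L = real (degree q) + 1"
 define r where "r = (%n i. SUM k<=n. monom ((L - real i) ^ k / fact k) k)"
 define f where "f = (%n::nat. (L, SUM i<=degree q. smult (coeff q i) (r n i)))"
 have pr: "poly (r n i) x = (SUM k<=n. ((L - real i) * x) ^ k / fact k)" for n i x
  unfolding r_def poly_sum by (rule sum.cong[OF refl]) (simp add: poly_monom power_mult_distrib)
 let ?A = "%x n i. exp (- L * x) * poly (r n i) x"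
 have ef: "exp_poly (f n) x = (SUM i<=degree q. coeff q i * (?A x n i))" for n x
  unfolding f_def exp_poly_def fst_conv snd_conv poly_sum poly_smult sum_distrib_left by (simp add: mult_ac)
 have e: "exp (- L * x) * exp ((L - real i) * x) = exp (- x) ^ i" for x i
  unfolding exp_of_nat_mult[symmetric] exp_add[symmetric] by (rule arg_cong[where f = exp]) (simp add: algebra_simps)
 have "abs (exp_poly (f n) x) <= (SUM i<=degree q. (abs (coeff q i)))" if x: "x >= 0" for n x
  unfolding ef
 proof (rule order.trans[OF sum_abs sum_mono])
  fix i assume i: "i : {..degree q}"
  then have nn: "0 <= (L - real i) * x" using x by (simp add: L_def)
  have "0 <= poly (r n i) x" unfolding pr using nn by (intro sum_nonneg) simp
  moreover have "poly (r n i) x <= exp ((L - real i) * x)" unfolding pr by (rule exp_partial_sums(2)[OF nn])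
  then have "exp (- L * x) * poly (r n i) x <= exp (- L * x) * exp ((L - real i) * x)" by (rule mult_left_mono) simp
  moreover have "exp (- x) ^ i <= 1" using x by (intro power_le_one) auto
  ultimately have "abs (?A x n i) <= 1" unfolding e by simp
  then have "abs (coeff q i) * abs (?A x n i) <= abs (coeff q i) * 1" by (rule mult_left_mono) simp
  then show "abs (coeff q i * (?A x n i)) <= abs (coeff q i)" by (simp add: abs_mult)
 qed
 moreover have "(%n. exp_poly (f n) x) ~> poly q (exp (- x))" for x
 proof -
  have "(%n. SUM i<=degree q. coeff q i * (?A x n i)) ~>
    (SUM i<=degree q. coeff q i * (exp (- L * x) * exp ((L - real i) * x)))"
   unfolding pr by (intro tendsto_sum tendsto_mult tendsto_const exp_partial_sums(1))
  then show ?thesis unfolding ef e poly_altdef .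
 qed
 moreover have "0 < fst (f n)" for n by (simp add: f_def L_def)
 moreover have "0 <= (SUM i<=degree q. (abs (coeff q i)))" by (simp add: sum_nonneg)
 ultimately show ?thesis by blast
qed

lemma poly_bounded_unit: "EX K>=0. ALL x:{0..1}. abs (poly q x) <= (K :: real)"
proof -
 obtain K where "K >= 0" "!!x. x : {0..1} ==> abs (poly q x) <= K"
  by (rule continuous_on_interval_bound[of 0 1 "poly q"]) (intro continuous_intros, (rule that; assumption))
 then show ?thesis by blast
qed

lemma exp_square_unit: "exp (- x\<^sup>2) : {0..1}" for x :: real by simp

section \<open>Symmetric functionals of nonnegative paths\<close>

context
 fixes N :: nat and T :: real
begin

text \<open>The generating functionals see the squares of the positions. On nonnegative paths these
  determine the positions themselves.\<close>

definition nonneg_paths :: "(nat => real => real) set" where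
 "nonneg_paths = {p. ALL j<N. ALL s>=0. 0 <= p j s}"

definition admissible :: "(real \<times> real \<times> real poly) list => bool" where
 "admissible xs \<longleftrightarrow> (ALL (s, f):set xs. 0 <= s & s <= T & 0 < fst f)"

definition product_functional :: "(real \<times> real \<times> real poly) list => (nat => real => real) => real" where
 "product_functional xs p = (PROD j<N. path_product xs (%s. (p j s)\<^sup>2))"

abbreviation product_functionals :: "((nat => real => real) => real) set" where
 "product_functionals \<equiv> product_functional ` {xs. admissible xs}"

lemma product_functional_bounded:
 assumes "admissible xs"
 shows "EX K. ALL p. (abs (product_functional xs p)) <= K"
proof -
 have mem: "0 <= s & 0 < fst f" if "(s, f) : set xs" for s f
  using assms that unfolding admissible_def by blast
 obtain K where K: "K >= 0" "ALL x. (ALL t>=0. 0 <= x t) --> abs (path_product xs x) <= K"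
 by (metis path_product_bounded[OF mem])
 have "abs (product_functional xs p) <= (PROD j<N. K)" for p
  unfolding product_functional_def abs_prod using K by (intro prod_mono) auto
 then show ?thesis by blast
qed

lemma product_functionals_class: "multiplicative_class nonneg_paths product_functionals"
proof
 fix g assume "g : product_functionals"
 then show "EX K. ALL p:nonneg_paths. (abs (g p)) <= K" using product_functional_bounded by fast
next
 fix g h assume "g : product_functionals" "h : product_functionals"
 then obtain xs ys where "g = product_functional xs" "h = product_functional ys" "admissible xs" "admissible ys" by blast
 then have "(%p. g p * h p) = product_functional (xs @ ys)" "admissible (xs @ ys)"
  by (auto simp: product_functional_def path_product_append prod.distrib admissible_def)
 then show "(%p. g p * h p) : product_functionals" by blast
next
 have "(%_. 1) = product_functional []" "admissible []" by (auto simp: product_functional_def admissible_def)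
 then show "(%_. 1) : product_functionals" by blast
qed

interpretation M: multiplicative_class nonneg_paths product_functionals by (rule product_functionals_class)

abbreviation "path_closure \<equiv> bounded_closure nonneg_paths product_functionals"

lemma path_closure_bounded: "path_closure Ps ==> EX K>=0. ALL p:nonneg_paths. (abs (Ps p)) <= K"
 by (rule M.bc_bounded)

context
 fixes s :: real assumes s: "0 <= s" "s <= T"
begin

lemma closure_prod_poly_exp: "path_closure (%p. PROD j<N. poly q (exp (- (p j s)\<^sup>2)))"
proof -
 obtain f K where f: "ALL n. 0 < fst (f n)" "0 <= K" "ALL n. ALL x>=0. abs (exp_poly (f n) x) <= K"
  "ALL x>=0. (%n. exp_poly (f n) x) ~> poly q (exp (- x))"
  using poly_exp_approximation[of q] by (elim exE conjE) (rule that; assumption)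
 have pf: "product_functional [(s, f n)] p = (PROD j<N. exp_poly (f n) ((p j s)^2))" for n p
  by (simp add: product_functional_def)
 show ?thesis
 proof (rule bounded_closure.limit[where f = "%n. product_functional [(s, f n)]" and K = "K ^ N"
    and g = "%p. PROD j<N. poly q (exp (- (p j s)\<^sup>2))"])
  show "path_closure (product_functional [(s, f n)])" for n
   by (rule bounded_closure.base) (use s f(1) in \<open>auto simp: admissible_def\<close>)
  show "abs (product_functional [(s, f n)] p) <= K ^ N" for n p
  proof -
   have "abs (product_functional [(s, f n)] p) <= (PROD j<N. K)"
    unfolding pf abs_prod using f(3) by (intro prod_mono) auto
   then show ?thesis by simp
  qed
  show "(%n. product_functional [(s, f n)] p) ~> (PROD j<N. poly q (exp (- (p j s)\<^sup>2)))" for p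
   unfolding pf using f(4) by (intro tendsto_prod) simp
 qed
qed

text \<open>The same factor \<open>1 + q / Suc n\<close> is put at every particle; the rescaled
  excess of the product over 1 tends to the sum.\<close>

lemma closure_sum_poly_exp: "path_closure (%p. SUM j<N. poly q (exp (- (p j s)\<^sup>2)))"
proof -
 obtain K where K: "K >= 0" "ALL x:{0..1}. abs (poly q x) <= K" using poly_bounded_unit by blast
 have Kb: "abs (poly q (exp (- x\<^sup>2))) <= K" for x using K(2) exp_square_unit by blast
 let ?A = "%p j s. exp (- (p j s)\<^sup>2)"
 define F where "F = (%n p. real (Suc n) * ((PROD j<N. poly ([:1:] + smult (1 / real (Suc n)) q) (?A p j s)) - 1))"
 have F: "F n p = real (Suc n) * ((PROD j<N. 1 + poly q (?A p j s) / real (Suc n)) - 1)" for n p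
  by (simp add: F_def)
 show ?thesis
 proof (rule bounded_closure.limit[where f = F and K = "(1 + K) ^ N - 1" and g = "%p. SUM j<N. poly q (?A p j s)"])
  show "path_closure (F n)" for n
   unfolding F_def by (intro bounded_closure.scale M.bc_diff M.bc_const closure_prod_poly_exp)
  show "abs (F n p) <= (1 + K) ^ N - 1" for n p
  proof -
   define e where "e = 1 / real (Suc n)"
   have e: "0 <= e" "e <= 1" by (simp_all add: e_def)
   have "abs ((PROD j<N. 1 + e * poly q (?A p j s)) - 1) <= e * ((1 + K) ^ N - 1)"
    by (rule prod_one_plus_bound[OF Kb e K(1)])
   then have "real (Suc n) * abs ((PROD j<N. 1 + e * poly q (?A p j s)) - 1) <= real (Suc n) * (e * ((1 + K) ^ N - 1))"
    by (rule mult_left_mono) simp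
   also have "... = (1 + K) ^ N - 1" by (simp add: e_def del: of_nat_Suc)
   finally show ?thesis unfolding F abs_mult e_def by simp
  qed
  show "(%n. F n p) ~> (SUM j<N. poly q (?A p j s))" for p
   unfolding F by (rule prod_one_plus_limit)
 qed
qed

lemma closure_sum_continuous:
 assumes ph: "continuous_on {0..1} ph"
 shows "path_closure (%p. SUM j<N. ph (exp (- (p j s)\<^sup>2)))"
proof -
 obtain q where q: "ALL m. ALL x:{0..1}. abs (ph x - poly (q m) x) < 1 / real (Suc m)"
  using poly_approximation[OF ph] ..
 obtain K where K: "K >= 0" "!!x. x : {0..1} ==> abs (ph x) <= K"
  by (rule continuous_on_interval_bound[OF ph]) (rule that; assumption)
 have qm: "abs (ph x - poly (q m) x) < 1 / real (Suc m)" if "x : {0..1}" for x m using q that by blast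
 have bd: "abs (poly (q m) (exp (- x\<^sup>2))) <= K + 1" for m x
 proof -
  have "1 / real (Suc m) <= 1" by simp
  then show ?thesis using qm[OF exp_square_unit, of x m] K(2)[OF exp_square_unit, of x] by linarith
 qed
 have lim: "(%m. poly (q m) (exp (- x\<^sup>2))) ~> ph (exp (- x\<^sup>2))" for x
 proof -
  have "(%m. poly (q m) (exp (- x\<^sup>2)) - ph (exp (- x\<^sup>2))) ~> 0"
  proof (rule LIMSEQ_0_abs_le)
   show "(%m. 1 / real (Suc m)) ~> 0" by (rule LIMSEQ_Suc[OF lim_1_over_n])
   show "\<forall>\<^sub>F m in sequentially. (abs (poly (q m) (exp (- x\<^sup>2)) - ph (exp (- x\<^sup>2)))) <= 1 / real (Suc m)"
    using qm[OF exp_square_unit, of x] by (intro always_eventually allI) (simp add: abs_minus_commute less_imp_le)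
  qed
  then show ?thesis by (rule LIM_zero_cancel)
 qed
 show ?thesis
 by (fastforce intro: tendsto_sum lim bounded_closure.limit closure_sum_poly_exp order.trans[OF sum_abs sum_mono] bd)
qed

lemma closure_count_atMost: "path_closure (%p. SUM j<N. of_bool (p j s : {..a}))"
proof (cases "0 <= a")
 case False
 show ?thesis
  by (rule M.bc_cong[OF M.bc_const[of 0]]) (use False s in \<open>force simp: nonneg_paths_def intro!: sum.neutral[symmetric]\<close>)
next
 case True
 define c where "c = exp (- a\<^sup>2)"
 \<comment> \<open>A continuous ramp in \<open>v = exp (- x^2)\<close>, equal to 1 for
   \<open>v >= c\<close> and to 0 for \<open>v <= c - 1 / m\<close>. For \<open>x >= 0\<close> the
   condition \<open>x <= a\<close> becomes \<open>v >= c\<close>, a closed condition on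
   \<open>v\<close>.\<close>
 define ph where "ph = (%m v. max 0 (min 1 (1 + real m * (v - c))))"
 have phc: "continuous_on {0..1} (ph m)" for m unfolding ph_def by (intro continuous_intros)
 have iff: "x <= a \<longleftrightarrow> c <= exp (- x\<^sup>2)" if "0 <= x" for x
  using that True by (simp add: c_def abs_le_square_iff[symmetric])
 have lim: "(%m. ph m v) ~> of_bool (c <= v)" for v
 proof (cases "c <= v")
  case True
  then have "ph m v = of_bool (c <= v)" for m by (simp add: ph_def)
  then show ?thesis by simp
 next
  case False
  obtain n where n: "1 / (c - v) <= real n" using real_arch_simple by blast
  have "\<forall>\<^sub>F m in sequentially. ph m v = of_bool (c <= v)"
   using eventually_ge_at_top[of n]
  proof eventually_elim
   case (elim m)
   have "1 / (c - v) <= real m" using n elim by linarith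
   then have "1 <= real m * (c - v)" using False by (simp add: field_simps)
   then show ?case using False by (simp add: ph_def algebra_simps)
  qed
  then show ?thesis by (rule tendsto_eventually)
 qed
 have bd: "abs (ph m v) <= 1" for m v by (simp add: ph_def)
 show ?thesis
 proof (rule bounded_closure.limit[where f = "%m p. SUM j<N. ph m (exp (- (p j s)\<^sup>2))" and K = "real N"
    and g = "%p. SUM j<N. of_bool (p j s : {..a})"])
  show "path_closure (%p. SUM j<N. ph m (exp (- (p j s)\<^sup>2)))" for m by (rule closure_sum_continuous[OF phc])
  show "abs (SUM j<N. ph m (exp (- (p j s)\<^sup>2))) <= real N" for m p
  proof -
   have "abs (SUM j<N. ph m (exp (- (p j s)\<^sup>2))) <= (SUM j<N. 1)"
    by (rule order.trans[OF sum_abs sum_mono]) (rule bd)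
   then show ?thesis by simp
  qed
  show "(%m. SUM j<N. ph m (exp (- (p j s)\<^sup>2))) ~> (SUM j<N. of_bool (p j s : {..a}))" if "p : nonneg_paths" for p
  proof (rule tendsto_sum)
   fix j assume "j : {..<N}"
   then have "0 <= p j s" using that s by (simp add: nonneg_paths_def)
   then show "(%m. ph m (exp (- (p j s)\<^sup>2))) ~> of_bool (p j s : {..a})"
    using lim[of "exp (- (p j s)\<^sup>2)"] iff[of "p j s"] by simp
  qed
 qed
qed

text \<open>Dynkin's theorem, started from half lines and run on counts instead of events:
  complements and disjoint unions act linearly on counts, and all partial counts are at most
  \<open>N\<close>.\<close>

lemma closure_count:
 assumes "A : sets borel"
 shows "path_closure (%p. SUM j<N. of_bool (p j s : A))"
proof -
 have A: "A : sigma_sets UNIV (range (%a::real. {..a}))"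
  using assms by (simp add: borel_eq_atMost sets_measure_of)
 have sub: "range (%a::real. {..a}) \<subseteq> Pow UNIV" by simp
 have int: "Int_stable (range (%a::real. {..a}))" by (auto simp: Int_stable_def)
 show ?thesis
  using int sub A
 proof (induction rule: sigma_sets_induct_disjoint)
  case (basic A)
  then show ?case using closure_count_atMost by auto
 next
  case empty
  show ?case using M.bc_const[of 0] by simp
 next
  case (compl A)
  have "(SUM j<N. of_bool (p j s : UNIV - A)) = real N - (SUM j<N. of_bool (p j s : A))" for p :: "nat => real => real"
  proof -
   have "(SUM j<N. of_bool (p j s : UNIV - A)) = (SUM j<N. 1 - of_bool (p j s : A) :: real)"
    by (intro sum.cong) auto
   then show ?thesis by (simp add: sum_subtractf)
  qed
  then show ?case using M.bc_diff[OF M.bc_const[of "real N"] compl.IH] by simp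
 next
  case (union A)
  have dis: "(SUM i<m. of_bool (x : A i)) = (of_bool (EX i<m. x : A i) :: real)" for x and m :: nat
  proof (induction m)
   case (Suc m)
   have no: "\<not> (x : A m & (EX i<m. x : A i))"
   proof
    assume "x : A m & (EX i<m. x : A i)"
    then obtain i where i: "i < m" "x : A i" "x : A m" by blast
    have "i ~= m" using i(1) by simp
    then have "A i \<inter> A m = {}" using union.hyps(1) unfolding disjoint_family_on_def by blast
    then show False using i by blast
   qed
   have e: "(EX i<Suc m. x : A i) \<longleftrightarrow> (EX i<m. x : A i) | x : A m"
    unfolding less_Suc_eq by blast
   have add: "of_bool P + of_bool Q = (of_bool (P | Q) :: real)" if "\<not> (Q & P)" for P Q
    using that by (cases P; cases Q) simp_all
   show ?case unfolding sum.lessThan_Suc Suc e by (rule add[OF no])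
  qed simp
  have lim: "(%m. of_bool (EX i<m. x : A i)) ~> (of_bool (x : \<Union> (range A)) :: real)" for x
  proof (cases "x : \<Union> (range A)")
   case True
   then obtain i where i: "x : A i" by blast
   have "\<forall>\<^sub>F m in sequentially. of_bool (EX i<m. x : A i) = (of_bool (x : \<Union> (range A)) :: real)"
    using eventually_gt_at_top[of i] by eventually_elim (use i in auto)
   then show ?thesis by (rule tendsto_eventually)
  next
   case False
   then have "of_bool (EX i<m. x : A i) = (of_bool (x : \<Union> (range A)) :: real)" for m by auto
   then show ?thesis by simp
  qed
  show ?case
  proof (rule bounded_closure.limit[where f = "%m p. SUM i<m. SUM j<N. of_bool (p j s : A i)" and K = "real N"
     and g = "%p. SUM j<N. of_bool (p j s : \<Union> (range A))"])
   show "path_closure (%p. SUM i<m. SUM j<N. of_bool (p j s : A i))" for m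
    by (rule M.bc_sum) (rule union.IH)
   have eq: "(SUM i<m. SUM j<N. of_bool (p j s : A i)) = (SUM j<N. of_bool (EX i<m. p j s : A i) :: real)" for m :: nat and p :: "nat => real => real"
   proof -
    have "(SUM i<m. SUM j<N. of_bool (p j s : A i)) = (SUM j<N. SUM i<m. of_bool (p j s : A i) :: real)"
     by (rule sum.swap)
    also have "... = (SUM j<N. of_bool (EX i<m. p j s : A i))" by (rule sum.cong[OF refl dis])
    finally show ?thesis .
   qed
   show "abs (SUM i<m. SUM j<N. of_bool (p j s : A i)) <= real N" for m and p :: "nat => real => real"
   proof -
    have "abs (SUM j<N. of_bool (EX i<m. p j s : A i)) <= (SUM j<N. 1 :: real)"
     by (rule order.trans[OF sum_abs sum_mono]) simp
    then show ?thesis unfolding eq[where m = m and p = p] by simp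
   qed
   show "(%m. SUM i<m. SUM j<N. of_bool (p j s : A i)) ~> (SUM j<N. of_bool (p j s : \<Union> (range A)) :: real)" for p
   proof -
    have "(%m. SUM j<N. of_bool (EX i<m. p j s : A i)) ~> (SUM j<N. of_bool (p j s : \<Union> (range A)) :: real)"
     by (intro tendsto_sum lim)
    moreover have "(%m. SUM i<m. SUM j<N. of_bool (p j s : A i)) = (%m. SUM j<N. of_bool (EX i<m. p j s : A i) :: real)"
     by (rule ext) (rule eq)
    ultimately show ?thesis by (simp only:)
   qed
  qed
 qed
qed

text \<open>The count takes values in \<open>{0..N}\<close>, so the event is a Lagrange
  interpolation polynomial in the count, and the closure is an algebra.\<close>

lemma closure_count_eq:
 assumes A: "A : sets borel"
 shows "M.bc_pred (%p. card {j. j < N & p j s : A} = k)"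
proof -
 define n where "n = (%p::nat => real => real. card {j. j < N & p j s : A})"
 have n: "(SUM j<N. of_bool (p j s : A)) = real (n p)" for p
 proof -
  have "(SUM j<N. of_bool (p j s : A)) = (SUM j:{j. j < N & p j s : A}. 1 :: real)"
   by (intro sum.mono_neutral_cong_right) auto
  then show ?thesis by (simp add: n_def)
 qed
 have le: "n p <= N" for p
 proof -
  have "card {j. j < N & p j s : A} <= card {..<N}" by (rule card_mono) auto
  then show ?thesis by (simp add: n_def)
 qed
 have c: "path_closure (%p. real (n p))" using closure_count[OF A] unfolding n .
 show ?thesis
 proof (cases "k <= N")
  case False
  then have "\<not> n p = k" for p using le[of p] by simp
  then show ?thesis using M.bc_const[of 0] by (simp add: M.bc_pred_def n_def)
 next
  case True
  have "path_closure (%p. PROD l:{..N} - {k}. inverse (real k - real l) * (real (n p) - real l))"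
   by (intro M.bc_prod bounded_closure.scale M.bc_diff c M.bc_const)
  moreover have "(PROD l:{..N} - {k}. inverse (real k - real l) * (real (n p) - real l)) = of_bool (n p = k)" for p
  using le by simp
  ultimately show ?thesis unfolding M.bc_pred_def n_def by simp
 qed
qed

lemma closure_config_basic:
 assumes A: "A : sets borel"
 shows "M.bc_pred (%p. emeasure (point_config N (%j. p j s)) A : U)"
proof -
 have "M.bc_pred (%p. EX k::nat. of_nat k : U & card {j. j < N & p j s : A} = k)"
 proof (rule M.bc_pred_ex)
  fix k :: nat
  show "M.bc_pred (%p. of_nat k : U & card {j. j < N & p j s : A} = k)"
  proof (cases "of_nat k : U")
   case True
   then show ?thesis using closure_count_eq[OF A, of k] by simp
  next
   case False
   then show ?thesis using M.bc_const[of 0] by (simp add: M.bc_pred_def)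
  qed
 qed
 then show ?thesis unfolding emeasure_point_config[OF A] by simp
qed

lemma closure_config_space:
 assumes "C : sets config_space"
 shows "M.bc_pred (%p. point_config N (%j. p j s) : C)"
proof -
 let ?E = "{(%\<mu>. emeasure \<mu> A) -` U \<inter> configurations | A U. A : sets borel & U : sets borel}"
 have C: "C : sigma_sets configurations ?E"
  using assms unfolding config_space_def by (subst (asm) sets_measure_of) auto
 show ?thesis
 using closure_config_basic by (auto simp: point_config_in_configurations intro!: M.bc_pred_sigma_sets[OF C])
qed

end

lemma sets_config_filtration:
 "sets (config_filtration t) = sigma_sets config_paths
   {(%\<Xi>. \<Xi> s) -` A \<inter> config_paths | s A. 0 <= s & s <= t & A : sets config_space}"
 unfolding config_filtration_def natural_filtration_def by (rule sets_measure_of) auto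

lemma space_config_filtration: "space (config_filtration t) = config_paths"
 unfolding config_filtration_def natural_filtration_def by (rule space_measure_of) auto

text \<open>The preimage of a generating event of the filtration is decided by the configuration at
  one time \<open>s <= T\<close>; sigma-algebra operations and simple functions do the rest.\<close>

theorem closure_path_functional:
 assumes t: "t <= T" and F: "F : bmeas (config_filtration t)" "bounded (F ` config_paths)"
 shows "path_closure (%p. F (%s. point_config N (%j. p j s)))"
proof -
 let ?A = "%p. %s. point_config N (%j. p j s)"
 have path: "(?A p) : config_paths" for p
  unfolding config_paths_def using point_config_in_configurations by blast
 obtain K where K: "ALL x:config_paths. (abs (F x)) <= K" using F(2) unfolding bounded_iff by auto
 show ?thesis
 proof (rule M.bc_measurable_function[OF _ F(1), where h = "%p s. point_config N (%j. p j s)" and K = K])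
  fix A assume "A : sets (config_filtration t)"
  then show "M.bc_pred (%p. (?A p) : A)"
   unfolding sets_config_filtration
  proof (rule M.bc_pred_sigma_sets)
   fix a assume "a : {(%\<Xi>. \<Xi> s) -` A \<inter> config_paths | s A. 0 <= s & s <= t & A : sets config_space}"
   then obtain s C where a: "a = (%\<Xi>. \<Xi> s) -` C \<inter> config_paths" "0 <= s" "s <= t" "C : sets config_space" by blast
   have "s <= T" using a(3) t by simp
   from closure_config_space[OF a(2) this a(4)] show "M.bc_pred (%p. (?A p) : a)"
    unfolding a(1) using path by simp
  qed (rule path)
 next
  show "(?A p) : space (config_filtration t)" for p
   unfolding space_config_filtration by (rule path)
  show "abs (F x) <= K" if "x : space (config_filtration t)" for x
   using K that unfolding space_config_filtration by blast
 qed
qed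

end

section \<open>Hermite polynomials and Gaussian averages\<close>

text \<open>The monic Hermite polynomials of variance \<open>T\<close>; \<open>hermite T r\<close>
  at \<open>x\<close> is the mean of \<open>(x + i W) ^ r\<close> for a centred Gaussian
  \<open>W\<close> of variance \<open>T\<close>.\<close>

fun hermite :: "real => nat => real poly" where
 "hermite T 0 = 1"
| "hermite T (Suc 0) = [:0, 1:]"
| "hermite T (Suc (Suc r)) = pCons 0 (hermite T (Suc r)) - smult (real (Suc r) * T) (hermite T r)"

lemma pderiv_hermite: "pderiv (hermite T (Suc r)) = smult (real (Suc r)) (hermite T r)"
proof (induction T r rule: hermite.induct)
 case (3 T r)
 have "pderiv (hermite T (Suc (Suc (Suc r)))) =
   hermite T (Suc (Suc r)) + pCons 0 (pderiv (hermite T (Suc (Suc r)))) - smult (real (Suc (Suc r)) * T) (pderiv (hermite T (Suc r)))"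
  by (simp only: hermite.simps(3)[of T "Suc r"] pderiv_diff pderiv_pCons pderiv_smult)
 also have "... = hermite T (Suc (Suc r)) + smult (real (Suc (Suc r))) (pCons 0 (hermite T (Suc r))
   - smult (real (Suc r) * T) (hermite T r))"
  unfolding 3 by (simp add: smult_diff_right del: of_nat_Suc) (simp add: mult.commute mult.left_commute del: of_nat_Suc)
 also have "... = smult (1 + real (Suc (Suc r))) (hermite T (Suc (Suc r)))"
  by (simp only: hermite.simps(3)[symmetric] smult_add_left smult_1_left)
 finally show ?case by simp
qed (simp_all add: pderiv_pCons)

lemma hermite_derivative:
 "T * poly (pderiv (hermite T r)) x = x * poly (hermite T r) x - poly (hermite T (Suc r)) x"
 by (cases r) (simp_all add: pderiv_hermite del: of_nat_Suc)

lemma hermite_parity: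
 "EX E D. degree E = l & lead_coeff E = 1 & degree D = l & lead_coeff D = 1 &
   (ALL x. poly (hermite T (2 * l)) x = poly E (x^2)) &
   (ALL x. poly (hermite T (Suc (2 * l))) x = x * poly D (x^2))"
proof (induction l)
 case 0
 show ?case by (intro exI[of _ 1]) simp
next
 case (Suc l)
 then obtain E D where E: "degree E = l" "lead_coeff E = 1" and D: "degree D = l" "lead_coeff D = 1"
  and eE: "!!x. poly (hermite T (2 * l)) x = poly E (x^2)"
  and eD: "!!x. poly (hermite T (Suc (2 * l))) x = x * poly D (x^2)" by blast
 define E' where "E' = pCons 0 D - smult (real (Suc (2 * l)) * T) E"
 define D' where "D' = E' - smult (real (Suc (Suc (2 * l))) * T) D"
 have D0: "D ~= 0" using D(2) by auto
 have top: "degree (p - q) = degree p & lead_coeff (p - q) = lead_coeff p" if "degree q < degree p" for p q :: "real poly"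
 proof -
  have "degree (p - q) = degree p" using degree_add_eq_left[of "- q" p] that by simp
  then show ?thesis using that by (simp add: coeff_eq_0)
 qed
 have s: "degree (smult c E) < Suc l" "degree (smult c D) < Suc l" for c
  using degree_smult_le[of c E] degree_smult_le[of c D] E(1) D(1) by linarith+
 have pD: "degree (pCons 0 D) = Suc l" "lead_coeff (pCons 0 D) = 1" using D D0 by simp_all
 have dE: "degree E' = Suc l" "lead_coeff E' = 1"
 proof -
  have "degree (smult (real (Suc (2 * l)) * T) E) < degree (pCons 0 D)" unfolding pD(1) by (rule s(1))
  note e = top[OF this, folded E'_def]
  show "degree E' = Suc l" by (rule trans[OF conjunct1[OF e] pD(1)])
  show "lead_coeff E' = 1" by (rule trans[OF conjunct2[OF e] pD(2)])
 qed
 have dD: "degree D' = Suc l" "lead_coeff D' = 1"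
 proof -
  have "degree (smult (real (Suc (Suc (2 * l))) * T) D) < degree E'" unfolding dE(1) by (rule s(2))
  note e = top[OF this, folded D'_def]
  show "degree D' = Suc l" by (rule trans[OF conjunct1[OF e] dE(1)])
  show "lead_coeff D' = 1" by (rule trans[OF conjunct2[OF e] dE(2)])
 qed
 have h2: "poly (hermite T (2 * Suc l)) x = poly E' (x^2)" for x
 proof -
  have "2 * Suc l = Suc (Suc (2 * l))" by simp
  then show ?thesis
   by (simp only: hermite.simps(3) poly_diff poly_pCons poly_smult eE eD E'_def) (simp add: power2_eq_square)
 qed
 have h3: "poly (hermite T (Suc (2 * Suc l))) x = x * poly D' (x^2)" for x
 proof -
  have e: "2 * Suc l = Suc (Suc (2 * l))" by simp
  have "poly (hermite T (Suc (2 * Suc l))) x = x * poly (hermite T (2 * Suc l)) x - real (Suc (Suc (2 * l))) * T * poly (hermite T (Suc (2 * l))) x"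
   unfolding e hermite.simps(3)[of T "Suc (2 * l)"] by simp
  then show ?thesis unfolding h2 eD D'_def by (simp add: algebra_simps)
 qed
 show ?case using dE dD h2 h3 by blast
qed

text \<open>Up to powers of 2 these are the coefficients of the reverse Bessel polynomials. The
  value 0 for \<open>k > n\<close> lets the recursion below include
  \<open>k = Suc n\<close>.\<close>

definition weight_coeff :: "nat => nat => real" where
 "weight_coeff n k = (if k <= n then fact (2 * n - k) / (fact (n - k) * fact k) else 0)"

text \<open>Among the possible recursions, this one has a factor affine in \<open>k\<close>; on
  \<open>x ^ k\<close> such a factor is a first-order differential operator, which is exploited in
  \<open>weight_sum_Suc\<close>.\<close>

lemma weight_coeff_Suc:
 assumes "k <= Suc n"
 shows "weight_coeff (Suc n) k = 2 * (real (2 * n + 1) - real k) * weight_coeff n k + (if k = 0 then 0 else weight_coeff n (k - 1))"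
proof (cases "k = Suc n")
 case True
 then show ?thesis by (simp add: weight_coeff_def fact_Suc del: of_nat_Suc)
next
 case False
 then obtain d where n: "n = k + d" using assms by (metis le_SucE le_Suc_ex)
 show ?thesis
 proof (cases k)
  case 0
  have "2 * Suc n = Suc (Suc (2 * n))" by simp
  then show ?thesis using 0
   by (simp add: weight_coeff_def fact_Suc field_simps del: of_nat_Suc mult_Suc_right) (simp add: field_simps)
 next
  case (Suc k')
  have a: "2 * Suc n - k = Suc (Suc (k + 2 * d))" "2 * n - k = k + 2 * d" "2 * n - (k - 1) = Suc (k + 2 * d)"
   "Suc n - k = Suc d" "n - k = d" "n - (k - 1) = Suc d" "2 * n + 1 = Suc (2 * k + 2 * d)"
   using n Suc by simp_all
  define f where "f = (fact (k + 2 * d) :: real)"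
  define g where "g = (fact d :: real)"
  define k1 where "k1 = (fact k' :: real)"
  have nz: "g ~= 0" "k1 ~= 0" "real d + 1 ~= 0" "real k' + 1 ~= 0" by (simp_all add: g_def k1_def)
  have fk: "fact k = (real k' + 1) * k1" "fact (k - 1) = k1" using Suc by (simp_all add: k1_def)
  have kn: "k <= Suc n" "k <= n" "k - 1 <= n" using n by simp_all
  have L: "weight_coeff (Suc n) k = real (Suc (Suc (k + 2 * d))) * (real (Suc (k + 2 * d)) * f) / ((real (Suc d) * g) * ((real k' + 1) * k1))"
   by (simp only: weight_coeff_def kn if_True a fk fact_Suc f_def g_def)
  have R: "weight_coeff n k = f / (g * ((real k' + 1) * k1))" "weight_coeff n (k - 1) = (real (Suc (k + 2 * d)) * f) / ((real (Suc d) * g) * k1)"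
   by (simp_all only: weight_coeff_def kn if_True a fk fact_Suc f_def g_def)
  have k: "real k = real k' + 1" using Suc by simp
  have "real (2 * n + 1) - real k = real k + 2 * real d + 1" using n by simp
  then show ?thesis unfolding L R k using nz Suc by (simp add: divide_simps) (simp add: algebra_simps)
 qed
qed

text \<open>For \<open>s = 2 * l + 1\<close> this is \<open>x ^ (2 * n + 1)\<close> times the
  Gaussian mean of \<open>Q(Z) * Z ^ (2 * l)\<close> at \<open>Re Z = x\<close>, with the power of
  \<open>Z\<close> replaced by its mean, a Hermite polynomial.\<close>

definition weight_sum :: "real => nat => nat => real => real" where
 "weight_sum T n s x = (SUM k<=n. weight_coeff n k * (T / 2) ^ (n - k) * x ^ k * poly (hermite T (k + s)) x)"

text \<open>Raising \<open>n\<close> amounts to the operator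
  \<open>T * (2 * n + 1) + x^2 - T * x * d/dx\<close>: the factor \<open>k\<close> of the
  coefficient recursion comes from differentiating \<open>x ^ k\<close>, and the raised Hermite
  index from \<open>hermite_derivative\<close>.\<close>

lemma weight_sum_Suc:
 assumes D: "(weight_sum T n s has_real_derivative D) (at x)"
 shows "weight_sum T (Suc n) s x = T * real (2 * n + 1) * weight_sum T n s x + x^2 * weight_sum T n s x - T * x * D"
proof -
 define c where "c = (%k. weight_coeff n k * (T / 2) ^ (n - k))"
 define h where "h = (%k. poly (hermite T (k + s)) x)"
 have ws: "weight_sum T n s = (%x. SUM k<=n. c k * (x ^ k * poly (hermite T (k + s)) x))"
  by (simp add: weight_sum_def c_def fun_eq_iff mult.assoc)
 have "(weight_sum T n s has_real_derivative (SUM k<=n. c k * (real k * x ^ (k - 1) * h k + x ^ k * poly (pderiv (hermite T (k + s))) x))) (at x)"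
  unfolding ws h_def
  by (auto intro!: derivative_eq_intros poly_DERIV sum.cong simp: algebra_simps)
 from DERIV_unique[OF D this]
 have TD: "T * x * D = (SUM k<=n. c k * (T * real k * x ^ k * h k + x ^ Suc k * (x * h k - h (Suc k))))"
  unfolding sum_distrib_left
 proof (simp only: sum_distrib_left, intro sum.cong refl)
  fix k
  define A where "A = real k * x ^ (k - 1)"
  define E where "E = poly (pderiv (hermite T (k + s))) x"
  have 1: "T * E = x * h k - h (Suc k)"
   using hermite_derivative[of T "k + s" x] by (simp add: h_def E_def)
  have 2: "x * A = real k * x ^ k" unfolding A_def by (cases k) simp_all
  have "T * x * (c k * (A * h k + x ^ k * E)) = c k * (T * (x * A) * h k + x ^ Suc k * (T * E))"
   by (simp add: algebra_simps)
  then show "T * x * (c k * (real k * x ^ (k - 1) * h k + x ^ k * poly (pderiv (hermite T (k + s))) x)) =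
   c k * (T * real k * x ^ k * h k + x ^ Suc k * (x * h k - h (Suc k)))"
   unfolding 1 2 unfolding A_def E_def by (simp add: mult.assoc)
 qed
 have "weight_sum T (Suc n) s x = (SUM k<=Suc n. (2 * (real (2 * n + 1) - real k) * weight_coeff n k) * ((T / 2) ^ (Suc n - k) * x ^ k * h k))
   + (SUM k<=Suc n. (if k = 0 then 0 else weight_coeff n (k - 1)) * ((T / 2) ^ (Suc n - k) * x ^ k * h k))"
  unfolding weight_sum_def sum.distrib[symmetric]
  by (intro sum.cong refl) (simp add: weight_coeff_Suc h_def algebra_simps del: of_nat_Suc)
 also have "(SUM k<=Suc n. (2 * (real (2 * n + 1) - real k) * weight_coeff n k) * ((T / 2) ^ (Suc n - k) * x ^ k * h k)) =
   (SUM k<=n. c k * (T * (real (2 * n + 1) - real k) * x ^ k * h k))"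
 proof -
  have "weight_coeff n (Suc n) = 0" by (simp add: weight_coeff_def)
  then show ?thesis
   unfolding sum.atMost_Suc by (auto intro!: sum.cong simp: c_def Suc_diff_le)
 qed
 also have "(SUM k<=Suc n. (if k = 0 then 0 else weight_coeff n (k - 1)) * ((T / 2) ^ (Suc n - k) * x ^ k * h k)) =
   (SUM k<=n. c k * (x ^ Suc k * h (Suc k)))"
  unfolding sum.atMost_Suc_shift by (simp add: c_def mult_ac)
 finally have "weight_sum T (Suc n) s x = (SUM k<=n. c k * (T * (real (2 * n + 1) - real k) * x ^ k * h k) + c k * (x ^ Suc k * h (Suc k)))"
  by (simp only: sum.distrib)
 moreover have "T * real (2 * n + 1) * weight_sum T n s x + x^2 * weight_sum T n s x - T * x * D =
   (SUM k<=n. c k * (T * (real (2 * n + 1) - real k) * x ^ k * h k) + c k * (x ^ Suc k * h (Suc k)))"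
 proof -
  have w: "weight_sum T n s x = (SUM k<=n. c k * (x ^ k * h k))" unfolding ws h_def ..
  show ?thesis
   unfolding TD w sum_distrib_left sum.distrib[symmetric] sum_subtractf[symmetric]
   by (intro sum.cong refl) (simp add: algebra_simps power2_eq_square)
 qed
 ultimately show ?thesis by simp
qed

text \<open>On \<open>x ^ (2 * n + 1) * p (x^2)\<close> the operator of
  \<open>weight_sum_Suc\<close> cancels the terms in \<open>T * (2 * n + 1)\<close> and leaves
  \<open>x ^ (2 * n + 3)\<close> times \<open>p - 2 * T * p'\<close> at \<open>x^2\<close>. Thus the
  negative power of \<open>Re z\<close> in \<open>Q\<close> is compensated exactly, and
  \<open>p\<close> stays monic of degree \<open>l\<close>.\<close>

lemma weight_sum_polynomial:
 "EX p. degree p = l & lead_coeff p = 1 & (ALL x. weight_sum T n (Suc (2 * l)) x = x ^ (2 * n + 1) * poly p (x^2))"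
proof (induction n)
 case 0
 obtain D where "degree D = l" "lead_coeff D = 1" "ALL x. poly (hermite T (Suc (2 * l))) x = x * poly D (x^2)"
  using hermite_parity[of l T] by blast
 then show ?case by (intro exI[of _ D]) (simp add: weight_sum_def weight_coeff_def)
next
 case (Suc n)
 then obtain p where p: "degree p = l" "lead_coeff p = 1"
  "!!x. weight_sum T n (Suc (2 * l)) x = x ^ (2 * n + 1) * poly p (x^2)" by blast
 define p' where "p' = p - smult (2 * T) (pderiv p)"
 have "degree p' = l & lead_coeff p' = 1"
 proof (cases "l = 0")
  case True
  then have "pderiv p = 0" using p(1) pderiv_eq_0_iff by blast
  then show ?thesis using p True by (simp add: p'_def)
 next
  case False
  have lt: "degree (smult (2 * T) (pderiv p)) < degree p"
  proof -
   have "degree (smult (2 * T) (pderiv p)) <= degree (pderiv p)" by (rule degree_smult_le)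
   also have "... = degree p - 1" by (rule degree_pderiv)
   finally show ?thesis using False p(1) by simp
  qed
  then have "degree p' = degree p" unfolding p'_def using degree_add_eq_left[of "- smult (2 * T) (pderiv p)" p] by simp
  moreover have "coeff (smult (2 * T) (pderiv p)) (degree p) = 0" using lt by (rule coeff_eq_0)
  ultimately show ?thesis using p by (simp add: p'_def)
 qed
 moreover have "weight_sum T (Suc n) (Suc (2 * l)) x = x ^ (2 * Suc n + 1) * poly p' (x^2)" for x
 proof -
  have f: "weight_sum T n (Suc (2 * l)) = (%x. x ^ (2 * n + 1) * poly p (x^2))" using p(3) by (rule ext)
  have "((%x. x ^ (2 * n + 1) * poly p (x^2)) has_real_derivative
    real (2 * n + 1) * x ^ (2 * n) * poly p (x^2) + x ^ (2 * n + 1) * (poly (pderiv p) (x^2) * (2 * x))) (at x)"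
  proof -
   have "((%x. x ^ (2 * n + 1)) has_real_derivative real (2 * n + 1) * x ^ (2 * n)) (at x)"
    using DERIV_pow[of "2 * n + 1" x] by simp
   moreover have "((%x. poly p (x^2)) has_real_derivative poly (pderiv p) (x^2) * (2 * x)) (at x)"
    by (rule DERIV_chain2[OF poly_DERIV]) (auto intro!: derivative_eq_intros)
   ultimately show ?thesis by (rule DERIV_cong[OF DERIV_mult]) (simp only: mult.commute)
  qed
  then have "(weight_sum T n (Suc (2 * l)) has_real_derivative
    real (2 * n + 1) * x ^ (2 * n) * poly p (x^2) + x ^ (2 * n + 1) * (poly (pderiv p) (x^2) * (2 * x))) (at x)"
   unfolding f .
  from weight_sum_Suc[OF this] show ?thesis
   unfolding p(3) p'_def by (simp add: algebra_simps power2_eq_square)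
 qed
 ultimately show ?case by blast
qed

definition gauss_moment :: "real => nat => real" where
 "gauss_moment T m = (if even m then fact m / ((2 / T) ^ (m div 2) * fact (m div 2)) else 0)"

lemma gauss_moment_0 [simp]: "gauss_moment T 0 = 1"
 by (simp add: gauss_moment_def)

lemma gauss_moment_1 [simp]: "gauss_moment T (Suc 0) = 0"
 by (simp add: gauss_moment_def)

lemma gauss_moment_Suc:
 assumes "T > 0" shows "gauss_moment T (Suc (Suc m)) = real (Suc m) * T * gauss_moment T m"
proof (cases "even m")
 case True
 then obtain k where m: "m = 2 * k" by (elim evenE)
 define c where "c = (2 / T) ^ k * fact k"
 have c: "c ~= 0" using assms by (simp add: c_def)
 have "gauss_moment T (Suc (Suc m)) = real (Suc (Suc m)) * (real (Suc m) * fact m) / ((2 / T) * real (Suc k) * c)"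
  unfolding gauss_moment_def using True by (simp add: m c_def fact_Suc del: of_nat_Suc)
 also have "... = real (Suc m) * T * (fact m / c)"
 proof -
  have "(2 * s) * (a * f) / ((2 / T) * s * c) = a * T * (f / c)" if "s ~= 0" for s a f :: real
   using assms c that by (simp add: field_simps)
  moreover have "real (Suc (Suc m)) = 2 * real (Suc k)" by (simp add: m)
  ultimately show ?thesis by (simp only:)
 qed
 finally show ?thesis using True by (simp add: gauss_moment_def m c_def)
qed (simp add: gauss_moment_def)

text \<open>The binomial expansion of the mean of \<open>(x + i W) ^ r\<close>. Pascal's rule splits
  off one factor, and the moment recursion, in effect Gaussian integration by parts, turns the
  shifted sum into \<open>- T * r\<close> times the sum of order \<open>r - 1\<close>: the Hermite
  recursion.\<close>

lemma hermite_gauss_expansion: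
 fixes x T :: real
 assumes T: "T > 0"
 shows "(SUM m<=r. of_nat (r choose m) * of_real x ^ (r - m) * (\<i> ^ m * of_real (gauss_moment T m))) =
  cr (poly (hermite T r) x)"
proof -
 define c where "c = (%m. \<i> ^ m * cr (gauss_moment T m))"
 define S where "S = (%c r. SUM m<=r. of_nat (r choose m) * cr x ^ (r - m) * (c m :: complex))"
 have pascal: "S c (Suc r) = of_real x * S c r + S (%m. c (Suc m)) r" for c r
 proof -
  have "S c (Suc r) = of_real x ^ Suc r * c 0 + (SUM m<=r. of_nat (r choose m) * of_real x ^ (r - m) * c (Suc m)
    + of_nat (r choose Suc m) * of_real x ^ (r - m) * c (Suc m))"
   unfolding S_def sum.atMost_Suc_shift by (simp add: distrib_right)
  also have "... = S (%m. c (Suc m)) r + (of_real x ^ Suc r * c 0 + (SUM m<=r. of_nat (r choose Suc m) * of_real x ^ (r - m) * c (Suc m)))"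
   unfolding sum.distrib S_def by simp
  also have "of_real x ^ Suc r * c 0 + (SUM m<=r. of_nat (r choose Suc m) * of_real x ^ (r - m) * c (Suc m)) =
    (SUM m<=Suc r. of_nat (r choose m) * of_real x ^ (Suc r - m) * c m)"
   unfolding sum.atMost_Suc_shift by simp
  also have "... = of_real x * S c r"
   unfolding S_def sum_distrib_left sum.atMost_Suc
   by (auto intro!: sum.cong simp: Suc_diff_le binomial_eq_0 mult_ac)
  finally show ?thesis by simp
 qed
 have cSS: "c (Suc (Suc m)) = - of_real T * of_nat (Suc m) * c m" for m
  unfolding c_def gauss_moment_Suc[OF T] by (simp add: mult_ac)
 have c1: "c (Suc 0) = 0" by (simp add: c_def)
 have shift: "S (%m. c (Suc m)) (Suc r) = - of_real T * of_nat (Suc r) * S c r" for r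
 proof -
  have "S (%m. c (Suc m)) (Suc r) = (SUM m<=r. of_nat (Suc r choose Suc m) * of_real x ^ (r - m) * c (Suc (Suc m)))"
   unfolding S_def sum.atMost_Suc_shift c1 by simp
  also have "... = (SUM m<=r. - of_real T * of_nat (Suc r) * (of_nat (r choose m) * of_real x ^ (r - m) * c m))"
  proof (rule sum.cong[OF refl])
   fix m
   have "complex_of_nat (Suc m * (Suc r choose Suc m)) = of_nat (Suc r * (r choose m))"
    unfolding Suc_times_binomial ..
   then have "of_nat (Suc m) * complex_of_nat (Suc r choose Suc m) = of_nat (Suc r) * of_nat (r choose m)"
    by (simp only: of_nat_mult)
   moreover have "of_nat (Suc r choose Suc m) * of_real x ^ (r - m) * (- of_real T * of_nat (Suc m) * c m) =
     - of_real T * (of_nat (Suc m) * of_nat (Suc r choose Suc m)) * of_real x ^ (r - m) * c m"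
    by (simp only: mult_ac)
   ultimately show "of_nat (Suc r choose Suc m) * of_real x ^ (r - m) * c (Suc (Suc m)) =
     - of_real T * of_nat (Suc r) * (of_nat (r choose m) * of_real x ^ (r - m) * c m)"
    unfolding cSS by (simp only: mult_ac)
  qed
  finally show ?thesis unfolding S_def sum_distrib_left .
 qed
 have "S c r = of_real (poly (hermite T r) x) & S c (Suc r) = of_real (poly (hermite T (Suc r)) x)"
 proof (induction r)
  case 0
  show ?case by (simp add: S_def c_def)
 next
  case (Suc r)
  have "S c (Suc (Suc r)) = of_real (poly (hermite T (Suc (Suc r))) x)"
   unfolding pascal[of c "Suc r"] shift using Suc by (simp del: of_nat_Suc)
  then show ?case using Suc by simp
 qed
 then have "S c r = of_real (poly (hermite T r) x)" ..
 then show ?thesis unfolding S_def c_def .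
qed

text \<open>\<open>k\<close> runs over the sum in \<open>Q\<close>, and \<open>m\<close> is the
  power of the imaginary part in the binomial expansion of
  \<open>z ^ (k + 2 * l + 1)\<close>.\<close>

definition weight_index :: "nat => nat => (nat \<times> nat) set" where
 "weight_index n l = (SIGMA k:{..n}. {..k + Suc (2 * l)})"

definition weight_const :: "nat => real => nat => nat \<times> nat => complex" where
 "weight_const n T l = (%(k, m). of_real (weight_coeff n k * (T / 2) ^ (n - k)) * of_nat ((k + Suc (2 * l)) choose m) * \<i> ^ m)"

definition weight_power :: "nat => nat => nat \<times> nat => real => real" where
 "weight_power n l = (%(k, m) x. x ^ (k + (k + Suc (2 * l) - m)) / x ^ (2 * n + 1))"

lemma finite_weight_index [simp]: "finite (weight_index n l)"
 by (simp add: weight_index_def)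

text \<open>At \<open>x = 0\<close> both sides vanish because division by 0 gives 0.\<close>

lemma Q_weight_expansion:
 assumes T: "T > 0" and z: "z = of_real x + \<i> * of_real w"
 shows "Q_weight n T z * z ^ (2 * l) =
  (SUM i:weight_index n l. weight_const n T l i * of_real (weight_power n l i x) * of_real (w ^ snd i))"
proof -
 have re: "Re z = x" by (simp add: z)
 let ?A = "%n k. weight_coeff n k * (T / 2) ^ (n - k)"
 have "Q_weight n T z * z ^ (2 * l) = (SUM k<=n. of_real (?A n k) *
   of_real (x ^ k / x ^ (2 * n + 1)) * z ^ (k + Suc (2 * l)))"
  unfolding Q_weight_def re sum_distrib_left sum_distrib_right atLeast0AtMost
 proof (rule sum.cong[OF refl])
  fix k assume "k : {..n}"
  then have k: "k <= n" by simp
  have "(T / 2) ^ n = (T / 2) ^ (n - k) * (T / 2) ^ k" using k by (simp add: power_add[symmetric])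
  then have "(T / 2) ^ n * (2 / T) ^ k = (T / 2) ^ (n - k)" using T by (simp add: power_divide)
  then have 1: "cr ((T / 2) ^ n) * of_real ((2 / T) ^ k) = of_real ((T / 2) ^ (n - k))"
   by (metis of_real_mult)
  have 2: "(2 * cr x * z / of_real T) ^ k = of_real ((2 / T) ^ k) * of_real (x ^ k) * z ^ k"
   by (simp add: power_mult_distrib power_divide)
  have 3: "(fact (2 * n - k) / (fact (n - k) * fact k) :: complex) = of_real (weight_coeff n k)"
   using k by (simp add: weight_coeff_def)
  have "of_real ((T / 2) ^ n) * (z / of_real (x ^ (2 * n + 1))) * (of_real (weight_coeff n k) * (of_real ((2 / T) ^ k) * of_real (x ^ k) * z ^ k)) * z ^ (2 * l) =
   of_real (weight_coeff n k) * (of_real ((T / 2) ^ n) * of_real ((2 / T) ^ k)) * (of_real (x ^ k) / of_real (x ^ (2 * n + 1))) * (z * z ^ k * z ^ (2 * l))"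
   by (simp add: mult_ac)
  also have "z * z ^ k * z ^ (2 * l) = z ^ (k + Suc (2 * l))" by (simp add: power_add mult_ac)
  finally show "of_real ((T / 2) ^ n) * (z / of_real (x ^ (2 * n + 1))) *
   (fact (2 * n - k) / (fact (n - k) * fact k) * (2 * of_real x * z / of_real T) ^ k) * z ^ (2 * l) =
   of_real (?A n k) * of_real (x ^ k / x ^ (2 * n + 1)) * z ^ (k + Suc (2 * l))"
   unfolding 1 2 3 by simp
 qed
 also have "... = (SUM k<=n. SUM m<=k + Suc (2 * l). weight_const n T l (k, m) * of_real (weight_power n l (k, m) x) * of_real (w ^ snd (k, m)))"
 proof (rule sum.cong[OF refl])
  fix k
  let ?r = "k + Suc (2 * l)"
  have zr: "z ^ ?r = (SUM m<=?r. of_nat (?r choose m) * (\<i> * of_real w) ^ m * of_real x ^ (?r - m))"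
   unfolding z add.commute[of "of_real x"] by (rule binomial_ring)
  show "of_real (?A n k) * of_real (x ^ k / x ^ (2 * n + 1)) * z ^ ?r =
   (SUM m<=?r. weight_const n T l (k, m) * of_real (weight_power n l (k, m) x) * of_real (w ^ snd (k, m)))"
   unfolding zr sum_distrib_left
   by (rule sum.cong[OF refl]) (simp add: weight_const_def weight_power_def power_mult_distrib power_add mult_ac)
 qed
 also have "... = (SUM i:weight_index n l. weight_const n T l i * of_real (weight_power n l i x) * of_real (w ^ snd i))"
  unfolding weight_index_def by (subst sum.Sigma) (auto simp: case_prod_unfold)
 finally show ?thesis .
qed

lemma weight_gauss_expectation:
 assumes T: "T > 0" and x: "x ~= 0"
 shows "(SUM i:weight_index n l. weight_const n T l i * of_real (weight_power n l i x) * of_real (gauss_moment T (snd i))) =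
  cr (weight_sum T n (Suc (2 * l)) x / x ^ (2 * n + 1))"
proof -
 have "(SUM i:weight_index n l. weight_const n T l i * of_real (weight_power n l i x) * of_real (gauss_moment T (snd i))) =
  (SUM k<=n. SUM m<=k + Suc (2 * l). weight_const n T l (k, m) * of_real (weight_power n l (k, m) x) * of_real (gauss_moment T (snd (k, m))))"
  unfolding weight_index_def by (subst sum.Sigma) (auto simp: case_prod_unfold)
 also have "... = (SUM k<=n. of_real (weight_coeff n k * (T / 2) ^ (n - k) * x ^ k / x ^ (2 * n + 1)) * of_real (poly (hermite T (k + Suc (2 * l))) x))"
 proof (rule sum.cong[OF refl])
  fix k
  let ?r = "k + Suc (2 * l)"
  show "(SUM m<=?r. weight_const n T l (k, m) * of_real (weight_power n l (k, m) x) * of_real (gauss_moment T (snd (k, m)))) =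
   of_real (weight_coeff n k * (T / 2) ^ (n - k) * x ^ k / x ^ (2 * n + 1)) * of_real (poly (hermite T ?r) x)"
   unfolding hermite_gauss_expansion[OF T, symmetric] sum_distrib_left
   by (rule sum.cong[OF refl]) (simp add: weight_const_def weight_power_def power_add mult_ac)
 qed
 also have "... = of_real (weight_sum T n (Suc (2 * l)) x / x ^ (2 * n + 1))"
  unfolding weight_sum_def sum_divide_distrib by simp
 finally show ?thesis .
qed

text \<open>For \<open>x < 1\<close> the index \<open>k\<close> is that of the dyadic shell
  \<open>2 ^ - (k + 1) < x <= 2 ^ - k\<close>, where \<open>4 ^ k * x^2 <= 1\<close> makes the
  Gaussian at least \<open>1 / e\<close>. Negative powers are thus controlled by Gaussians, whose
  means are Laplace transforms.\<close>

lemma inverse_power_dyadic_bound: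
 fixes x :: real
 assumes x: "x > 0"
 shows "EX k. 1 / x ^ m <= 1 + exp 1 * 2 ^ m * (2 ^ (k * m) * exp (- (4 ^ k) * x^2))"
proof (cases "x < 1")
 case False
 then have "1 / x ^ m <= 1" by (simp add: one_le_power)
 moreover have "0 <= exp 1 * 2 ^ m * (2 ^ (0 * m) * exp (- (4 ^ 0) * x^2))" by simp
 ultimately show ?thesis by (intro exI[of _ 0]) linarith
next
 case True
 define k where "k = (LEAST k. (1 / 2) ^ Suc k < x)"
 obtain k0 where "(1 / 2) ^ k0 < x" using real_arch_pow_inv[OF x, of "1 / 2"] by auto
 then have "(1 / 2) ^ Suc k0 < x" by (simp add: x) (use zero_less_power[of "1/2::real" k0] in linarith)
 then have k1: "(1 / 2) ^ Suc k < x" unfolding k_def by (rule LeastI)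
 have k2: "x <= (1 / 2) ^ k"
 proof (cases k)
  case (Suc k')
  have "\<not> (1 / 2) ^ Suc k' < x" by (rule not_less_Least) (use Suc in \<open>simp add: k_def\<close>)
  then show ?thesis using Suc by simp
 qed (use True in simp)
 have "x^2 <= ((1 / 2) ^ k)^2" using k2 x by (intro power_mono) auto
 also have "((1 / 2) ^ k)^2 = 1 / (4::real) ^ k"
  by (simp add: power_mult[symmetric] power_divide mult.commute[of k 2]) (simp add: power_mult)
 finally have "4 ^ k * x^2 <= 1" by (simp add: field_simps)
 then have "1 <= exp 1 * exp (- (4 ^ k) * x^2)" by (simp add: exp_add[symmetric])
 then have e: "2 ^ m * 2 ^ (k * m) * 1 <= 2 ^ m * 2 ^ (k * m) * (exp 1 * exp (- (4 ^ k) * x^2))"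
  by (intro mult_left_mono) auto
 have "1 / x <= 2 ^ Suc k" using k1 x by (simp add: field_simps power_divide)
 then have "(1 / x) ^ m <= (2 ^ Suc k) ^ m" using x by (intro power_mono) auto
 also have "(2 ^ Suc k) ^ m = 2 ^ m * (2 ^ (k * m) :: real)"
  by (simp add: power_mult[symmetric] power_add power_mult_distrib)
 finally have "1 / x ^ m <= 2 ^ m * 2 ^ (k * m)" by (simp add: power_divide)
 moreover have "2 ^ m * 2 ^ (k * m) * (exp 1 * exp (- (4 ^ k) * x^2)) = exp 1 * 2 ^ m * (2 ^ (k * m) * exp (- (4 ^ k) * x^2))"
  by (simp only: mult_ac)
 ultimately have "1 / x ^ m <= 1 + exp 1 * 2 ^ m * (2 ^ (k * m) * exp (- (4 ^ k) * x^2))"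
  using e by linarith
 then show ?thesis by blast
qed

text \<open>\<open>nu + 1 = n + 3/2\<close>, and the exponent of 2 is
  \<open>k * (2n + 1) - 2 * k * (n + 3/2) = - 2 * k\<close>; this gives the convergent ratio
  \<open>1 / 4\<close>.\<close>

lemma dyadic_powr: "2 ^ (k * (2 * n + 1)) * (4 ^ k) powr - (real n + 3 / 2) = (1 / 4 :: real) ^ k"
proof -
 have 4: "(4 :: real) ^ k = 2 powr (2 * real k)"
  using powr_realpow[of 2 "2 * k"] by (simp add: power_mult)
 have "real (k * (2 * n + 1)) = real k * (2 * real n + 1)" by (simp add: distrib_left)
 then have "2 ^ (k * (2 * n + 1)) = 2 powr (real k * (2 * real n + 1))"
  using powr_realpow[of 2 "k * (2 * n + 1)"] by simp
 then have "2 ^ (k * (2 * n + 1)) * (4 ^ k) powr - (real n + 3 / 2) =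
   2 powr (real k * (2 * real n + 1) + 2 * real k * - (real n + 3 / 2))"
  unfolding 4 powr_powr by (simp only: powr_add)
 also have "real k * (2 * real n + 1) + 2 * real k * - (real n + 3 / 2) = - (2 * real k)" by (simp add: algebra_simps)
 also have "2 powr (- (2 * real k)) = (1 / 4 :: real) ^ k" unfolding powr_minus 4[symmetric] by (simp add: power_divide field_simps)
 finally show ?thesis .
qed

context bes_family
begin

lemma laplace_bound:
 assumes c: "0 <= c" "lam > 0" and j: "j < N"
 shows "expectation (%w. exp (- lam * (Rt j c w)^2)) <= (1 + 2 * lam * c) powr - (nu + 1)"
proof -
 obtain \<F> B R where R: "besq_process P \<F> B R nu ((u j)^2)"
  "ALL t>=0. ALL w:space P. Rt j t w = sqrt (R t w) & R t w = (Rt j t w)^2"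
  using squared_process[OF j] by blast
 have "expectation (%w. exp (- lam * (Rt j c w)^2)) = expectation (%w. exp (- lam * R c w))"
 proof (rule integral_cong[OF refl])
  fix w assume "w : space P"
  then have "R c w = (Rt j c w)^2" using R(2) c(1) by blast
  then show "exp (- lam * (Rt j c w)^2) = exp (- lam * R c w)" by (simp only:)
 qed
 then show ?thesis using besq_process.laplace_bound[OF R(1) c] by simp
qed

lemma laplace_integrable:
 assumes "0 <= c" "lam >= 0" "j < N"
 shows "integrable P (%w. exp (- lam * (Rt j c w)^2))"
proof (rule integrable_const_bound[where B = 1])
 have [measurable]: "Rt j c : bmeas P" by (rule Rt_measurable[OF assms(3,1)])
 show "(%w. exp (- lam * (Rt j c w)^2)) : bmeas P" by measurable
 show "AE w in P. norm (exp (- lam * (Rt j c w)^2)) <= 1" using assms(2) by (intro AE_I2) simp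
qed

text \<open>The probability of the value 0 is at most every Laplace transform
  \<open>E[exp (- lam * R^2)]\<close>, and these tend to 0. This holds for a start at 0 as well,
  since the bound ignores the starting point.\<close>

lemma Rt_positive:
 assumes c: "0 < c" and j: "j < N"
 shows "AE w in P. 0 < Rt j c w"
proof -
 have [measurable]: "Rt j c : bmeas P" using Rt_measurable[OF j] c by simp
 let ?A = "{w:space P. Rt j c w = 0}"
 have A: "?A : sets P" by measurable
 have le: "prob ?A <= (1 + 2 * real (Suc k) * c) powr - (nu + 1)" for k
 proof -
  have "prob ?A = expectation (indicator ?A)" using A by simp
  also have "... <= expectation (%w. exp (- real (Suc k) * (Rt j c w)^2))"
   using laplace_integrable[of c "real (Suc k)" j] c j A
  using A by (fastforce simp: emeasure_eq_measure indicator_def intro: integral_mono integrable_real_indicator)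
  also have "... <= (1 + 2 * real (Suc k) * c) powr - (nu + 1)"
   using c j by (intro laplace_bound) auto
  finally show ?thesis .
 qed
 have "(%k. (1 + 2 * real (Suc k) * c) powr - (nu + 1)) ~> 0"
 proof (rule tendsto_neg_powr)
  show "- (nu + 1) < 0" using index by simp
  show "filterlim (%k. 1 + 2 * real (Suc k) * c) at_top sequentially" using c by real_asymp
 qed
 then have "prob ?A <= 0" by (rule LIMSEQ_le_const) (use le in blast)
 then have "prob ?A = 0" by (simp add: measure_le_0_iff)
 then have "AE w in P. w ~: ?A" using A by (intro AE_not_in) (simp add: null_sets_def emeasure_eq_measure)
 then show ?thesis
  using AE_space
 proof eventually_elim
  case (elim w)
  then have "Rt j c w ~= 0" by blast
  moreover have "0 <= Rt j c w" using Rt_nonneg[OF j _ elim(2)] c by simp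
  ultimately show ?case by simp
 qed
qed

text \<open>The dyadic Gaussian bound is summed over all shells. Each mean is at most a Laplace
  bound, and the resulting series is geometric by \<open>dyadic_powr\<close>.\<close>

lemma inverse_power_integrable:
 assumes nu: "nu = real n + 1 / 2" and c: "0 < c" and j: "j < N"
 shows "integrable P (%w. 1 / Rt j c w ^ (2 * n + 1))"
proof -
 define m where "m = 2 * n + 1"
 have Rm [measurable]: "Rt j c : bmeas P" using Rt_measurable[OF j] c by simp
 let ?B = "%k j c w. - (4 ^ k) * (Rt j c w)^2"
 define g where "g = (%k w. ennreal (2 ^ (k * m) * exp (?B k j c w)))"
 define C where "C = (2 * c) powr - (real n + 3 / 2)"
 define D where "D = exp 1 * 2 ^ m * (1 :: real)"
 have gm: "g k : bmeas P" for k unfolding g_def by measurable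
 have g_le: "(\<integral>\<^sup>+w. g k w \<partial>P) <= ennreal (C * (1 / 4) ^ k)" for k
 proof -
  have i: "integrable P (%w. 2 ^ (k * m) * exp (?B k j c w))"
   using laplace_integrable[of c "4 ^ k" j] c j by simp
  have "(\<integral>\<^sup>+w. g k w \<partial>P) = ennreal (expectation (%w. 2 ^ (k * m) * exp (?B k j c w)))"
   unfolding g_def by (rule nn_integral_eq_integral[OF i]) simp
  also have "expectation (%w. 2 ^ (k * m) * exp (?B k j c w)) = 2 ^ (k * m) * expectation (%w. exp (?B k j c w))"
   by (rule integral_mult_right_zero)
  also have "... <= 2 ^ (k * m) * (1 + 2 * 4 ^ k * c) powr - (nu + 1)"
   using c j by (intro mult_left_mono laplace_bound) auto
  also have "... <= 2 ^ (k * m) * ((2 * c) * 4 ^ k) powr - (nu + 1)"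
   using c index by (intro mult_left_mono powr_mono2') (auto simp: mult_ac)
  also have "... = C * (2 ^ (k * (2 * n + 1)) * (4 ^ k) powr - (real n + 3 / 2))"
  proof -
   have e: "- (nu + 1) = - (real n + 3 / 2)" by (simp add: nu)
   have "((2 * c) * 4 ^ k) powr - (real n + 3 / 2) = C * (4 ^ k) powr - (real n + 3 / 2)"
    using c by (simp add: powr_mult C_def)
   then show ?thesis unfolding e m_def by (simp only: mult.left_commute)
  qed
  also have "... = C * (1 / 4) ^ k" unfolding dyadic_powr ..
  finally show ?thesis by (simp add: ennreal_leI)
 qed
 let ?A = "\<integral>\<^sup>+w. (\<Sum>k. g k w) \<partial>P"
 have "?A = (\<Sum>k. \<integral>\<^sup>+w. g k w \<partial>P)" by (rule nn_integral_suminf[OF gm])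
 also have "... <= (\<Sum>k. ennreal (C * (1 / 4) ^ k))" by (rule suminf_le[OF g_le]) auto
 also have "... = ennreal (\<Sum>k. C * (1 / 4) ^ k)"
  by (rule suminf_ennreal2) (auto simp: C_def intro!: summable_mult summable_geometric)
 finally have sum_fin: "?A < \<infinity>" by (rule le_less_trans) simp
 have "AE w in P. ennreal (1 / Rt j c w ^ m) <= 1 + ennreal D * (\<Sum>k. g k w)"
  using Rt_positive[OF c j]
 proof eventually_elim
  case (elim w)
  obtain k where k: "1 / Rt j c w ^ m <= 1 + exp 1 * 2 ^ m * (2 ^ (k * m) * exp (?B k j c w))"
   using inverse_power_dyadic_bound[OF elim, of m] ..
  have "ennreal (1 / Rt j c w ^ m) <= ennreal (1 + D * (2 ^ (k * m) * exp (?B k j c w)))"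
   using k by (intro ennreal_leI) (simp add: D_def)
  also have "... = 1 + ennreal D * g k w"
   by (simp add: g_def D_def ennreal_mult'[symmetric])
  also have "... <= 1 + ennreal D * (\<Sum>k. g k w)"
   using sum_le_suminf[of "%k. g k w" "{k}"] by (intro add_left_mono mult_left_mono) auto
  finally show ?case .
 qed
 then have "(\<integral>\<^sup>+w. ennreal (1 / Rt j c w ^ m) \<partial>P) <= (\<integral>\<^sup>+w. 1 + ennreal D * (\<Sum>k. g k w) \<partial>P)"
  by (rule nn_integral_mono_AE)
 also have "... = 1 + ennreal D * ?A"
  using gm by (subst nn_integral_add) (auto simp: nn_integral_cmult emeasure_space_1)
 also have "... < \<infinity>" using sum_fin by (simp add: ennreal_mult_less_top)
 finally show ?thesis
  unfolding m_def using Rt_nonneg[OF j] c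
  by (intro integrableI_nonneg) (auto intro!: AE_I2)
qed

lemma weight_power_integrable:
 assumes nu: "nu = real n + 1 / 2" and c: "0 < c" and j: "j < N"
 shows "integrable P (%w. weight_power n l i (Rt j c w))"
proof -
 obtain k m where i: "i = (k, m)" by (cases i)
 define e where "e = k + (k + Suc (2 * l) - m)"
 have [measurable]: "Rt j c : bmeas P" using Rt_measurable[OF j] c by simp
 have "integrable P (%w. Rt j c w ^ e / Rt j c w ^ (2 * n + 1))"
 proof (rule integrable_bound)
  show "integrable P (%w. 1 / Rt j c w ^ (2 * n + 1) + ((Rt j c w)^2) ^ e)"
   using inverse_power_integrable[OF nu c j] moment_integrable[of c j e] c j by simp
  show "(%w. Rt j c w ^ e / Rt j c w ^ (2 * n + 1)) : bmeas P" by measurable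
  show "AE w in P. norm (Rt j c w ^ e / Rt j c w ^ (2 * n + 1)) <= norm (1 / Rt j c w ^ (2 * n + 1) + ((Rt j c w)^2) ^ e)"
  proof (rule AE_I2)
   fix w assume w: "w : space P"
   define x where "x = Rt j c w"
   have x: "0 <= x" unfolding x_def using Rt_nonneg[OF j _ w] c by simp
   have "x ^ e / x ^ (2 * n + 1) <= 1 / x ^ (2 * n + 1) + (x^2) ^ e"
   proof (cases "x <= 1")
    case True
    then have "x ^ e / x ^ (2 * n + 1) <= 1 / x ^ (2 * n + 1)" using x by (intro divide_right_mono power_le_one) auto
    then show ?thesis by (rule order.trans) simp
   next
    case False
    have "x ^ e / x ^ (2 * n + 1) <= x ^ e / 1" using False by (intro divide_left_mono one_le_power) auto
    also have "... <= x ^ (2 * e)" using False by (simp add: power_increasing)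
    also have "... <= 1 / x ^ (2 * n + 1) + (x^2) ^ e" using x by (simp add: power_mult)
    finally show ?thesis .
   qed
   moreover have "0 <= x ^ e / x ^ (2 * n + 1)" "0 <= 1 / x ^ (2 * n + 1) + (x^2) ^ e" using x by simp_all
   ultimately show "norm (Rt j c w ^ e / Rt j c w ^ (2 * n + 1)) <= norm (1 / Rt j c w ^ (2 * n + 1) + ((Rt j c w)^2) ^ e)"
    unfolding x_def real_norm_def by linarith
  qed
 qed
 then show ?thesis by (simp add: i weight_power_def e_def)
qed

end

lemma (in prob_space) indep_processes_reindex:
 assumes ind: "indep_processes M Y K" and h: "inj_on h I" "h ` I \<subseteq> K"
 shows "indep_processes M (%i. Y (h i)) I"
proof -
 let ?N = "PiM {0..} (%_. borel) :: (real => real) measure"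
 define F where "F = (%i. {(%w. \<lambda>s\<in>{0..}. Y i s w) -` A \<inter> space M |A. A : sets ?N})"
 have rv: "ALL i:K. random_variable ?N (%w. \<lambda>s\<in>{0..}. Y i s w)" and isF: "indep_sets F K"
  using ind unfolding indep_processes_def indep_vars_def2 F_def by blast+
 have "indep_sets (%i. F (h i)) I"
  unfolding indep_sets_def
 proof (intro conjI ballI allI impI)
  show "F (h i) \<subseteq> events" if "i : I" for i
   using isF h that unfolding indep_sets_def by blast
  fix J A assume J: "J \<subseteq> I" "J ~= {}" "finite J" and A: "A : Pi J (%i. F (h i))"
  have inj: "inj_on h J" using h(1) J(1) by (rule inj_on_subset)
  define A' where "A' = (%k. A (the_inv_into J h k))"
  have A': "A' (h i) = A i" if "i : J" for i using the_inv_into_f_f[OF inj that] by (simp add: A'_def)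
  have "prob (\<Inter>k\<in>h ` J. A' k) = (PROD k:h ` J. prob (A' k))"
  proof (rule indep_setsD[OF isF])
   show "h ` J \<subseteq> K" using J(1) h(2) by blast
   show "ALL k:h ` J. A' k : F k" using A A' by (auto simp: Pi_iff)
  qed (use J in auto)
  moreover have "(\<Inter>k\<in>h ` J. A' k) = (\<Inter>i\<in>J. A i)" using A' by auto
  moreover have "(PROD k:h ` J. prob (A' k)) = (PROD i:J. prob (A i))"
   using A' by (subst prod.reindex[OF inj]) simp
  ultimately show "prob (\<Inter>i\<in>J. A i) = (PROD i:J. prob (A i))" by simp
 qed
 then show ?thesis
  unfolding indep_processes_def indep_vars_def2 F_def using rv h(2) by blast
qed

section \<open>The complex weight\<close>

locale bes_wiener_family = bes_family P "real n + 1 / 2" N Rt u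
 for P :: "'b measure" and n N :: nat and Rt :: "nat => real => 'b => real" and u :: "nat => real" +
 fixes W :: "nat => real => 'b => real" and T :: real
 assumes wiener: "j < N ==> standard_brownian_motion P (W j)"
  and joint_indep: "indep_processes P (case_sum Rt W) ({..<N} <+> {..<N})"
  and T_pos: "0 < T"
begin

lemma wiener_brownian: "j < N ==> brownian P (natural_filtration (space P) borel (W j)) (W j)"
 using wiener[of j] prob_space_axioms by (simp add: brownian_def brownian_axioms_def standard_brownian_motion_def)

lemma W_measurable: "j < N ==> 0 <= t ==> W j t : bmeas P"
 by (rule brownian.B_measurable[OF wiener_brownian])

lemma wiener_moment:
 assumes j: "j < N"
 shows "integrable P (%w. W j T w ^ m)" "expectation (%w. W j T w ^ m) = gauss_moment T m"
proof -
 interpret b: brownian P "natural_filtration (space P) borel (W j)" "W j" by (rule wiener_brownian[OF j])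
 have start: "AE w in P. W j 0 w = 0" using b.bm unfolding brownian_motion_wrt_def by (elim conjE)
 have dist: "distributed P lborel (%w. W j T w - W j 0 w) (normal_density 0 (sqrt T))"
 proof -
  have "ALL s t. 0 <= s & s < t -->
    distributed P lborel (%w. W j t w - W j s w) (normal_density 0 (sqrt (t - s))) &
    indep_set (sets (natural_filtration (space P) borel (W j) s))
     (sets (vimage_algebra (space P) (%w. W j t w - W j s w) borel))"
   using b.bm unfolding brownian_motion_wrt_def by (elim conjE)
  from this[rule_format, of 0 T] T_pos show ?thesis by simp
 qed
 have sT: "0 < sqrt T" using T_pos by simp
 have hb: "has_bochner_integral lborel (%x. normal_density 0 (sqrt T) x * x ^ m) (gauss_moment T m)"
 proof (cases "even m")
  case True
  then obtain k where m: "m = 2 * k" by (elim evenE)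
  have "gauss_moment T m = fact (2 * k) / ((2 / (sqrt T)^2) ^ k * fact k)"
   using T_pos by (simp add: m gauss_moment_def)
  then show ?thesis using normal_moment_even[OF sT, of 0 k] by (simp only: m diff_0_right)
 next
  case False
  then obtain k where m: "m = 2 * k + 1" by (elim oddE)
  have "gauss_moment T m = 0" using False by (simp add: gauss_moment_def)
  then show ?thesis using normal_moment_odd[OF sT, of 0 k] by (simp only: m diff_0_right)
 qed
 have WT: "W j T : bmeas P" using W_measurable[OF j] T_pos by simp
 have W0: "W j 0 : bmeas P" using W_measurable[OF j] by simp
 have ae: "AE w in P. (W j T w - W j 0 w) ^ m = W j T w ^ m" using start by eventually_elim simp
 have meas: "(%w. W j T w ^ m) : bmeas P" "(%w. (W j T w - W j 0 w) ^ m) : bmeas P"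
  using WT W0 by measurable
 have i: "integrable P (%w. (W j T w - W j 0 w) ^ m)" by (rule b.increment_moments(1)) (use T_pos in auto)
 show "integrable P (%w. W j T w ^ m)" using i integrable_cong_AE[OF meas(2,1) ae] by simp
 have "expectation (%w. W j T w ^ m) = expectation (%w. (W j T w - W j 0 w) ^ m)"
  by (rule integral_cong_AE[OF meas]) (use ae in eventually_elim, simp)
 also have "... = (\<integral>x. normal_density 0 (sqrt T) x * x ^ m \<partial>lborel)"
  by (rule distributed_integral[OF dist, symmetric]) auto
 also have "... = gauss_moment T m" by (rule has_bochner_integral_integral_eq[OF hb])
 finally show "expectation (%w. W j T w ^ m) = gauss_moment T m" .
qed

lemma joint_factorization:
 fixes A B :: "nat => 'b => complex"
 assumes ph: "!!j. j < N ==> ph j : bmeas (PiM {0..} (%_. borel))"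
  and ps: "!!j. j < N ==> ps j : bmeas (PiM {0..} (%_. borel))"
  and A: "!!j w. j < N ==> A j w = ph j (\<lambda>s\<in>{0..}. Rt j s w)" "!!j. j < N ==> integrable P (A j)"
  and B: "!!j w. j < N ==> B j w = ps j (\<lambda>s\<in>{0..}. W j s w)" "!!j. j < N ==> integrable P (B j)"
 shows "integrable P (%w. (PROD j<N. A j w) * (PROD j<N. B j w))"
  "(\<integral>w. (PROD j<N. A j w) * (PROD j<N. B j w) \<partial>P) = (PROD j<N. integral\<^sup>L P (A j)) * (PROD j<N. integral\<^sup>L P (B j))"
proof -
 let ?I = "{..<N} <+> {..<N}"
 define V where "V = (%i w. case_sum ph ps i (\<lambda>s\<in>{0..}. case_sum Rt W i s w))"
 have VA: "V (Inl j) = A j" if "j < N" for j unfolding V_def using A(1)[OF that] by (intro ext) simp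
 have VB: "V (Inr j) = B j" if "j < N" for j unfolding V_def using B(1)[OF that] by (intro ext) simp
 have ind: "indep_vars (%_. borel) V ?I"
  unfolding V_def by (rule indep_processes_functionals[OF joint_indep]) (use ph ps in auto)
 have iV: "integrable P (V i)" if "i : ?I" for i
  using that VA VB A(2) B(2) by auto
 have prod: "(PROD i:?I. f i) = (PROD j<N. f (Inl j)) * (PROD j<N. f (Inr j))" for f :: "nat + nat => complex"
  by (simp add: prod.Plus)
 have eq: "(PROD i:?I. V i w) = (PROD j<N. A j w) * (PROD j<N. B j w)" for w
  unfolding prod using VA VB by simp
 have fin: "finite ?I" by simp
 show "integrable P (%w. (PROD j<N. A j w) * (PROD j<N. B j w))"
  using indep_vars_integrable[OF fin ind iV] unfolding eq .
 let ?A = "\<integral>w. (PROD j<N. A j w) * (PROD j<N. B j w) \<partial>P"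
 have "?A = (PROD i:?I. integral\<^sup>L P (V i))"
  using indep_vars_lebesgue_integral[OF fin ind iV] unfolding eq .
 then show "?A = (PROD j<N. integral\<^sup>L P (A j)) * (PROD j<N. integral\<^sup>L P (B j))"
  unfolding prod using VA VB by simp
qed

definition Z :: "nat => 'b => complex" where
 "Z j w = of_real (Rt j T w) + \<i> * of_real (W j T w)"

definition weight_monomial :: "nat => nat => 'b => complex" where
 "weight_monomial l j w = Q_weight n T (Z j w) * Z j w ^ (2 * l)"

text \<open>The part of an expanded summand that depends on \<open>Rt j\<close>; the power of
  \<open>W j T\<close> is kept apart so that \<open>joint_factorization\<close> applies.\<close>

definition weight_term :: "(real \<times> real \<times> real poly) list => nat => nat => nat \<times> nat => 'b => complex" where
 "weight_term xs l j i w = of_real (pp xs j w) *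
   (weight_const n T l i * of_real (weight_power n l i (Rt j T w)))"

lemma weight_power_borel: "weight_power n l i : bmeas borel"
 unfolding weight_power_def case_prod_unfold by measurable

lemma weight_term_integrable:
 assumes o: "times_ordered T xs" and j: "j < N"
 shows "integrable P (weight_term xs l j i)"
proof -
 obtain K where K: "K >= 0" "ALL x. (ALL t>=0. 0 <= x t) --> abs (path_product xs x) <= K"
 proof -
  have "EX K>=0. ALL x. (ALL t>=0. 0 <= x t) --> abs (path_product xs x) <= K"
   by (rule path_product_bounded) (use times_ordered_mem[OF o] in blast)
  then show ?thesis using that by blast
 qed
 have wi: "integrable P (%w. weight_power n l i (Rt j T w))"
  by (rule weight_power_integrable[OF refl T_pos j])
 show ?thesis
 proof (rule integrable_bound)
  show "integrable P (%w. K * (norm (weight_const n T l i) * abs (weight_power n l i (Rt j T w))))"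
   using wi by simp
  have m1: "(%w. cr (pp xs j w)) : bmeas P"
   by (rule measurable_compose[OF path_product_Rt_measurable[OF o j] borel_measurable_of_real])
  have m2: "(%w. cr (weight_power n l i (Rt j T w))) : bmeas P"
   using wi by (intro measurable_compose[OF _ borel_measurable_of_real]) simp
  show "weight_term xs l j i : bmeas P"
   unfolding weight_term_def by (intro borel_measurable_times m1 m2 borel_measurable_const)
  show "AE w in P. norm (weight_term xs l j i w) <= norm (K * (norm (weight_const n T l i) * abs (weight_power n l i (Rt j T w))))"
  using K(2) K(1) by (auto simp: weight_term_def norm_mult abs_mult intro!: AE_I2 mult_right_mono)
 qed
qed

lemma weight_term_functional:
 assumes o: "times_ordered T xs"
 shows "EX ph. ph : bmeas (PiM {0..} (%_. borel)) & (ALL w. weight_term xs l j i w = ph (\<lambda>s\<in>{0..}. Rt j s w))"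
proof (intro exI conjI allI)
 let ?ph = "%x. cr (path_product xs (%t. (x t)\<^sup>2)) * (weight_const n T l i * of_real (weight_power n l i (x T)))"
 have T: "0 <= T" using T_pos by simp
 show "?ph : bmeas (PiM {0..} (%_. borel))"
  by (intro borel_measurable_times borel_measurable_const measurable_compose[OF _ borel_measurable_of_real]
    path_product_path_measurable[OF o] measurable_compose[OF path_component_measurable[OF T] weight_power_borel])
 fix w
 have "pp xs j w = path_product xs (%t. ((\<lambda>s\<in>{0..}. Rt j s w) t)\<^sup>2)"
  by (rule path_product_cong[OF o]) simp
 then show "weight_term xs l j i w = ?ph (\<lambda>s\<in>{0..}. Rt j s w)"
  using T by (simp add: weight_term_def)
qed

lemma term_product:
 assumes o: "times_ordered T xs"
 shows "integrable P (%w. (PROD j<N. weight_term xs (l j) j (g j) w) * (PROD j<N. of_real (W j T w ^ snd (g j))))"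
  and "(\<integral>w. (PROD j<N. weight_term xs (l j) j (g j) w) * (PROD j<N. of_real (W j T w ^ snd (g j))) \<partial>P) =
   (PROD j<N. integral\<^sup>L P (weight_term xs (l j) j (g j)) * of_real (gauss_moment T (snd (g j))))"
proof -
 have T: "0 <= T" using T_pos by simp
 have "ALL j. EX ph. ph : bmeas (PiM {0..} (%_. borel)) &
   (ALL w. weight_term xs (l j) j (g j) w = ph (\<lambda>s\<in>{0..}. Rt j s w))"
  using weight_term_functional[OF o] by blast
 from choice[OF this] obtain ph where ph: "ALL j. ph j : bmeas (PiM {0..} (%_. borel)) &
   (ALL w. weight_term xs (l j) j (g j) w = ph j (\<lambda>s\<in>{0..}. Rt j s w))" ..
 define B where "B = (%j w. cr (W j T w ^ snd (g j)))"
 define ps where "ps = (%j x. cr ((x T :: real) ^ snd (g j)))"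
 have psm: "ps j : bmeas (PiM {0..} (%_. borel))" for j
  unfolding ps_def
  by (rule measurable_compose[OF borel_measurable_power[OF path_component_measurable[OF T]] borel_measurable_of_real])
 have Bps: "B j w = ps j (\<lambda>s\<in>{0..}. W j s w)" for j w unfolding B_def ps_def using T by simp
 have Bi: "integrable P (B j)" if "j < N" for j
  unfolding B_def using wiener_moment(1)[OF that] by (rule integrable_of_real)
 have Be: "integral\<^sup>L P (B j) = of_real (gauss_moment T (snd (g j)))" if "j < N" for j
  unfolding B_def by (subst integral_of_real) (simp_all add: wiener_moment[OF that])
 have ph1: "ph j : bmeas (PiM {0..} (%_. borel))" for j using ph by blast
 have ph2: "weight_term xs (l j) j (g j) w = ph j (\<lambda>s\<in>{0..}. Rt j s w)" for j w using ph by blast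
 note f = joint_factorization[where A = "%j. weight_term xs (l j) j (g j)" and B = B and ph = ph and ps = ps,
  OF ph1 psm ph2 weight_term_integrable[OF o] Bps Bi]
 show "integrable P (%w. (PROD j<N. weight_term xs (l j) j (g j) w) * (PROD j<N. of_real (W j T w ^ snd (g j))))"
  using f(1) unfolding B_def .
 have "(PROD j<N. integral\<^sup>L P (B j)) = (PROD j<N. of_real (gauss_moment T (snd (g j))))" using Be by simp
 then show "(\<integral>w. (PROD j<N. weight_term xs (l j) j (g j) w) * (PROD j<N. of_real (W j T w ^ snd (g j))) \<partial>P) =
   (PROD j<N. integral\<^sup>L P (weight_term xs (l j) j (g j)) * of_real (gauss_moment T (snd (g j))))"
  using f(2) unfolding B_def prod.distrib by simp
qed

lemma weight_monomial_expansion: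
 "of_real (PROD j<N. pp xs j w) * (PROD j<N. weight_monomial (l j) j w) =
  (SUM g:PiE {..<N} (%j. weight_index n (l j)).
   (PROD j<N. weight_term xs (l j) j (g j) w) * (PROD j<N. of_real (W j T w ^ snd (g j))))"
proof -
 have "of_real (PROD j<N. pp xs j w) * (PROD j<N. weight_monomial (l j) j w) =
  (PROD j<N. SUM i:weight_index n (l j). weight_term xs (l j) j i w * of_real (W j T w ^ snd i))"
  unfolding of_real_prod prod.distrib[symmetric]
 proof (rule prod.cong[OF refl])
  fix j
  have "weight_monomial (l j) j w = (SUM i:weight_index n (l j). weight_const n T (l j) i * of_real (weight_power n (l j) i (Rt j T w)) * of_real (W j T w ^ snd i))"
   unfolding weight_monomial_def by (rule Q_weight_expansion[OF T_pos Z_def])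
  then show "of_real (pp xs j w) * weight_monomial (l j) j w =
   (SUM i:weight_index n (l j). weight_term xs (l j) j i w * of_real (W j T w ^ snd i))"
   unfolding weight_term_def by (simp only: sum_distrib_left mult.assoc)
 qed
 also have "... = (SUM g:PiE {..<N} (%j. weight_index n (l j)). PROD j<N. weight_term xs (l j) j (g j) w * of_real (W j T w ^ snd (g j)))"
  by (rule prod_sum_PiE) simp_all
 finally show ?thesis unfolding prod.distrib .
qed

text \<open>The mean of \<open>Q(Z) * Z ^ (2 * l)\<close> over the imaginary part is this polynomial
  at the squared real part, as long as the real part is nonzero.\<close>

definition mean_poly :: "nat => real poly" where
 "mean_poly l = (SOME p. degree p = l & lead_coeff p = 1 &
   (ALL x. weight_sum T n (Suc (2 * l)) x = x ^ (2 * n + 1) * poly p (x^2)))"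

lemma mean_poly: "degree (mean_poly l) = l" "lead_coeff (mean_poly l) = 1"
 "weight_sum T n (Suc (2 * l)) x = x ^ (2 * n + 1) * poly (mean_poly l) (x^2)"
 using someI_ex[OF weight_sum_polynomial[of l T n]] unfolding mean_poly_def by blast+

text \<open>The Gaussian sum agrees with the polynomial off the null set where \<open>Rt j T\<close>
  is 0, so that integrability and mean of the polynomial side follow from those of the expanded
  terms.\<close>

lemma mean_poly_integrable:
 assumes o: "times_ordered T xs" and j: "j < N"
 shows "integrable P (%w. pp xs j w * poly (mean_poly l) ((Rt j T w)^2))"
  and "(SUM i:weight_index n l. integral\<^sup>L P (weight_term xs l j i) * of_real (gauss_moment T (snd i))) =
   cr (expectation (%w. pp xs j w * poly (mean_poly l) ((Rt j T w)^2)))"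
proof -
 let ?g = "%w. pp xs j w * poly (mean_poly l) ((Rt j T w)^2)"
 let ?s = "%w. SUM i:weight_index n l. weight_term xs l j i w * of_real (gauss_moment T (snd i))"
 have si: "integrable P ?s" using weight_term_integrable[OF o j] by (intro integrable_sum integrable_mult_left) simp
 let ?A = "%n l j w. SUM i:weight_index n l. weight_const n T l i * of_real (weight_power n l i (Rt j T w)) * of_real (gauss_moment T (snd i))"
 have ae: "AE w in P. ?s w = cr (?g w)"
  using Rt_positive[OF T_pos j]
 proof eventually_elim
  case (elim w)
  have "?s w = of_real (pp xs j w) *
    (?A n l j w)"
   unfolding weight_term_def by (simp only: sum_distrib_left mult.assoc)
  also have "(?A n l j w) =
    cr (weight_sum T n (Suc (2 * l)) (Rt j T w) / Rt j T w ^ (2 * n + 1))"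
   using elim by (intro weight_gauss_expectation T_pos) simp
  also have "weight_sum T n (Suc (2 * l)) (Rt j T w) / Rt j T w ^ (2 * n + 1) = poly (mean_poly l) ((Rt j T w)^2)"
   unfolding mean_poly(3) using elim by simp
  finally show ?case by simp
 qed
 have Rm: "Rt j T : bmeas P" using Rt_measurable[OF j] T_pos by simp
 have pm: "poly (mean_poly l) : bmeas borel" by (intro borel_measurable_continuous_onI continuous_intros)
 have gm: "?g : bmeas P"
  by (intro borel_measurable_times path_product_Rt_measurable[OF o j] measurable_compose[OF borel_measurable_power[OF Rm] pm])
 have cgm: "(%w. cr (?g w)) : bmeas P"
  by (rule measurable_compose[OF gm borel_measurable_of_real])
 have sm: "?s : bmeas P" using si by simp
 have ci: "integrable P (%w. cr (?g w))" using si integrable_cong_AE[OF sm cgm ae] by simp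
 from integrable_Re[OF ci] show gi: "integrable P ?g" by simp
 let ?B = "%n l L xs j. SUM i:weight_index n l. integral\<^sup>L P (weight_term xs l j i) * of_real (gauss_moment T (snd i))"
 have "(?B n l L xs j) = (\<integral>w. ?s w \<partial>P)"
  using weight_term_integrable[OF o j] by (subst integral_sum) simp_all
 also have "... = (\<integral>w. cr (?g w) \<partial>P)" by (rule integral_cong_AE[OF sm cgm ae])
 also have "... = cr (expectation ?g)" by (rule integral_of_real) (simp add: gi)
 finally show "(?B n l L xs j) = cr (expectation ?g)" .
qed

lemma mean_poly_product:
 assumes o: "times_ordered T xs"
 shows "integrable P (%w. (PROD j<N. pp xs j w) * (PROD j<N. poly (mean_poly (l j)) ((Rt j T w)^2)))"
  and "expectation (%w. (PROD j<N. pp xs j w) * (PROD j<N. poly (mean_poly (l j)) ((Rt j T w)^2))) =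
   (PROD j<N. expectation (%w. pp xs j w * poly (mean_poly (l j)) ((Rt j T w)^2)))"
proof -
 have T: "0 <= T" using T_pos by simp
 define Y where "Y = (%j w. pp xs j w * poly (mean_poly (l j)) ((Rt j T w)^2))"
 define ph where "ph = (%j x. path_product xs (%t. (x t)\<^sup>2) * poly (mean_poly (l j)) ((x T)^2))"
 have pm: "poly q : bmeas borel" for q :: "real poly" by (intro borel_measurable_continuous_onI continuous_intros)
 have phm: "ph j : bmeas (PiM {0..} (%_. borel))" for j
  unfolding ph_def
  by (intro borel_measurable_times path_product_path_measurable[OF o]
    measurable_compose[OF borel_measurable_power[OF path_component_measurable[OF T]] pm])
 have Yph: "Y j w = ph j (\<lambda>s\<in>{0..}. Rt j s w)" for j w
 proof -
  have "pp xs j w = path_product xs (%t. ((\<lambda>s\<in>{0..}. Rt j s w) t)\<^sup>2)"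
   by (rule path_product_cong[OF o]) simp
  then show ?thesis using T by (simp add: Y_def ph_def)
 qed
 have Yi: "integrable P (Y j)" if "j < N" for j unfolding Y_def by (rule mean_poly_integrable(1)[OF o that])
 note f = product_factorization[where Y = Y and ph = ph, OF phm Yph Yi]
 let ?A = "%xs l. %w. (PROD j<N. pp xs j w) * (PROD j<N. poly (mean_poly (l j)) ((Rt j T w)^2))"
 show "integrable P (?A xs l)"
  using f(1) unfolding Y_def prod.distrib .
 show "expectation (?A xs l) =
   (PROD j<N. expectation (%w. pp xs j w * poly (mean_poly (l j)) ((Rt j T w)^2)))"
  using f(2) unfolding Y_def prod.distrib .
qed

text \<open>Each summand of the expansion splits over particles and over real and imaginary parts by
  independence; Gaussian moments replace the powers of \<open>W\<close>, and the sums are recombined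
  particle by particle. This takes the place of conditioning on the real parts.\<close>

lemma weight_monomial_expectation:
 assumes o: "times_ordered T xs"
 shows "integrable P (%w. of_real (PROD j<N. pp xs j w) * (PROD j<N. weight_monomial (l j) j w))"
  and "(\<integral>w. of_real (PROD j<N. pp xs j w) * (PROD j<N. weight_monomial (l j) j w) \<partial>P) =
   cr (expectation (%w. (PROD j<N. pp xs j w) * (PROD j<N. poly (mean_poly (l j)) ((Rt j T w)^2))))"
proof -
 let ?G = "PiE {..<N} (%j. weight_index n (l j))"
 let ?t = "%g w. (PROD j<N. weight_term xs (l j) j (g j) w) * (PROD j<N. cr (W j T w ^ snd (g j)))"
 show "integrable P (%w. of_real (PROD j<N. pp xs j w) * (PROD j<N. weight_monomial (l j) j w))"
  unfolding weight_monomial_expansion by (intro integrable_sum term_product(1)[OF o])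
 let ?A = "%xs l. \<integral>w. of_real (PROD j<N. pp xs j w) * (PROD j<N. weight_monomial (l j) j w) \<partial>P"
 let ?B = "%xs l. expectation (%w. (PROD j<N. pp xs j w) * (PROD j<N. poly (mean_poly (l j)) ((Rt j T w)^2)))"
 have "(?A xs l) = (SUM g:?G. \<integral>w. ?t g w \<partial>P)"
  unfolding weight_monomial_expansion by (rule integral_sum[OF term_product(1)[OF o]])
 also have "... = (SUM g:?G. PROD j<N. integral\<^sup>L P (weight_term xs (l j) j (g j)) * of_real (gauss_moment T (snd (g j))))"
  by (rule sum.cong[OF refl term_product(2)[OF o]])
 also have "... = (PROD j<N. SUM i:weight_index n (l j). integral\<^sup>L P (weight_term xs (l j) j i) * of_real (gauss_moment T (snd i)))"
  by (rule prod_sum_PiE[symmetric]) simp_all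
 also have "... = (PROD j<N. cr (expectation (%w. pp xs j w * poly (mean_poly (l j)) ((Rt j T w)^2))))"
  by (rule prod.cong[OF refl]) (rule mean_poly_integrable(2)[OF o], simp)
 also have "... = cr (?B xs l)"
  unfolding mean_poly_product(2)[OF o] of_real_prod ..
 finally show "(?A xs l) =
   cr (?B xs l)" .
qed

end

text \<open>The Lagrange basis polynomial in \<open>z^2\<close> for the nodes
  \<open>(u l)^2\<close>. Since the \<open>u l\<close> are nonnegative and distinct, deleting both
  \<open>u k\<close> and \<open>- u k\<close> from the support removes exactly the index
  \<open>k\<close>.\<close>

lemma Phi_tilde_polynomial:
 fixes u :: "nat => real"
 assumes u: "ALL j<N. 0 <= u j" "strict_mono_on {..<N} u" and k: "k < N"
 shows "EX p. degree p < N & (ALL z. poly p (z^2) = Phi_tilde (point_config N u) (u k) z) &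
  (ALL l<N. poly p ((of_real (u l))^2) = (if l = k then 1 else 0))"
proof -
 have inj: "inj_on u {..<N}" using u(2) by (rule strict_mono_on_imp_inj_on)
 have sq: "(u l)^2 ~= (u k)^2" if "l < N" "l ~= k" for l
  using inj_onD[OF inj, of l k] that k u(1) by (auto simp: power2_eq_iff_nonneg)
 have supp: "measure_support (point_config N u) - {u k, - u k} = u ` ({..<N} - {k})"
 using sq by (fastforce simp: measure_support_point_config Diff_iff image_iff singleton_iff intro: bexI)
 define c where "c = (%l. (cr (u k))\<^sup>2 - (cr (u l))^2)"
 have c: "c l ~= 0" if "l < N" "l ~= k" for l
 proof -
  have "cr ((u k)^2) ~= cr ((u l)^2)" using sq[OF that] unfolding of_real_eq_iff by (rule not_sym)
  then show ?thesis unfolding c_def of_real_power right_minus_eq .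
 qed
 define p where "p = (PROD l:{..<N} - {k}. smult (inverse (c l)) [:- (cr (u l))\<^sup>2, 1:])"
 have pe: "poly p z = (PROD l:{..<N} - {k}. (z - (cr (u l))^2) / c l)" for z
  unfolding p_def poly_prod by (rule prod.cong[OF refl]) (simp add: divide_inverse algebra_simps)
 have "degree p <= (SUM l:{..<N} - {k}. degree (smult (inverse (c l)) [:- (cr (u l))\<^sup>2, 1:]))"
  unfolding p_def by (rule order.trans[OF degree_prod_sum_le]) (simp_all add: o_def)
 also have "... <= (SUM l:{..<N} - {k}. 1)" by (rule sum_mono) (simp add: degree_smult_eq)
 also have "... < N" using k by simp
 finally have "degree p < N" .
 moreover have "poly p (z^2) = Phi_tilde (point_config N u) (u k) z" for z
  unfolding Phi_tilde_def supp pe c_def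
  using prod.reindex[OF inj_on_subset[OF inj, of "{..<N} - {k}"], of "%r. (z^2 - (cr r)^2) / ((cr (u k))^2 - (cr r)^2)"]
  by (simp add: o_def)
 moreover have "poly p ((of_real (u l))^2) = (if l = k then 1 else 0)" if l: "l < N" for l
 proof (cases "l = k")
  case True
  have "(PROD i:{..<N} - {k}. ((cr (u k))^2 - (cr (u i))^2) / c i) = 1"
   by (rule prod.neutral) (use c in \<open>auto simp: c_def\<close>)
  then show ?thesis using True by (simp add: pe)
 next
  case False
  then show ?thesis using l by (auto simp: pe prod_zero_iff)
 qed
 ultimately show ?thesis by (intro exI[of _ p] conjI allI impI) assumption+
qed

text \<open>
 All \<open>\<Phi>\<close> are polynomials of degree below \<open>N\<close> in \<open>z\<^sup>2\<close>, so the determinant is the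
 Vandermonde determinant up to a constant; the constant is read off at \<open>z = u\<close>.
\<close>

lemma det_Phi_tilde:
 fixes u :: "nat => real" and z Q :: "nat => complex"
 assumes u: "ALL j<N. 0 <= u j" "strict_mono_on {..<N} u"
 shows "alternant N (%j k. Q j * Phi_tilde (point_config N u) (u k) (z j)) * of_real (vdm N (%j. (u j)\<^sup>2)) =
  (PROD j<N. Q j) * vdm N (%j. (z j)\<^sup>2)"
proof -
 have "ALL k. EX p. k < N --> degree p < N & (ALL z. poly p (z^2) = Phi_tilde (point_config N u) (u k) z) &
  (ALL l<N. poly p ((of_real (u l))^2) = (if l = k then 1 else 0))"
  using Phi_tilde_polynomial[OF u] by blast
 from choice[OF this] obtain p where p: "ALL k. k < N --> degree (p k) < N &
  (ALL z. poly (p k) (z^2) = Phi_tilde (point_config N u) (u k) z) &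
  (ALL l<N. poly (p k) ((cr (u l))^2) = (if l = k then 1 else 0))" ..
 have deg: "degree (p k) < N" if "k < N" for k using p that by blast
 have pz: "poly (p k) (z^2) = Phi_tilde (point_config N u) (u k) z" if "k < N" for k z using p that by blast
 have pu: "poly (p k) ((cr (u l))^2) = (if l = k then 1 else 0)" if "k < N" "l < N" for k l using p that by blast
 define C where "C = alternant N (%m k. coeff (p k) m)"
 have A: "alternant N (%j k. poly (p k) (x j)) = vdm N x * C" for x :: "nat => complex"
  unfolding C_def alternant_powers[symmetric] by (rule alternant_poly) (rule deg)
 let ?A = "%j. (cr (u j))\<^sup>2"
 have "vdm N ?A * C = alternant N (%j k. if j = k then 1 else (0 :: complex))"
  unfolding A[of "%j. (cr (u j))\<^sup>2", symmetric] by (rule alternant_cong) (simp add: pu)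
 also have "... = Determinant.det (1\<^sub>m N)"
  unfolding det_eq_alternant[symmetric] one_mat_def by simp
 also have "... = 1" by (rule Determinant.det_one)
 finally have C: "vdm N ?A * C = 1" .
 have v: "cr (vdm N (%j. (u j)\<^sup>2)) = vdm N ?A"
  unfolding vdm_def of_real_prod by (rule prod.cong) auto
 have "alternant N (%j k. Q j * Phi_tilde (point_config N u) (u k) (z j)) = (PROD j<N. Q j) * alternant N (%j k. poly (p k) ((z j)^2))"
  unfolding alternant_scale_rows by (rule arg_cong[where f = "(*) (PROD j<N. Q j)"], rule alternant_cong) (simp add: pz)
 then show ?thesis unfolding A[of "%j. (z j)\<^sup>2"] v using C by (simp add: mult_ac)
qed

context bes_wiener_family
begin

text \<open>By \<open>det_Phi_tilde\<close> this is the determinant of the claim times the constant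
  \<open>vdm N (u^2)\<close>; it does not mention the starting points.\<close>

definition complex_weight :: "'b => complex" where
 "complex_weight w = (PROD j<N. Q_weight n T (Z j w)) * vdm N (%j. (Z j w)\<^sup>2)"

lemma complex_weight_expand:
 "complex_weight w = (\<Sum>p | p permutes {..<N}. of_int (sign p) * (PROD j<N. weight_monomial (p j) j w))"
 unfolding complex_weight_def alternant_powers[symmetric] alternant_scale_rows[symmetric]
 unfolding alternant_def weight_monomial_def by (simp add: power_mult)

lemma vdm_mean_poly:
 "vdm N (%j. (Rt j T w)\<^sup>2) = (\<Sum>p | p permutes {..<N}. of_int (sign p) * (PROD j<N. poly (mean_poly (p j)) ((Rt j T w)^2)))"
proof -
 have "alternant N (%j k. poly (mean_poly k) ((Rt j T w)^2)) = vdm N (%j. (Rt j T w)\<^sup>2)"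
  unfolding alternant_powers[symmetric] by (rule alternant_monic_poly) (intro conjI mean_poly)
 then show ?thesis unfolding alternant_def by (rule sym)
qed

lemma complex_weight_integrable: "integrable P complex_weight"
proof -
 have o: "times_ordered T []" using T_pos by (simp add: times_ordered_def)
 have i: "integrable P (%w. PROD j<N. weight_monomial (l j) j w)" for l
  using weight_monomial_expectation(1)[OF o, of l] by simp
 show ?thesis
  unfolding complex_weight_expand[abs_def]
  by (intro integrable_sum integrable_mult_right i)
qed

lemma complex_weight_product:
 assumes o: "times_ordered T xs"
 shows "(\<integral>w. cr (PROD j<N. pp xs j w) * complex_weight w \<partial>P) =
  cr (expectation (%w. (PROD j<N. pp xs j w) * vdm N (%j. (Rt j T w)\<^sup>2)))"
proof -
 define a where "a w = (PROD j<N. pp xs j w)" for w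
 let ?S = "{p. p permutes {..<N}}"
 note i1 = weight_monomial_expectation(1)[OF o, folded a_def] and i2 = mean_poly_product(1)[OF o, folded a_def]
  and e = weight_monomial_expectation(2)[OF o, folded a_def]
 let ?A = "%p w. PROD j<N. poly (mean_poly (p j)) ((Rt j T w)^2)"
 have "(\<integral>w. cr (a w) * complex_weight w \<partial>P) =
   (\<integral>w. (SUM p:?S. of_int (sign p) * (cr (a w) * (PROD j<N. weight_monomial (p j) j w))) \<partial>P)"
  unfolding complex_weight_expand sum_distrib_left by (simp only: mult.left_commute)
 also have "... = (SUM p:?S. of_int (sign p) * cr (expectation (%w. a w * (?A p w))))"
  by (subst integral_sum, intro integrable_mult_right i1) (simp only: integral_mult_right_zero e)
 also have "... = cr (SUM p:?S. expectation (%w. of_int (sign p) * (a w * (?A p w))))"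
  by (simp only: of_real_sum integral_mult_right_zero of_real_mult of_real_of_int_eq)
 also have "... = cr (expectation (%w. SUM p:?S. of_int (sign p) * (a w * (?A p w))))"
  by (subst integral_sum, intro integrable_mult_right i2) (rule refl)
 also have "(%w. SUM p:?S. of_int (sign p) * (a w * (?A p w))) = (%w. a w * vdm N (%j. (Rt j T w)\<^sup>2))"
  unfolding vdm_mean_poly sum_distrib_left by (simp only: mult.left_commute)
 finally show ?thesis unfolding a_def .
qed

text \<open>Two weights are compared through the closure: \<open>complex_weight\<close> for the
  independent processes and the constant \<open>vdm N (u^2)\<close> for the noncolliding one. On the
  generating products both sides equal a mean with the real weight
  \<open>vdm N (R(T)^2)\<close>.\<close>

theorem complex_weight_law:
 fixes M :: "'a measure" and F :: "(real => real measure) => real"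
 assumes N: "1 <= N" and bes_M: "noncolliding_BES M (real n + 1 / 2) N Xt" and start_M: "!!j. j < N ==> AE w in M. Xt j 0 w = u j"
  and dist: "!!j k. j < k ==> k < N ==> (u j)^2 ~= (u k)^2"
  and t: "t <= T" and F: "F : bmeas (config_filtration t)" "bounded (F ` config_paths)"
 shows "integrable P (%w. cr (F (%s. point_config N (%j. Rt j s w))) * complex_weight w)"
  and "(\<integral>w. cr (F (%s. point_config N (%j. Rt j s w))) * complex_weight w \<partial>P) =
   cr (vdm N (%j. (u j)\<^sup>2) * (\<integral>w. F (%s. point_config N (%j. Xt j s w)) \<partial>M))"
proof -
 have T: "0 <= T" using T_pos by simp
 obtain X where X: "noncolliding_BESQ M (real n + 1 / 2) N X" and Xt: "ALL j<N. ALL t>=0. ALL w:space M. Xt j t w = sqrt (X j t w)"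
  using bes_M unfolding noncolliding_BES_def by blast
 obtain \<F> B where nc: "noncolliding_system M \<F> B N X (real n + 1 / 2)"
  using noncolliding_BESQ_system[OF X N index] by blast
 interpret nc: noncolliding_system M \<F> B N X "real n + 1 / 2" by (rule nc)
 interpret L: multiplicative_class "nonneg_paths N" "product_functionals N T" by (rule product_functionals_class)
 have sqrtX: "Xt j s w = sqrt (X j s w)" if "j < N" "0 <= s" "w : space M" for j s w using Xt that by blast
 have sq: "(Xt j s w)^2 = X j s w" if "j < N" "0 <= s" "w : space M" for j s w
  using sqrtX[OF that] nc.nonneg[OF that] by simp
 have x0: "AE w in M. X j 0 w = (u j)^2" if j: "j < N" for j
  using start_M[OF j] AE_space
 proof eventually_elim
  case (elim w)
  show ?case using sq[OF j order.refl elim(2)] unfolding elim(1) by (rule sym)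
 qed
 define R where "R = (%w j s. Rt j s w)"
 define Y where "Y = (%w j s. Xt j s w)"
 define c where "c = vdm N (%j. (u j)\<^sup>2)"
 define f where "f = (%p. F (%s. point_config N (%j. p j s)))"
 have R: "R w : nonneg_paths N" if "w : space P" for w
  using Rt_nonneg that by (simp add: nonneg_paths_def R_def)
 have Y: "Y w : nonneg_paths N" if "w : space M" for w
  using sqrtX nc.nonneg that by (simp add: nonneg_paths_def Y_def)
 have f: "path_closure N T f" unfolding f_def by (rule closure_path_functional[OF t F])
 let ?A = "\<integral>w. cr (f (R w)) * complex_weight w \<partial>P"
 let ?B = "%g. \<integral>w. cr (g (R w)) * complex_weight w \<partial>P"
 have law: "(%w. f (R w)) : bmeas P & (%w. f (Y w)) : bmeas M &
   ?A = (\<integral>w. cr (f (Y w)) * cr c \<partial>M)"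
 proof (rule L.bc_integral_eq[OF R complex_weight_integrable Y nc.integrable_const _ f])
  fix g assume "g : product_functionals N T"
  then obtain xs where g: "g = product_functional N xs" and xs: "admissible T xs" by blast
  \<comment> \<open>The factors of a generator may come in any order; sorting them by decreasing
    time leaves the product unchanged and gives the form that the backward evolution needs.\<close>
  obtain ys where ys: "mset ys = mset xs" "times_ordered T ys"
   using times_ordered_sort[OF T, of xs] xs unfolding admissible_def by blast
  have gy: "g p = (PROD j<N. path_product ys (%s. (p j s)\<^sup>2))" for p
   unfolding g product_functional_def by (rule prod.cong[OF refl]) (rule path_product_mset_cong[OF ys(1)[symmetric]])
  have gR: "g (R w) = (PROD j<N. pp ys j w)" for w unfolding gy R_def ..
  have gY: "g (Y w) = (PROD j<N. path_product ys (%s. X j s w))" if "w : space M" for w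
   unfolding gy Y_def using path_product_cong[OF ys(2) sq[OF _ _ that]] by (intro prod.cong) auto
  have "(%w. g (R w)) : bmeas P"
   unfolding gR using path_product_Rt_measurable[OF ys(2)] by (intro borel_measurable_prod) simp
  moreover have "(%w. g (Y w)) : bmeas M"
   using nc.path_product_measurable[OF ys(2)] by (simp only: measurable_cong[OF gY])
  moreover have "nc.expectation (%w. g (Y w)) = nc.expectation (%w. PROD j<N. path_product ys (%s. X j s w))"
   by (rule integral_cong[OF refl gY])
  moreover have "(?B g) = cr (c * nc.expectation (%w. PROD j<N. path_product ys (%s. X j s w)))"
   unfolding gR complex_weight_product[OF ys(2)] c_def
   by (rule arg_cong[where f = cr]) (rule weighted_product_expectation[OF nc x0 dist ys(2)])
  ultimately show "(%w. g (R w)) : bmeas P & (%w. g (Y w)) : bmeas M &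
   (?B g) = (\<integral>w. cr (g (Y w)) * cr c \<partial>M)"
   by (simp add: mult.commute)
 qed simp
 obtain K where K: "ALL p:nonneg_paths N. (abs (f p)) <= K" using path_closure_bounded[OF f] by blast
 have "integrable P (%w. cr (f (R w)) * complex_weight w)"
  using K by (intro L.weighted_integrable[OF R complex_weight_integrable conjunct1[OF law], where K = K]) blast+
 moreover have "?A = cr (c * (\<integral>w. f (Y w) \<partial>M))"
  using law by (simp add: mult.commute)
 ultimately show "integrable P (%w. cr (F (%s. point_config N (%j. Rt j s w))) * complex_weight w)"
  "(\<integral>w. cr (F (%s. point_config N (%j. Rt j s w))) * complex_weight w \<partial>P) =
   cr (vdm N (%j. (u j)\<^sup>2) * (\<integral>w. F (%s. point_config N (%j. Xt j s w)) \<partial>M))"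
  unfolding f_def R_def Y_def c_def .
qed

end

theorem corollary5p8:
  fixes n N :: nat and u :: "nat \<Rightarrow> real" and t T :: real
    and M :: "'a measure" and Xt :: "nat \<Rightarrow> real \<Rightarrow> 'a \<Rightarrow> real"
    and P :: "'b measure" and Rt W :: "nat \<Rightarrow> real \<Rightarrow> 'b \<Rightarrow> real"
    and F :: "(real \<Rightarrow> real measure) \<Rightarrow> real"
  assumes "1 \<le> N"
    and "\<forall>j<N. 0 \<le> u j"
    and "strict_mono_on {..<N} u"
    and "prob_space M"
    and "noncolliding_BES M (real n + 1 / 2) N Xt"
    and "\<forall>j<N. AE \<omega> in M. Xt j 0 \<omega> = u j"
    and "prob_space P"
    and "\<forall>j<N. BES P (real n + 1 / 2) (Rt j)"
    and "\<forall>j<N. AE \<omega> in P. Rt j 0 \<omega> = u j"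
    and "\<forall>j<N. standard_brownian_motion P (W j)"
    and "indep_processes P (case_sum Rt W) ({..<N} <+> {..<N})"
    and "0 < t" and "t \<le> T"
    and "F \<in> borel_measurable (config_filtration t)"
    and "bounded (F ` config_paths)"
  shows "integrable P (\<lambda>\<omega>.
           complex_of_real (F (\<lambda>s. point_config N (\<lambda>j. Re (complex_process Rt W j s \<omega>)))) *
           Determinant.det (Matrix.mat N N (\<lambda>(j, k).
             Q_weight n T (complex_process Rt W j T \<omega>) *
             Phi_tilde (point_config N u) (u k) (complex_process Rt W j T \<omega>))))
    \<and> complex_of_real (\<integral>\<omega>. F (\<lambda>s. point_config N (\<lambda>j. Xt j s \<omega>)) \<partial>M) =
      (\<integral>\<omega>.
           complex_of_real (F (\<lambda>s. point_config N (\<lambda>j. Re (complex_process Rt W j s \<omega>)))) *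
           Determinant.det (Matrix.mat N N (\<lambda>(j, k).
             Q_weight n T (complex_process Rt W j T \<omega>) *
             Phi_tilde (point_config N u) (u k) (complex_process Rt W j T \<omega>))) \<partial>P)"
proof -
 have T: "0 < T" "0 <= T" using assms(12,13) by simp_all
 interpret prob_space P by fact
 have indR: "indep_processes P Rt {..<N}"
  using indep_processes_reindex[OF assms(11), of Inl "{..<N}"] by (auto simp: inj_on_def)
 interpret bes_wiener_family P n N Rt u W T
  by unfold_locales (use assms(8-11) indR T in simp_all)
 \<comment> \<open>Nonnegativity carries the strict order of the starting points over to their
   squares, also when the first one is 0.\<close>
 have dist: "(u j)^2 ~= (u k)^2" if "j < k" "k < N" for j k
 proof -
  have "u j < u k" using assms(3) that by (simp add: strict_mono_on_def)
  moreover have "0 <= u j" using assms(2) that by simp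
  ultimately have "(u j)^2 < (u k)^2" by (intro power_strict_mono) auto
  then show ?thesis by simp
 qed
 define c where "c = vdm N (%j. (u j)\<^sup>2)"
 have c: "c ~= 0" unfolding c_def using dist by (rule vdm_nonzero)
 have "(Determinant.det (Matrix.mat N N (%(j, k). Q_weight n T (complex_process Rt W j T w) *
   Phi_tilde (point_config N u) (u k) (complex_process Rt W j T w)))) * of_real c = complex_weight w" for w
  unfolding det_eq_alternant c_def det_Phi_tilde[OF assms(2,3)] complex_weight_def Z_def complex_process_def ..
 then have det: "Determinant.det (Matrix.mat N N (%(j, k). Q_weight n T (complex_process Rt W j T w) *
   Phi_tilde (point_config N u) (u k) (complex_process Rt W j T w))) = complex_weight w / of_real c" for w
  using c by (simp add: eq_divide_eq)
 have Re: "Re (complex_process Rt W j s w) = Rt j s w" for j s w by (simp add: complex_process_def)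
 note law = complex_weight_law[OF assms(1,5) _ dist assms(13-15)]
 show ?thesis
  unfolding Re det times_divide_eq_right integral_divide_zero
  using law[folded c_def] assms(6) c by (simp add: integrable_divide_zero)
qed

end
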